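(* Consider the $K$-user Gaussian interference channel with confidential messages and one external eavesdropper (IC-CM-EE). Write $Y_0:=Z$ and $\mathcal K_{0,-i}=\{0,1,\dots,K\}\setminus\{i\}$. Let $V_1,\dots,V_K$ be mutually independent random variables taking values in finite sets, and for each $i$ let $X_i$ be generated from $V_i$ through a conditional distribution $p(x_i\mid v_i)$ (so that $V_i\to X_i\to(Y_0,Y_1,\dots,Y_K)$ is a Markov chain, with the $(V_i,X_i)$ pairs mutually independent across $i$), with $E[X_i^2]\le P$. Then every rate tuple $(R_1,\dots,R_K)$ with $$0\le R_i< I(V_i;Y_i)-\max_{j\in\mathcal K_{0,-i}} I(V_i;Y_j\mid V_{-i}^K),\qquad i=1,\dots,K,$$ is achievable under the IC-CM-EE secrecy requirement, where $V_{-i}^K=\{V_j\}_{j\ne i}$.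
   Context: The $K$-user Gaussian interference channel: $Y_i=\sum_{j=1}^K h_{ji}X_j+N_i$ ($i=1,\dots,K$), $Z=\sum_{j=1}^K g_jX_j+N_Z$, fixed nonzero real gains, mutually independent zero-mean unit-variance Gaussian noises i.i.d. over time, power constraint $E[X_i^2]\le P$. Transmitter $i$ encodes a uniform message $W_i$ of rate $R_i=\frac1n\log|\mathcal W_i|$ stochastically into $\mathbf X_i=X_i^n$; receiver $i$ decodes $\hat W_i$ from $\mathbf Y_i=Y_i^n$; $\mathbf Z=Z^n$; $W_{-i}^K=\{W_j\}_{j\neq i}$. A rate tuple is achievable under IC-CM-EE if for every $\epsilon>0$ there exist codes with $\max_j\Pr[W_j\ne\hat W_j]\le\epsilon$, $H(W_1,\dots,W_K\mid\mathbf Z)\ge H(W_1,\dots,W_K)-n\epsilon$, and $H(W_{-i}^K\mid\mathbf Y_i)\ge H(W_{-i}^K)-n\epsilon$ for all $i$. *)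

theory Defs
  imports "HOL-Probability.Probability"
begin

text \<open>Transmitters are indexed by 1..K, receivers by 0..K, where receiver 0 is the
  eavesdropper (Y_0 = Z).  h j i is the gain from transmitter j to receiver i,
  g j the gain from transmitter j to the eavesdropper.\<close>

definition gain :: "(nat \<Rightarrow> nat \<Rightarrow> real) \<Rightarrow> (nat \<Rightarrow> real) \<Rightarrow> nat \<Rightarrow> nat \<Rightarrow> real" where
  "gain h g j i = (if i = 0 then g j else h j i)"

definition blk :: "nat \<Rightarrow> (nat \<Rightarrow> real) measure" where
  "blk n = PiM {..<n} (\<lambda>_. lborel)"

definition std_gauss :: "real measure" where
  "std_gauss = density lborel std_normal_density"

definition user_law :: "nat \<Rightarrow> nat \<Rightarrow> (nat \<Rightarrow> (nat \<Rightarrow> real) measure) \<Rightarrow> (nat \<times> (nat \<Rightarrow> real)) measure" where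
  "user_law n Mi enc_i =
     measure_pmf (pmf_of_set {..<Mi}) \<bind>
       (\<lambda>m. distr (enc_i m) (count_space UNIV \<Otimes>\<^sub>M blk n) (\<lambda>x. (m, x)))"

definition code_space :: "nat \<Rightarrow> nat \<Rightarrow> (nat \<Rightarrow> nat) \<Rightarrow> (nat \<Rightarrow> nat \<Rightarrow> (nat \<Rightarrow> real) measure)
    \<Rightarrow> ((nat \<Rightarrow> nat \<times> (nat \<Rightarrow> real)) \<times> (nat \<Rightarrow> nat \<Rightarrow> real)) measure" where
  "code_space K n Msz enc =
     PiM {1..K} (\<lambda>i. user_law n (Msz i) (enc i)) \<Otimes>\<^sub>M
     PiM {0..K} (\<lambda>_. PiM {..<n} (\<lambda>_. std_gauss))"

definition cW :: "nat \<Rightarrow> ((nat \<Rightarrow> nat \<times> (nat \<Rightarrow> real)) \<times> (nat \<Rightarrow> nat \<Rightarrow> real)) \<Rightarrow> nat" where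
  "cW i \<omega> = fst (fst \<omega> i)"

definition cX :: "nat \<Rightarrow> ((nat \<Rightarrow> nat \<times> (nat \<Rightarrow> real)) \<times> (nat \<Rightarrow> nat \<Rightarrow> real)) \<Rightarrow> nat \<Rightarrow> real" where
  "cX i \<omega> = snd (fst \<omega> i)"

definition cY :: "(nat \<Rightarrow> nat \<Rightarrow> real) \<Rightarrow> (nat \<Rightarrow> real) \<Rightarrow> nat \<Rightarrow> nat \<Rightarrow> nat
    \<Rightarrow> ((nat \<Rightarrow> nat \<times> (nat \<Rightarrow> real)) \<times> (nat \<Rightarrow> nat \<Rightarrow> real)) \<Rightarrow> nat \<Rightarrow> real" where
  "cY h g K n j \<omega> = (\<lambda>t\<in>{..<n}. (\<Sum>k\<in>{1..K}. gain h g k j * cX k \<omega> t) + snd \<omega> j t)"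

definition cWall :: "nat \<Rightarrow> ((nat \<Rightarrow> nat \<times> (nat \<Rightarrow> real)) \<times> (nat \<Rightarrow> nat \<Rightarrow> real)) \<Rightarrow> nat list" where
  "cWall K \<omega> = map (\<lambda>j. cW j \<omega>) [1..<Suc K]"

definition cWminus :: "nat \<Rightarrow> nat \<Rightarrow> ((nat \<Rightarrow> nat \<times> (nat \<Rightarrow> real)) \<times> (nat \<Rightarrow> nat \<Rightarrow> real)) \<Rightarrow> nat list" where
  "cWminus K i \<omega> = map (\<lambda>j. cW j \<omega>) (filter (\<lambda>j. j \<noteq> i) [1..<Suc K])"

definition ic_cm_ee_achievable ::
  "nat \<Rightarrow> (nat \<Rightarrow> nat \<Rightarrow> real) \<Rightarrow> (nat \<Rightarrow> real) \<Rightarrow> real \<Rightarrow> (nat \<Rightarrow> real) \<Rightarrow> bool" where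
  "ic_cm_ee_achievable K h g P R \<longleftrightarrow>
    (\<forall>\<epsilon>>0. \<exists>(n::nat) (Msz::nat \<Rightarrow> nat) (enc::nat \<Rightarrow> nat \<Rightarrow> (nat \<Rightarrow> real) measure)
               (dec::nat \<Rightarrow> (nat \<Rightarrow> real) \<Rightarrow> nat).
      0 < n \<and>
      (\<forall>i\<in>{1..K}.
         0 < Msz i \<and>
         R i - \<epsilon> \<le> log 2 (real (Msz i)) / real n \<and>
         (\<forall>m. prob_space (enc i m) \<and> sets (enc i m) = sets (blk n)) \<and>
         dec i \<in> blk n \<rightarrow>\<^sub>M count_space UNIV) \<and>
      (let \<Omega> = code_space K n Msz enc in
        (\<forall>i\<in>{1..K}.
           (\<forall>t<n. integrable \<Omega> (\<lambda>\<omega>. (cX i \<omega> t)\<^sup>2)) \<and>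
           (\<Sum>t<n. \<integral>\<omega>. (cX i \<omega> t)\<^sup>2 \<partial>\<Omega>) / real n \<le> P \<and>
           measure \<Omega> {\<omega> \<in> space \<Omega>. dec i (cY h g K n i \<omega>) \<noteq> cW i \<omega>} \<le> \<epsilon> \<and>
           prob_space.conditional_entropy \<Omega> 2 (count_space UNIV) (blk n) (cWminus K i) (cY h g K n i)
             \<ge> prob_space.entropy \<Omega> 2 (count_space UNIV) (cWminus K i) - real n * \<epsilon>) \<and>
        prob_space.conditional_entropy \<Omega> 2 (count_space UNIV) (blk n) (cWall K) (cY h g K n 0)
          \<ge> prob_space.entropy \<Omega> 2 (count_space UNIV) (cWall K) - real n * \<epsilon>))"

end

theory Submission
  imports Defs
begin

text \<open>Random wiretap coding. User \<open>i\<close> draws codewords i.i.d. from the law of \<open>V i\<close>, one for each pair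
  of a message and a local randomisation index of rate \<open>R' i\<close>, and passes the selected codeword
  letter by letter through the prefix channel \<open>V i \<rightarrow> X i\<close>. A threshold decoder succeeds when
  \<open>R i + R' i < I(V i; Y i)\<close>. By the chain rule, and since conditioning reduces entropy, the leakage
  to receiver \<open>j\<close> is at most the sum over users \<open>i\<close> of the information about \<open>W i\<close> given the
  codewords of all other users; soft covering makes this vanish when
  \<open>R' i > I(V i; Y j | V_{-i})\<close>. Both expectations over the codebook decay exponentially
  because the likelihood ratios are bounded above by the inverse prior probabilities of the finitely
  supported inputs, which makes Chernoff bounds available. Finally a codebook that is good for all
  receivers at once is selected.\<close>

section \<open>Conditional entropy along fibers\<close>

text \<open>Everything is done pointwise in the channel output first. For a fixed output block the
  label tuples carry positive weights \<open>F\<close>, the output density given the selected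
  codewords, and entropies become finite sums of fiber masses of \<open>F\<close>. The integral over
  the output comes last and in \<open>ennreal\<close>, so that Tonelli exchanges it freely with the
  codebook average. Chernoff bounds near 0 also need the lower tail of the log-likelihood ratio. It
  is controlled by a change of measure: the inverse ratio has mean 1. No typical sets are involved,
  which suits continuous outputs and arbitrary prefix channels. The rate condition says that an
  interval for the randomisation rate of each user is nonempty; the exponents for decoding and for
  secrecy both live on its two halves. The power constraint is a separate obstacle. A random
  codebook obeys it only in the mean, possibly with equality, so concentration alone cannot enforce
  it; a small fraction of silent letters creates the required slack at a negligible loss of
  rate.\<close>

definition fiber_sum :: "('a \<Rightarrow> real) \<Rightarrow> 'a set \<Rightarrow> ('a \<Rightarrow> 'b) \<Rightarrow> 'a \<Rightarrow> real" where
  "fiber_sum F A \<phi> a = sum F {a' \<in> A. \<phi> a' = \<phi> a}"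

lemma fiber_sum_cong:
  assumes "\<And>a'. a' \<in> A \<Longrightarrow> \<phi> a' = \<phi> a \<longleftrightarrow> \<psi> a' = \<psi> a"
  shows "fiber_sum F A \<phi> a = fiber_sum F A \<psi> a"
proof -
  have "{a' \<in> A. \<phi> a' = \<phi> a} = {a' \<in> A. \<psi> a' = \<psi> a}" using assms by auto
  then show ?thesis by (simp add: fiber_sum_def)
qed

lemma fiber_sum_eq: "\<phi> a = \<phi> b \<Longrightarrow> fiber_sum F A \<phi> a = fiber_sum F A \<phi> b"
  by (simp add: fiber_sum_def)

lemma fiber_sum_pos:
  fixes F :: "'a \<Rightarrow> real"
  assumes "finite A" "\<And>a. a \<in> A \<Longrightarrow> F a > 0" "a \<in> A"
  shows "fiber_sum F A \<phi> a > 0"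
  unfolding fiber_sum_def using assms by (intro sum_pos) auto

text \<open>Both sides add \<open>F a' * G a\<close> over all pairs in a common fiber, and being in
  a common fiber is symmetric. Summation over fibers is thus self-adjoint; this serves as the tower
  property for unnormalised conditional expectations.\<close>

lemma sum_fiber_sum_swap:
  assumes "finite A"
  shows "(\<Sum>a\<in>A. fiber_sum F A \<gamma> a * G a) = (\<Sum>a\<in>A. F a * fiber_sum G A \<gamma> a)"
proof -
  have "(\<Sum>a\<in>A. fiber_sum F A \<gamma> a * G a) = (\<Sum>a\<in>A. \<Sum>a'\<in>{a' \<in> A. \<gamma> a' = \<gamma> a}. F a' * G a)"
    by (simp add: fiber_sum_def sum_distrib_right)
  also have "\<dots> = (\<Sum>a'\<in>A. \<Sum>a\<in>{a \<in> A. \<gamma> a' = \<gamma> a}. F a' * G a)"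
    using assms by (rule sum.swap_restrict) (use assms in auto)
  also have "\<dots> = (\<Sum>a\<in>A. F a * fiber_sum G A \<gamma> a)"
    by (simp add: fiber_sum_def sum_distrib_left eq_commute)
  finally show ?thesis .
qed

text \<open>The quotients are the conditional probabilities inside one fiber. They add up to exactly
  1 unless the fiber over \<open>z\<close> is empty, which is why only an inequality is
  claimed.\<close>

lemma sum_ratio_fiber_le_1:
  fixes F :: "'a \<Rightarrow> real"
  assumes "finite A" "\<And>a. a \<in> A \<Longrightarrow> F a > 0"
  shows "(\<Sum>a\<in>{a \<in> A. \<phi> a = z}. F a / fiber_sum F A \<phi> a) \<le> 1"
proof -
  have "(\<Sum>a\<in>{a \<in> A. \<phi> a = z}. F a / fiber_sum F A \<phi> a)
      = (\<Sum>a\<in>{a \<in> A. \<phi> a = z}. F a / sum F {a \<in> A. \<phi> a = z})"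
    by (intro sum.cong) (auto simp: fiber_sum_def)
  also have "\<dots> = sum F {a \<in> A. \<phi> a = z} / sum F {a \<in> A. \<phi> a = z}"
    by (rule sum_divide_distrib[symmetric])
  also have "\<dots> \<le> 1" by simp
  finally show ?thesis .
qed

text \<open>For normalised \<open>F\<close> the left side is the mean of 1 / P(\<beta> | \<gamma>).
  Given \<gamma>, each value of \<beta> that occurs contributes its probability times the inverse,
  that is 1, so the mean counts at most the values of \<beta>.\<close>

lemma sum_fiber_ratio_le:
  fixes F :: "'a \<Rightarrow> real"
  assumes fin: "finite A" and pos: "\<And>a. a \<in> A \<Longrightarrow> F a > 0"
  shows "(\<Sum>a\<in>A. F a * (fiber_sum F A \<gamma> a / fiber_sum F A (\<lambda>a. (\<beta> a, \<gamma> a)) a))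
    \<le> card (\<beta> ` A) * sum F A"
proof -
  have "(\<Sum>a\<in>A. F a * (fiber_sum F A \<gamma> a / fiber_sum F A (\<lambda>a. (\<beta> a, \<gamma> a)) a))
      = (\<Sum>a\<in>A. fiber_sum F A \<gamma> a * (F a / fiber_sum F A (\<lambda>a. (\<beta> a, \<gamma> a)) a))"
    by (intro sum.cong) auto
  also have "\<dots> = (\<Sum>a\<in>A. F a * fiber_sum (\<lambda>a. F a / fiber_sum F A (\<lambda>a. (\<beta> a, \<gamma> a)) a) A \<gamma> a)"
    by (rule sum_fiber_sum_swap[OF fin])
  also have "\<dots> \<le> (\<Sum>a\<in>A. F a * card (\<beta> ` A))"
  proof (intro sum_mono mult_left_mono)
    fix a assume a: "a \<in> A"
    have "fiber_sum (\<lambda>a. F a / fiber_sum F A (\<lambda>a. (\<beta> a, \<gamma> a)) a) A \<gamma> a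
      = (\<Sum>b\<in>\<beta> ` A. \<Sum>a'\<in>{a' \<in> {a' \<in> A. \<gamma> a' = \<gamma> a}. \<beta> a' = b}. F a' / fiber_sum F A (\<lambda>a. (\<beta> a, \<gamma> a)) a')"
      unfolding fiber_sum_def[of _ A \<gamma>] using fin by (intro sum.group[symmetric]) auto
    also have "\<dots> \<le> (\<Sum>b\<in>\<beta> ` A. 1)"
    proof (intro sum_mono)
      fix b
      have "{a' \<in> {a' \<in> A. \<gamma> a' = \<gamma> a}. \<beta> a' = b} = {a' \<in> A. (\<beta> a', \<gamma> a') = (b, \<gamma> a)}" by auto
      then show "(\<Sum>a'\<in>{a' \<in> {a' \<in> A. \<gamma> a' = \<gamma> a}. \<beta> a' = b}. F a' / fiber_sum F A (\<lambda>a. (\<beta> a, \<gamma> a)) a') \<le> 1"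
        using sum_ratio_fiber_le_1[of A F "\<lambda>a. (\<beta> a, \<gamma> a)" "(b, \<gamma> a)", OF fin pos] by simp
    qed
    finally show "fiber_sum (\<lambda>a. F a / fiber_sum F A (\<lambda>a. (\<beta> a, \<gamma> a)) a) A \<gamma> a \<le> card (\<beta> ` A)"
      by simp
  qed (use pos in \<open>auto simp: less_imp_le\<close>)
  also have "\<dots> = card (\<beta> ` A) * sum F A" by (simp add: sum_distrib_right[symmetric])
  finally show ?thesis .
qed

text \<open>The bound ln z \<ge> 1 - 1/z reduces H(\<beta> | \<gamma>) \<le> ln \<open>M\<close> to
  the mean of the inverse conditional probability. It makes the leakage nonnegative at every output,
  so that it can be integrated in \<open>ennreal\<close>.\<close>

lemma sum_fiber_info_nonneg:
  fixes F :: "'a \<Rightarrow> real"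
  assumes fin: "finite A" and pos: "\<And>a. a \<in> A \<Longrightarrow> F a > 0"
    and M: "card (\<beta> ` A) \<le> M" "0 < M"
  shows "0 \<le> (\<Sum>a\<in>A. F a * ln (real M * (fiber_sum F A (\<lambda>a. (\<beta> a, \<gamma> a)) a / fiber_sum F A \<gamma> a)))"
proof -
  let ?r = "\<lambda>a. fiber_sum F A \<gamma> a / fiber_sum F A (\<lambda>a. (\<beta> a, \<gamma> a)) a"
  have "(\<Sum>a\<in>A. F a * ?r a) \<le> card (\<beta> ` A) * sum F A"
    by (rule sum_fiber_ratio_le[of A F, OF fin pos])
  also have "\<dots> \<le> M * sum F A"
    using M pos by (intro mult_right_mono sum_nonneg) (auto simp: less_imp_le)
  finally have "0 \<le> sum F A - (\<Sum>a\<in>A. F a * ?r a) / M"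
    using M by (simp add: field_simps)
  also have "\<dots> = (\<Sum>a\<in>A. F a * (1 - ?r a / M))"
    by (simp add: algebra_simps sum_subtractf sum_divide_distrib)
  also have "\<dots> \<le> (\<Sum>a\<in>A. F a * ln (real M * (fiber_sum F A (\<lambda>a. (\<beta> a, \<gamma> a)) a / fiber_sum F A \<gamma> a)))"
  proof (intro sum_mono mult_left_mono)
    fix a assume a: "a \<in> A"
    have p: "fiber_sum F A (\<lambda>a. (\<beta> a, \<gamma> a)) a > 0" "fiber_sum F A \<gamma> a > 0"
      using fiber_sum_pos[of A F, OF fin pos a] by auto
    have "ln (?r a / M) \<le> ?r a / M - 1" using p M by (intro ln_le_minus_one) auto
    moreover have "ln (real M * (fiber_sum F A (\<lambda>a. (\<beta> a, \<gamma> a)) a / fiber_sum F A \<gamma> a)) = - ln (?r a / M)"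
      using p M by (simp add: ln_mult ln_div)
    ultimately show "1 - ?r a / M \<le> ln (real M * (fiber_sum F A (\<lambda>a. (\<beta> a, \<gamma> a)) a / fiber_sum F A \<gamma> a))"
      by simp
  qed (use pos in \<open>auto simp: less_imp_le\<close>)
  finally show ?thesis .
qed

text \<open>Up to sign and normalisation this is H(\<beta>|\<alpha>) \<ge> H(\<beta>|\<gamma>) for a random
  element of \<open>A\<close> with weights \<open>F\<close>, when \<open>\<alpha>\<close> is a function of \<open>\<gamma>\<close>.\<close>

lemma conditioning_reduces_fiber_entropy:
  fixes F :: "'a \<Rightarrow> real"
  assumes fin: "finite A" and pos: "\<And>a. a \<in> A \<Longrightarrow> F a > 0"
    and factor: "\<And>a a'. a \<in> A \<Longrightarrow> a' \<in> A \<Longrightarrow> \<gamma> a = \<gamma> a' \<Longrightarrow> \<alpha> a = \<alpha> a'"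
  shows "(\<Sum>a\<in>A. F a * ln (fiber_sum F A (\<lambda>a. (\<alpha> a, \<beta> a)) a / fiber_sum F A \<alpha> a))
    \<le> (\<Sum>a\<in>A. F a * ln (fiber_sum F A (\<lambda>a. (\<beta> a, \<gamma> a)) a / fiber_sum F A \<gamma> a))"
proof -
  define ab where "ab = fiber_sum F A (\<lambda>a. (\<alpha> a, \<beta> a))"
  define bg where "bg = fiber_sum F A (\<lambda>a. (\<beta> a, \<gamma> a))"
  define fa where "fa = fiber_sum F A \<alpha>"
  define fg where "fg = fiber_sum F A \<gamma>"
  have p: "ab a > 0" "bg a > 0" "fa a > 0" "fg a > 0" if "a \<in> A" for a
    unfolding ab_def bg_def fa_def fg_def using fiber_sum_pos[of A F, OF fin pos that] by auto
  \<comment> \<open>On a \<gamma>-fiber \<alpha> is constant. The weights \<open>F a / bg a\<close>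
    there add up to at most 1 for each value of \<beta>, so what is left is a sum of P(\<beta> |
    \<alpha>) over values of \<beta>, which is at most 1.\<close>
  have inner: "fiber_sum (\<lambda>a. F a * ab a / (fa a * bg a)) A \<gamma> c \<le> 1" if c: "c \<in> A" for c
  proof -
    let ?Z = "{a \<in> A. \<gamma> a = \<gamma> c}"
    have "fiber_sum (\<lambda>a. F a * ab a / (fa a * bg a)) A \<gamma> c
        = (\<Sum>a\<in>?Z. \<Sum>d\<in>{d \<in> A. (\<alpha> d, \<beta> d) = (\<alpha> a, \<beta> a)}. F a / bg a * F d / fa c)"
      unfolding fiber_sum_def
    proof (intro sum.cong refl)
      fix a assume a: "a \<in> ?Z"
      then have "\<alpha> a = \<alpha> c" using factor[of a c] c by auto
      then have "fa a = fa c" unfolding fa_def by (rule fiber_sum_eq)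
      then show "F a * ab a / (fa a * bg a)
        = (\<Sum>d\<in>{d \<in> A. (\<alpha> d, \<beta> d) = (\<alpha> a, \<beta> a)}. F a / bg a * F d / fa c)"
        unfolding sum_divide_distrib[symmetric] sum_distrib_left[symmetric]
        by (simp add: ab_def fiber_sum_def)
    qed
    also have "\<dots> = (\<Sum>a\<in>?Z. \<Sum>d\<in>{d \<in> {d \<in> A. \<alpha> d = \<alpha> c}. \<beta> d = \<beta> a}. F a / bg a * F d / fa c)"
    proof (intro sum.cong refl)
      fix a assume "a \<in> ?Z"
      then have "\<alpha> a = \<alpha> c" using factor[of a c] c by auto
      then show "{d \<in> A. (\<alpha> d, \<beta> d) = (\<alpha> a, \<beta> a)} = {d \<in> {d \<in> A. \<alpha> d = \<alpha> c}. \<beta> d = \<beta> a}" by auto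
    qed
    also have "\<dots> = (\<Sum>d\<in>{d \<in> A. \<alpha> d = \<alpha> c}. \<Sum>a\<in>{a \<in> ?Z. \<beta> d = \<beta> a}. F a / bg a * F d / fa c)"
      using fin by (intro sum.swap_restrict) auto
    also have "\<dots> = (\<Sum>d\<in>{d \<in> A. \<alpha> d = \<alpha> c}. (\<Sum>a\<in>{a \<in> ?Z. \<beta> d = \<beta> a}. F a / bg a) * (F d / fa c))"
      by (simp add: sum_distrib_right sum_divide_distrib)
    also have "\<dots> \<le> (\<Sum>d\<in>{d \<in> A. \<alpha> d = \<alpha> c}. 1 * (F d / fa c))"
    proof (intro sum_mono mult_right_mono)
      fix d assume d: "d \<in> {d \<in> A. \<alpha> d = \<alpha> c}"
      have "{a \<in> ?Z. \<beta> d = \<beta> a} = {a \<in> A. (\<beta> a, \<gamma> a) = (\<beta> d, \<gamma> c)}" by auto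
      then show "(\<Sum>a\<in>{a \<in> ?Z. \<beta> d = \<beta> a}. F a / bg a) \<le> 1"
        unfolding bg_def using sum_ratio_fiber_le_1[of A F "\<lambda>a. (\<beta> a, \<gamma> a)" "(\<beta> d, \<gamma> c)", OF fin pos] by simp
      show "0 \<le> F d / fa c" using d p[OF c] pos[of d] by auto
    qed
    also have "\<dots> = 1" using p[OF c]
      by (simp add: sum_divide_distrib[symmetric] fa_def fiber_sum_def)
    finally show ?thesis .
  qed
  \<comment> \<open>Gibbs inequality: the ratio of P(\<beta> | \<alpha>) to P(\<beta> | \<gamma>)
    has mean at most 1, so by ln x \<le> x - 1 its logarithm has mean at most 0.\<close>
  have "(\<Sum>a\<in>A. F a * (ab a / fa a * (fg a / bg a))) = (\<Sum>a\<in>A. fg a * (F a * ab a / (fa a * bg a)))"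
    by (intro sum.cong) auto
  also have "\<dots> = (\<Sum>a\<in>A. F a * fiber_sum (\<lambda>a. F a * ab a / (fa a * bg a)) A \<gamma> a)"
    unfolding fg_def by (rule sum_fiber_sum_swap[OF fin])
  also have "\<dots> \<le> (\<Sum>a\<in>A. F a * 1)"
    using inner pos by (intro sum_mono mult_left_mono) (auto simp: less_imp_le)
  finally have le: "(\<Sum>a\<in>A. F a * (ab a / fa a * (fg a / bg a) - 1)) \<le> 0"
    by (simp add: algebra_simps sum_subtractf)
  have "(\<Sum>a\<in>A. F a * ln (ab a / fa a)) - (\<Sum>a\<in>A. F a * ln (bg a / fg a))
      = (\<Sum>a\<in>A. F a * ln (ab a / fa a * (fg a / bg a)))"
    unfolding sum_subtractf[symmetric]
  proof (intro sum.cong refl)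
    fix a assume a: "a \<in> A"
    show "F a * ln (ab a / fa a) - F a * ln (bg a / fg a) = F a * ln (ab a / fa a * (fg a / bg a))"
      using p[OF a] by (simp add: ln_mult ln_div algebra_simps)
  qed
  also have "\<dots> \<le> (\<Sum>a\<in>A. F a * (ab a / fa a * (fg a / bg a) - 1))"
    using p pos by (intro sum_mono mult_left_mono ln_le_minus_one mult_pos_pos divide_pos_pos)
      (auto simp: less_imp_le)
  also note le
  finally show ?thesis by (simp add: ab_def bg_def fa_def fg_def)
qed

text \<open>Chain rule, one user at a time: when user \<open>i\<close> joins \<open>S\<close>, its
  message is conditioned on the messages already in \<open>S\<close>, and conditioning on every
  label except the \<open>i\<close>-th only lowers its entropy further. Erasing coordinate
  \<open>i\<close> by \<open>a(i := undefined)\<close> encodes this maximal side information. The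
  sums are negative entropies, hence the direction of the inequality.\<close>

lemma fiber_entropy_chain:
  fixes F :: "(nat \<Rightarrow> 'b) \<Rightarrow> real" and \<mu> :: "'b \<Rightarrow> 'c"
  assumes fin: "finite A" and pos: "\<And>a. a \<in> A \<Longrightarrow> F a > 0" and S: "finite S"
  shows "(\<Sum>a\<in>A. F a * ln (fiber_sum F A (\<lambda>a. restrict (\<lambda>k. \<mu> (a k)) S) a / sum F A))
    \<le> (\<Sum>i\<in>S. \<Sum>a\<in>A. F a * ln (fiber_sum F A (\<lambda>a. (\<mu> (a i), a(i := undefined))) a
                           / fiber_sum F A (\<lambda>a. a(i := undefined)) a))"
  using S
proof (induction S rule: finite_induct)
  case empty
  have "(\<Sum>a\<in>A. F a * ln (fiber_sum F A (\<lambda>a. restrict (\<lambda>k. \<mu> (a k)) {}) a / sum F A)) = (\<Sum>a\<in>A. F a * ln 1)"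
  proof (intro sum.cong refl)
    fix a assume a: "a \<in> A"
    have "sum F A > 0" using a fin pos by (intro sum_pos) auto
    moreover have "{a' \<in> A. (\<lambda>k\<in>{}. \<mu> (a' k)) = (\<lambda>k\<in>{}. \<mu> (a k))} = A"
      by (auto simp: restrict_def)
    ultimately show "F a * ln (fiber_sum F A (\<lambda>a. restrict (\<lambda>k. \<mu> (a k)) {}) a / sum F A) = F a * ln 1"
      by (simp add: fiber_sum_def)
  qed
  then show ?case unfolding sum.empty by (simp only: ln_one mult_zero_right sum.neutral_const order.refl)
next
  case (insert i S)
  let ?\<alpha> = "\<lambda>a. restrict (\<lambda>k. \<mu> (a k)) S"
  have eq: "fiber_sum F A (\<lambda>a. restrict (\<lambda>k. \<mu> (a k)) (insert i S)) a = fiber_sum F A (\<lambda>a. (?\<alpha> a, \<mu> (a i))) a" for a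
    by (rule fiber_sum_cong) (auto simp: restrict_def fun_eq_iff; metis insert.hyps(2))
  have "(\<Sum>a\<in>A. F a * ln (fiber_sum F A (\<lambda>a. (?\<alpha> a, \<mu> (a i))) a / sum F A))
      = (\<Sum>a\<in>A. F a * ln (fiber_sum F A (\<lambda>a. (?\<alpha> a, \<mu> (a i))) a / fiber_sum F A ?\<alpha> a))
       + (\<Sum>a\<in>A. F a * ln (fiber_sum F A ?\<alpha> a / sum F A))"
    unfolding sum.distrib[symmetric]
  proof (intro sum.cong refl)
    fix a assume a: "a \<in> A"
    have "sum F A > 0" using a fin pos by (intro sum_pos) auto
    moreover have "fiber_sum F A (\<lambda>a. (?\<alpha> a, \<mu> (a i))) a > 0" "fiber_sum F A ?\<alpha> a > 0"
      using fiber_sum_pos[of A F, OF fin pos a] by auto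
    ultimately show "F a * ln (fiber_sum F A (\<lambda>a. (?\<alpha> a, \<mu> (a i))) a / sum F A)
      = F a * ln (fiber_sum F A (\<lambda>a. (?\<alpha> a, \<mu> (a i))) a / fiber_sum F A ?\<alpha> a)
      + F a * ln (fiber_sum F A ?\<alpha> a / sum F A)"
      by (simp add: ln_div algebra_simps)
  qed
  also have "(\<Sum>a\<in>A. F a * ln (fiber_sum F A (\<lambda>a. (?\<alpha> a, \<mu> (a i))) a / fiber_sum F A ?\<alpha> a))
     \<le> (\<Sum>a\<in>A. F a * ln (fiber_sum F A (\<lambda>a. (\<mu> (a i), a(i := undefined))) a
                           / fiber_sum F A (\<lambda>a. a(i := undefined)) a))"
  proof (rule conditioning_reduces_fiber_entropy[OF fin pos])
    fix a a' :: "nat \<Rightarrow> 'b" assume *: "a(i := undefined) = a'(i := undefined)"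
    have "a k = a' k" if "k \<noteq> i" for k using fun_cong[OF *, of k] that by simp
    then have "a k = a' k" if "k \<in> S" for k using that insert.hyps by metis
    then show "?\<alpha> a = ?\<alpha> a'" by (auto simp: restrict_def fun_eq_iff)
  qed
  finally show ?case unfolding eq sum.insert[OF insert.hyps] using insert.IH by linarith
qed

section \<open>Random codebooks\<close>

lemma finite_set_Pi_pmf:
  assumes "finite A" "\<And>x. x \<in> A \<Longrightarrow> finite (set_pmf (p x))"
  shows "finite (set_pmf (Pi_pmf A d p))"
  using assms by (subst set_Pi_pmf) (auto simp: o_def)

lemma set_Pi_pmf_extensional:
  "finite A \<Longrightarrow> u \<in> set_pmf (Pi_pmf A undefined p) \<Longrightarrow> u \<in> extensional A"
  using set_Pi_pmf_subset[of A undefined p] by (auto simp: extensional_def)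

text \<open>Injectivity of \<open>e\<close> is the point: a codebook read at distinct positions
  gives independent codewords.\<close>

lemma Pi_pmf_reindex:
  assumes fin: "finite J" "finite I" and inj: "inj_on e I" and sub: "e ` I \<subseteq> J"
  shows "map_pmf (\<lambda>C. \<lambda>x\<in>I. C (e x)) (Pi_pmf J d q) = Pi_pmf I undefined (\<lambda>x. q (e x))"
proof (rule pmf_eqI)
  fix g
  let ?h = "\<lambda>C. \<lambda>x\<in>I. C (e x)"
  show "pmf (map_pmf ?h (Pi_pmf J d q)) g = pmf (Pi_pmf I undefined (\<lambda>x. q (e x))) g"
  proof (cases "g \<in> extensional I")
    case True
    \<comment> \<open>The event that the reading along \<open>e\<close> equals \<open>g\<close> is a
      box: positions hit by \<open>e\<close> are pinned to one value, all others stay free.\<close>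
    define B where "B j = (if j \<in> e ` I then {g (inv_into I e j)} else UNIV)" for j
    have "?h -` {g} = Pi J B"
    proof (intro set_eqI iffI)
      fix C assume "C \<in> ?h -` {g}"
      then have "\<And>x. x \<in> I \<Longrightarrow> C (e x) = g x" by (auto simp: restrict_def dest: fun_cong)
      then show "C \<in> Pi J B" using inj by (auto simp: B_def)
    next
      fix C assume C: "C \<in> Pi J B"
      have "C (e x) = g x" if "x \<in> I" for x
      proof -
        have "e x \<in> J" using that sub by auto
        then have "C (e x) \<in> B (e x)" using C by auto
        then show ?thesis using that inj by (simp add: B_def)
      qed
      then show "C \<in> ?h -` {g}" using True by (auto simp: restrict_def extensional_def fun_eq_iff)
    qed
    then have "pmf (map_pmf ?h (Pi_pmf J d q)) g = (\<Prod>j\<in>J. measure (measure_pmf (q j)) (B j))"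
      using fin by (simp add: pmf_map measure_Pi_pmf_Pi)
    also have "\<dots> = (\<Prod>j\<in>e ` I. measure (measure_pmf (q j)) (B j))"
      using fin sub by (intro prod.mono_neutral_right) (auto simp: B_def)
    also have "\<dots> = (\<Prod>x\<in>I. pmf (q (e x)) (g x))"
      using inj by (simp add: prod.reindex B_def measure_pmf_single)
    also have "\<dots> = pmf (Pi_pmf I undefined (\<lambda>x. q (e x))) g"
      using True fin by (subst pmf_Pi') (auto simp: extensional_def)
    finally show ?thesis .
  next
    case False
    then have "?h -` {g} = {}" by auto
    then have "pmf (map_pmf ?h (Pi_pmf J d q)) g = 0" by (simp add: pmf_map)
    moreover have "pmf (Pi_pmf I undefined (\<lambda>x. q (e x))) g = 0"
      using False fin by (intro pmf_Pi_outside) (auto simp: extensional_def)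
    ultimately show ?thesis by simp
  qed
qed

lemma expectation_pair_pmf_finite:
  fixes f :: "'a \<Rightarrow> 'b \<Rightarrow> real"
  assumes "finite (set_pmf p)" "finite (set_pmf q)"
  shows "measure_pmf.expectation (pair_pmf p q) (\<lambda>(x, y). f x y)
    = measure_pmf.expectation p (\<lambda>x. measure_pmf.expectation q (f x))"
proof -
  have "measure_pmf.expectation (pair_pmf p q) (\<lambda>(x, y). f x y)
      = (\<Sum>(x, y)\<in>set_pmf p \<times> set_pmf q. f x y * (pmf p x * pmf q y))"
    using assms by (subst integral_measure_pmf_real[of "set_pmf p \<times> set_pmf q"])
      (auto simp: pmf_pair intro!: sum.cong)
  then show ?thesis
    using assms
    by (simp add: integral_measure_pmf_real[of "set_pmf p"] integral_measure_pmf_real[of "set_pmf q"]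
      sum.cartesian_product[symmetric] sum_distrib_left sum_distrib_right mult_ac)
qed

lemma expectation_swap_finite:
  fixes f :: "'a \<Rightarrow> 'b \<Rightarrow> real"
  assumes "finite (set_pmf p)" "finite (set_pmf q)"
  shows "measure_pmf.expectation p (\<lambda>x. measure_pmf.expectation q (f x))
    = measure_pmf.expectation q (\<lambda>y. measure_pmf.expectation p (\<lambda>x. f x y))"
  using assms
  by (simp add: integral_measure_pmf_real[of "set_pmf p"] integral_measure_pmf_real[of "set_pmf q"]
       sum_distrib_left sum_distrib_right mult_ac) (rule sum.swap)

lemma expectation_pos:
  fixes f :: "'a \<Rightarrow> real"
  assumes "finite (set_pmf p)" "\<And>x. 0 < f x"
  shows "0 < measure_pmf.expectation p f"
proof -
  have "0 < (\<Sum>x\<in>set_pmf p. f x * pmf p x)"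
    using assms by (intro sum_pos) (auto simp: set_pmf_not_empty pmf_positive)
  then show ?thesis using assms by (subst integral_measure_pmf_real[of "set_pmf p"]) auto
qed

text \<open>After splitting off coordinate \<open>i\<close>, the left side draws that coordinate
  twice and forgets the first draw. Applied to likelihoods: averaging over the codeword of user
  \<open>i\<close> does not change the mean over all codewords.\<close>

lemma expectation_Pi_pmf_resample:
  fixes f :: "('a \<Rightarrow> 'b) \<Rightarrow> real"
  assumes I: "finite I" "i \<in> I" and fin: "\<And>x. x \<in> I \<Longrightarrow> finite (set_pmf (q x))"
  shows "measure_pmf.expectation (Pi_pmf I d q) (\<lambda>u. measure_pmf.expectation (q i) (\<lambda>c. f (u(i := c))))
    = measure_pmf.expectation (Pi_pmf I d q) f"
proof -
  let ?R = "Pi_pmf (I - {i}) d q"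
  have eq: "Pi_pmf I d q = map_pmf (\<lambda>(y, f). f(i := y)) (pair_pmf (q i) ?R)"
    using I Pi_pmf_insert[of "I - {i}" i d q] by (simp add: insert_absorb)
  have fR: "finite (set_pmf ?R)" using I fin by (intro finite_set_Pi_pmf) auto
  have fi: "finite (set_pmf (q i))" using I fin by auto
  have "measure_pmf.expectation (Pi_pmf I d q) (\<lambda>u. measure_pmf.expectation (q i) (\<lambda>c. f (u(i := c))))
    = measure_pmf.expectation (pair_pmf (q i) ?R) (\<lambda>(y, g). measure_pmf.expectation (q i) (\<lambda>c. f (g(i := c))))"
    by (simp add: eq case_prod_unfold)
  also have "\<dots> = measure_pmf.expectation (q i) (\<lambda>c. measure_pmf.expectation ?R (\<lambda>g. f (g(i := c))))"
    using fR fi by (subst expectation_pair_pmf_finite) (auto intro: expectation_swap_finite)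
  also have "\<dots> = measure_pmf.expectation (Pi_pmf I d q) f"
    unfolding eq using fR fi by (simp add: case_prod_unfold expectation_pair_pmf_finite[of "q i" ?R "\<lambda>c g. f (g(i := c))", unfolded case_prod_unfold])
  finally show ?thesis .
qed

section \<open>Logarithm bounds behind soft covering\<close>

lemma ln_one_plus_le_powr:
  fixes x s :: real
  assumes "0 \<le> x" "0 < s" "s \<le> 1"
  shows "ln (1 + x) \<le> x powr s / s"
proof (cases "x \<le> 1")
  case True
  have "ln (1 + x) \<le> x" using assms ln_add_one_self_le_self by auto
  also have "x \<le> x powr s"
    using assms True powr_mono'[of s 1 x] by (cases "x = 0") auto
  also have "\<dots> \<le> x powr s / s" using assms mult_right_mono[of s 1 "x powr s"] by (simp add: field_simps)
  finally show ?thesis .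
next
  case False
  have "ln (1 + x) \<le> ln (2 * x)" using False by simp
  also have "\<dots> = ln 2 + ln x" using False by (simp add: ln_mult)
  also have "ln x = ln (x powr s) / s" using False assms by (simp add: ln_powr)
  also have "\<dots> \<le> (x powr s - 1) / s"
    using False assms by (intro divide_right_mono ln_le_minus_one) auto
  \<comment> \<open>The \<open>- 1 / s\<close> obtained from \<open>ln_le_minus_one\<close> pays for
    \<open>ln 2\<close>, because ln 2 < 1 \<le> 1 / \<open>s\<close>.\<close>
  also have "ln 2 + (x powr s - 1) / s \<le> x powr s / s"
  proof -
    have "ln 2 \<le> (1::real)" using ln_2_less_1 by simp
    also have "1 \<le> 1 / s" using assms by simp
    finally show ?thesis by (simp add: diff_divide_distrib)
  qed
  finally show ?thesis by simp
qed

text \<open>Superposes the tangent of \<open>ln\<close> at \<open>1 + x\<close>: the second summand has nonpositive mean once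
  \<open>r\<close> has conditional mean at most 1, which plays the role of Jensen's inequality.\<close>

lemma ln_add_le_powr_tangent:
  fixes x r s :: real
  assumes "0 < x" "0 \<le> r" "0 < s" "s \<le> 1"
  shows "ln (x + r) \<le> x powr s / s + (r - 1) / (1 + x)"
proof -
  have "ln (x + r) = ln (1 + x) + ln ((x + r) / (1 + x))" using assms by (simp add: ln_div)
  also have "ln ((x + r) / (1 + x)) \<le> (x + r) / (1 + x) - 1"
    using assms by (intro ln_le_minus_one) (auto intro!: divide_pos_pos)
  also have "(x + r) / (1 + x) - 1 = (r - 1) / (1 + x)" using assms by (simp add: field_simps)
  finally show ?thesis using ln_one_plus_le_powr[of x s] assms by simp
qed

section \<open>Random codebooks with message and randomisation labels\<close>

locale random_code =
  fixes I :: "nat set" and q :: "nat \<Rightarrow> 'c pmf" and Mn Ln :: "nat \<Rightarrow> nat"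
  assumes I: "finite I" "0 \<notin> I"
    and fin_q: "\<And>i. i \<in> I \<Longrightarrow> finite (set_pmf (q i))"
    and Mn: "\<And>i. i \<in> I \<Longrightarrow> 0 < Mn i" and Ln: "\<And>i. i \<in> I \<Longrightarrow> 0 < Ln i"
begin

text \<open>A label consists of a message and a local randomisation index. \<open>U\<close> is the
  law of \<open>word C a\<close> for every single \<open>a\<close>; codeword tuples are dependent
  only through labels that they share.\<close>

definition "labels i = {..<Mn i} \<times> {..<Ln i}"
definition "A = PiE I labels"
definition "codebook_law = Pi_pmf (Sigma I labels) undefined (\<lambda>(i, b). q i)"
definition "U = Pi_pmf I undefined q"
definition "word C a = (\<lambda>k\<in>I. C (k, a k))"

abbreviation "E p f \<equiv> measure_pmf.expectation p (f :: _ \<Rightarrow> real)"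

lemma finite_labels [simp]: "finite (labels i)"
  by (simp add: labels_def)

lemma finite_codebook_index [simp]: "finite (Sigma I labels)"
  using I by (intro finite_SigmaI) auto

lemma finite_A [simp]: "finite A"
  unfolding A_def using I by (intro finite_PiE) auto

lemma A_nonempty: "A \<noteq> {}"
  unfolding A_def PiE_eq_empty_iff using Mn Ln by (force simp: labels_def)

lemma A_D: "a \<in> A \<Longrightarrow> i \<in> I \<Longrightarrow> a i \<in> labels i"
  by (auto simp: A_def)

lemma A_upd: "a \<in> A \<Longrightarrow> i \<in> I \<Longrightarrow> b \<in> labels i \<Longrightarrow> a(i := b) \<in> A"
  by (auto simp: A_def PiE_iff extensional_def)

lemma card_labels: "card (labels i) = Mn i * Ln i"
  by (simp add: labels_def)

lemma finite_codebook_law [simp]: "finite (set_pmf codebook_law)"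
  unfolding codebook_law_def by (rule finite_set_Pi_pmf) (auto simp: fin_q)

lemma fin_U [simp]: "finite (set_pmf U)"
  unfolding U_def using I by (intro finite_set_Pi_pmf) (auto simp: fin_q)

lemma integrable_codebook_law [simp]: "integrable (measure_pmf codebook_law) (f :: _ \<Rightarrow> real)"
  by (rule integrable_measure_pmf_finite) simp

lemma word_upd: "i \<in> I \<Longrightarrow> word C (a(i := b)) = (word C a)(i := C (i, b))"
  by (auto simp: word_def restrict_def)

text \<open>A competing label \<open>b\<close> occupies a codebook position that \<open>a\<close>
  does not use, so its codeword is independent of the transmitted tuple. \<open>0 \<notin> I\<close>
  keeps index 0 free as a slot in which the competing codeword is listed next to the others.\<close>

lemma word_pair_law:
  assumes a: "a \<in> A" and i: "i \<in> I" "b \<in> labels i" "b \<noteq> a i"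
  shows "map_pmf (\<lambda>C. (word C a, C (i, b))) codebook_law = pair_pmf U (q i)"
proof -
  define e where "e k = (if k = 0 then (i, b) else (k, a k))" for k
  let ?I = "insert 0 I"
  have inj: "inj_on e ?I" using i I by (auto simp: e_def inj_on_def)
  have sub: "e ` ?I \<subseteq> Sigma I labels" using i a A_D by (auto simp: e_def)
  have "map_pmf (\<lambda>C. (word C a, C (i, b))) codebook_law
      = map_pmf (\<lambda>g. (restrict g I, g 0)) (map_pmf (\<lambda>C. \<lambda>x\<in>?I. C (e x)) codebook_law)"
    unfolding map_pmf_comp using I by (intro map_pmf_cong) (auto simp: e_def word_def restrict_def fun_eq_iff)
  also have "map_pmf (\<lambda>C. \<lambda>x\<in>?I. C (e x)) codebook_law = Pi_pmf ?I undefined (\<lambda>x. case e x of (i, b) \<Rightarrow> q i)"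
    unfolding codebook_law_def using I inj sub by (intro Pi_pmf_reindex) auto
  also have "\<dots> = map_pmf (\<lambda>(y, f). f(0 := y)) (pair_pmf (q i) (Pi_pmf I undefined (\<lambda>x. case e x of (i, b) \<Rightarrow> q i)))"
    using I by (subst Pi_pmf_insert) (auto simp: e_def)
  also have "Pi_pmf I undefined (\<lambda>x. case e x of (i, b) \<Rightarrow> q i) = U"
    unfolding U_def using I by (intro Pi_pmf_cong) (auto simp: e_def)
  also have "map_pmf (\<lambda>g. (restrict g I, g 0)) (map_pmf (\<lambda>(y, f). f(0 := y)) (pair_pmf (q i) U))
      = map_pmf (\<lambda>(x, y). (y, x)) (pair_pmf (q i) U)"
    unfolding map_pmf_comp
  proof (intro map_pmf_cong refl)
    fix z assume "z \<in> set_pmf (pair_pmf (q i) U)"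
    then have "snd z \<in> extensional I" unfolding U_def using I by (auto dest: set_Pi_pmf_extensional)
    then show "(restrict ((case z of (y, f) \<Rightarrow> f(0 := y))) I, (case z of (y, f) \<Rightarrow> f(0 := y)) 0)
      = (case z of (x, y) \<Rightarrow> (y, x))"
      using I by (auto simp: case_prod_unfold restrict_def extensional_def fun_eq_iff)
  qed
  also have "\<dots> = pair_pmf U (q i)" by (rule pair_commute_pmf[symmetric])
  finally show ?thesis .
qed

lemma E_word_pair:
  fixes \<phi> :: "(nat \<Rightarrow> 'c) \<Rightarrow> 'c \<Rightarrow> real"
  assumes "a \<in> A" "i \<in> I" "b \<in> labels i" "b \<noteq> a i"
  shows "E codebook_law (\<lambda>C. \<phi> (word C a) (C (i, b))) = E U (\<lambda>u. E (q i) (\<phi> u))"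
proof -
  have "E codebook_law (\<lambda>C. \<phi> (word C a) (C (i, b))) = E (map_pmf (\<lambda>C. (word C a, C (i, b))) codebook_law) (\<lambda>(u, c). \<phi> u c)"
    by simp
  then show ?thesis
    using assms fin_q by (simp add: word_pair_law expectation_pair_pmf_finite)
qed

lemma E_word:
  fixes \<phi> :: "(nat \<Rightarrow> 'c) \<Rightarrow> real"
  assumes a: "a \<in> A"
  shows "E codebook_law (\<lambda>C. \<phi> (word C a)) = E U \<phi>"
proof -
  have "map_pmf (\<lambda>C. word C a) codebook_law = U"
    unfolding codebook_law_def U_def word_def using I a A_D
    by (subst Pi_pmf_reindex[where e = "\<lambda>k. (k, a k)"]) (auto simp: inj_on_def)
  then have "E U \<phi> = E (map_pmf (\<lambda>C. word C a) codebook_law) \<phi>" by simp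
  then show ?thesis by simp
qed


lemma fiber_letter:
  assumes "a \<in> A" "i \<in> I"
  shows "{a' \<in> A. a'(i := undefined) = a(i := undefined)} = (\<lambda>b. a(i := b)) ` labels i"
proof (intro set_eqI iffI)
  fix a' assume a': "a' \<in> {a' \<in> A. a'(i := undefined) = a(i := undefined)}"
  then have *: "a'(i := undefined) = a(i := undefined)" by simp
  have "a' k = (a(i := a' i)) k" for k using fun_cong[OF *, of k] by (cases "k = i") auto
  then have "a' = a(i := a' i)" by (rule ext)
  moreover have "a' i \<in> labels i" using a' assms by (auto intro: A_D)
  ultimately show "a' \<in> (\<lambda>b. a(i := b)) ` labels i" by blast
qed (use assms in \<open>auto intro: A_upd\<close>)

text \<open>These tuples differ from \<open>a\<close> only in the randomisation index of user
  \<open>i\<close>: they select the codewords over which soft covering averages.\<close>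

lemma fiber_message:
  assumes "a \<in> A" "i \<in> I"
  shows "{a' \<in> A. (fst (a' i), a'(i := undefined)) = (fst (a i), a(i := undefined))}
    = (\<lambda>l. a(i := (fst (a i), l))) ` {..<Ln i}"
proof -
  have "{a' \<in> A. (fst (a' i), a'(i := undefined)) = (fst (a i), a(i := undefined))}
      = {a' \<in> {a' \<in> A. a'(i := undefined) = a(i := undefined)}. fst (a' i) = fst (a i)}" by auto
  also have "\<dots> = (\<lambda>b. a(i := b)) ` {b \<in> labels i. fst b = fst (a i)}"
    unfolding fiber_letter[OF assms] by auto
  also have "{b \<in> labels i. fst b = fst (a i)} = (\<lambda>l. (fst (a i), l)) ` {..<Ln i}"
    using A_D[OF assms] by (auto simp: labels_def)
  finally show ?thesis unfolding image_image .
qed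

lemma inj_upd: "inj_on (\<lambda>b. a(i := b)) B"
  by (auto simp: inj_on_def dest: fun_upd_eqD)

text \<open>The information that the message of user \<open>i\<close> shares with an observation, given all
  other codeword indices, when codeword tuple \<open>u\<close> produces the observation with weight \<open>W u\<close>.\<close>

definition genie_leak :: "((nat \<Rightarrow> 'c) \<Rightarrow> real) \<Rightarrow> nat \<Rightarrow> (nat \<times> nat \<times> nat \<Rightarrow> 'c) \<Rightarrow> real" where
  "genie_leak W i C = (\<Sum>a\<in>A. W (word C a) * ln (real (Mn i) *
     (fiber_sum (\<lambda>a. W (word C a)) A (\<lambda>a. (fst (a i), a(i := undefined))) a
        / fiber_sum (\<lambda>a. W (word C a)) A (\<lambda>a. a(i := undefined)) a))) / card A"

lemma genie_leak_nonneg: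
  assumes "\<And>u. 0 < W u" "i \<in> I"
  shows "0 \<le> genie_leak W i C"
proof -
  have "(\<lambda>a. fst (a i)) ` A \<subseteq> {..<Mn i}" using assms A_D by (force simp: labels_def)
  then have "card ((\<lambda>a. fst (a i)) ` A) \<le> Mn i" using card_mono[of "{..<Mn i}"] by fastforce
  then show ?thesis unfolding genie_leak_def using assms Mn
    by (intro divide_nonneg_nonneg sum_fiber_info_nonneg) auto
qed

text \<open>The mass of the message fiber splits into the own codeword and the
  \<open>Ln i - 1\<close> others with the same message. In units of \<open>Ln i * Q\<close> the
  first part is \<open>x\<close> and the rest is \<open>r\<close>. When \<open>Q\<close> is the mean
  likelihood over the codeword of user \<open>i\<close>, the rest has mean at most 1, which is what
  the tangent bound asks for. The last bracket compares the mass of all \<open>Mn i * Ln i\<close>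
  codewords with its mean.\<close>

lemma genie_leak_summand_le:
  fixes F :: "(nat \<Rightarrow> nat \<times> nat) \<Rightarrow> real" and Q s :: real
  assumes Fp: "\<And>b. 0 < F b" and i: "i \<in> I" and s: "0 < s" "s \<le> 1" and a: "a \<in> A"
    and Q: "Q > 0"
  shows "F a * ln (real (Mn i) * (fiber_sum F A (\<lambda>a. (fst (a i), a(i := undefined))) a
        / fiber_sum F A (\<lambda>a. a(i := undefined)) a))
    \<le> F a * ((F a / (Ln i * Q)) powr s / s)
      + (\<Sum>l\<in>{..<Ln i} - {snd (a i)}. F a / (1 + F a / (Ln i * Q)) * (F (a(i := (fst (a i), l))) / (Ln i * Q)))
      - F a / (1 + F a / (Ln i * Q))
      + (real (Mn i * Ln i) * Q * (F a / fiber_sum F A (\<lambda>a. a(i := undefined)) a) - F a)"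
proof -
  let ?L = "real (Ln i)" and ?M = "real (Mn i)"
  let ?G = "fiber_sum F A (\<lambda>a. (fst (a i), a(i := undefined))) a"
  let ?H = "fiber_sum F A (\<lambda>a. a(i := undefined)) a"
  have LM: "0 < ?L" "0 < ?M" using Mn Ln i by auto
  have GH: "?G > 0" "?H > 0" using fiber_sum_pos[of A F a] Fp a by auto
  define x where "x = F a / (?L * Q)"
  define r where "r = (\<Sum>l\<in>{..<Ln i} - {snd (a i)}. F (a(i := (fst (a i), l))) / (?L * Q))"
  have xr: "0 < x" "0 \<le> r" unfolding x_def r_def using Fp LM Q by (auto intro!: sum_nonneg simp: less_imp_le)
  have sn: "snd (a i) < Ln i" using A_D[OF a i] by (auto simp: labels_def)
  have "?G = (\<Sum>l\<in>{..<Ln i}. F (a(i := (fst (a i), l))))"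
    unfolding fiber_sum_def fiber_message[OF a i] by (subst sum.reindex) (auto simp: inj_on_def dest!: fun_upd_eqD)
  also have "\<dots> = F a + (\<Sum>l\<in>{..<Ln i} - {snd (a i)}. F (a(i := (fst (a i), l))))"
    using sn by (subst sum.remove[of _ "snd (a i)"]) auto
  also have "\<dots> = ?L * Q * (x + r)"
    using LM Q by (simp add: x_def r_def sum_divide_distrib[symmetric] distrib_left)
  finally have G: "?G = ?L * Q * (x + r)" .
  have "ln (?M * (?G / ?H)) = ln (x + r) + ln (?M * ?L * Q / ?H)"
    using xr LM Q GH by (simp add: G ln_mult ln_div)
  also have "\<dots> \<le> (x powr s / s + (r - 1) / (1 + x)) + (?M * ?L * Q / ?H - 1)"
    using xr s LM Q GH by (intro add_mono ln_add_le_powr_tangent ln_le_minus_one) auto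
  finally have "F a * ln (?M * (?G / ?H)) \<le> F a * ((x powr s / s + (r - 1) / (1 + x)) + (?M * ?L * Q / ?H - 1))"
    using Fp[of a] by (intro mult_left_mono) auto
  also have "\<dots> = F a * (x powr s / s) + F a / (1 + x) * r - F a / (1 + x) + (?M * ?L * Q * (F a / ?H) - F a)"
    by (simp add: algebra_simps diff_divide_distrib)
  finally show ?thesis unfolding r_def sum_distrib_left x_def by simp
qed

text \<open>Soft covering at a fixed observation. In the mean over codebooks only the first term of
  \<open>genie_leak_summand_le\<close> survives: the competing codewords of the same message add at
  most what \<open>- F a / (1 + x)\<close> takes away, and the bracket with \<open>Q\<close> has
  mean at most 0. The power of \<open>x\<close> carries the gain
  \<open>Ln i powr (- s)\<close>.\<close>

lemma E_genie_leak_le: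
  assumes W: "\<And>u. 0 < W u" and i: "i \<in> I" and s: "0 < s" "s \<le> 1"
  shows "E codebook_law (genie_leak W i) \<le> real (Ln i) powr (- s) / s *
    E U (\<lambda>u. W u * (W u / E (q i) (\<lambda>c. W (u(i := c)))) powr s)"
proof -
  let ?L = "real (Ln i)" and ?M = "real (Mn i)"
  define Q where "Q u = E (q i) (\<lambda>c. W (u(i := c)))" for u
  have Qp: "0 < Q u" for u
  proof -
    have "0 < (\<Sum>c\<in>set_pmf (q i). W (u(i := c)) * pmf (q i) c)"
      using fin_q[OF i] W by (intro sum_pos) (auto simp: set_pmf_not_empty pmf_positive)
    then show ?thesis unfolding Q_def using fin_q[OF i] by (subst integral_measure_pmf_real[of "set_pmf (q i)"]) auto
  qed
  have LM: "0 < ?L" "0 < ?M" using Mn Ln i by auto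
  define F where "F C a = W (word C a)" for C and a :: "nat \<Rightarrow> nat \<times> nat"
  have Fp: "0 < F C a" for C a by (simp add: F_def W)
  define x where "x u = W u / (?L * Q u)" for u
  define H where "H C a = fiber_sum (F C) A (\<lambda>a. a(i := undefined)) a" for C a
  define T where "T C a = F C a * (x (word C a) powr s / s)
      + (\<Sum>l\<in>{..<Ln i} - {snd (a i)}. F C a / (1 + x (word C a)) * (W ((word C a)(i := C (i, (fst (a i), l)))) / (?L * Q (word C a))))
      - F C a / (1 + x (word C a)) - F C a" for C a
  have "genie_leak W i C \<le> (\<Sum>a\<in>A. T C a + Q (word C a)) / card A" for C
  proof -
    have "card A * genie_leak W i C \<le> (\<Sum>a\<in>A. T C a + ?M * ?L * Q (word C a) * (F C a / H C a))"
    proof -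
      have "card A * genie_leak W i C = (\<Sum>a\<in>A. F C a * ln (?M * (fiber_sum (F C) A (\<lambda>a. (fst (a i), a(i := undefined))) a / H C a)))"
        unfolding genie_leak_def H_def F_def using A_nonempty by simp
      also have "\<dots> \<le> (\<Sum>a\<in>A. T C a + ?M * ?L * Q (word C a) * (F C a / H C a))"
      proof (intro sum_mono)
        fix a assume a: "a \<in> A"
        show "F C a * ln (?M * (fiber_sum (F C) A (\<lambda>a. (fst (a i), a(i := undefined))) a / H C a))
          \<le> T C a + ?M * ?L * Q (word C a) * (F C a / H C a)"
          using genie_leak_summand_le[of "F C" i s a "Q (word C a)", OF Fp i s a Qp]
          unfolding T_def H_def x_def F_def word_upd[OF i] of_nat_mult by linarith
      qed
      finally show ?thesis .
    qed
    also have "\<dots> = sum (T C) A + (\<Sum>a\<in>A. fiber_sum (\<lambda>a. Q (word C a)) A (\<lambda>a. a(i := undefined)) a * (F C a / H C a))"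
      unfolding sum.distrib[symmetric]
    proof (intro sum.cong refl arg_cong2[where f = "(+)"] arg_cong2[where f = "(*)"])
      fix a assume a: "a \<in> A"
      \<comment> \<open>\<open>Q\<close> averages over the codeword of user \<open>i\<close>, hence
        is constant along the fiber in coordinate \<open>i\<close>, and the factor
        \<open>Mn i * Ln i\<close> is just the number of its elements.\<close>
      have "fiber_sum (\<lambda>a. Q (word C a)) A (\<lambda>a. a(i := undefined)) a = (\<Sum>b\<in>labels i. Q (word C (a(i := b))))"
        unfolding fiber_sum_def fiber_letter[OF a i] by (subst sum.reindex) (auto intro: inj_upd)
      also have "\<dots> = (\<Sum>b\<in>labels i. Q (word C a))" by (simp add: word_upd[OF i] Q_def)
      also have "\<dots> = ?M * ?L * Q (word C a)" by (simp add: card_labels)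
      finally show "?M * ?L * Q (word C a) = fiber_sum (\<lambda>a. Q (word C a)) A (\<lambda>a. a(i := undefined)) a" ..
    qed
    \<comment> \<open>Moving the fiber sum onto the ratio leaves conditional probabilities, which
      add up to at most 1.\<close>
    also have "(\<Sum>a\<in>A. fiber_sum (\<lambda>a. Q (word C a)) A (\<lambda>a. a(i := undefined)) a * (F C a / H C a))
        = (\<Sum>a\<in>A. Q (word C a) * fiber_sum (\<lambda>a. F C a / H C a) A (\<lambda>a. a(i := undefined)) a)"
      by (rule sum_fiber_sum_swap) simp
    also have "\<dots> \<le> (\<Sum>a\<in>A. Q (word C a) * 1)"
      unfolding fiber_sum_def[of "\<lambda>a. F C a / H C a"] unfolding H_def
      by (intro sum_mono mult_left_mono sum_ratio_fiber_le_1) (auto simp: Fp Qp less_imp_le)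
    finally have "card A * genie_leak W i C \<le> (\<Sum>a\<in>A. T C a + Q (word C a))" by (simp add: sum.distrib)
    then show ?thesis using A_nonempty by (simp add: field_simps card_gt_0_iff)
  qed
  then have "E codebook_law (genie_leak W i) \<le> E codebook_law (\<lambda>C. (\<Sum>a\<in>A. T C a + Q (word C a)) / card A)"
    by (intro integral_mono) auto
  also have "\<dots> = (\<Sum>a\<in>A. E codebook_law (\<lambda>C. T C a) + E codebook_law (\<lambda>C. Q (word C a))) / card A"
    by (simp add: Bochner_Integration.integral_sum)
  also have "\<dots> \<le> (\<Sum>a\<in>A. E U (\<lambda>u. W u * (x u powr s / s))) / card A"
  proof (intro divide_right_mono sum_mono)
    fix a assume a: "a \<in> A"
    have sn: "snd (a i) < Ln i" "fst (a i) < Mn i" using A_D[OF a i] by (auto simp: labels_def)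
    have EQ: "E codebook_law (\<lambda>C. Q (word C a)) = E U W"
      unfolding E_word[OF a, of Q] unfolding Q_def U_def using I i fin_q by (intro expectation_Pi_pmf_resample) auto
    \<comment> \<open>The label \<open>(fst (a i), l)\<close> differs from \<open>a i\<close>, so
      its codeword is independent of \<open>word C a\<close> and its likelihood averages to
      \<open>Q\<close>.\<close>
    have cross: "E codebook_law (\<lambda>C. F C a / (1 + x (word C a)) * (W ((word C a)(i := C (i, (fst (a i), l)))) / (?L * Q (word C a))))
        = E U (\<lambda>u. W u / (1 + x u)) / ?L" if l: "l \<in> {..<Ln i} - {snd (a i)}" for l
    proof -
      have "E codebook_law (\<lambda>C. F C a / (1 + x (word C a)) * (W ((word C a)(i := C (i, (fst (a i), l)))) / (?L * Q (word C a))))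
          = E U (\<lambda>u. E (q i) (\<lambda>c. W u / (1 + x u) * (W (u(i := c)) / (?L * Q u))))"
        unfolding F_def using a i sn l
        by (intro E_word_pair[where \<phi> = "\<lambda>u c. W u / (1 + x u) * (W (u(i := c)) / (?L * Q u))"])
          (auto simp: labels_def prod_eq_iff)
      also have "\<dots> = E U (\<lambda>u. W u / (1 + x u) * (Q u / (?L * Q u)))"
        by (simp only: Q_def integral_mult_right_zero integral_divide_zero)
      also have "\<dots> = E U (\<lambda>u. W u / (1 + x u) / ?L)"
        using Qp by (intro Bochner_Integration.integral_cong) (auto simp: less_imp_neq[symmetric])
      finally show ?thesis by (simp only: integral_divide_zero)
    qed
    have S: "(\<Sum>l\<in>{..<Ln i} - {snd (a i)}. E codebook_law (\<lambda>C. F C a / (1 + x (word C a))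
          * (W ((word C a)(i := C (i, (fst (a i), l)))) / (?L * Q (word C a)))))
        = (\<Sum>l\<in>{..<Ln i} - {snd (a i)}. E U (\<lambda>u. W u / (1 + x u)) / ?L)"
      by (intro sum.cong refl cross)
    have "E codebook_law (\<lambda>C. T C a) = E U (\<lambda>u. W u * (x u powr s / s))
       + (\<Sum>l\<in>{..<Ln i} - {snd (a i)}. E U (\<lambda>u. W u / (1 + x u)) / ?L)
       - E U (\<lambda>u. W u / (1 + x u)) - E U W"
      unfolding T_def using E_word[OF a, of "\<lambda>u. W u * (x u powr s / s)"]
        E_word[OF a, of "\<lambda>u. W u / (1 + x u)"] E_word[OF a, of W]
      by (simp add: Bochner_Integration.integral_sum S[unfolded F_def] F_def del: times_divide_eq_right times_divide_eq_left)
    \<comment> \<open>There are \<open>Ln i - 1\<close> competitors with weight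
      \<open>1 / Ln i\<close> each: this is the conditional mean at most 1 that replaces Jensen's
      inequality.\<close>
    also have "(\<Sum>l\<in>{..<Ln i} - {snd (a i)}. E U (\<lambda>u. W u / (1 + x u)) / ?L) \<le> E U (\<lambda>u. W u / (1 + x u))"
    proof -
      have nn: "0 \<le> E U (\<lambda>u. W u / (1 + x u))"
        using W Qp LM
        by (intro Bochner_Integration.integral_nonneg divide_nonneg_nonneg add_nonneg_nonneg) (auto simp: x_def less_imp_le)
      have "real (card ({..<Ln i} - {snd (a i)})) \<le> ?L" using sn by simp
      then have "real (card ({..<Ln i} - {snd (a i)})) * (E U (\<lambda>u. W u / (1 + x u)) / ?L) \<le> ?L * (E U (\<lambda>u. W u / (1 + x u)) / ?L)"
        using nn by (intro mult_right_mono) auto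
      then show ?thesis using LM by simp
    qed
    finally show "E codebook_law (\<lambda>C. T C a) + E codebook_law (\<lambda>C. Q (word C a)) \<le> E U (\<lambda>u. W u * (x u powr s / s))"
      by (simp add: EQ)
  qed simp
  also have "\<dots> = E U (\<lambda>u. W u * (x u powr s / s))"
    using A_nonempty by simp
  also have "\<dots> = E U (\<lambda>u. (?L powr (- s) / s) * (W u * (W u / Q u) powr s))"
  proof (intro Bochner_Integration.integral_cong refl)
    fix u
    have "x u powr s = ?L powr (- s) * (W u / Q u) powr s"
      using LM Qp[of u] W[of u] by (simp add: x_def powr_divide powr_mult powr_minus field_simps)
    then show "W u * (x u powr s / s) = ?L powr (- s) / s * (W u * (W u / Q u) powr s)" by simp
  qed
  also have "\<dots> = ?L powr (- s) / s * E U (\<lambda>u. W u * (W u / Q u) powr s)" by simp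
  finally show ?thesis by (simp only: Q_def)
qed

text \<open>\<open>P c\<close> is the likelihood of the observation under codeword \<open>c\<close>.
  \<open>LEAST\<close> chooses among several passing messages; if none passes, its value is
  arbitrary and the bound below charges the case as an error.\<close>

definition threshold_decoder :: "('c \<Rightarrow> real) \<Rightarrow> real \<Rightarrow> nat \<Rightarrow> (nat \<times> nat \<times> nat \<Rightarrow> 'c) \<Rightarrow> nat" where
  "threshold_decoder P T i C = (LEAST m. \<exists>l<Ln i. m < Mn i \<and> T < P (C (i, (m, l))))"

text \<open>Either a wrong label passes, and then one summand \<open>P / T\<close> exceeds 1; or the
  true label fails, and then \<open>T / P\<close> is at least 1, as are its positive powers; or the
  true label alone passes and its message is returned. Wrong labels that share the true message are
  charged too, a harmless overcount.\<close>

lemma threshold_decoder_error_le: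
  assumes P: "\<And>c. 0 < P c" and T: "0 < T" and s: "0 < s" and i: "i \<in> I" and a: "a \<in> A"
  shows "of_bool (threshold_decoder P T i C \<noteq> fst (a i))
    \<le> (T / P (C (i, a i))) powr s + (\<Sum>b\<in>labels i - {a i}. P (C (i, b)) / T)"
proof (cases "\<exists>b\<in>labels i - {a i}. T < P (C (i, b))")
  case True
  then obtain b where b: "b \<in> labels i - {a i}" "T < P (C (i, b))" by auto
  have "1 \<le> P (C (i, b)) / T" using b T by simp
  also have "\<dots> \<le> (\<Sum>b\<in>labels i - {a i}. P (C (i, b)) / T)"
    using b P T by (intro member_le_sum) (auto simp: less_imp_le)
  finally have "1 \<le> (\<Sum>b\<in>labels i - {a i}. P (C (i, b)) / T)" .
  moreover have "0 \<le> (T / P (C (i, a i))) powr s" by simp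
  moreover have "of_bool (threshold_decoder P T i C \<noteq> fst (a i)) \<le> (1::real)" by simp
  ultimately show ?thesis by linarith
next
  case False
  have nn: "0 \<le> (\<Sum>b\<in>labels i - {a i}. P (C (i, b)) / T)"
    using P T by (intro sum_nonneg) (auto simp: less_imp_le)
  show ?thesis
  proof (cases "T < P (C (i, a i))")
    case True
    have ai: "fst (a i) < Mn i" "snd (a i) < Ln i" using A_D[OF a i] by (auto simp: labels_def)
    have "threshold_decoder P T i C = fst (a i)"
      unfolding threshold_decoder_def
    proof (rule Least_equality)
      show "\<exists>l<Ln i. fst (a i) < Mn i \<and> T < P (C (i, (fst (a i), l)))"
        using ai True by (intro exI[of _ "snd (a i)"]) simp
      fix m assume "\<exists>l<Ln i. m < Mn i \<and> T < P (C (i, (m, l)))"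
      then obtain l where "l < Ln i" "m < Mn i" "T < P (C (i, (m, l)))" by auto
      with False have "(m, l) = a i" by (force simp: labels_def)
      then show "fst (a i) \<le> m" by (metis fst_conv order.refl)
    qed
    then show ?thesis using nn by simp
  next
    case False
    have "1 \<le> T / P (C (i, a i))" using False P[of "C (i, a i)"] by simp
    then have "1 \<le> (T / P (C (i, a i))) powr s" using s by (intro ge_one_powr_ge_zero) auto
    moreover have "of_bool (threshold_decoder P T i C \<noteq> fst (a i)) \<le> (1::real)" by simp
    ultimately show ?thesis using nn by linarith
  qed
qed

text \<open>The contribution of one observation to the error probability, \<open>W u\<close> being
  its density under the codeword tuple \<open>u\<close>. The decoder treats the other users as
  noise: it averages the likelihood over their codewords and compares it with \<tau> times the
  overall mean.\<close>

definition decoding_error :: "((nat \<Rightarrow> 'c) \<Rightarrow> real) \<Rightarrow> real \<Rightarrow> nat \<Rightarrow> (nat \<times> nat \<times> nat \<Rightarrow> 'c) \<Rightarrow> real" where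
  "decoding_error W \<tau> i C = (\<Sum>a\<in>A. W (word C a) * of_bool (threshold_decoder
      (\<lambda>c. E U (\<lambda>u. W (u(i := c)))) (\<tau> * E U W) i C \<noteq> fst (a i))) / card A"

text \<open>The true codeword leaves a moment of order \<open>s\<close> of the inverse likelihood
  ratio. A wrong codeword is independent of the transmitted tuple, so its likelihood averages to
  \<open>E U W\<close>, and each label costs at most \<open>E U W / \<tau>\<close>.\<close>

lemma E_decoding_error_le:
  assumes W: "\<And>u. 0 < W u" and i: "i \<in> I" and s: "0 < s" and \<tau>: "0 < \<tau>"
  shows "E codebook_law (decoding_error W \<tau> i) \<le>
     \<tau> powr s * E U (\<lambda>u. W u * (E U W / E U (\<lambda>u'. W (u'(i := u i)))) powr s)
     + real (Mn i * Ln i) / \<tau> * E U W"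
proof -
  define P where "P c = E U (\<lambda>u. W (u(i := c)))" for c
  define Q where "Q = E U W"
  have Pp: "0 < P c" for c unfolding P_def by (intro expectation_pos) (auto simp: W)
  have Qp: "0 < Q" unfolding Q_def by (intro expectation_pos) (auto simp: W)
  have EP: "E (q i) P = Q"
    unfolding P_def Q_def U_def using I i fin_q
    by (subst expectation_swap_finite) (auto intro!: finite_set_Pi_pmf expectation_Pi_pmf_resample)
  let ?T = "\<lambda>C a. W (word C a) * ((\<tau> * Q / P (word C a i)) powr s)
      + (\<Sum>b\<in>labels i - {a i}. W (word C a) * (P (C (i, b)) / (\<tau> * Q)))"
  have "decoding_error W \<tau> i C \<le> (\<Sum>a\<in>A. ?T C a) / card A" for C
    unfolding decoding_error_def P_def[symmetric] Q_def[symmetric]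
  proof (intro divide_right_mono sum_mono)
    fix a assume a: "a \<in> A"
    have "W (word C a) * of_bool (threshold_decoder P (\<tau> * Q) i C \<noteq> fst (a i))
       \<le> W (word C a) * ((\<tau> * Q / P (C (i, a i))) powr s + (\<Sum>b\<in>labels i - {a i}. P (C (i, b)) / (\<tau> * Q)))"
      using Pp Qp \<tau> s i a W by (intro mult_left_mono threshold_decoder_error_le) (auto simp: less_imp_le)
    also have "\<dots> = ?T C a"
      using i by (simp add: distrib_left sum_distrib_left word_def del: times_divide_eq_right times_divide_eq_left)
    finally show "W (word C a) * of_bool (threshold_decoder P (\<tau> * Q) i C \<noteq> fst (a i)) \<le> ?T C a" .
  qed simp
  then have "E codebook_law (decoding_error W \<tau> i) \<le> E codebook_law (\<lambda>C. (\<Sum>a\<in>A. ?T C a) / card A)"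
    by (intro integral_mono) auto
  also have "\<dots> = (\<Sum>a\<in>A. E codebook_law (\<lambda>C. ?T C a)) / card A"
    by (simp add: Bochner_Integration.integral_sum)
  also have "\<dots> \<le> (\<Sum>a\<in>A. \<tau> powr s * E U (\<lambda>u. W u * (Q / P (u i)) powr s) + real (Mn i * Ln i) / \<tau> * Q) / card A"
  proof (intro divide_right_mono sum_mono)
    fix a assume a: "a \<in> A"
    have "E codebook_law (\<lambda>C. W (word C a) * (P (C (i, b)) / (\<tau> * Q))) = Q / \<tau>" if b: "b \<in> labels i - {a i}" for b
    proof -
      have "E codebook_law (\<lambda>C. W (word C a) * (P (C (i, b)) / (\<tau> * Q))) = E U (\<lambda>u. E (q i) (\<lambda>c. W u * (P c / (\<tau> * Q))))"
        using a i b by (intro E_word_pair[where \<phi> = "\<lambda>u c. W u * (P c / (\<tau> * Q))"]) auto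
      then show ?thesis using Qp \<tau> by (simp add: EP flip: Q_def)
    qed
    then have "E codebook_law (\<lambda>C. ?T C a) = E U (\<lambda>u. W u * (\<tau> * Q / P (u i)) powr s) + real (card (labels i - {a i})) * (Q / \<tau>)"
      using E_word[OF a, of "\<lambda>u. W u * (\<tau> * Q / P (u i)) powr s"]
      by (simp add: Bochner_Integration.integral_sum del: times_divide_eq_right times_divide_eq_left)
    also have "real (card (labels i - {a i})) * (Q / \<tau>) \<le> real (Mn i * Ln i) * (Q / \<tau>)"
      using Qp \<tau> by (intro mult_right_mono of_nat_mono) (auto simp: card_labels[symmetric] intro!: card_mono)
    also have "E U (\<lambda>u. W u * (\<tau> * Q / P (u i)) powr s) = E U (\<lambda>u. \<tau> powr s * (W u * (Q / P (u i)) powr s))"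
      using \<tau> Qp Pp by (intro Bochner_Integration.integral_cong refl)
        (simp add: powr_mult powr_divide less_imp_le)
    finally show "E codebook_law (\<lambda>C. ?T C a) \<le> \<tau> powr s * E U (\<lambda>u. W u * (Q / P (u i)) powr s) + real (Mn i * Ln i) / \<tau> * Q"
      by simp
  qed simp
  also have "\<dots> = \<tau> powr s * E U (\<lambda>u. W u * (Q / P (u i)) powr s) + real (Mn i * Ln i) / \<tau> * Q"
    using A_nonempty by simp
  finally show ?thesis unfolding P_def Q_def .
qed

end

section \<open>Exponential moments near zero\<close>

lemma exp_le_quadratic:
  fixes x :: real
  shows "exp x \<le> 1 + x + x\<^sup>2 / 2 * exp \<bar>x\<bar>"
proof -
  obtain t where t: "\<bar>t\<bar> \<le> \<bar>x\<bar>" "exp x = (\<Sum>m<2. x ^ m / fact m) + exp t / fact 2 * x ^ 2"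
    using Maclaurin_exp_le[of x 2] by blast
  have "exp t / 2 * x\<^sup>2 \<le> exp \<bar>x\<bar> / 2 * x\<^sup>2"
    using t by (intro mult_right_mono divide_right_mono) auto
  then show ?thesis using t by (simp add: eval_nat_numeral mult.commute)
qed

text \<open>For small \<open>t\<close> one half of the exponent \<bar>i\<bar> pays for the square of
  \<open>i\<close>, at the price of a factor 8, and the other half for
  \<open>exp \<bar>t * i\<bar>\<close>; the 4 is 8 / 2. The resulting
  \<open>exp \<bar>i\<bar>\<close> is split by sign: nonnegative values are capped by
  \<open>B\<close>, negative ones are covered by \<open>exp (- i)\<close>.\<close>

lemma exp_scaled_le:
  fixes i t B :: real
  assumes "\<bar>t\<bar> \<le> 1/2" "i \<le> B"
  shows "exp (t * i) \<le> 1 + t * i + t\<^sup>2 * (4 * (exp (- i) + exp B))"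
proof -
  have "(\<bar>i\<bar>/2)\<^sup>2 / 2 \<le> exp (\<bar>i\<bar>/2)"
    using exp_lower_Taylor_quadratic[of "\<bar>i\<bar>/2"] by simp
  then have i2: "i\<^sup>2 \<le> 8 * exp (\<bar>i\<bar>/2)" by (simp add: power_divide)
  have ti: "\<bar>t * i\<bar> \<le> \<bar>i\<bar> / 2" using mult_right_mono[OF assms(1), of "\<bar>i\<bar>"] by (simp add: abs_mult)
  have "(t * i)\<^sup>2 / 2 * exp \<bar>t * i\<bar> \<le> (t\<^sup>2 * (8 * exp (\<bar>i\<bar>/2))) / 2 * exp (\<bar>i\<bar>/2)"
    using i2 ti by (intro mult_mono divide_right_mono) (auto simp: power_mult_distrib intro!: mult_left_mono)
  also have "\<dots> = t\<^sup>2 * (4 * exp \<bar>i\<bar>)"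
    by (simp add: mult_exp_exp)
  also have "\<dots> \<le> t\<^sup>2 * (4 * (exp (- i) + exp B))"
  proof -
    have "exp \<bar>i\<bar> \<le> exp (- i) + exp B" using assms(2)
      by (cases "0 \<le> i") (auto intro: add_increasing add_increasing2)
    then show ?thesis by (intro mult_left_mono) auto
  qed
  finally show ?thesis using exp_le_quadratic[of "t * i"] by linarith
qed

text \<open>The moment generating function has slope \<open>expectation i\<close> at 0, so for small
  \<open>s\<close> its logarithm is linear up to an error \<open>s * d\<close> in both directions.
  The upper bound on \<open>i\<close> and the integrability of \<open>exp (- i x)\<close> together
  dominate the quadratic remainder.\<close>

lemma (in prob_space) exponential_moment_near_0:
  fixes i :: "'a \<Rightarrow> real"
  assumes [measurable]: "i \<in> borel_measurable M" and ub: "AE x in M. i x \<le> B"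
    and int: "integrable M (\<lambda>x. exp (- i x))" and d: "0 < d"
  obtains s where "0 < s" "s \<le> 1" "integrable M i"
    "integrable M (\<lambda>x. exp (s * i x))" "expectation (\<lambda>x. exp (s * i x)) \<le> exp (s * (expectation i + d))"
    "integrable M (\<lambda>x. exp (- (s * i x)))" "expectation (\<lambda>x. exp (- (s * i x))) \<le> exp (- (s * (expectation i - d)))"
proof -
  define h where "h x = 4 * (exp (- i x) + exp B)" for x
  have ih: "integrable M h" unfolding h_def using int by auto
  have ii: "integrable M i"
  proof (rule Bochner_Integration.integrable_bound[OF ih])
    show "AE x in M. norm (i x) \<le> norm (h x)"
      using ub
    proof eventually_elim
      case (elim x)
      have "\<bar>i x\<bar> \<le> exp (- i x) + exp B"
      proof (cases "0 \<le> i x")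
        case True
        have "i x \<le> B" by fact
        also have "B \<le> exp B" using exp_ge_add_one_self[of B] by linarith
        finally show ?thesis using True exp_gt_zero[of "- i x"] by linarith
      next
        case False
        then show ?thesis using exp_ge_add_one_self[of "- i x"] exp_gt_zero[of B] by linarith
      qed
      also have "\<dots> \<le> h x" by (simp add: h_def)
      finally show ?case by simp
    qed
  qed simp
  define K where "K = expectation h"
  have K: "0 < K"
  proof -
    have "(\<integral>x. 4 * exp B \<partial>M) \<le> K" unfolding K_def by (intro integral_mono ih) (auto simp: h_def)
    then show ?thesis using exp_gt_zero[of B] prob_space by (simp del: exp_gt_zero)
  qed
  \<comment> \<open>1/2 is the range of \<open>exp_scaled_le\<close>; \<open>d / K\<close> brings
    the remainder \<open>s * s * K\<close> down to \<open>s * d\<close>.\<close>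
  define s where "s = min (1/2) (d / K)"
  have s: "0 < s" "s \<le> 1/2" "s * K \<le> d" using K d by (auto simp: s_def field_simps min_def)
  have main: "integrable M (\<lambda>x. exp (t * i x)) \<and> expectation (\<lambda>x. exp (t * i x)) \<le> exp (t * expectation i + s * d)"
    if t: "\<bar>t\<bar> = s" for t
  proof -
    have le: "AE x in M. exp (t * i x) \<le> 1 + t * i x + t\<^sup>2 * h x"
      using ub unfolding h_def by eventually_elim (rule exp_scaled_le, use t s in auto)
    have intr: "integrable M (\<lambda>x. 1 + t * i x + t\<^sup>2 * h x)" using ii ih by auto
    have I: "integrable M (\<lambda>x. exp (t * i x))"
      by (rule Bochner_Integration.integrable_bound[OF intr]) (use le in \<open>auto elim!: eventually_mono intro: order.trans\<close>)
    have "expectation (\<lambda>x. exp (t * i x)) \<le> expectation (\<lambda>x. 1 + t * i x + t\<^sup>2 * h x)"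
      by (rule integral_mono_AE[OF I intr le])
    also have "\<dots> = 1 + t * expectation i + t\<^sup>2 * K"
      using ii ih by (simp add: K_def prob_space)
    also have "t\<^sup>2 = s * s" using t by (metis power2_abs power2_eq_square)
    also have "s * s * K \<le> s * d" using s mult_left_mono[of "s * K" d s] by (simp add: mult.assoc)
    also have "1 + t * expectation i + s * d \<le> exp (t * expectation i + s * d)"
      using exp_ge_add_one_self[of "t * expectation i + s * d"] by linarith
    finally show ?thesis using I by simp
  qed
  show ?thesis
    using main[of s] main[of "- s"] s by (intro that[of s] ii) (auto simp: algebra_simps)
qed

section \<open>Transposition and mixtures of product measures\<close>

text \<open>Codebooks are drawn user by user, while the channel acts time by time. All entries are
  independent, so both arrangements of them have the same law.\<close>

lemma Pi_pmf_transpose: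
  assumes fin: "finite I" "finite T"
  shows "map_pmf (\<lambda>u. \<lambda>t\<in>T. \<lambda>i\<in>I. u i t) (Pi_pmf I undefined (\<lambda>i. Pi_pmf T undefined (\<lambda>_. p i)))
    = Pi_pmf T undefined (\<lambda>t. Pi_pmf I undefined p)"
proof (rule pmf_eqI)
  fix z
  let ?P = "Pi_pmf I undefined (\<lambda>i. Pi_pmf T undefined (\<lambda>_. p i))"
  let ?h = "\<lambda>u. \<lambda>t\<in>T. \<lambda>i\<in>I. u i t"
  show "pmf (map_pmf ?h ?P) z = pmf (Pi_pmf T undefined (\<lambda>t. Pi_pmf I undefined p)) z"
  proof (cases "z \<in> extensional T \<and> (\<forall>t\<in>T. z t \<in> extensional I)")
    case True
    let ?w = "\<lambda>i\<in>I. \<lambda>t\<in>T. z t i"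
    \<comment> \<open>Only on the support is \<open>u\<close> determined by its transpose, because
      there the entries outside \<open>I\<close> and \<open>T\<close> are
      \<open>undefined\<close>.\<close>
    have "?h -` {z} \<inter> set_pmf ?P = {?w} \<inter> set_pmf ?P"
    proof (intro set_eqI iffI)
      fix u assume u: "u \<in> ?h -` {z} \<inter> set_pmf ?P"
      then have ext: "u \<in> extensional I" "\<And>i. i \<in> I \<Longrightarrow> u i \<in> extensional T"
        using fin by (auto simp: set_Pi_pmf PiE_dflt_def extensional_def)
      have "z = ?h u" using u by auto
      then have "u = ?w" using ext by (auto simp: fun_eq_iff restrict_def extensional_def)
      then show "u \<in> {?w} \<inter> set_pmf ?P" using u by auto
    next
      fix u assume "u \<in> {?w} \<inter> set_pmf ?P"
      moreover have "?h ?w = z" using True by (auto simp: fun_eq_iff restrict_def extensional_def)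
      ultimately show "u \<in> ?h -` {z} \<inter> set_pmf ?P" by auto
    qed
    then have "measure (measure_pmf ?P) (?h -` {z}) = pmf ?P ?w"
      by (metis measure_Int_set_pmf measure_pmf_single)
    also have "\<dots> = (\<Prod>i\<in>I. \<Prod>t\<in>T. pmf (p i) (z t i))"
      using fin by (subst pmf_Pi') (auto intro!: prod.cong simp: pmf_Pi')
    also have "\<dots> = (\<Prod>t\<in>T. \<Prod>i\<in>I. pmf (p i) (z t i))" by (rule prod.swap)
    also have "\<dots> = pmf (Pi_pmf T undefined (\<lambda>t. Pi_pmf I undefined p)) z"
      using fin True by (subst pmf_Pi') (auto intro!: prod.cong simp: pmf_Pi' extensional_def)
    finally show ?thesis by (simp add: pmf_map)
  next
    case False
    then have "?h -` {z} = {}" by auto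
    then have "pmf (map_pmf ?h ?P) z = 0" by (simp add: pmf_map)
    moreover have "pmf (Pi_pmf T undefined (\<lambda>t. Pi_pmf I undefined p)) z = 0"
    proof (cases "z \<in> extensional T")
      case True
      then obtain t where t: "t \<in> T" "z t \<notin> extensional I" using False by auto
      then have "pmf (Pi_pmf I undefined p) (z t) = 0"
        using fin by (intro pmf_Pi_outside) (auto simp: extensional_def)
      then show ?thesis using fin t True by (subst pmf_Pi') (auto simp: extensional_def)
    qed (use fin in \<open>auto intro!: pmf_Pi_outside simp: extensional_def\<close>)
    ultimately show ?thesis by simp
  qed
qed

lemma expectation_prod_transpose:
  fixes g :: "'t \<Rightarrow> ('i \<Rightarrow> 'b) \<Rightarrow> real"
  assumes fin: "finite I" "finite T" and fp: "\<And>i. i \<in> I \<Longrightarrow> finite (set_pmf (p i))"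
    and nn: "\<And>t v. t \<in> T \<Longrightarrow> 0 \<le> g t v"
  shows "measure_pmf.expectation (Pi_pmf I undefined (\<lambda>i. Pi_pmf T undefined (\<lambda>_. p i)))
      (\<lambda>u. \<Prod>t\<in>T. g t (\<lambda>i\<in>I. u i t))
    = (\<Prod>t\<in>T. measure_pmf.expectation (Pi_pmf I undefined p) (g t))"
proof -
  let ?P = "Pi_pmf I undefined (\<lambda>i. Pi_pmf T undefined (\<lambda>_. p i))"
  let ?h = "\<lambda>u. \<lambda>t\<in>T. \<lambda>i\<in>I. u i t"
  have "(\<Prod>t\<in>T. measure_pmf.expectation (Pi_pmf I undefined p) (g t))
      = measure_pmf.expectation (Pi_pmf T undefined (\<lambda>t. Pi_pmf I undefined p)) (\<lambda>z. \<Prod>t\<in>T. g t (z t))"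
    using fin fp nn by (intro expectation_prod_Pi_pmf[symmetric] integrable_measure_pmf_finite finite_set_Pi_pmf) auto
  also have "\<dots> = measure_pmf.expectation ?P (\<lambda>u. \<Prod>t\<in>T. g t (?h u t))"
    unfolding Pi_pmf_transpose[OF fin, symmetric] by simp
  also have "\<dots> = measure_pmf.expectation ?P (\<lambda>u. \<Prod>t\<in>T. g t (\<lambda>i\<in>I. u i t))"
    by (intro Bochner_Integration.integral_cong prod.cong) auto
  finally show ?thesis ..
qed

text \<open>Expanding the product, one coordinate per induction step, turns finite mixtures into a
  mixture over all choices of components. The maps \<open>\<theta>\<close> let a component carry its
  label along, so that the lemma serves both for messages with codewords and for auxiliary letters
  with channel inputs.\<close>

lemma nn_integral_PiM_mixture:
  fixes \<mu> :: "'i \<Rightarrow> 'm measure" and \<nu> :: "'i \<Rightarrow> 'b \<Rightarrow> 'n measure"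
  assumes I: "finite I"
    and sf: "\<And>k. prob_space (\<mu> k)" "\<And>k a. prob_space (\<nu> k a)"
    and A: "\<And>k. k \<in> I \<Longrightarrow> finite (A k)"
    and \<theta>: "\<And>k a. k \<in> I \<Longrightarrow> a \<in> A k \<Longrightarrow> \<theta> k a \<in> \<nu> k a \<rightarrow>\<^sub>M \<mu> k"
    and mix: "\<And>k F. k \<in> I \<Longrightarrow> F \<in> borel_measurable (\<mu> k) \<Longrightarrow>
      (\<integral>\<^sup>+x. F x \<partial>\<mu> k) = (\<Sum>a\<in>A k. c k a * (\<integral>\<^sup>+x. F (\<theta> k a x) \<partial>\<nu> k a))"
    and F: "F \<in> borel_measurable (PiM I \<mu>)"
  shows "(\<integral>\<^sup>+x. F x \<partial>PiM I \<mu>)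
    = (\<Sum>a\<in>PiE I A. (\<Prod>k\<in>I. c k (a k)) * (\<integral>\<^sup>+x. F (\<lambda>k\<in>I. \<theta> k (a k) (x k)) \<partial>PiM I (\<lambda>k. \<nu> k (a k))))"
proof -
  interpret \<mu>: product_prob_space \<mu> by (rule product_prob_spaceI) (rule sf)
  show ?thesis
    using I A \<theta> mix F
  proof (induction I arbitrary: F rule: finite_induct)
    case empty
    then show ?case by (simp add: PiM_empty nn_integral_count_space_finite restrict_def)
  next
    case (insert i I)
    note \<theta>i[measurable] = insert.prems(2)
    note [measurable] = insert.prems(4)
    have Fi: "(\<lambda>(x, y). F (x(i := y))) \<in> borel_measurable (PiM I \<mu> \<Otimes>\<^sub>M \<mu> i)" by measurable
    have upd: "(\<lambda>x. \<lambda>k\<in>insert i I. \<theta> k ((a(i := b)) k) (x k)) \<in> PiM (insert i I) (\<lambda>k. \<nu> k ((a(i := b)) k)) \<rightarrow>\<^sub>M PiM (insert i I) \<mu>"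
      if "a \<in> PiE I A" "b \<in> A i" for a b
    proof (rule measurable_restrict)
      fix k assume k: "k \<in> insert i I"
      then have "(a(i := b)) k \<in> A k" using that by (auto simp: PiE_iff)
      with k show "(\<lambda>x. \<theta> k ((a(i := b)) k) (x k)) \<in> PiM (insert i I) (\<lambda>k. \<nu> k ((a(i := b)) k)) \<rightarrow>\<^sub>M \<mu> k"
        by (intro measurable_compose[OF measurable_component_singleton[OF k, where M = "\<lambda>k. \<nu> k ((a(i := b)) k)"] insert.prems(2)])
    qed
    have meas_a: "(\<lambda>x. F (x(i := \<theta> i b y))) \<in> borel_measurable (PiM I \<mu>)" if "b \<in> A i" "y \<in> space (\<nu> i b)" for b y
    proof -
      have "\<theta> i b y \<in> space (\<mu> i)" using that measurable_space[OF \<theta>i, of i b y] by auto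
      then show ?thesis by (intro measurable_compose[OF _ insert.prems(4)] measurable_fun_upd[where J = I]) auto
    qed
    have "(\<integral>\<^sup>+x. F x \<partial>PiM (insert i I) \<mu>) = (\<integral>\<^sup>+x. \<integral>\<^sup>+y. F (x(i := y)) \<partial>\<mu> i \<partial>PiM I \<mu>)"
      using insert by (intro \<mu>.product_nn_integral_insert) auto
    also have "\<dots> = (\<integral>\<^sup>+x. (\<Sum>b\<in>A i. c i b * (\<integral>\<^sup>+y. F (x(i := \<theta> i b y)) \<partial>\<nu> i b)) \<partial>PiM I \<mu>)"
    proof (intro nn_integral_cong)
      fix x assume x: "x \<in> space (PiM I \<mu>)"
      show "(\<integral>\<^sup>+y. F (x(i := y)) \<partial>\<mu> i) = (\<Sum>b\<in>A i. c i b * (\<integral>\<^sup>+y. F (x(i := \<theta> i b y)) \<partial>\<nu> i b))"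
        using x by (intro insert.prems(3)) auto
    qed
    also have "\<dots> = (\<Sum>a\<in>PiE I A. (\<Prod>k\<in>I. c k (a k)) * (\<integral>\<^sup>+x. (\<Sum>b\<in>A i. c i b * (\<integral>\<^sup>+y. F ((\<lambda>k\<in>I. \<theta> k (a k) (x k))(i := \<theta> i b y)) \<partial>\<nu> i b)) \<partial>PiM I (\<lambda>k. \<nu> k (a k))))"
    proof (intro insert.IH)
      show "(\<lambda>x. \<Sum>b\<in>A i. c i b * (\<integral>\<^sup>+y. F (x(i := \<theta> i b y)) \<partial>\<nu> i b)) \<in> borel_measurable (PiM I \<mu>)"
      proof (intro borel_measurable_sum borel_measurable_times_ennreal borel_measurable_const)
        fix b assume b: "b \<in> A i"
        interpret b: prob_space "\<nu> i b" by (rule sf)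
        have [measurable]: "\<theta> i b \<in> \<nu> i b \<rightarrow>\<^sub>M \<mu> i" using b by (intro \<theta>i) auto
        show "(\<lambda>x. \<integral>\<^sup>+y. F (x(i := \<theta> i b y)) \<partial>\<nu> i b) \<in> borel_measurable (PiM I \<mu>)" by measurable
      qed
    qed (use insert.prems in auto)
    also have "\<dots> = (\<Sum>a\<in>PiE I A. \<Sum>b\<in>A i. (c i b * (\<Prod>k\<in>I. c k (a k))) *
        (\<integral>\<^sup>+x. F (\<lambda>k\<in>insert i I. \<theta> k ((a(i := b)) k) (x k)) \<partial>PiM (insert i I) (\<lambda>k. \<nu> k ((a(i := b)) k))))"
    proof (intro sum.cong refl)
      fix a assume a: "a \<in> PiE I A"
      have mm: "(\<lambda>x. \<integral>\<^sup>+y. F ((\<lambda>k\<in>I. \<theta> k (a k) (x k))(i := \<theta> i b y)) \<partial>\<nu> i b) \<in> borel_measurable (PiM I (\<lambda>k. \<nu> k (a k)))"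
        if b: "b \<in> A i" for b
      proof -
        interpret b: prob_space "\<nu> i b" by (rule sf)
        have [measurable]: "\<theta> i b \<in> \<nu> i b \<rightarrow>\<^sub>M \<mu> i" using b by (intro \<theta>i) auto
        have [measurable]: "(\<lambda>x. \<lambda>k\<in>I. \<theta> k (a k) (x k)) \<in> PiM I (\<lambda>k. \<nu> k (a k)) \<rightarrow>\<^sub>M PiM I \<mu>"
        proof (rule measurable_restrict)
          fix k assume k: "k \<in> I"
          then have ak: "a k \<in> A k" using a by auto
          show "(\<lambda>x. \<theta> k (a k) (x k)) \<in> PiM I (\<lambda>k. \<nu> k (a k)) \<rightarrow>\<^sub>M \<mu> k"
            by (rule measurable_compose[OF measurable_component_singleton[OF k, where M = "\<lambda>k. \<nu> k (a k)"] insert.prems(2)[OF insertI2[OF k] ak]])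
        qed
        show ?thesis by measurable
      qed
      have "(\<integral>\<^sup>+x. (\<Sum>b\<in>A i. c i b * (\<integral>\<^sup>+y. F ((\<lambda>k\<in>I. \<theta> k (a k) (x k))(i := \<theta> i b y)) \<partial>\<nu> i b)) \<partial>PiM I (\<lambda>k. \<nu> k (a k)))
        = (\<Sum>b\<in>A i. c i b * (\<integral>\<^sup>+x. \<integral>\<^sup>+y. F ((\<lambda>k\<in>I. \<theta> k (a k) (x k))(i := \<theta> i b y)) \<partial>\<nu> i b \<partial>PiM I (\<lambda>k. \<nu> k (a k))))"
        using mm by (subst nn_integral_sum) (auto intro!: sum.cong nn_integral_cmult)
      also have "\<dots> = (\<Sum>b\<in>A i. c i b * (\<integral>\<^sup>+x. F (\<lambda>k\<in>insert i I. \<theta> k ((a(i := b)) k) (x k)) \<partial>PiM (insert i I) (\<lambda>k. \<nu> k ((a(i := b)) k))))"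
      proof (intro sum.cong refl arg_cong2[where f = "(*)"])
        fix b assume b: "b \<in> A i"
        interpret ab: product_prob_space "\<lambda>k. \<nu> k ((a(i := b)) k)" by (rule product_prob_spaceI) (rule sf)
        have eq: "PiM I (\<lambda>k. \<nu> k ((a(i := b)) k)) = PiM I (\<lambda>k. \<nu> k (a k))"
          using insert.hyps by (intro PiM_cong) auto
        have "(\<integral>\<^sup>+x. F (\<lambda>k\<in>insert i I. \<theta> k ((a(i := b)) k) (x k)) \<partial>PiM (insert i I) (\<lambda>k. \<nu> k ((a(i := b)) k)))
          = (\<integral>\<^sup>+x. \<integral>\<^sup>+y. F (\<lambda>k\<in>insert i I. \<theta> k ((a(i := b)) k) ((x(i := y)) k)) \<partial>\<nu> i b \<partial>PiM I (\<lambda>k. \<nu> k (a k)))"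
          unfolding eq[symmetric]
          by (subst ab.product_nn_integral_insert[OF insert.hyps(1,2) measurable_compose[OF upd[OF a b] insert.prems(4)]]) simp
        also have "\<dots> = (\<integral>\<^sup>+x. \<integral>\<^sup>+y. F ((\<lambda>k\<in>I. \<theta> k (a k) (x k))(i := \<theta> i b y)) \<partial>\<nu> i b \<partial>PiM I (\<lambda>k. \<nu> k (a k)))"
          using insert.hyps by (intro nn_integral_cong arg_cong[where f = F]) (auto simp: restrict_def fun_eq_iff)
        finally show "(\<integral>\<^sup>+x. \<integral>\<^sup>+y. F ((\<lambda>k\<in>I. \<theta> k (a k) (x k))(i := \<theta> i b y)) \<partial>\<nu> i b \<partial>PiM I (\<lambda>k. \<nu> k (a k)))
          = (\<integral>\<^sup>+x. F (\<lambda>k\<in>insert i I. \<theta> k ((a(i := b)) k) (x k)) \<partial>PiM (insert i I) (\<lambda>k. \<nu> k ((a(i := b)) k)))" ..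
      qed
      finally show "(\<Prod>k\<in>I. c k (a k)) * (\<integral>\<^sup>+x. (\<Sum>b\<in>A i. c i b * (\<integral>\<^sup>+y. F ((\<lambda>k\<in>I. \<theta> k (a k) (x k))(i := \<theta> i b y)) \<partial>\<nu> i b)) \<partial>PiM I (\<lambda>k. \<nu> k (a k)))
        = (\<Sum>b\<in>A i. (c i b * (\<Prod>k\<in>I. c k (a k))) *
        (\<integral>\<^sup>+x. F (\<lambda>k\<in>insert i I. \<theta> k ((a(i := b)) k) (x k)) \<partial>PiM (insert i I) (\<lambda>k. \<nu> k ((a(i := b)) k))))"
        by (simp add: sum_distrib_left mult_ac)
    qed
    also have "\<dots> = (\<Sum>(b, a)\<in>A i \<times> PiE I A. (c i b * (\<Prod>k\<in>I. c k (a k))) *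
        (\<integral>\<^sup>+x. F (\<lambda>k\<in>insert i I. \<theta> k ((a(i := b)) k) (x k)) \<partial>PiM (insert i I) (\<lambda>k. \<nu> k ((a(i := b)) k))))"
      unfolding sum.cartesian_product[symmetric] by (rule sum.swap)
    also have "\<dots> = (\<Sum>a\<in>PiE (insert i I) A. (\<Prod>k\<in>insert i I. c k (a k)) *
        (\<integral>\<^sup>+x. F (\<lambda>k\<in>insert i I. \<theta> k (a k) (x k)) \<partial>PiM (insert i I) (\<lambda>k. \<nu> k (a k))))"
    proof -
      have inj: "inj_on (\<lambda>(y, g). g(i := y)) (A i \<times> PiE I A)"
        using insert.hyps by (intro inj_combinator)
      have pr: "(\<Prod>k\<in>insert i I. c k ((a(i := b)) k)) = c i b * (\<Prod>k\<in>I. c k (a k))" for a b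
      proof -
        have "(\<Prod>k\<in>I. c k ((a(i := b)) k)) = (\<Prod>k\<in>I. c k (a k))" using insert.hyps by (intro prod.cong) auto
        then show ?thesis using insert.hyps by simp
      qed
      show ?thesis
        unfolding PiE_insert_eq sum.reindex[OF inj] comp_def
        by (intro sum.cong refl) (simp only: case_prod_unfold pr)
    qed
    finally show ?case .
  qed
qed

text \<open>Each factor sees only column \<open>t\<close>. A new row is independent over time, so
  its integral factorises and is absorbed into the factors, which then depend on the remaining rows
  only.\<close>

lemma nn_integral_PiM_transpose:
  fixes \<mu> :: "'i \<Rightarrow> 't \<Rightarrow> 'm measure"
  assumes I: "finite I" and T: "finite T" and pr: "\<And>k t. prob_space (\<mu> k t)"
    and g: "\<And>t. t \<in> T \<Longrightarrow> g t \<in> borel_measurable (PiM I (\<lambda>k. \<mu> k t))"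
  shows "(\<integral>\<^sup>+x. (\<Prod>t\<in>T. g t (\<lambda>k\<in>I. x k t)) \<partial>PiM I (\<lambda>k. PiM T (\<mu> k)))
    = (\<Prod>t\<in>T. \<integral>\<^sup>+v. g t v \<partial>PiM I (\<lambda>k. \<mu> k t))"
  using I g
proof (induction I arbitrary: g rule: finite_induct)
  case empty
  then show ?case by (simp add: PiM_empty nn_integral_count_space_finite restrict_def)
next
  case (insert i I)
  interpret P: product_sigma_finite "\<lambda>k. PiM T (\<mu> k)" by (intro product_sigma_finite.intro prob_space_imp_sigma_finite prob_space_PiM pr)
  interpret Q: product_sigma_finite "\<lambda>k. \<mu> k t" for t by (intro product_sigma_finite.intro prob_space_imp_sigma_finite pr)
  interpret R: product_sigma_finite "\<mu> k" for k by (intro product_sigma_finite.intro prob_space_imp_sigma_finite pr)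
  note g[measurable] = insert.prems
  have col[measurable]: "(\<lambda>x. \<lambda>k\<in>J. x k t) \<in> PiM J (\<lambda>k. PiM T (\<mu> k)) \<rightarrow>\<^sub>M PiM J (\<lambda>k. \<mu> k t)" if "t \<in> T" for t J
    by (rule measurable_restrict, rule measurable_compose[OF measurable_component_singleton],
      assumption, rule measurable_component_singleton, rule that)
  have "(\<integral>\<^sup>+x. (\<Prod>t\<in>T. g t (\<lambda>k\<in>insert i I. x k t)) \<partial>PiM (insert i I) (\<lambda>k. PiM T (\<mu> k)))
      = (\<integral>\<^sup>+x. \<integral>\<^sup>+\<xi>. (\<Prod>t\<in>T. g t (\<lambda>k\<in>insert i I. (x(i := \<xi>)) k t)) \<partial>PiM T (\<mu> i) \<partial>PiM I (\<lambda>k. PiM T (\<mu> k)))"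
    using insert.hyps
    by (intro P.product_nn_integral_insert borel_measurable_prod_ennreal measurable_compose[OF col g]) auto
  also have "\<dots> = (\<integral>\<^sup>+x. (\<Prod>t\<in>T. \<integral>\<^sup>+\<xi>. g t ((\<lambda>k\<in>I. x k t)(i := \<xi>)) \<partial>\<mu> i t) \<partial>PiM I (\<lambda>k. PiM T (\<mu> k)))"
  proof (intro nn_integral_cong)
    fix x assume x: "x \<in> space (PiM I (\<lambda>k. PiM T (\<mu> k)))"
    have "(\<integral>\<^sup>+\<xi>. (\<Prod>t\<in>T. g t (\<lambda>k\<in>insert i I. (x(i := \<xi>)) k t)) \<partial>PiM T (\<mu> i))
        = (\<integral>\<^sup>+\<xi>. (\<Prod>t\<in>T. g t ((\<lambda>k\<in>I. x k t)(i := \<xi> t))) \<partial>PiM T (\<mu> i))"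
      using insert.hyps by (intro nn_integral_cong prod.cong arg_cong[where f = "g _"]) (auto simp: restrict_def fun_eq_iff)
    also have "\<dots> = (\<Prod>t\<in>T. \<integral>\<^sup>+\<xi>. g t ((\<lambda>k\<in>I. x k t)(i := \<xi>)) \<partial>\<mu> i t)"
    proof (rule R.product_nn_integral_prod[OF T])
      fix t assume t: "t \<in> T"
      show "(\<lambda>\<xi>. g t ((\<lambda>k\<in>I. x k t)(i := \<xi>))) \<in> borel_measurable (\<mu> i t)"
        by (intro measurable_compose[OF _ g[OF t]] measurable_component_update measurable_space[OF col[OF t] x] insert.hyps(2))
    qed
    finally show "(\<integral>\<^sup>+\<xi>. (\<Prod>t\<in>T. g t (\<lambda>k\<in>insert i I. (x(i := \<xi>)) k t)) \<partial>PiM T (\<mu> i))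
      = (\<Prod>t\<in>T. \<integral>\<^sup>+\<xi>. g t ((\<lambda>k\<in>I. x k t)(i := \<xi>)) \<partial>\<mu> i t)" .
  qed
  also have "\<dots> = (\<Prod>t\<in>T. \<integral>\<^sup>+v. (\<integral>\<^sup>+\<xi>. g t (v(i := \<xi>)) \<partial>\<mu> i t) \<partial>PiM I (\<lambda>k. \<mu> k t))"
  proof (rule insert.IH)
    fix t assume t[measurable]: "t \<in> T"
    show "(\<lambda>v. \<integral>\<^sup>+\<xi>. g t (v(i := \<xi>)) \<partial>\<mu> i t) \<in> borel_measurable (PiM I (\<lambda>k. \<mu> k t))"
      using g[OF t] by measurable
  qed
  also have "\<dots> = (\<Prod>t\<in>T. \<integral>\<^sup>+v. g t v \<partial>PiM (insert i I) (\<lambda>k. \<mu> k t))"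
    using insert.hyps g by (intro prod.cong refl Q.product_nn_integral_insert[symmetric]) auto
  finally show ?case .
qed

section \<open>Gaussian channels\<close>

lemma prob_space_std_gauss: "prob_space std_gauss"
  unfolding std_gauss_def by (rule prob_space_normal_density) simp

lemma sets_std_gauss [simp, measurable_cong]: "sets std_gauss = sets borel"
  by (simp add: std_gauss_def)

lemma space_std_gauss [simp]: "space std_gauss = UNIV"
  by (simp add: std_gauss_def)

lemma nn_integral_std_gauss_shift:
  assumes [measurable]: "G \<in> borel_measurable borel"
  shows "(\<integral>\<^sup>+z. G (c + z) \<partial>std_gauss) = (\<integral>\<^sup>+y. G y * ennreal (std_normal_density (y - c)) \<partial>lborel)"
proof -
  have "(\<integral>\<^sup>+y. G y * ennreal (std_normal_density (y - c)) \<partial>lborel)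
      = (\<integral>\<^sup>+z. G (c + 1 * z) * ennreal (std_normal_density (c + 1 * z - c)) \<partial>lborel)"
    by (subst nn_integral_real_affine[where c = 1 and t = c]) auto
  also have "\<dots> = (\<integral>\<^sup>+z. G (c + z) \<partial>std_gauss)"
    unfolding std_gauss_def by (subst nn_integral_density) (auto simp: mult.commute)
  finally show ?thesis ..
qed

lemma nn_integral_PiM_std_gauss_shift:
  fixes c :: "'t \<Rightarrow> real"
  assumes T: "finite T" and F: "F \<in> borel_measurable (PiM T (\<lambda>_. lborel))"
  shows "(\<integral>\<^sup>+z. F (\<lambda>t\<in>T. c t + z t) \<partial>PiM T (\<lambda>_. std_gauss))
    = (\<integral>\<^sup>+y. F y * (\<Prod>t\<in>T. ennreal (std_normal_density (y t - c t))) \<partial>PiM T (\<lambda>_. lborel))"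
  using T F
proof (induction T arbitrary: F rule: finite_induct)
  case empty
  then show ?case by (simp add: PiM_empty nn_integral_count_space_finite restrict_def)
next
  case (insert s T)
  interpret L: product_sigma_finite "\<lambda>_::'t. lborel :: real measure" by standard
  interpret G: product_prob_space "\<lambda>_::'t. std_gauss" by (intro product_prob_spaceI prob_space_std_gauss)
  note F[measurable] = insert.prems
  have sh: "(\<lambda>z. \<lambda>t\<in>J. c t + z t) \<in> PiM J (\<lambda>_. std_gauss) \<rightarrow>\<^sub>M PiM J (\<lambda>_. lborel)" for J :: "'t set"
    by measurable
  have "(\<integral>\<^sup>+z. F (\<lambda>t\<in>insert s T. c t + z t) \<partial>PiM (insert s T) (\<lambda>_. std_gauss))
      = (\<integral>\<^sup>+z. \<integral>\<^sup>+\<zeta>. F (\<lambda>t\<in>insert s T. c t + (z(s := \<zeta>)) t) \<partial>std_gauss \<partial>PiM T (\<lambda>_. std_gauss))"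
    using insert.hyps by (intro G.product_nn_integral_insert measurable_compose[OF sh F])
  also have "\<dots> = (\<integral>\<^sup>+z. \<integral>\<^sup>+\<eta>. F ((\<lambda>t\<in>T. c t + z t)(s := \<eta>)) * ennreal (std_normal_density (\<eta> - c s)) \<partial>lborel \<partial>PiM T (\<lambda>_. std_gauss))"
  proof (intro nn_integral_cong)
    fix z assume z: "z \<in> space (PiM T (\<lambda>_. std_gauss))"
    have m: "(\<lambda>\<eta>. F ((\<lambda>t\<in>T. c t + z t)(s := \<eta>))) \<in> borel_measurable lborel"
      by (intro measurable_compose[OF _ F] measurable_component_update measurable_space[OF sh z] insert.hyps(2))
    have "(\<integral>\<^sup>+\<zeta>. F (\<lambda>t\<in>insert s T. c t + (z(s := \<zeta>)) t) \<partial>std_gauss)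
        = (\<integral>\<^sup>+\<zeta>. F ((\<lambda>t\<in>T. c t + z t)(s := c s + \<zeta>)) \<partial>std_gauss)"
      using insert.hyps by (intro nn_integral_cong arg_cong[where f = F]) (auto simp: restrict_def fun_eq_iff)
    also have "\<dots> = (\<integral>\<^sup>+\<eta>. F ((\<lambda>t\<in>T. c t + z t)(s := \<eta>)) * ennreal (std_normal_density (\<eta> - c s)) \<partial>lborel)"
      using m by (intro nn_integral_std_gauss_shift) simp
    finally show "(\<integral>\<^sup>+\<zeta>. F (\<lambda>t\<in>insert s T. c t + (z(s := \<zeta>)) t) \<partial>std_gauss)
      = (\<integral>\<^sup>+\<eta>. F ((\<lambda>t\<in>T. c t + z t)(s := \<eta>)) * ennreal (std_normal_density (\<eta> - c s)) \<partial>lborel)" .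
  qed
  also have "\<dots> = (\<integral>\<^sup>+y. (\<integral>\<^sup>+\<eta>. F (y(s := \<eta>)) * ennreal (std_normal_density (\<eta> - c s)) \<partial>lborel)
      * (\<Prod>t\<in>T. ennreal (std_normal_density (y t - c t))) \<partial>PiM T (\<lambda>_. lborel))"
    by (intro insert.IH) measurable
  also have "\<dots> = (\<integral>\<^sup>+y. \<integral>\<^sup>+\<eta>. F (y(s := \<eta>)) *
      (\<Prod>t\<in>insert s T. ennreal (std_normal_density ((y(s := \<eta>)) t - c t))) \<partial>lborel \<partial>PiM T (\<lambda>_. lborel))"
  proof (intro nn_integral_cong)
    fix y assume y: "y \<in> space (PiM T (\<lambda>_::'t. lborel :: real measure))"
    have m: "(\<lambda>\<eta>. F (y(s := \<eta>))) \<in> borel_measurable lborel"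
      using insert.hyps y by (intro measurable_compose[OF _ F] measurable_component_update) auto
    have "(\<Prod>t\<in>T. ennreal (std_normal_density ((y(s := \<eta>)) t - c t))) = (\<Prod>t\<in>T. ennreal (std_normal_density (y t - c t)))" for \<eta>
      using insert.hyps by (intro prod.cong) auto
    then show "(\<integral>\<^sup>+\<eta>. F (y(s := \<eta>)) * ennreal (std_normal_density (\<eta> - c s)) \<partial>lborel) * (\<Prod>t\<in>T. ennreal (std_normal_density (y t - c t)))
      = (\<integral>\<^sup>+\<eta>. F (y(s := \<eta>)) * (\<Prod>t\<in>insert s T. ennreal (std_normal_density ((y(s := \<eta>)) t - c t))) \<partial>lborel)"
      using m insert.hyps by (subst nn_integral_multc[symmetric]) (auto simp: mult_ac)
  qed
  also have "\<dots> = (\<integral>\<^sup>+y. F y * (\<Prod>t\<in>insert s T. ennreal (std_normal_density (y t - c t))) \<partial>PiM (insert s T) (\<lambda>_. lborel))"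
    using insert.hyps by (intro L.product_nn_integral_insert[symmetric]) measurable
  finally show ?case .
qed

lemma nn_integral_pos_of_pos:
  assumes "prob_space M" "f \<in> borel_measurable M" "\<And>x. 0 < f x"
  shows "0 < (\<integral>\<^sup>+x. f x \<partial>M)"
proof -
  interpret prob_space M by fact
  have "\<not> (AE x in M. f x = 0)"
  proof
    assume "AE x in M. f x = 0"
    then have "AE x in M. False" by eventually_elim (use assms(3) in \<open>auto simp: less_le\<close>)
    then show False by simp
  qed
  then show ?thesis using nn_integral_0_iff_AE[OF assms(2)] by (auto simp: zero_less_iff_neq_zero)
qed

text \<open>Output density of a Gaussian channel with independent inputs. It is real-valued because
  ratios, powers and logarithms of it are taken; \<open>ennreal_channel_density\<close> shows that
  \<open>enn2real\<close> loses nothing.\<close>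

definition channel_density :: "nat set \<Rightarrow> (nat \<Rightarrow> real) \<Rightarrow> (nat \<Rightarrow> real measure) \<Rightarrow> real \<Rightarrow> real" where
  "channel_density I c \<mu> y
    = enn2real (\<integral>\<^sup>+x. ennreal (std_normal_density (y - (\<Sum>k\<in>I. c k * x k))) \<partial>PiM I \<mu>)"

lemma channel_density_cong: "(\<And>k. k \<in> I \<Longrightarrow> \<mu> k = \<nu> k) \<Longrightarrow> channel_density I c \<mu> = channel_density I c \<nu>"
  unfolding channel_density_def by (simp cong: PiM_cong)

locale real_inputs =
  fixes I :: "nat set" and \<mu> :: "nat \<Rightarrow> real measure"
  assumes fin: "finite I" and pr: "\<And>k. prob_space (\<mu> k)" and sets: "\<And>k. sets (\<mu> k) = sets borel"
begin

lemma sets_PiM_inputs [measurable_cong]: "sets (PiM I \<mu>) = sets (PiM I (\<lambda>_. borel))"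
  by (intro sets_PiM_cong refl sets)

sublocale P: prob_space "PiM I \<mu>" by (intro prob_space_PiM pr)

lemma gaussian_kernel_measurable:
  "(\<lambda>x. ennreal (std_normal_density (y - (\<Sum>k\<in>I. c k * x k)))) \<in> borel_measurable (PiM I \<mu>)"
  by measurable

lemma ennreal_channel_density:
  "ennreal (channel_density I c \<mu> y) = (\<integral>\<^sup>+x. ennreal (std_normal_density (y - (\<Sum>k\<in>I. c k * x k))) \<partial>PiM I \<mu>)"
proof -
  \<comment> \<open>A bounded Gaussian density keeps the average over the inputs finite.\<close>
  have "std_normal_density z \<le> 1" for z :: real
  proof -
    have "1 \<le> sqrt (2 * pi)" using pi_gt3 by (intro real_le_rsqrt) auto
    then have "1 / sqrt (2 * pi) \<le> 1" by simp
    moreover have "exp (- z\<^sup>2 / 2) \<le> 1" by simp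
    ultimately show ?thesis unfolding std_normal_density_def by (intro mult_le_one) auto
  qed
  then have "(\<integral>\<^sup>+x. ennreal (std_normal_density (y - (\<Sum>k\<in>I. c k * x k))) \<partial>PiM I \<mu>) \<le> (\<integral>\<^sup>+x. 1 \<partial>PiM I \<mu>)"
    by (intro nn_integral_mono) auto
  also have "\<dots> = 1" using P.emeasure_space_1 by simp
  finally have "(\<integral>\<^sup>+x. ennreal (std_normal_density (y - (\<Sum>k\<in>I. c k * x k))) \<partial>PiM I \<mu>) < \<top>"
    by (rule order.strict_trans1) simp
  then show ?thesis unfolding channel_density_def by simp
qed

lemma channel_density_pos: "0 < channel_density I c \<mu> y"
proof -
  have "0 < (\<integral>\<^sup>+x. ennreal (std_normal_density (y - (\<Sum>k\<in>I. c k * x k))) \<partial>PiM I \<mu>)"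
  proof (rule nn_integral_pos_of_pos[OF P.prob_space_axioms])
    show "0 < ennreal (std_normal_density (y - (\<Sum>k\<in>I. c k * x k)))" for x
      by (simp add: normal_density_pos)
  qed measurable
  then show ?thesis by (simp add: ennreal_channel_density[symmetric])
qed

lemma channel_density_measurable [measurable]: "channel_density I c \<mu> \<in> borel_measurable borel"
  unfolding channel_density_def[abs_def] by measurable

lemma channel_law:
  assumes [measurable]: "F \<in> borel_measurable borel"
  shows "(\<integral>\<^sup>+x. \<integral>\<^sup>+z. F ((\<Sum>k\<in>I. c k * x k) + z) \<partial>std_gauss \<partial>PiM I \<mu>)
    = (\<integral>\<^sup>+y. F y * ennreal (channel_density I c \<mu> y) \<partial>lborel)"
proof -
  interpret PL: pair_sigma_finite lborel "PiM I \<mu>" ..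
  have "(\<integral>\<^sup>+x. \<integral>\<^sup>+z. F ((\<Sum>k\<in>I. c k * x k) + z) \<partial>std_gauss \<partial>PiM I \<mu>)
      = (\<integral>\<^sup>+x. \<integral>\<^sup>+y. F y * ennreal (std_normal_density (y - (\<Sum>k\<in>I. c k * x k))) \<partial>lborel \<partial>PiM I \<mu>)"
    by (intro nn_integral_cong nn_integral_std_gauss_shift) simp
  also have "\<dots> = (\<integral>\<^sup>+y. \<integral>\<^sup>+x. F y * ennreal (std_normal_density (y - (\<Sum>k\<in>I. c k * x k))) \<partial>PiM I \<mu> \<partial>lborel)"
    by (intro PL.Fubini') measurable
  also have "\<dots> = (\<integral>\<^sup>+y. F y * ennreal (channel_density I c \<mu> y) \<partial>lborel)"
    unfolding ennreal_channel_density by (intro nn_integral_cong nn_integral_cmult) measurable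
  finally show ?thesis .
qed

lemma nn_integral_channel_density: "(\<integral>\<^sup>+y. ennreal (channel_density I c \<mu> y) \<partial>lborel) = 1"
  using channel_law[of "\<lambda>_. 1" c] P.emeasure_space_1 prob_space.emeasure_space_1[OF prob_space_std_gauss] by simp

end

lemma measurable_entry:
  assumes "k \<in> I" "t \<in> T"
  shows "(\<lambda>x. x k t) \<in> PiM I (\<lambda>k. PiM T (\<lambda>_. borel)) \<rightarrow>\<^sub>M borel"
  by (rule measurable_compose[OF measurable_component_singleton[OF assms(1), where M = "\<lambda>k. PiM T (\<lambda>_. borel)"]
      measurable_component_singleton[OF assms(2)]])

text \<open>For fixed inputs the noise yields a product of Gaussian densities. Its average over the
  inputs factorises again, since the letters of a codeword pass through the prefix channel
  independently.\<close>

lemma block_channel_law: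
  fixes \<mu> :: "nat \<Rightarrow> nat \<Rightarrow> real measure"
  assumes I: "finite I" and T: "finite T" and pr: "\<And>k t. prob_space (\<mu> k t)"
    and sets: "\<And>k t. sets (\<mu> k t) = sets borel"
    and F[measurable]: "F \<in> borel_measurable (PiM T (\<lambda>_. lborel))"
  shows "(\<integral>\<^sup>+x. \<integral>\<^sup>+z. F (\<lambda>t\<in>T. (\<Sum>k\<in>I. c k * x k t) + z t) \<partial>PiM T (\<lambda>_. std_gauss) \<partial>PiM I (\<lambda>k. PiM T (\<mu> k)))
    = (\<integral>\<^sup>+y. F y * (\<Prod>t\<in>T. ennreal (channel_density I c (\<lambda>k. \<mu> k t) (y t))) \<partial>PiM T (\<lambda>_. lborel))"
proof -
  have letter_real_inputs: "real_inputs I (\<lambda>k. \<mu> k t)" for t by (rule real_inputs.intro[OF I pr sets])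
  interpret L: product_sigma_finite "\<lambda>_::nat. lborel :: real measure" by standard
  interpret X: prob_space "PiM I (\<lambda>k. PiM T (\<mu> k))" by (intro prob_space_PiM pr)
  interpret PL: pair_sigma_finite "PiM T (\<lambda>_. lborel) :: (nat \<Rightarrow> real) measure" "PiM I (\<lambda>k. PiM T (\<mu> k))"
    by (intro pair_sigma_finite.intro X.sigma_finite_measure L.sigma_finite T)
  have [measurable_cong]: "sets (PiM I (\<lambda>k. PiM T (\<mu> k))) = sets (PiM I (\<lambda>k. PiM T (\<lambda>_. borel)))"
    by (intro sets_PiM_cong refl sets)
  have col: "(\<Sum>k\<in>I. c k * (\<lambda>k\<in>I. x k t) k) = (\<Sum>k\<in>I. c k * x k t)" for x :: "nat \<Rightarrow> nat \<Rightarrow> real" and t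
    by (intro sum.cong) auto
  note entry = measurable_entry[measurable]
  have [measurable]: "(\<lambda>x. snd x k t) \<in> N \<Otimes>\<^sub>M PiM I (\<lambda>k. PiM T (\<lambda>_. borel)) \<rightarrow>\<^sub>M borel" if "k \<in> I" "t \<in> T"
    for k t and N :: "(nat \<Rightarrow> real) measure"
    by (rule measurable_compose[OF measurable_snd entry[OF that]])
  have "(\<integral>\<^sup>+x. \<integral>\<^sup>+z. F (\<lambda>t\<in>T. (\<Sum>k\<in>I. c k * x k t) + z t) \<partial>PiM T (\<lambda>_. std_gauss) \<partial>PiM I (\<lambda>k. PiM T (\<mu> k)))
      = (\<integral>\<^sup>+x. \<integral>\<^sup>+y. F y * (\<Prod>t\<in>T. ennreal (std_normal_density (y t - (\<Sum>k\<in>I. c k * x k t)))) \<partial>PiM T (\<lambda>_. lborel) \<partial>PiM I (\<lambda>k. PiM T (\<mu> k)))"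
    by (intro nn_integral_cong nn_integral_PiM_std_gauss_shift T F)
  also have "\<dots> = (\<integral>\<^sup>+y. \<integral>\<^sup>+x. F y * (\<Prod>t\<in>T. ennreal (std_normal_density (y t - (\<Sum>k\<in>I. c k * x k t)))) \<partial>PiM I (\<lambda>k. PiM T (\<mu> k)) \<partial>PiM T (\<lambda>_. lborel))"
    by (intro PL.Fubini') measurable
  also have "\<dots> = (\<integral>\<^sup>+y. F y * (\<Prod>t\<in>T. ennreal (channel_density I c (\<lambda>k. \<mu> k t) (y t))) \<partial>PiM T (\<lambda>_. lborel))"
  proof (intro nn_integral_cong)
    fix y :: "nat \<Rightarrow> real"
    have "(\<integral>\<^sup>+x. (\<Prod>t\<in>T. ennreal (std_normal_density (y t - (\<Sum>k\<in>I. c k * x k t)))) \<partial>PiM I (\<lambda>k. PiM T (\<mu> k)))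
        = (\<integral>\<^sup>+x. (\<Prod>t\<in>T. ennreal (std_normal_density (y t - (\<Sum>k\<in>I. c k * (\<lambda>k\<in>I. x k t) k)))) \<partial>PiM I (\<lambda>k. PiM T (\<mu> k)))"
      by (simp only: col)
    also have "\<dots> = (\<Prod>t\<in>T. \<integral>\<^sup>+v. ennreal (std_normal_density (y t - (\<Sum>k\<in>I. c k * v k))) \<partial>PiM I (\<lambda>k. \<mu> k t))"
    proof (rule nn_integral_PiM_transpose[where I = I and T = T and \<mu> = \<mu>
          and g = "\<lambda>t v. ennreal (std_normal_density (y t - (\<Sum>k\<in>I. c k * v k)))", OF I T pr])
    qed (rule real_inputs.gaussian_kernel_measurable[OF letter_real_inputs])
    also have "\<dots> = (\<Prod>t\<in>T. ennreal (channel_density I c (\<lambda>k. \<mu> k t) (y t)))"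
      by (intro prod.cong refl real_inputs.ennreal_channel_density[symmetric] letter_real_inputs)
    finally have J: "(\<integral>\<^sup>+x. (\<Prod>t\<in>T. ennreal (std_normal_density (y t - (\<Sum>k\<in>I. c k * x k t)))) \<partial>PiM I (\<lambda>k. PiM T (\<mu> k)))
      = (\<Prod>t\<in>T. ennreal (channel_density I c (\<lambda>k. \<mu> k t) (y t)))" .
    show "(\<integral>\<^sup>+x. F y * (\<Prod>t\<in>T. ennreal (std_normal_density (y t - (\<Sum>k\<in>I. c k * x k t)))) \<partial>PiM I (\<lambda>k. PiM T (\<mu> k)))
      = F y * (\<Prod>t\<in>T. ennreal (channel_density I c (\<lambda>k. \<mu> k t) (y t)))"
      unfolding J[symmetric] by (intro nn_integral_cmult) measurable
  qed
  finally show ?thesis .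
qed

lemma sigma_finite_blk: "sigma_finite_measure (blk n)"
proof -
  interpret L: product_sigma_finite "\<lambda>_::nat. lborel :: real measure" by standard
  show ?thesis unfolding blk_def by (rule L.sigma_finite) simp
qed

lemma sets_PiM_real_eq_blk:
  assumes "\<And>t. sets (\<mu> t) = sets borel"
  shows "sets (PiM {..<n} \<mu>) = sets (blk n)"
  unfolding blk_def by (intro sets_PiM_cong) (auto simp: assms)

lemma measure_pmf_kernel_measurable:
  assumes "\<And>x. prob_space (N x)" "\<And>x. sets (N x) = sets B"
  shows "N \<in> measure_pmf p \<rightarrow>\<^sub>M subprob_algebra B"
  using assms by (auto simp: space_subprob_algebra intro!: prob_space_imp_subprob_space)

lemma nn_integral_pmf_of_lessThan:
  assumes "0 < n"
  shows "(\<integral>\<^sup>+x. f x \<partial>measure_pmf (pmf_of_set {..<n::nat})) = (\<Sum>x<n. ennreal (1 / n) * f x)"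
proof -
  have ne: "{..<n} \<noteq> {}" using assms by auto
  have "(\<integral>\<^sup>+x. f x \<partial>measure_pmf (pmf_of_set {..<n})) = (\<Sum>x\<in>set_pmf (pmf_of_set {..<n}). f x * pmf (pmf_of_set {..<n}) x)"
    using ne by (intro nn_integral_measure_pmf_finite) auto
  also have "\<dots> = (\<Sum>x<n. ennreal (1 / n) * f x)"
    using ne by (intro sum.cong) (auto simp: mult.commute)
  finally show ?thesis .
qed

section \<open>Random-codebook encoders\<close>

text \<open>\<open>w\<close> is the codebook of one user and \<open>\<kappa> t v\<close> the prefix
  channel at time \<open>t\<close>; the dependence on \<open>t\<close> allows some positions to be
  silent.\<close>

definition stochastic_encoder ::
  "nat \<Rightarrow> nat \<Rightarrow> (nat \<Rightarrow> nat \<Rightarrow> real measure) \<Rightarrow> (nat \<times> nat \<Rightarrow> nat \<Rightarrow> nat) \<Rightarrow> nat \<Rightarrow> (nat \<Rightarrow> real) measure" where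
  "stochastic_encoder n L \<kappa> w m = measure_pmf (pmf_of_set {..<L}) \<bind> (\<lambda>l. PiM {..<n} (\<lambda>t. \<kappa> t (w (m, l) t)))"

locale letter_kernel =
  fixes \<kappa> :: "nat \<Rightarrow> nat \<Rightarrow> real measure"
  assumes prob_kernel: "\<And>t v. prob_space (\<kappa> t v)" and sets_kernel: "\<And>t v. sets (\<kappa> t v) = sets borel"
begin

lemma word_kernel: "(\<lambda>l. PiM {..<n} (\<lambda>t. \<kappa> t (w (m, l) t))) \<in> measure_pmf p \<rightarrow>\<^sub>M subprob_algebra (blk n)"
  by (intro measure_pmf_kernel_measurable prob_space_PiM prob_kernel sets_PiM_real_eq_blk sets_kernel)

lemma sets_stochastic_encoder: "sets (stochastic_encoder n L \<kappa> w m) = sets (blk n)"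
  unfolding stochastic_encoder_def
  by (subst sets_bind[where N = "blk n"]) (auto intro!: sets_PiM_real_eq_blk sets_kernel)

lemma prob_space_stochastic_encoder: "prob_space (stochastic_encoder n L \<kappa> w m)"
  unfolding stochastic_encoder_def
  by (intro measure_pmf.prob_space_bind[OF _ word_kernel] AE_I2 prob_space_PiM prob_kernel)

lemma nn_integral_stochastic_encoder:
  assumes "0 < L" "F \<in> borel_measurable (blk n)"
  shows "(\<integral>\<^sup>+x. F x \<partial>stochastic_encoder n L \<kappa> w m)
    = (\<Sum>l<L. ennreal (1 / L) * (\<integral>\<^sup>+x. F x \<partial>PiM {..<n} (\<lambda>t. \<kappa> t (w (m, l) t))))"
  unfolding stochastic_encoder_def nn_integral_bind[OF assms(2) word_kernel]
  by (rule nn_integral_pmf_of_lessThan[OF assms(1)])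

lemma user_kernel: "(\<lambda>m. distr (stochastic_encoder n L \<kappa> w m) (count_space UNIV \<Otimes>\<^sub>M blk n) (\<lambda>x. (m, x)))
    \<in> measure_pmf p \<rightarrow>\<^sub>M subprob_algebra (count_space UNIV \<Otimes>\<^sub>M blk n)"
proof (intro measure_pmf_kernel_measurable)
  fix m :: nat
  have "(\<lambda>x. (m, x)) \<in> stochastic_encoder n L \<kappa> w m \<rightarrow>\<^sub>M count_space UNIV \<Otimes>\<^sub>M blk n"
    unfolding measurable_cong_sets[OF sets_stochastic_encoder refl] by measurable
  then show "prob_space (distr (stochastic_encoder n L \<kappa> w m) (count_space UNIV \<Otimes>\<^sub>M blk n) (\<lambda>x. (m, x)))"
    by (intro prob_space.prob_space_distr prob_space_stochastic_encoder)
qed simp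

lemma prob_space_user_law: "prob_space (user_law n M (stochastic_encoder n L \<kappa> w))"
  unfolding user_law_def
proof (intro measure_pmf.prob_space_bind[OF _ user_kernel] AE_I2)
  fix m :: nat
  have "(\<lambda>x. (m, x)) \<in> stochastic_encoder n L \<kappa> w m \<rightarrow>\<^sub>M count_space UNIV \<Otimes>\<^sub>M blk n"
    unfolding measurable_cong_sets[OF sets_stochastic_encoder refl] by measurable
  then show "prob_space (distr (stochastic_encoder n L \<kappa> w m) (count_space UNIV \<Otimes>\<^sub>M blk n) (\<lambda>x. (m, x)))"
    by (intro prob_space.prob_space_distr prob_space_stochastic_encoder)
qed

lemma sets_user_law: "sets (user_law n M (stochastic_encoder n L \<kappa> w)) = sets (count_space UNIV \<Otimes>\<^sub>M blk n)"
  unfolding user_law_def by (subst sets_bind) auto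

lemma nn_integral_user_law:
  assumes pos: "0 < M" "0 < L" and F[measurable]: "F \<in> borel_measurable (count_space UNIV \<Otimes>\<^sub>M blk n)"
  shows "(\<integral>\<^sup>+x. F x \<partial>user_law n M (stochastic_encoder n L \<kappa> w))
    = (\<Sum>b\<in>{..<M} \<times> {..<L}. ennreal (1 / (real M * real L)) * (\<integral>\<^sup>+x. F (fst b, x) \<partial>PiM {..<n} (\<lambda>t. \<kappa> t (w b t))))"
proof -
  have Fm: "(\<lambda>x. F (m, x)) \<in> borel_measurable (blk n)" for m by measurable
  have "(\<integral>\<^sup>+x. F x \<partial>user_law n M (stochastic_encoder n L \<kappa> w))
      = (\<Sum>m<M. ennreal (1 / M) * (\<integral>\<^sup>+x. F x \<partial>distr (stochastic_encoder n L \<kappa> w m) (count_space UNIV \<Otimes>\<^sub>M blk n) (\<lambda>x. (m, x))))"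
    unfolding user_law_def nn_integral_bind[OF F user_kernel] by (rule nn_integral_pmf_of_lessThan[OF pos(1)])
  also have "\<dots> = (\<Sum>m<M. ennreal (1 / M) * (\<integral>\<^sup>+x. F (m, x) \<partial>stochastic_encoder n L \<kappa> w m))"
  proof (intro sum.cong refl arg_cong2[where f = "(*)"])
    fix m
    have "(\<lambda>x. (m, x)) \<in> stochastic_encoder n L \<kappa> w m \<rightarrow>\<^sub>M count_space UNIV \<Otimes>\<^sub>M blk n"
      unfolding measurable_cong_sets[OF sets_stochastic_encoder refl] by measurable
    then show "(\<integral>\<^sup>+x. F x \<partial>distr (stochastic_encoder n L \<kappa> w m) (count_space UNIV \<Otimes>\<^sub>M blk n) (\<lambda>x. (m, x)))
      = (\<integral>\<^sup>+x. F (m, x) \<partial>stochastic_encoder n L \<kappa> w m)"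
      by (intro nn_integral_distr) auto
  qed
  also have "\<dots> = (\<Sum>m<M. \<Sum>l<L. ennreal (1 / (real M * real L)) * (\<integral>\<^sup>+x. F (m, x) \<partial>PiM {..<n} (\<lambda>t. \<kappa> t (w (m, l) t))))"
    unfolding nn_integral_stochastic_encoder[OF pos(2) Fm] sum_distrib_left
  proof (intro sum.cong refl)
    fix m l :: nat
    have "ennreal (1 / real M) * ennreal (1 / real L) = ennreal (1 / (real M * real L))"
      by (subst ennreal_mult[symmetric]) auto
    then show "ennreal (1 / real M) * (ennreal (1 / real L) * (\<integral>\<^sup>+x. F (m, x) \<partial>PiM {..<n} (\<lambda>t. \<kappa> t (w (m, l) t))))
      = ennreal (1 / (real M * real L)) * (\<integral>\<^sup>+x. F (m, x) \<partial>PiM {..<n} (\<lambda>t. \<kappa> t (w (m, l) t)))"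
      by (simp only: mult.assoc[symmetric])
  qed
  also have "\<dots> = (\<Sum>b\<in>{..<M} \<times> {..<L}. ennreal (1 / (real M * real L)) * (\<integral>\<^sup>+x. F (fst b, x) \<partial>PiM {..<n} (\<lambda>t. \<kappa> t (w b t))))"
    by (simp add: sum.cartesian_product case_prod_unfold)
  finally show ?thesis .
qed

end

section \<open>A fixed codebook on the Gaussian network\<close>

locale gaussian_code =
  fixes K :: nat and h :: "nat \<Rightarrow> nat \<Rightarrow> real" and g :: "nat \<Rightarrow> real" and n :: nat
    and Mn Ln :: "nat \<Rightarrow> nat" and \<kappa> :: "nat \<Rightarrow> nat \<Rightarrow> nat \<Rightarrow> real measure"
    and C :: "nat \<times> nat \<times> nat \<Rightarrow> nat \<Rightarrow> nat"
  assumes prob_kappa: "\<And>k t v. prob_space (\<kappa> k t v)" and sets_kappa: "\<And>k t v. sets (\<kappa> k t v) = sets borel"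
    and Mn_pos: "\<And>k. 0 < Mn k" and Ln_pos: "\<And>k. 0 < Ln k"
begin

definition "enc k = stochastic_encoder n (Ln k) (\<kappa> k) (\<lambda>b. C (k, b))"
definition "\<Omega> = code_space K n Mn enc"
definition "label_set k = {..<Mn k} \<times> {..<Ln k}"
definition "label_tuples = PiE {1..K} label_set"
text \<open>Density of letter \<open>t\<close> at receiver \<open>j\<close> given the auxiliary
  letters \<open>v\<close>, the prefix channels being averaged out; \<open>W\<close> is the density
  of the whole block. The restriction to \<open>{1..K}\<close> inside \<open>W\<close> matches the
  extensional tuples drawn by \<open>Pi_pmf\<close>.\<close>

definition "f j t v = channel_density {1..K} (\<lambda>k. gain h g k j) (\<lambda>k. \<kappa> k t (v k))"
definition "W j y u = (\<Prod>t<n. f j t (\<lambda>k\<in>{1..K}. u k t) (y t))"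
definition "word a = (\<lambda>k\<in>{1..K}. C (k, a k))"

sublocale kernel: letter_kernel "\<kappa> k" for k
  by (rule letter_kernel.intro) (rule prob_kappa sets_kappa)+

lemma real_inputs_f: "real_inputs {1..K} (\<lambda>k. \<kappa> k t (v k))"
  by (rule real_inputs.intro) (simp, rule prob_kappa, rule sets_kappa)

lemma f_measurable [measurable]: "f j t v \<in> borel_measurable borel"
  unfolding f_def by (rule real_inputs.channel_density_measurable[OF real_inputs_f])

lemma f_pos: "0 < f j t v y"
  unfolding f_def by (rule real_inputs.channel_density_pos[OF real_inputs_f])

lemma nn_integral_f: "(\<integral>\<^sup>+y. ennreal (f j t v y) \<partial>lborel) = 1"
  unfolding f_def by (rule real_inputs.nn_integral_channel_density[OF real_inputs_f])

lemma W_pos: "0 < W j y u"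
  unfolding W_def by (intro prod_pos) (simp add: f_pos)

lemma W_measurable [measurable]: "(\<lambda>y. W j y u) \<in> borel_measurable (blk n)"
  unfolding W_def blk_def by measurable

lemma nn_integral_W: "(\<integral>\<^sup>+y. ennreal (W j y u) \<partial>blk n) = 1"
proof -
  interpret L: product_sigma_finite "\<lambda>_::nat. lborel :: real measure" by standard
  have "(\<integral>\<^sup>+y. ennreal (W j y u) \<partial>blk n) = (\<integral>\<^sup>+y. (\<Prod>t<n. ennreal (f j t (\<lambda>k\<in>{1..K}. u k t) (y t))) \<partial>PiM {..<n} (\<lambda>_. lborel))"
    unfolding blk_def W_def by (intro nn_integral_cong prod_ennreal[symmetric]) (simp add: f_pos less_imp_le)
  also have "\<dots> = (\<Prod>t<n. \<integral>\<^sup>+y. ennreal (f j t (\<lambda>k\<in>{1..K}. u k t) y) \<partial>lborel)"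
    by (intro L.product_nn_integral_prod) auto
  finally show ?thesis by (simp add: nn_integral_f)
qed

lemma finite_label_tuples [simp]: "finite label_tuples"
  unfolding label_tuples_def label_set_def by (intro finite_PiE) auto

lemma label_tuples_nonempty: "label_tuples \<noteq> {}"
proof -
  have "(\<lambda>k\<in>{1..K}. (0, 0)) \<in> label_tuples" unfolding label_tuples_def label_set_def using Mn_pos Ln_pos by auto
  then show ?thesis by blast
qed

lemma card_label_tuples: "card label_tuples = (\<Prod>k\<in>{1..K}. Mn k * Ln k)"
  unfolding label_tuples_def label_set_def by (subst card_PiE) (auto simp: card_cartesian_product)

lemma sets_user [measurable_cong]: "sets (user_law n (Mn k) (enc k)) = sets (count_space UNIV \<Otimes>\<^sub>M blk n)"
  unfolding enc_def by (rule kernel.sets_user_law)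

lemma prob_user: "prob_space (user_law n (Mn k) (enc k))"
  unfolding enc_def by (rule kernel.prob_space_user_law)

abbreviation "Inp \<equiv> PiM {1..K} (\<lambda>k. user_law n (Mn k) (enc k))"
abbreviation "Noise \<equiv> PiM {0..K} (\<lambda>_. PiM {..<n} (\<lambda>_. std_gauss))"

lemma sets_Inp [measurable_cong]: "sets Inp = sets (PiM {1..K} (\<lambda>_. count_space UNIV \<Otimes>\<^sub>M blk n))"
  by (intro sets_PiM_cong refl sets_user)

lemma sets_Noise [measurable_cong]: "sets Noise = sets (PiM {0..K} (\<lambda>_. PiM {..<n} (\<lambda>_. borel)))"
  by (intro sets_PiM_cong refl sets_std_gauss)

lemma prob_Inp: "prob_space Inp"
  by (intro prob_space_PiM prob_user)

lemma prob_Noise: "prob_space Noise"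
  by (intro prob_space_PiM prob_space_std_gauss)

sublocale \<Omega>: prob_space \<Omega>
proof -
  interpret IN: pair_prob_space Inp Noise
    by (intro pair_prob_space.intro pair_sigma_finite.intro prob_space_imp_sigma_finite prob_Inp prob_Noise)
  show "prob_space \<Omega>" unfolding \<Omega>_def code_space_def by (rule IN.prob_space_axioms)
qed

lemma sets_\<Omega> [measurable_cong]:
  "sets \<Omega> = sets (PiM {1..K} (\<lambda>_. count_space UNIV \<Otimes>\<^sub>M blk n) \<Otimes>\<^sub>M PiM {0..K} (\<lambda>_. PiM {..<n} (\<lambda>_. borel)))"
  unfolding \<Omega>_def code_space_def by (intro sets_pair_measure_cong sets_Inp sets_Noise)

lemma comp_user: "k \<in> {1..K} \<Longrightarrow> (\<lambda>x. x k) \<in> PiM {1..K} (\<lambda>_. count_space UNIV \<Otimes>\<^sub>M blk n) \<rightarrow>\<^sub>M count_space (UNIV :: nat set) \<Otimes>\<^sub>M blk n"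
  by (rule measurable_component_singleton)

lemma cW_measurable:
  assumes k: "k \<in> {1..K}"
  shows "cW k \<in> \<Omega> \<rightarrow>\<^sub>M count_space UNIV"
  unfolding measurable_cong_sets[OF sets_\<Omega> refl] cW_def
  by (rule measurable_compose[OF measurable_compose[OF measurable_fst comp_user[OF k]] measurable_fst])

lemma cX_measurable:
  assumes k: "k \<in> {1..K}" and t: "t < n"
  shows "(\<lambda>\<omega>. cX k \<omega> t) \<in> borel_measurable \<Omega>"
proof -
  have "(\<lambda>x. x t) \<in> blk n \<rightarrow>\<^sub>M lborel" unfolding blk_def using t by (intro measurable_component_singleton) auto
  then have "(\<lambda>x. x t) \<in> blk n \<rightarrow>\<^sub>M borel" by simp
  from measurable_compose[OF measurable_compose[OF measurable_compose[OF measurable_fst comp_user[OF k]] measurable_snd] this]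
  show ?thesis unfolding measurable_cong_sets[OF sets_\<Omega> refl] cX_def .
qed

lemma noise_measurable:
  assumes j: "j \<in> {0..K}" and t: "t < n"
  shows "(\<lambda>\<omega>. snd \<omega> j t) \<in> borel_measurable \<Omega>"
  unfolding measurable_cong_sets[OF sets_\<Omega> refl]
  by (rule measurable_compose[OF measurable_snd measurable_entry]) (use j t in auto)

lemma cY_measurable:
  assumes j: "j \<in> {0..K}"
  shows "cY h g K n j \<in> \<Omega> \<rightarrow>\<^sub>M blk n"
  unfolding cY_def[abs_def] blk_def
proof (rule measurable_restrict)
  fix t assume t: "t \<in> {..<n}"
  then have "(\<lambda>\<omega>. (\<Sum>k\<in>{1..K}. gain h g k j * cX k \<omega> t) + snd \<omega> j t) \<in> borel_measurable \<Omega>"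
    using j by (intro borel_measurable_add borel_measurable_sum borel_measurable_times borel_measurable_const cX_measurable noise_measurable) auto
  then show "(\<lambda>\<omega>. (\<Sum>k\<in>{1..K}. gain h g k j * cX k \<omega> t) + snd \<omega> j t) \<in> \<Omega> \<rightarrow>\<^sub>M lborel"
    by simp
qed

lemma cWs_measurable: "(\<lambda>\<omega>. \<lambda>k\<in>{1..K}. cW k \<omega>) \<in> \<Omega> \<rightarrow>\<^sub>M PiM {1..K} (\<lambda>_. count_space UNIV)"
  by (rule measurable_restrict) (rule cW_measurable)

lemma nn_integral_Inp:
  assumes F: "F \<in> borel_measurable Inp"
  shows "(\<integral>\<^sup>+x. F x \<partial>Inp) = (\<Sum>a\<in>label_tuples. ennreal (1 / card label_tuples) *
    (\<integral>\<^sup>+\<xi>. F (\<lambda>k\<in>{1..K}. (fst (a k), \<xi> k)) \<partial>PiM {1..K} (\<lambda>k. PiM {..<n} (\<lambda>t. \<kappa> k t (C (k, a k) t)))))"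
proof -
  have "(\<integral>\<^sup>+x. F x \<partial>Inp) = (\<Sum>a\<in>PiE {1..K} label_set. (\<Prod>k\<in>{1..K}. ennreal (1 / (real (Mn k) * real (Ln k)))) *
    (\<integral>\<^sup>+\<xi>. F (\<lambda>k\<in>{1..K}. (\<lambda>k a \<xi>. (fst a, \<xi>)) k (a k) (\<xi> k)) \<partial>PiM {1..K} (\<lambda>k. (\<lambda>k a. PiM {..<n} (\<lambda>t. \<kappa> k t (C (k, a) t))) k (a k))))"
  proof (rule nn_integral_PiM_mixture[where c = "\<lambda>k _. ennreal (1 / (real (Mn k) * real (Ln k)))"
        and \<theta> = "\<lambda>k a \<xi>. (fst a, \<xi>)" and \<nu> = "\<lambda>k a. PiM {..<n} (\<lambda>t. \<kappa> k t (C (k, a) t))"])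
    fix k and G :: "_ \<Rightarrow> ennreal" assume "G \<in> borel_measurable (user_law n (Mn k) (enc k))"
    then have G: "G \<in> borel_measurable (count_space UNIV \<Otimes>\<^sub>M blk n)"
      by (simp add: measurable_cong_sets[OF sets_user refl])
    show "(\<integral>\<^sup>+x. G x \<partial>user_law n (Mn k) (enc k)) = (\<Sum>a\<in>label_set k. ennreal (1 / (real (Mn k) * real (Ln k))) *
        (\<integral>\<^sup>+x. G (fst a, x) \<partial>PiM {..<n} (\<lambda>t. \<kappa> k t (C (k, a) t))))"
      unfolding enc_def label_set_def by (rule kernel.nn_integral_user_law[OF Mn_pos Ln_pos G])
  next
    show "F \<in> borel_measurable Inp" by (rule F)
  next
    fix k and a :: "nat \<times> nat"
    have *: "sets (PiM {..<n} (\<lambda>t. \<kappa> k t (C (k, a) t))) = sets (blk n)"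
      by (intro sets_PiM_real_eq_blk sets_kappa)
    show "(\<lambda>\<xi>. (fst a, \<xi>)) \<in> PiM {..<n} (\<lambda>t. \<kappa> k t (C (k, a) t)) \<rightarrow>\<^sub>M user_law n (Mn k) (enc k)"
      unfolding measurable_cong_sets[OF * sets_user] by (rule measurable_Pair1') simp
  qed (auto simp: prob_user label_set_def intro!: prob_space_PiM prob_kappa)
  also have "\<dots> = (\<Sum>a\<in>label_tuples. ennreal (1 / card label_tuples) *
    (\<integral>\<^sup>+\<xi>. F (\<lambda>k\<in>{1..K}. (fst (a k), \<xi> k)) \<partial>PiM {1..K} (\<lambda>k. PiM {..<n} (\<lambda>t. \<kappa> k t (C (k, a k) t)))))"
  proof -
    have "(\<Prod>k\<in>{1..K}. ennreal (1 / (real (Mn k) * real (Ln k)))) = ennreal (1 / card label_tuples)"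
      by (subst prod_ennreal) (auto simp: card_label_tuples prod_dividef)
    then show ?thesis unfolding label_tuples_def by simp
  qed
  finally show ?thesis .
qed

text \<open>The label tuple is uniform, and given it the block at receiver \<open>j\<close> has
  density \<open>W j y (word a)\<close>. Error probability and entropies of the code are computed
  through this formula, which removes the sample space.\<close>

lemma code_law:
  assumes j: "j \<in> {0..K}"
    and G: "(\<lambda>(w, y). G w y) \<in> borel_measurable (PiM {1..K} (\<lambda>_. count_space UNIV) \<Otimes>\<^sub>M blk n)"
  shows "(\<integral>\<^sup>+\<omega>. G (\<lambda>k\<in>{1..K}. cW k \<omega>) (cY h g K n j \<omega>) \<partial>\<Omega>)
    = (\<Sum>a\<in>label_tuples. ennreal (1 / card label_tuples) * (\<integral>\<^sup>+y. G (\<lambda>k\<in>{1..K}. fst (a k)) y * ennreal (W j y (word a)) \<partial>blk n))"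
proof -
  \<comment> \<open>Separates the noiseless part \<open>c\<close> from the noise, so that the noise
    can be integrated before the inputs.\<close>
  define H where "H w c z = G w (\<lambda>t\<in>{..<n}. c t + z t)" for w and c z :: "nat \<Rightarrow> real"
  interpret No: prob_space Noise by (rule prob_Noise)
  have mG: "(\<lambda>\<omega>. G (\<lambda>k\<in>{1..K}. cW k \<omega>) (cY h g K n j \<omega>)) \<in> borel_measurable (Inp \<Otimes>\<^sub>M Noise)"
    using measurable_compose[OF measurable_Pair[OF cWs_measurable cY_measurable[OF j]] G]
    by (simp add: \<Omega>_def code_space_def)
  have Gw: "G w \<in> borel_measurable (blk n)" if "w \<in> extensional {1..K}" for w :: "nat \<Rightarrow> nat"
    using measurable_compose[OF measurable_Pair1'[of w "PiM {1..K} (\<lambda>_. count_space UNIV)" "blk n"] G] that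
    by (simp add: space_PiM PiE_def)
  \<comment> \<open>Receiver \<open>j\<close> sees only its own noise vector, whose marginal law is
    a standard Gaussian block.\<close>
  have comp: "distr Noise (PiM {..<n} (\<lambda>_. std_gauss)) (\<lambda>z. z j) = PiM {..<n} (\<lambda>_. std_gauss)"
    using j by (intro distr_PiM_component[where M = "\<lambda>_. PiM {..<n} (\<lambda>_. std_gauss)"] prob_space_PiM prob_space_std_gauss) auto
  have "(\<integral>\<^sup>+\<omega>. G (\<lambda>k\<in>{1..K}. cW k \<omega>) (cY h g K n j \<omega>) \<partial>\<Omega>)
      = (\<integral>\<^sup>+x. \<integral>\<^sup>+z. G (\<lambda>k\<in>{1..K}. fst (x k)) (cY h g K n j (x, z)) \<partial>Noise \<partial>Inp)"
    unfolding \<Omega>_def code_space_def No.nn_integral_fst[OF mG, symmetric] by (simp add: cW_def)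
  also have "\<dots> = (\<integral>\<^sup>+x. \<integral>\<^sup>+z. H (\<lambda>k\<in>{1..K}. fst (x k)) (\<lambda>t. \<Sum>k\<in>{1..K}. gain h g k j * snd (x k) t) z \<partial>PiM {..<n} (\<lambda>_. std_gauss) \<partial>Inp)"
  proof (intro nn_integral_cong)
    fix x :: "nat \<Rightarrow> nat \<times> (nat \<Rightarrow> real)"
    have m: "H (\<lambda>k\<in>{1..K}. fst (x k)) c \<in> borel_measurable (PiM {..<n} (\<lambda>_. std_gauss))" for c
      unfolding H_def blk_def[symmetric]
      by (rule measurable_compose[OF _ Gw]) (auto simp: blk_def)
    have "(\<integral>\<^sup>+z. G (\<lambda>k\<in>{1..K}. fst (x k)) (cY h g K n j (x, z)) \<partial>Noise)
        = (\<integral>\<^sup>+z. H (\<lambda>k\<in>{1..K}. fst (x k)) (\<lambda>t. \<Sum>k\<in>{1..K}. gain h g k j * snd (x k) t) (z j) \<partial>Noise)"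
      by (simp add: H_def cY_def cX_def)
    also have "\<dots> = (\<integral>\<^sup>+z. H (\<lambda>k\<in>{1..K}. fst (x k)) (\<lambda>t. \<Sum>k\<in>{1..K}. gain h g k j * snd (x k) t) z \<partial>distr Noise (PiM {..<n} (\<lambda>_. std_gauss)) (\<lambda>z. z j))"
      using j m by (subst nn_integral_distr) auto
    finally show "(\<integral>\<^sup>+z. G (\<lambda>k\<in>{1..K}. fst (x k)) (cY h g K n j (x, z)) \<partial>Noise)
      = (\<integral>\<^sup>+z. H (\<lambda>k\<in>{1..K}. fst (x k)) (\<lambda>t. \<Sum>k\<in>{1..K}. gain h g k j * snd (x k) t) z \<partial>PiM {..<n} (\<lambda>_. std_gauss))"
      unfolding comp .
  qed
  also have "\<dots> = (\<Sum>a\<in>label_tuples. ennreal (1 / card label_tuples) *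
    (\<integral>\<^sup>+\<xi>. (\<integral>\<^sup>+z. H (\<lambda>k\<in>{1..K}. fst (a k)) (\<lambda>t. \<Sum>k\<in>{1..K}. gain h g k j * \<xi> k t) z \<partial>PiM {..<n} (\<lambda>_. std_gauss))
      \<partial>PiM {1..K} (\<lambda>k. PiM {..<n} (\<lambda>t. \<kappa> k t (C (k, a k) t)))))"
  proof -
    interpret G: prob_space "PiM {..<n} (\<lambda>_. std_gauss)" by (intro prob_space_PiM prob_space_std_gauss)
    have wm: "(\<lambda>p. \<lambda>k\<in>{1..K}. fst (fst p k)) \<in> Inp \<Otimes>\<^sub>M PiM {..<n} (\<lambda>_. std_gauss) \<rightarrow>\<^sub>M PiM {1..K} (\<lambda>_. count_space UNIV)"
      unfolding measurable_cong_sets[OF sets_pair_measure_cong[OF sets_Inp refl] refl]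
      by (rule measurable_restrict) (rule measurable_compose[OF measurable_compose[OF measurable_fst comp_user] measurable_fst])
    have ym: "(\<lambda>p. \<lambda>t\<in>{..<n}. (\<Sum>k\<in>{1..K}. gain h g k j * snd (fst p k) t) + snd p t) \<in> Inp \<Otimes>\<^sub>M PiM {..<n} (\<lambda>_. std_gauss) \<rightarrow>\<^sub>M blk n"
      unfolding blk_def
    proof (rule measurable_restrict)
      fix t assume t: "t \<in> {..<n}"
      have "(\<lambda>x. x t) \<in> blk n \<rightarrow>\<^sub>M lborel" unfolding blk_def using t by (intro measurable_component_singleton) auto
      then have ev: "(\<lambda>x. x t) \<in> blk n \<rightarrow>\<^sub>M borel" by simp
      have [measurable]: "(\<lambda>p. snd (fst p k) t) \<in> Inp \<Otimes>\<^sub>M PiM {..<n} (\<lambda>_. std_gauss) \<rightarrow>\<^sub>M borel" if "k \<in> {1..K}" for k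
        unfolding measurable_cong_sets[OF sets_pair_measure_cong[OF sets_Inp refl] refl]
        by (rule measurable_compose[OF measurable_compose[OF measurable_compose[OF measurable_fst comp_user[OF that]] measurable_snd] ev])
      have [measurable]: "(\<lambda>p. snd p t) \<in> Inp \<Otimes>\<^sub>M PiM {..<n} (\<lambda>_. std_gauss) \<rightarrow>\<^sub>M borel"
        using measurable_compose[OF measurable_snd measurable_component_singleton[OF t, where M = "\<lambda>_. std_gauss"], of Inp]
        by (simp add: measurable_cong_sets[OF refl sets_std_gauss])
      show "(\<lambda>p. (\<Sum>k\<in>{1..K}. gain h g k j * snd (fst p k) t) + snd p t) \<in> Inp \<Otimes>\<^sub>M PiM {..<n} (\<lambda>_. std_gauss) \<rightarrow>\<^sub>M lborel"
        by measurable
    qed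
    have "(\<lambda>p. H (\<lambda>k\<in>{1..K}. fst (fst p k)) (\<lambda>t. \<Sum>k\<in>{1..K}. gain h g k j * snd (fst p k) t) (snd p)) \<in> borel_measurable (Inp \<Otimes>\<^sub>M PiM {..<n} (\<lambda>_. std_gauss))"
      using measurable_compose[OF measurable_Pair[OF wm ym] G] by (simp add: H_def)
    then have "(\<lambda>x. \<integral>\<^sup>+z. H (\<lambda>k\<in>{1..K}. fst (x k)) (\<lambda>t. \<Sum>k\<in>{1..K}. gain h g k j * snd (x k) t) z \<partial>PiM {..<n} (\<lambda>_. std_gauss)) \<in> borel_measurable Inp"
      by (intro G.borel_measurable_nn_integral) (simp add: case_prod_unfold)
    from nn_integral_Inp[OF this] show ?thesis by (simp cong: restrict_cong)
  qed
  also have "\<dots> = (\<Sum>a\<in>label_tuples. ennreal (1 / card label_tuples) * (\<integral>\<^sup>+y. G (\<lambda>k\<in>{1..K}. fst (a k)) y * ennreal (W j y (word a)) \<partial>blk n))"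
  proof (intro sum.cong refl arg_cong2[where f = "(*)"])
    fix a assume "a \<in> label_tuples"
    have Ga: "G (\<lambda>k\<in>{1..K}. fst (a k)) \<in> borel_measurable (PiM {..<n} (\<lambda>_. lborel))"
      using Gw[of "\<lambda>k\<in>{1..K}. fst (a k)"] by (simp add: blk_def)
    have "(\<integral>\<^sup>+\<xi>. (\<integral>\<^sup>+z. H (\<lambda>k\<in>{1..K}. fst (a k)) (\<lambda>t. \<Sum>k\<in>{1..K}. gain h g k j * \<xi> k t) z \<partial>PiM {..<n} (\<lambda>_. std_gauss))
      \<partial>PiM {1..K} (\<lambda>k. PiM {..<n} (\<lambda>t. \<kappa> k t (C (k, a k) t))))
      = (\<integral>\<^sup>+y. G (\<lambda>k\<in>{1..K}. fst (a k)) y * (\<Prod>t\<in>{..<n}. ennreal (channel_density {1..K} (\<lambda>k. gain h g k j) (\<lambda>k. \<kappa> k t (C (k, a k) t)) (y t))) \<partial>PiM {..<n} (\<lambda>_. lborel))"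
      unfolding H_def
      by (rule block_channel_law[where \<mu> = "\<lambda>k t. \<kappa> k t (C (k, a k) t)", OF _ _ prob_kappa sets_kappa Ga]) auto
    also have "\<dots> = (\<integral>\<^sup>+y. G (\<lambda>k\<in>{1..K}. fst (a k)) y * ennreal (W j y (word a)) \<partial>blk n)"
    proof -
      have "(\<Prod>t\<in>{..<n}. ennreal (channel_density {1..K} (\<lambda>k. gain h g k j) (\<lambda>k. \<kappa> k t (C (k, a k) t)) (y t))) = ennreal (W j y (word a))" for y
      proof -
        have "channel_density {1..K} (\<lambda>k. gain h g k j) (\<lambda>k. \<kappa> k t (C (k, a k) t)) = f j t (\<lambda>k\<in>{1..K}. word a k t)" for t
          unfolding f_def by (intro channel_density_cong) (simp add: word_def)
        then show ?thesis unfolding W_def by (subst prod_ennreal) (auto simp: f_pos less_imp_le)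
      qed
      then show ?thesis by (simp add: blk_def)
    qed
    finally show "(\<integral>\<^sup>+\<xi>. (\<integral>\<^sup>+z. H (\<lambda>k\<in>{1..K}. fst (a k)) (\<lambda>t. \<Sum>k\<in>{1..K}. gain h g k j * \<xi> k t) z \<partial>PiM {..<n} (\<lambda>_. std_gauss))
      \<partial>PiM {1..K} (\<lambda>k. PiM {..<n} (\<lambda>t. \<kappa> k t (C (k, a k) t))))
      = (\<integral>\<^sup>+y. G (\<lambda>k\<in>{1..K}. fst (a k)) y * ennreal (W j y (word a)) \<partial>blk n)" .
  qed
  finally show ?thesis .
qed

end

section \<open>Entropy of finite mixtures\<close>

lemma fiber_sum_measurable [measurable (raw)]:
  assumes "\<And>a. a \<in> A \<Longrightarrow> (\<lambda>y. F y a) \<in> borel_measurable T"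
  shows "(\<lambda>y. fiber_sum (F y) A \<phi> a) \<in> borel_measurable T"
  unfolding fiber_sum_def using assms by (intro borel_measurable_sum) auto

lemma log2_le: "0 < z \<Longrightarrow> log 2 z \<le> z / ln 2"
  using ln_le_minus_one[of z] by (simp add: log_def field_simps)

context prob_space
begin

context
  fixes X :: "'a \<Rightarrow> 'b :: countable" and Y :: "'a \<Rightarrow> 'c" and T :: "'c measure"
    and A :: "'i set" and \<alpha> :: "'i \<Rightarrow> 'b" and F :: "'c \<Rightarrow> 'i \<Rightarrow> real"
  assumes X[measurable]: "X \<in> M \<rightarrow>\<^sub>M count_space UNIV" and Y[measurable]: "Y \<in> M \<rightarrow>\<^sub>M T"
    and T: "sigma_finite_measure T" and A: "finite A" "A \<noteq> {}"
    and F: "\<And>a. (\<lambda>y. F y a) \<in> borel_measurable T" and F_pos: "\<And>a y. 0 < F y a"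
    and F_int: "\<And>a. (\<integral>\<^sup>+y. ennreal (F y a) \<partial>T) = 1"
    and law: "\<And>G. case_prod G \<in> borel_measurable (count_space UNIV \<Otimes>\<^sub>M T) \<Longrightarrow>
      (\<integral>\<^sup>+\<omega>. G (X \<omega>) (Y \<omega>) \<partial>M) = (\<Sum>a\<in>A. ennreal (1 / card A) * (\<integral>\<^sup>+y. G (\<alpha> a) y * ennreal (F y a) \<partial>T))"
begin

text \<open>The surprisal \<open>surp\<close> is nonnegative because \<open>Pxy\<close> is at most
  \<open>Py\<close>, so the entropy can be computed as a nonnegative integral and expanded over
  \<open>A\<close>. Finiteness of this integral is part of the argument: the entropy is defined by a
  Bochner integral, which would be 0 otherwise.\<close>

lemma mixture_conditional_entropy:
  shows conditional_entropy_mixture_eq: "ennreal (conditional_entropy 2 (count_space UNIV) T X Y)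
    = (\<integral>\<^sup>+y. ennreal ((\<Sum>a\<in>A. F y a * log 2 (sum (F y) A / fiber_sum (F y) A \<alpha> a)) / card A) \<partial>T)"
    and conditional_entropy_mixture_nonneg: "0 \<le> conditional_entropy 2 (count_space UNIV) T X Y"
proof -
  interpret information_space M 2 by unfold_locales simp
  interpret T: sigma_finite_measure T by (rule T)
  let ?N = "real (card A)" and ?S = "count_space (UNIV :: 'b set)"
  have N: "0 < ?N" using A by (simp add: card_gt_0_iff)
  note F[measurable]
  \<comment> \<open>Densities of the output and of the pair, the latter with respect to counting
    measure times \<open>T\<close>. The indicators in \<open>Pxy\<close> merge the labels with the
    same value of \<alpha>.\<close>
  define Py where "Py y = sum (F y) A / ?N" for y
  define Pxy where "Pxy p = (\<Sum>a\<in>A. indicator {\<alpha> a} (fst p) * F (snd p) a) / ?N" for p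
  have Py_m[measurable]: "Py \<in> borel_measurable T" unfolding Py_def by measurable
  have Pxy_m[measurable]: "Pxy \<in> borel_measurable (?S \<Otimes>\<^sub>M T)" unfolding Pxy_def by measurable
  have Py_pos: "0 < Py y" for y unfolding Py_def using A F_pos N by (intro divide_pos_pos sum_pos) auto
  have Pxy_nn: "0 \<le> Pxy p" for p unfolding Pxy_def using F_pos by (intro divide_nonneg_nonneg sum_nonneg) (auto simp: less_imp_le)
  have Pxy_le: "Pxy (x, y) \<le> Py y" for x y
    unfolding Pxy_def Py_def by (intro divide_right_mono sum_mono) (auto simp: indicator_def F_pos less_imp_le)
  have joint: "(\<integral>\<^sup>+p. ennreal (Pxy p) * G p \<partial>(?S \<Otimes>\<^sub>M T)) = (\<Sum>a\<in>A. ennreal (1 / ?N) * (\<integral>\<^sup>+y. G (\<alpha> a, y) * ennreal (F y a) \<partial>T))"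
    if [measurable]: "G \<in> borel_measurable (?S \<Otimes>\<^sub>M T)" for G
  proof -
    have "(\<integral>\<^sup>+p. ennreal (Pxy p) * G p \<partial>(?S \<Otimes>\<^sub>M T)) = (\<integral>\<^sup>+x. \<integral>\<^sup>+y. ennreal (Pxy (x, y)) * G (x, y) \<partial>T \<partial>?S)"
      by (intro T.nn_integral_fst[symmetric]) measurable
    also have "\<dots> = (\<integral>\<^sup>+x. (\<Sum>a\<in>A. (ennreal (1 / ?N) * (\<integral>\<^sup>+y. G (x, y) * ennreal (F y a) \<partial>T)) * indicator {\<alpha> a} x) \<partial>?S)"
    proof (intro nn_integral_cong)
      fix x
      have "ennreal (Pxy (x, y)) * G (x, y) = (\<Sum>a\<in>A. ennreal (1 / ?N) * indicator {\<alpha> a} x * (G (x, y) * ennreal (F y a)))" for y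
      proof -
        have "ennreal (Pxy (x, y)) = (\<Sum>a\<in>A. ennreal (1 / ?N) * indicator {\<alpha> a} x * ennreal (F y a))"
        proof -
          have "(\<Sum>a\<in>A. ennreal (1 / ?N) * indicator {\<alpha> a} x * ennreal (F y a)) = (\<Sum>a\<in>A. ennreal (indicator {\<alpha> a} x * F y a / ?N))"
            by (intro sum.cong refl) (auto simp: F_pos less_imp_le indicator_def ennreal_mult[symmetric])
          also have "\<dots> = ennreal (Pxy (x, y))"
            unfolding Pxy_def sum_divide_distrib using F_pos
            by (subst sum_ennreal) (auto intro!: divide_nonneg_nonneg mult_nonneg_nonneg simp: less_imp_le)
          finally show ?thesis ..
        qed
        then show ?thesis by (simp add: sum_distrib_left mult_ac)
      qed
      then have "(\<integral>\<^sup>+y. ennreal (Pxy (x, y)) * G (x, y) \<partial>T) = (\<Sum>a\<in>A. \<integral>\<^sup>+y. ennreal (1 / ?N) * indicator {\<alpha> a} x * (G (x, y) * ennreal (F y a)) \<partial>T)"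
        by (simp add: nn_integral_sum)
      also have "\<dots> = (\<Sum>a\<in>A. ennreal (1 / ?N) * indicator {\<alpha> a} x * (\<integral>\<^sup>+y. G (x, y) * ennreal (F y a) \<partial>T))"
        by (intro sum.cong refl nn_integral_cmult) measurable
      finally show "(\<integral>\<^sup>+y. ennreal (Pxy (x, y)) * G (x, y) \<partial>T) = (\<Sum>a\<in>A. (ennreal (1 / ?N) * (\<integral>\<^sup>+y. G (x, y) * ennreal (F y a) \<partial>T)) * indicator {\<alpha> a} x)"
        by (simp add: mult_ac)
    qed
    also have "\<dots> = (\<Sum>a\<in>A. ennreal (1 / ?N) * (\<integral>\<^sup>+y. G (\<alpha> a, y) * ennreal (F y a) \<partial>T))"
      by (subst nn_integral_sum) (auto intro!: sum.cong simp: nn_integral_indicator_singleton)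
    finally show ?thesis .
  qed
  have dist_xy: "distributed M (?S \<Otimes>\<^sub>M T) (\<lambda>\<omega>. (X \<omega>, Y \<omega>)) Pxy"
    unfolding distributed_def
  proof (intro conjI measure_eqI)
    fix B assume "B \<in> sets (distr M (?S \<Otimes>\<^sub>M T) (\<lambda>\<omega>. (X \<omega>, Y \<omega>)))"
    then have B[measurable]: "B \<in> sets (?S \<Otimes>\<^sub>M T)" by simp
    have "emeasure (distr M (?S \<Otimes>\<^sub>M T) (\<lambda>\<omega>. (X \<omega>, Y \<omega>))) B = (\<integral>\<^sup>+\<omega>. indicator B (X \<omega>, Y \<omega>) \<partial>M)"
      by (subst nn_integral_distr[of "\<lambda>\<omega>. (X \<omega>, Y \<omega>)" M "?S \<Otimes>\<^sub>M T" "indicator B", symmetric]) auto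
    also have "\<dots> = (\<Sum>a\<in>A. ennreal (1 / ?N) * (\<integral>\<^sup>+y. indicator B (\<alpha> a, y) * ennreal (F y a) \<partial>T))"
      by (rule law[of "\<lambda>x y. indicator B (x, y)"]) simp
    also have "\<dots> = emeasure (density (?S \<Otimes>\<^sub>M T) (\<lambda>p. ennreal (Pxy p))) B"
      using joint[of "indicator B"] by (simp add: emeasure_density)
    finally show "emeasure (distr M (?S \<Otimes>\<^sub>M T) (\<lambda>\<omega>. (X \<omega>, Y \<omega>))) B = emeasure (density (?S \<Otimes>\<^sub>M T) (\<lambda>p. ennreal (Pxy p))) B" .
  qed auto
  have dist_y: "distributed M T Y Py"
    unfolding distributed_def
  proof (intro conjI measure_eqI)
    fix B assume "B \<in> sets (distr M T Y)"
    then have B[measurable]: "B \<in> sets T" by simp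
    have "emeasure (distr M T Y) B = (\<integral>\<^sup>+\<omega>. indicator B (Y \<omega>) \<partial>M)"
      by (subst nn_integral_distr[of Y M T "indicator B", symmetric]) auto
    also have "\<dots> = (\<Sum>a\<in>A. ennreal (1 / ?N) * (\<integral>\<^sup>+y. indicator B y * ennreal (F y a) \<partial>T))"
      by (rule law[of "\<lambda>x y. indicator B y"]) measurable
    also have "\<dots> = (\<integral>\<^sup>+y. (\<Sum>a\<in>A. ennreal (1 / ?N) * (indicator B y * ennreal (F y a))) \<partial>T)"
      by (subst nn_integral_sum) (auto intro!: sum.cong nn_integral_cmult[symmetric])
    also have "\<dots> = (\<integral>\<^sup>+y. ennreal (Py y) * indicator B y \<partial>T)"
    proof (intro nn_integral_cong)
      fix y
      have "ennreal (Py y) = (\<Sum>a\<in>A. ennreal (1 / ?N) * ennreal (F y a))"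
        unfolding Py_def sum_divide_distrib
        by (subst sum_ennreal[symmetric]) (auto intro!: sum.cong simp: F_pos less_imp_le ennreal_mult[symmetric])
      then show "(\<Sum>a\<in>A. ennreal (1 / ?N) * (indicator B y * ennreal (F y a))) = ennreal (Py y) * indicator B y"
        by (simp add: sum_distrib_left mult_ac)
    qed
    also have "\<dots> = emeasure (density T (\<lambda>p. ennreal (Py p))) B"
      by (simp add: emeasure_density)
    finally show "emeasure (distr M T Y) B = emeasure (density T (\<lambda>p. ennreal (Py p))) B" .
  qed auto
  \<comment> \<open>Where \<open>Pxy\<close> vanishes, the convention \<open>log 2 0 = 0\<close>
    makes the surprisal 0.\<close>
  define surp where "surp p = - log 2 (Pxy p / Py (snd p))" for p
  have surp_nn: "0 \<le> surp p" for p
  proof (cases "Pxy p = 0")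
    case False
    then have "0 < Pxy p" using Pxy_nn[of p] by simp
    then have "0 < Pxy p / Py (snd p)" "Pxy p / Py (snd p) \<le> 1"
      using Pxy_le[of "fst p" "snd p"] Py_pos[of "snd p"] by auto
    then show ?thesis by (simp add: surp_def)
  qed (simp add: surp_def log_def)
  have surp_m[measurable]: "surp \<in> borel_measurable (?S \<Otimes>\<^sub>M T)" unfolding surp_def by measurable
  have fib: "fiber_sum (F y) A \<alpha> a = (\<Sum>a'\<in>A. indicator {\<alpha> a'} (\<alpha> a) * F y a')" for y a
    unfolding fiber_sum_def sum.inter_filter[OF A(1)] by (intro sum.cong) auto
  have surp_eq: "surp (\<alpha> a, y) = log 2 (sum (F y) A / fiber_sum (F y) A \<alpha> a)" if "a \<in> A" for a y
  proof -
    have "0 < fiber_sum (F y) A \<alpha> a" "0 < sum (F y) A"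
      using that A F_pos by (auto intro!: fiber_sum_pos sum_pos)
    moreover have "Pxy (\<alpha> a, y) / Py y = fiber_sum (F y) A \<alpha> a / sum (F y) A"
      using N unfolding Pxy_def Py_def fib by simp
    ultimately show ?thesis by (simp add: surp_def log_divide)
  qed
  let ?R = "\<lambda>y. (\<Sum>a\<in>A. F y a * log 2 (sum (F y) A / fiber_sum (F y) A \<alpha> a)) / ?N"
  have R: "(\<integral>\<^sup>+p. ennreal (Pxy p * surp p) \<partial>(?S \<Otimes>\<^sub>M T)) = (\<integral>\<^sup>+y. ennreal (?R y) \<partial>T)"
  proof -
    have "(\<integral>\<^sup>+p. ennreal (Pxy p * surp p) \<partial>(?S \<Otimes>\<^sub>M T)) = (\<integral>\<^sup>+p. ennreal (Pxy p) * ennreal (surp p) \<partial>(?S \<Otimes>\<^sub>M T))"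
      by (simp add: ennreal_mult Pxy_nn surp_nn)
    also have "\<dots> = (\<Sum>a\<in>A. ennreal (1 / ?N) * (\<integral>\<^sup>+y. ennreal (surp (\<alpha> a, y)) * ennreal (F y a) \<partial>T))"
      by (rule joint) measurable
    also have "\<dots> = (\<integral>\<^sup>+y. (\<Sum>a\<in>A. ennreal (1 / ?N) * (ennreal (surp (\<alpha> a, y)) * ennreal (F y a))) \<partial>T)"
      by (subst nn_integral_sum) (auto intro!: sum.cong nn_integral_cmult[symmetric])
    also have "\<dots> = (\<integral>\<^sup>+y. ennreal (?R y) \<partial>T)"
    proof (intro nn_integral_cong)
      fix y
      have "(\<Sum>a\<in>A. ennreal (1 / ?N) * (ennreal (surp (\<alpha> a, y)) * ennreal (F y a))) = (\<Sum>a\<in>A. ennreal (F y a * surp (\<alpha> a, y) / ?N))"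
        by (intro sum.cong) (auto simp: ennreal_mult[symmetric] surp_nn F_pos less_imp_le mult_ac)
      also have "\<dots> = ennreal (\<Sum>a\<in>A. F y a * surp (\<alpha> a, y) / ?N)"
        using surp_nn F_pos by (intro sum_ennreal) (auto simp: less_imp_le)
      also have "(\<Sum>a\<in>A. F y a * surp (\<alpha> a, y) / ?N) = ?R y"
        by (simp add: surp_eq sum_divide_distrib)
      finally show "(\<Sum>a\<in>A. ennreal (1 / ?N) * (ennreal (surp (\<alpha> a, y)) * ennreal (F y a))) = ennreal (?R y)" .
    qed
    finally show ?thesis .
  qed
  \<comment> \<open>A crude bound is enough: log z \<le> z / ln 2, and each weight is at most its
    fiber mass, so the integrand is at most the total weight divided by \<open>ln 2\<close>.\<close>
  have "(\<integral>\<^sup>+y. ennreal (?R y) \<partial>T) \<le> (\<integral>\<^sup>+y. (\<Sum>a\<in>A. ennreal (1 / ln 2) * ennreal (F y a)) \<partial>T)"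
  proof (intro nn_integral_mono)
    fix y
    have tot: "0 < sum (F y) A" using A F_pos by (intro sum_pos) auto
    have "F y a * log 2 (sum (F y) A / fiber_sum (F y) A \<alpha> a) \<le> sum (F y) A / ln 2" if a: "a \<in> A" for a
    proof -
      have fp: "0 < fiber_sum (F y) A \<alpha> a" using A F_pos a by (intro fiber_sum_pos) auto
      have "F y a \<le> fiber_sum (F y) A \<alpha> a"
        unfolding fiber_sum_def using A a F_pos by (intro member_le_sum) (auto simp: less_imp_le)
      then have "F y a * (sum (F y) A / fiber_sum (F y) A \<alpha> a) \<le> sum (F y) A"
        using fp tot by (simp add: field_simps)
      then have "F y a * (sum (F y) A / fiber_sum (F y) A \<alpha> a) / ln 2 \<le> sum (F y) A / ln 2"
        by (intro divide_right_mono) auto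
      moreover have "F y a * log 2 (sum (F y) A / fiber_sum (F y) A \<alpha> a) \<le> F y a * (sum (F y) A / fiber_sum (F y) A \<alpha> a / ln 2)"
        using fp tot F_pos[of y a] by (intro mult_left_mono log2_le) auto
      ultimately show ?thesis by simp
    qed
    then have "?R y \<le> (\<Sum>a\<in>A. sum (F y) A / ln 2) / ?N"
      by (intro divide_right_mono sum_mono) auto
    also have "\<dots> = (\<Sum>a\<in>A. 1 / ln 2 * F y a)" using N by (simp add: sum_divide_distrib)
    finally have "ennreal (?R y) \<le> ennreal (\<Sum>a\<in>A. 1 / ln 2 * F y a)" by (rule ennreal_leI)
    also have "\<dots> = (\<Sum>a\<in>A. ennreal (1 / ln 2) * ennreal (F y a))"
      using F_pos by (subst sum_ennreal[symmetric]) (auto simp: ennreal_mult[symmetric] less_imp_le)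
    finally show "ennreal (?R y) \<le> (\<Sum>a\<in>A. ennreal (1 / ln 2) * ennreal (F y a))" .
  qed
  also have "\<dots> = (\<Sum>a\<in>A. ennreal (1 / ln 2))"
    by (subst nn_integral_sum) (auto simp: nn_integral_cmult F_int)
  also have "\<dots> < \<top>" by (simp add: ennreal_mult_less_top of_nat_less_top)
  finally have fin: "(\<integral>\<^sup>+y. ennreal (?R y) \<partial>T) < \<top>" .
  have int: "integrable (?S \<Otimes>\<^sub>M T) (\<lambda>p. Pxy p * surp p)"
    using fin R Pxy_nn surp_nn by (intro integrableI_nonneg) auto
  have "conditional_entropy 2 ?S T X Y = - (\<integral>(x, y). Pxy (x, y) * log 2 (Pxy (x, y) / Py y) \<partial>(?S \<Otimes>\<^sub>M T))"
    by (rule conditional_entropy_generic_eq[OF sigma_finite_measure_count_space T dist_y _ dist_xy])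
      (auto simp: Py_pos less_imp_le Pxy_nn)
  also have "\<dots> = (\<integral>p. Pxy p * surp p \<partial>(?S \<Otimes>\<^sub>M T))"
    by (subst integral_minus[symmetric]) (simp add: surp_def case_prod_unfold)
  finally have H: "conditional_entropy 2 ?S T X Y = (\<integral>p. Pxy p * surp p \<partial>(?S \<Otimes>\<^sub>M T))" .
  show "ennreal (conditional_entropy 2 ?S T X Y) = (\<integral>\<^sup>+y. ennreal (?R y) \<partial>T)"
    using nn_integral_eq_integral[OF int] Pxy_nn surp_nn R H by simp
  show "0 \<le> conditional_entropy 2 ?S T X Y"
    unfolding H using Pxy_nn surp_nn by (intro Bochner_Integration.integral_nonneg) auto
qed

text \<open>The label is uniform on \<open>A\<close>, and fibers of equal size \<open>c\<close> pass
  this on to \<open>X\<close>; the output density integrates out.\<close>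

lemma mixture_entropy_uniform:
  assumes c: "\<And>x. x \<in> \<alpha> ` A \<Longrightarrow> card {a \<in> A. \<alpha> a = x} = c"
  shows "entropy 2 (count_space UNIV) X = log 2 (card (\<alpha> ` A))"
proof -
  interpret information_space M 2 by unfold_locales simp
  let ?S = "count_space (UNIV :: 'b set)"
  have cN: "card A = c * card (\<alpha> ` A)"
  proof -
    have "card A = (\<Sum>a\<in>A. 1)" by simp
    also have "\<dots> = (\<Sum>x\<in>\<alpha> ` A. \<Sum>a\<in>{a \<in> A. \<alpha> a = x}. 1)" using A by (intro sum.group[symmetric]) auto
    also have "\<dots> = (\<Sum>x\<in>\<alpha> ` A. c)" using c by (intro sum.cong) auto
    finally show ?thesis by simp
  qed
  have N: "0 < card A" using A by (simp add: card_gt_0_iff)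
  have "distributed M ?S X (\<lambda>x. indicator (\<alpha> ` A) x / measure ?S (\<alpha> ` A))"
    unfolding distributed_def
  proof (intro conjI measure_eqI)
    fix B :: "'b set"
    have "emeasure (distr M ?S X) B = (\<integral>\<^sup>+\<omega>. indicator B (X \<omega>) \<partial>M)"
      by (subst nn_integral_distr[of X M ?S "indicator B", symmetric]) auto
    also have "\<dots> = (\<Sum>a\<in>A. ennreal (1 / card A) * (\<integral>\<^sup>+y. indicator B (\<alpha> a) * ennreal (F y a) \<partial>T))"
      by (rule law[of "\<lambda>x y. indicator B x"]) measurable
    also have "\<dots> = (\<Sum>a\<in>A. ennreal (1 / card A) * indicator B (\<alpha> a))"
      using F by (simp add: nn_integral_cmult F_int)
    also have "\<dots> = (\<Sum>x\<in>\<alpha> ` A. \<Sum>a\<in>{a \<in> A. \<alpha> a = x}. ennreal (1 / card A) * indicator B (\<alpha> a))"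
      using A by (intro sum.group[symmetric]) auto
    also have "\<dots> = (\<Sum>x\<in>\<alpha> ` A. ennreal (1 / card (\<alpha> ` A)) * indicator B x)"
    proof (intro sum.cong refl)
      fix x assume x: "x \<in> \<alpha> ` A"
      have "(\<Sum>a\<in>{a \<in> A. \<alpha> a = x}. ennreal (1 / card A) * indicator B (\<alpha> a)) = of_nat c * (ennreal (1 / card A) * indicator B x)"
        using c[OF x] by simp
      moreover have "of_nat c * ennreal (1 / card A) = ennreal (1 / card (\<alpha> ` A))"
        using N by (simp add: ennreal_of_nat_eq_real_of_nat ennreal_mult[symmetric] cN)
      ultimately show "(\<Sum>a\<in>{a \<in> A. \<alpha> a = x}. ennreal (1 / card A) * indicator B (\<alpha> a)) = ennreal (1 / card (\<alpha> ` A)) * indicator B x"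
        by (simp add: mult.assoc[symmetric])
    qed
    also have "\<dots> = (\<integral>\<^sup>+x. ennreal (1 / card (\<alpha> ` A)) * indicator B x \<partial>count_space (\<alpha> ` A))"
      using A by (simp add: nn_integral_count_space_finite)
    also have "\<dots> = (\<integral>\<^sup>+x. ennreal (1 / card (\<alpha> ` A)) * indicator B x * indicator (\<alpha> ` A) x \<partial>?S)"
      by (subst nn_integral_count_space_indicator) auto
    also have "\<dots> = emeasure (density ?S (\<lambda>x. ennreal (indicator (\<alpha> ` A) x / measure ?S (\<alpha> ` A)))) B"
    proof -
      have "ennreal (1 / card (\<alpha> ` A)) * indicator B x * indicator (\<alpha> ` A) x
        = ennreal (indicator (\<alpha> ` A) x / measure ?S (\<alpha> ` A)) * indicator B x" for x
        using A by (cases "x \<in> \<alpha> ` A") (auto simp: measure_count_space)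
      then show ?thesis by (subst emeasure_density) auto
    qed
    finally show "emeasure (distr M ?S X) B = emeasure (density ?S (\<lambda>x. ennreal (indicator (\<alpha> ` A) x / measure ?S (\<alpha> ` A)))) B" .
  qed auto
  from entropy_uniform[OF this] show ?thesis using A by (simp add: measure_count_space)
qed

end

end

section \<open>Power, error probability and secrecy of a fixed codebook\<close>

context gaussian_code
begin

lemma nn_integral_input_power:
  assumes i: "i \<in> {1..K}" and t: "t < n"
  shows "(\<integral>\<^sup>+\<omega>. ennreal ((cX i \<omega> t)\<^sup>2) \<partial>\<Omega>)
    = (\<Sum>b\<in>label_set i. ennreal (1 / (real (Mn i) * real (Ln i))) * (\<integral>\<^sup>+x. ennreal (x\<^sup>2) \<partial>\<kappa> i t (C (i, b) t)))"
proof -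
  have em: "(\<lambda>x. x t) \<in> blk n \<rightarrow>\<^sub>M borel"
  proof -
    have "(\<lambda>x. x t) \<in> blk n \<rightarrow>\<^sub>M lborel" unfolding blk_def using t by (intro measurable_component_singleton) auto
    then show ?thesis by simp
  qed
  interpret No: prob_space Noise by (rule prob_Noise)
  have sq: "(\<lambda>p :: nat \<times> (nat \<Rightarrow> real). ennreal ((snd p t)\<^sup>2)) \<in> borel_measurable (user_law n (Mn i) (enc i))"
    unfolding measurable_cong_sets[OF sets_user refl]
    by (intro measurable_compose[OF measurable_compose[OF measurable_snd em]]) measurable
  have sqI: "(\<lambda>x. ennreal ((snd (x i) t)\<^sup>2)) \<in> borel_measurable Inp"
    by (rule measurable_compose[OF measurable_component_singleton[OF i, where M = "\<lambda>k. user_law n (Mn k) (enc k)"] sq])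
  have "(\<integral>\<^sup>+\<omega>. ennreal ((cX i \<omega> t)\<^sup>2) \<partial>\<Omega>) = (\<integral>\<^sup>+x. \<integral>\<^sup>+z. ennreal ((snd (x i) t)\<^sup>2) \<partial>Noise \<partial>Inp)"
    unfolding \<Omega>_def code_space_def cX_def
    unfolding No.nn_integral_fst[OF measurable_compose[OF measurable_fst sqI], symmetric] fst_conv ..
  also have "\<dots> = (\<integral>\<^sup>+x. ennreal ((snd (x i) t)\<^sup>2) \<partial>Inp)"
    by (simp add: No.emeasure_space_1)
  also have "\<dots> = (\<integral>\<^sup>+p. ennreal ((snd p t)\<^sup>2) \<partial>distr Inp (user_law n (Mn i) (enc i)) (\<lambda>x. x i))"
    using i sq by (subst nn_integral_distr) auto
  also have "distr Inp (user_law n (Mn i) (enc i)) (\<lambda>x. x i) = user_law n (Mn i) (enc i)"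
    using i by (intro distr_PiM_component prob_user)
  also have "(\<integral>\<^sup>+p. ennreal ((snd p t)\<^sup>2) \<partial>user_law n (Mn i) (enc i))
    = (\<Sum>b\<in>label_set i. ennreal (1 / (real (Mn i) * real (Ln i))) * (\<integral>\<^sup>+\<xi>. ennreal ((snd (fst b, \<xi>) t)\<^sup>2) \<partial>PiM {..<n} (\<lambda>t. \<kappa> i t (C (i, b) t))))"
    unfolding enc_def label_set_def
  proof (rule kernel.nn_integral_user_law[OF Mn_pos Ln_pos])
    show "(\<lambda>p :: nat \<times> (nat \<Rightarrow> real). ennreal ((snd p t)\<^sup>2)) \<in> borel_measurable (count_space UNIV \<Otimes>\<^sub>M blk n)"
      using sq unfolding measurable_cong_sets[OF sets_user refl] .
  qed
  also have "\<dots> = (\<Sum>b\<in>label_set i. ennreal (1 / (real (Mn i) * real (Ln i))) * (\<integral>\<^sup>+x. ennreal (x\<^sup>2) \<partial>\<kappa> i t (C (i, b) t)))"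
  proof (intro sum.cong refl arg_cong2[where f = "(*)"])
    fix b
    have c: "distr (PiM {..<n} (\<lambda>t. \<kappa> i t (C (i, b) t))) (\<kappa> i t (C (i, b) t)) (\<lambda>x. x t) = \<kappa> i t (C (i, b) t)"
      using t by (intro distr_PiM_component[where M = "\<lambda>t. \<kappa> i t (C (i, b) t)"] prob_kappa) auto
    have m: "(\<lambda>x. ennreal (x\<^sup>2)) \<in> borel_measurable (\<kappa> i t (C (i, b) t))"
      unfolding measurable_cong_sets[OF sets_kappa refl] by measurable
    have "(\<integral>\<^sup>+x. ennreal (x\<^sup>2) \<partial>distr (PiM {..<n} (\<lambda>t. \<kappa> i t (C (i, b) t))) (\<kappa> i t (C (i, b) t)) (\<lambda>x. x t))
        = (\<integral>\<^sup>+\<xi>. ennreal ((\<xi> t)\<^sup>2) \<partial>PiM {..<n} (\<lambda>t. \<kappa> i t (C (i, b) t)))"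
      using t m by (intro nn_integral_distr measurable_component_singleton) auto
    then show "(\<integral>\<^sup>+\<xi>. ennreal ((snd (fst b, \<xi>) t)\<^sup>2) \<partial>PiM {..<n} (\<lambda>t. \<kappa> i t (C (i, b) t))) = (\<integral>\<^sup>+x. ennreal (x\<^sup>2) \<partial>\<kappa> i t (C (i, b) t))"
      unfolding c by simp
  qed
  finally show ?thesis .
qed

text \<open>Second moments are demanded only at letters that the codebook uses: a finite mean power
  says nothing about letters outside the support of the prior.\<close>

lemma input_power:
  assumes i: "i \<in> {1..K}" and t: "t < n"
    and fin: "\<And>b. b \<in> label_set i \<Longrightarrow> (\<integral>\<^sup>+x. ennreal (x\<^sup>2) \<partial>\<kappa> i t (C (i, b) t)) = ennreal (pw (C (i, b) t))"
    and nn: "\<And>v. 0 \<le> pw v"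
  shows "integrable \<Omega> (\<lambda>\<omega>. (cX i \<omega> t)\<^sup>2)"
    "(\<integral>\<omega>. (cX i \<omega> t)\<^sup>2 \<partial>\<Omega>) = (\<Sum>b\<in>label_set i. pw (C (i, b) t)) / (real (Mn i) * real (Ln i))"
proof -
  have "(\<integral>\<^sup>+\<omega>. ennreal ((cX i \<omega> t)\<^sup>2) \<partial>\<Omega>) = (\<Sum>b\<in>label_set i. ennreal (pw (C (i, b) t) / (real (Mn i) * real (Ln i))))"
    unfolding nn_integral_input_power[OF i t]
    by (intro sum.cong refl) (simp add: fin ennreal_mult[symmetric] nn)
  also have "\<dots> = ennreal ((\<Sum>b\<in>label_set i. pw (C (i, b) t)) / (real (Mn i) * real (Ln i)))"
    by (simp add: sum_ennreal nn sum_divide_distrib)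
  finally have eq: "(\<integral>\<^sup>+\<omega>. ennreal ((cX i \<omega> t)\<^sup>2) \<partial>\<Omega>) = ennreal ((\<Sum>b\<in>label_set i. pw (C (i, b) t)) / (real (Mn i) * real (Ln i)))" .
  have m: "(\<lambda>\<omega>. (cX i \<omega> t)\<^sup>2) \<in> borel_measurable \<Omega>"
    using cX_measurable[OF i t] by (intro borel_measurable_power)
  show int: "integrable \<Omega> (\<lambda>\<omega>. (cX i \<omega> t)\<^sup>2)"
    by (rule integrableI_nonneg[OF m]) (auto simp: eq)
  show "(\<integral>\<omega>. (cX i \<omega> t)\<^sup>2 \<partial>\<Omega>) = (\<Sum>b\<in>label_set i. pw (C (i, b) t)) / (real (Mn i) * real (Ln i))"
  proof -
    have "0 \<le> (\<Sum>b\<in>label_set i. pw (C (i, b) t)) / (real (Mn i) * real (Ln i))"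
      by (intro divide_nonneg_nonneg sum_nonneg) (auto simp: nn)
    then show ?thesis using m by (subst integral_eq_nn_integral) (auto simp: eq)
  qed
qed

lemma error_prob:
  assumes i: "i \<in> {1..K}" and d[measurable]: "dec \<in> blk n \<rightarrow>\<^sub>M count_space UNIV"
  shows "emeasure \<Omega> {\<omega> \<in> space \<Omega>. dec (cY h g K n i \<omega>) \<noteq> cW i \<omega>}
    = (\<integral>\<^sup>+y. ennreal ((\<Sum>a\<in>label_tuples. W i y (word a) * of_bool (dec y \<noteq> fst (a i))) / card label_tuples) \<partial>blk n)"
proof -
  have j: "i \<in> {0..K}" using i by auto
  note [measurable] = cW_measurable[OF i] cY_measurable[OF j]
  have ci[measurable]: "(\<lambda>w. w i) \<in> PiM {1..K} (\<lambda>_. count_space (UNIV :: nat set)) \<rightarrow>\<^sub>M count_space UNIV"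
    by (rule measurable_component_singleton[OF i])
  define G where "G w y = (of_bool (dec y \<noteq> w i) :: ennreal)" for w y
  have "emeasure \<Omega> {\<omega> \<in> space \<Omega>. dec (cY h g K n i \<omega>) \<noteq> cW i \<omega>}
      = (\<integral>\<^sup>+\<omega>. indicator {\<omega> \<in> space \<Omega>. dec (cY h g K n i \<omega>) \<noteq> cW i \<omega>} \<omega> \<partial>\<Omega>)"
  proof (intro nn_integral_indicator[symmetric])
    have "(\<lambda>\<omega>. (dec (cY h g K n i \<omega>), cW i \<omega>)) \<in> \<Omega> \<rightarrow>\<^sub>M count_space UNIV \<Otimes>\<^sub>M count_space UNIV"
      by (intro measurable_Pair measurable_compose[OF cY_measurable[OF j] d] cW_measurable[OF i])
    then have "(\<lambda>\<omega>. (dec (cY h g K n i \<omega>), cW i \<omega>)) \<in> \<Omega> \<rightarrow>\<^sub>M count_space UNIV"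
      by (simp add: pair_measure_countable)
    from measurable_sets[OF this, of "{(u, v). u \<noteq> v}"]
    show "{\<omega> \<in> space \<Omega>. dec (cY h g K n i \<omega>) \<noteq> cW i \<omega>} \<in> sets \<Omega>"
      by (simp add: vimage_def Int_def conj_commute)
  qed
  also have "\<dots> = (\<integral>\<^sup>+\<omega>. G (\<lambda>k\<in>{1..K}. cW k \<omega>) (cY h g K n i \<omega>) \<partial>\<Omega>)"
    using i by (intro nn_integral_cong) (auto simp: G_def)
  also have "\<dots> = (\<Sum>a\<in>label_tuples. ennreal (1 / card label_tuples) * (\<integral>\<^sup>+y. G (\<lambda>k\<in>{1..K}. fst (a k)) y * ennreal (W i y (word a)) \<partial>blk n))"
  proof (rule code_law[OF j])
    have "(\<lambda>p. (dec (snd p), fst p i)) \<in> PiM {1..K} (\<lambda>_. count_space (UNIV :: nat set)) \<Otimes>\<^sub>M blk n \<rightarrow>\<^sub>M count_space UNIV \<Otimes>\<^sub>M count_space UNIV"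
      by (rule measurable_Pair[OF measurable_compose[OF measurable_snd d] measurable_compose[OF measurable_fst ci]])
    then have "(\<lambda>p. (dec (snd p), fst p i)) \<in> PiM {1..K} (\<lambda>_. count_space (UNIV :: nat set)) \<Otimes>\<^sub>M blk n \<rightarrow>\<^sub>M count_space UNIV"
      by (simp only: pair_measure_countable countableI_type UNIV_Times_UNIV)
    moreover have "(\<lambda>(u, v). of_bool (u \<noteq> v)) \<in> count_space UNIV \<rightarrow>\<^sub>M (borel :: ennreal measure)" by simp
    ultimately have "(\<lambda>p. case (dec (snd p), fst p i) of (u, v) \<Rightarrow> of_bool (u \<noteq> v))
      \<in> PiM {1..K} (\<lambda>_. count_space (UNIV :: nat set)) \<Otimes>\<^sub>M blk n \<rightarrow>\<^sub>M (borel :: ennreal measure)"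
      by (rule measurable_compose)
    then    show "(\<lambda>(w, y). G w y) \<in> borel_measurable (PiM {1..K} (\<lambda>_. count_space UNIV) \<Otimes>\<^sub>M blk n)"
      by (simp only: G_def case_prod_unfold fst_conv snd_conv)
  qed
  also have "\<dots> = (\<integral>\<^sup>+y. (\<Sum>a\<in>label_tuples. ennreal (1 / card label_tuples) * (G (\<lambda>k\<in>{1..K}. fst (a k)) y * ennreal (W i y (word a)))) \<partial>blk n)"
    unfolding G_def by (subst nn_integral_sum) (auto intro!: sum.cong nn_integral_cmult[symmetric])
  also have "\<dots> = (\<integral>\<^sup>+y. ennreal ((\<Sum>a\<in>label_tuples. W i y (word a) * of_bool (dec y \<noteq> fst (a i))) / card label_tuples) \<partial>blk n)"
  proof (intro nn_integral_cong)
    fix y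
    have "(\<Sum>a\<in>label_tuples. ennreal (1 / card label_tuples) * (G (\<lambda>k\<in>{1..K}. fst (a k)) y * ennreal (W i y (word a))))
        = (\<Sum>a\<in>label_tuples. ennreal (W i y (word a) * of_bool (dec y \<noteq> fst (a i)) / card label_tuples))"
      using i by (intro sum.cong refl) (auto simp: G_def ennreal_mult[symmetric] W_pos less_imp_le)
    also have "\<dots> = ennreal ((\<Sum>a\<in>label_tuples. W i y (word a) * of_bool (dec y \<noteq> fst (a i))) / card label_tuples)"
      unfolding sum_divide_distrib by (intro sum_ennreal) (auto simp: W_pos less_imp_le)
    finally show "(\<Sum>a\<in>label_tuples. ennreal (1 / card label_tuples) * (G (\<lambda>k\<in>{1..K}. fst (a k)) y * ennreal (W i y (word a))))
      = ennreal ((\<Sum>a\<in>label_tuples. W i y (word a) * of_bool (dec y \<noteq> fst (a i))) / card label_tuples)" .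
  qed
  finally show ?thesis .
qed

text \<open>\<open>genie_leak\<close> with weight \<open>W j y\<close>. Its integral over
  \<open>y\<close> is the information in nats between message \<open>i\<close> and the output at
  \<open>j\<close>, given the labels of all other users, since \<open>Mn i\<close> equally likely
  messages have entropy ln \<open>Mn i\<close>.\<close>

definition "leak j i y = (\<Sum>a\<in>label_tuples. W j y (word a) * ln (real (Mn i) *
     (fiber_sum (\<lambda>a. W j y (word a)) label_tuples (\<lambda>a. (fst (a i), a(i := undefined))) a
        / fiber_sum (\<lambda>a. W j y (word a)) label_tuples (\<lambda>a. a(i := undefined)) a))) / card label_tuples"

lemma leak_nonneg:
  assumes "i \<in> {1..K}"
  shows "0 \<le> leak j i y"
proof -
  have "fst (a i) \<in> {..<Mn i}" if "a \<in> label_tuples" for a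
    using PiE_mem[OF that[unfolded label_tuples_def] assms] by (auto simp: label_set_def)
  then have "(\<lambda>a. fst (a i)) ` label_tuples \<subseteq> {..<Mn i}" by blast
  then have "card ((\<lambda>a. fst (a i)) ` label_tuples) \<le> Mn i" using card_mono[of "{..<Mn i}"] by fastforce
  then show ?thesis unfolding leak_def using Mn_pos W_pos
    by (intro divide_nonneg_nonneg sum_fiber_info_nonneg) auto
qed

lemma leak_measurable [measurable]: "leak j i \<in> borel_measurable (blk n)"
  unfolding leak_def by measurable

text \<open>One map for any selection of users, so that \<open>cWall\<close> and
  \<open>cWminus\<close> are treated together.\<close>

definition "msgs ks \<omega> = map (\<lambda>k. cW k \<omega>) ks"

lemma msgs_measurable:
  assumes "set ks \<subseteq> {1..K}"
  shows "msgs ks \<in> \<Omega> \<rightarrow>\<^sub>M count_space UNIV"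
  using assms
proof (induction ks)
  case Nil
  then show ?case by (simp add: msgs_def[abs_def])
next
  case (Cons k ks)
  have "(\<lambda>\<omega>. (cW k \<omega>, msgs ks \<omega>)) \<in> \<Omega> \<rightarrow>\<^sub>M count_space UNIV \<Otimes>\<^sub>M count_space UNIV"
    using Cons by (intro measurable_Pair cW_measurable) auto
  then have "(\<lambda>\<omega>. (cW k \<omega>, msgs ks \<omega>)) \<in> \<Omega> \<rightarrow>\<^sub>M count_space UNIV"
    by (simp add: pair_measure_countable)
  from measurable_compose[OF this, of "\<lambda>(w, l). w # l" "count_space UNIV"]
  show ?case by (simp add: msgs_def[abs_def])
qed

lemma msgs_law:
  assumes j: "j \<in> {0..K}" and ks: "set ks \<subseteq> {1..K}"
    and G[measurable]: "case_prod G \<in> borel_measurable (count_space UNIV \<Otimes>\<^sub>M blk n)"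
  shows "(\<integral>\<^sup>+\<omega>. G (msgs ks \<omega>) (cY h g K n j \<omega>) \<partial>\<Omega>)
    = (\<Sum>a\<in>label_tuples. ennreal (1 / card label_tuples) * (\<integral>\<^sup>+y. G (map (\<lambda>k. fst (a k)) ks) y * ennreal (W j y (word a)) \<partial>blk n))"
proof -
  have mm: "(\<lambda>w. map w ks) \<in> PiM {1..K} (\<lambda>_. count_space (UNIV :: nat set)) \<rightarrow>\<^sub>M count_space UNIV"
    using ks
  proof (induction ks)
    case (Cons k ks)
    have k: "k \<in> {1..K}" using Cons by auto
    have "(\<lambda>w. (w k, map w ks)) \<in> PiM {1..K} (\<lambda>_. count_space (UNIV :: nat set)) \<rightarrow>\<^sub>M count_space UNIV \<Otimes>\<^sub>M count_space UNIV"
      using Cons by (intro measurable_Pair measurable_component_singleton[OF k]) auto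
    then have "(\<lambda>w. (w k, map w ks)) \<in> PiM {1..K} (\<lambda>_. count_space (UNIV :: nat set)) \<rightarrow>\<^sub>M count_space UNIV"
      by (simp add: pair_measure_countable)
    from measurable_compose[OF this, of "\<lambda>(w, l). w # l" "count_space UNIV"] show ?case by simp
  qed simp
  have res: "map (restrict w {1..K}) ks = map w ks" for w :: "nat \<Rightarrow> nat"
    using ks by (intro map_cong) auto
  have "(\<integral>\<^sup>+\<omega>. G (msgs ks \<omega>) (cY h g K n j \<omega>) \<partial>\<Omega>) = (\<integral>\<^sup>+\<omega>. G (map (\<lambda>k\<in>{1..K}. cW k \<omega>) ks) (cY h g K n j \<omega>) \<partial>\<Omega>)"
    unfolding res msgs_def ..
  also have "\<dots> = (\<Sum>a\<in>label_tuples. ennreal (1 / card label_tuples) * (\<integral>\<^sup>+y. G (map (\<lambda>k\<in>{1..K}. fst (a k)) ks) y * ennreal (W j y (word a)) \<partial>blk n))"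
    using measurable_compose[OF measurable_Pair[OF measurable_compose[OF measurable_fst mm] measurable_snd] G]
    by (intro code_law[where G = "\<lambda>w. G (map w ks)", OF j]) (simp add: case_prod_unfold)
  finally show ?thesis unfolding res .
qed

text \<open>A user in \<open>S\<close> keeps only its randomisation index free, the others keep
  their whole label. The count does not depend on \<open>a\<close>, which is what makes the messages
  uniform.\<close>

lemma card_message_fiber:
  assumes a: "a \<in> label_tuples" and S: "S \<subseteq> {1..K}"
  shows "card {a' \<in> label_tuples. \<forall>k\<in>S. fst (a' k) = fst (a k)} = (\<Prod>k\<in>{1..K}. if k \<in> S then Ln k else Mn k * Ln k)"
proof -
  have "{a' \<in> label_tuples. \<forall>k\<in>S. fst (a' k) = fst (a k)} = PiE {1..K} (\<lambda>k. if k \<in> S then {fst (a k)} \<times> {..<Ln k} else label_set k)"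
  proof (intro set_eqI iffI)
    fix a' assume a': "a' \<in> {a' \<in> label_tuples. \<forall>k\<in>S. fst (a' k) = fst (a k)}"
    then show "a' \<in> PiE {1..K} (\<lambda>k. if k \<in> S then {fst (a k)} \<times> {..<Ln k} else label_set k)"
      using S by (force simp: label_tuples_def PiE_iff label_set_def mem_Times_iff)
  next
    fix a' assume a': "a' \<in> PiE {1..K} (\<lambda>k. if k \<in> S then {fst (a k)} \<times> {..<Ln k} else label_set k)"
    have "a' k \<in> label_set k \<and> (k \<in> S \<longrightarrow> fst (a' k) = fst (a k))" if "k \<in> {1..K}" for k
      using PiE_mem[OF a' that] PiE_mem[OF a[unfolded label_tuples_def] that] by (auto simp: label_set_def split: if_splits)
    then show "a' \<in> {a' \<in> label_tuples. \<forall>k\<in>S. fst (a' k) = fst (a k)}"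
      using a' S by (auto simp: label_tuples_def PiE_iff)
  qed
  then show ?thesis
    by (simp add: card_PiE) (intro prod.cong, auto simp: card_cartesian_product label_set_def)
qed

lemma entropy_msgs:
  assumes ks: "set ks \<subseteq> {1..K}" "distinct ks"
  shows "\<Omega>.entropy 2 (count_space UNIV) (msgs ks) = (\<Sum>k\<in>set ks. log 2 (Mn k))"
proof -
  let ?\<alpha> = "\<lambda>a :: nat \<Rightarrow> nat \<times> nat. map (\<lambda>k. fst (a k)) ks"
  \<comment> \<open>Receiver 0 merely supplies an output for the mixture lemma; the entropy of the
    messages does not depend on the receiver.\<close>
  have j: "0 \<in> {0..K}" by auto
  have fib: "card {a' \<in> label_tuples. ?\<alpha> a' = ?\<alpha> a} = (\<Prod>k\<in>{1..K}. if k \<in> set ks then Ln k else Mn k * Ln k)" if "a \<in> label_tuples" for a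
    using card_message_fiber[OF that ks(1)] by simp
  have "\<Omega>.entropy 2 (count_space UNIV) (msgs ks) = log 2 (card (?\<alpha> ` label_tuples))"
    by (rule \<Omega>.mixture_entropy_uniform[where c = "\<Prod>k\<in>{1..K}. if k \<in> set ks then Ln k else Mn k * Ln k",
          OF msgs_measurable[OF ks(1)] cY_measurable[OF j] sigma_finite_blk finite_label_tuples label_tuples_nonempty
          W_measurable W_pos nn_integral_W msgs_law[OF j ks(1)]])
      (use fib in auto)
  also have "?\<alpha> ` label_tuples = {l. list_all2 (\<lambda>k w. w < Mn k) ks l}"
  proof (intro set_eqI iffI)
    fix l assume "l \<in> ?\<alpha> ` label_tuples"
    then obtain a where a: "a \<in> label_tuples" "l = ?\<alpha> a" by auto
    have "fst (a k) < Mn k" if "k \<in> set ks" for k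
    proof -
      have "k \<in> {1..K}" using that ks(1) by blast
      from PiE_mem[OF a(1)[unfolded label_tuples_def] this] show ?thesis by (auto simp: label_set_def)
    qed
    then show "l \<in> {l. list_all2 (\<lambda>k w. w < Mn k) ks l}"
      by (auto simp: a(2) list_all2_conv_all_nth)
  next
    fix l assume "l \<in> {l. list_all2 (\<lambda>k w. w < Mn k) ks l}"
    then have l: "length l = length ks" "\<And>m. m < length ks \<Longrightarrow> l ! m < Mn (ks ! m)"
      by (auto simp: list_all2_conv_all_nth)
    \<comment> \<open>A preimage of \<open>l\<close>: messages are read off the list, and 0 stands
      for every other entry, randomisation indices included.\<close>
    define a :: "nat \<Rightarrow> nat \<times> nat"
      where "a = (\<lambda>k\<in>{1..K}. case map_of (zip ks l) k of None \<Rightarrow> (0, 0) | Some w \<Rightarrow> (w, 0))"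
    have val: "a (ks ! m) = (l ! m, 0)" if "m < length ks" for m
    proof -
      have "map_of (zip ks l) (ks ! m) = Some (l ! m)"
        using l ks(2) that by (intro map_of_zip_nth) auto
      moreover have "ks ! m \<in> {1..K}" using ks(1) that by (meson nth_mem subsetD)
      ultimately show ?thesis by (simp add: a_def)
    qed
    have "a k \<in> label_set k" if k: "k \<in> {1..K}" for k
    proof (cases "k \<in> set ks")
      case True
      then obtain m where "m < length ks" "k = ks ! m" by (auto simp: in_set_conv_nth)
      then show ?thesis using val l Ln_pos by (auto simp: label_set_def)
    next
      case False
      then have "map_of (zip ks l) k = None" using l by (simp add: map_of_zip_is_None)
      then show ?thesis using k Mn_pos Ln_pos by (simp add: a_def label_set_def)
    qed
    then have "a \<in> label_tuples" by (auto simp: label_tuples_def a_def PiE_iff extensional_def)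
    moreover have "?\<alpha> a = l" using l val by (intro nth_equalityI) auto
    ultimately show "l \<in> ?\<alpha> ` label_tuples" by force
  qed
  also have "card {l. list_all2 (\<lambda>k w. w < Mn k) ks l} = (\<Prod>k\<in>set ks. Mn k)"
    using ks(2)
  proof (induction ks)
    case (Cons k ks)
    have "{l. list_all2 (\<lambda>k w. w < Mn k) (k # ks) l} = (\<lambda>(w, l). w # l) ` ({..<Mn k} \<times> {l. list_all2 (\<lambda>k w. w < Mn k) ks l})"
      by (auto simp: list_all2_Cons1 image_iff)
    moreover have "inj_on (\<lambda>(w, l). w # l) B" for B :: "(nat \<times> nat list) set" by (auto simp: inj_on_def)
    ultimately show ?case using Cons by (simp add: card_image card_cartesian_product)
  next
    case Nil
    have "{l :: nat list. list_all2 (\<lambda>k w. w < Mn k) [] l} = {[]}" by auto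
    then show ?case by simp
  qed
  also have "log 2 (real (\<Prod>k\<in>set ks. Mn k)) = (\<Sum>k\<in>set ks. log 2 (Mn k))"
  proof -
    have "log 2 (\<Prod>k\<in>S. real (Mn k)) = (\<Sum>k\<in>S. log 2 (Mn k))" if "finite S" for S
      using that
    proof (induction S rule: finite_induct)
      case (insert k S)
      have "0 < (\<Prod>k\<in>S. real (Mn k))" by (intro prod_pos) (simp add: Mn_pos)
      moreover have "Mn k \<noteq> 0" for k using Mn_pos[of k] by simp
      ultimately show ?case using insert by (simp add: log_mult)
    qed simp
    then show ?thesis by simp
  qed
  finally show ?thesis .
qed

text \<open>At each \<open>y\<close> the fiber chain rule bounds the missing entropy of the messages
  by the sum of the genie leakages. Integration over \<open>y\<close> turns \<open>h0\<close> times
  the output density into \<open>h0\<close>, and the right side into the conditional entropy plus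
  the leakage bound. Dividing by \<open>ln 2\<close> converts nats to bits.\<close>

lemma secrecy:
  assumes j: "j \<in> {0..K}" and ks: "set ks \<subseteq> {1..K}" "distinct ks"
    and leak: "(\<Sum>i\<in>set ks. \<integral>\<^sup>+y. ennreal (leak j i y) \<partial>blk n) \<le> ennreal \<delta>" and \<delta>: "0 \<le> \<delta>"
  shows "\<Omega>.conditional_entropy 2 (count_space UNIV) (blk n) (msgs ks) (cY h g K n j)
    \<ge> \<Omega>.entropy 2 (count_space UNIV) (msgs ks) - \<delta> / ln 2"
proof -
  let ?\<alpha> = "\<lambda>a :: nat \<Rightarrow> nat \<times> nat. map (\<lambda>k. fst (a k)) ks"
  let ?F = "\<lambda>y a. W j y (word a)"
  let ?N = "real (card label_tuples)"
  let ?H = "\<Omega>.conditional_entropy 2 (count_space UNIV) (blk n) (msgs ks) (cY h g K n j)"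
  \<comment> \<open>The output density at \<open>y\<close> times the posterior entropy of the
    messages in bits.\<close>
  define R where "R y = (\<Sum>a\<in>label_tuples. ?F y a * log 2 (sum (?F y) label_tuples / fiber_sum (?F y) label_tuples ?\<alpha> a)) / ?N" for y
  define h0 where "h0 = (\<Sum>k\<in>set ks. log 2 (Mn k))"
  have N: "0 < ?N" using label_tuples_nonempty by (simp add: card_gt_0_iff)
  have cond: "ennreal ?H = (\<integral>\<^sup>+y. ennreal (R y) \<partial>blk n)"
    unfolding R_def
    by (rule \<Omega>.conditional_entropy_mixture_eq[OF msgs_measurable[OF ks(1)] cY_measurable[OF j] sigma_finite_blk finite_label_tuples label_tuples_nonempty
          W_measurable W_pos nn_integral_W msgs_law[OF j ks(1)]])
  have h0: "0 \<le> h0" unfolding h0_def using Mn_pos by (intro sum_nonneg) (auto simp: Suc_le_eq)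
  have point: "h0 * (sum (?F y) label_tuples / ?N) \<le> R y + (\<Sum>i\<in>set ks. leak j i y) / ln 2" and R_nn: "0 \<le> R y" for y
  proof -
    let ?g = "\<lambda>i a. fiber_sum (?F y) label_tuples (\<lambda>a. (fst (a i), a(i := undefined))) a"
    let ?h = "\<lambda>i a. fiber_sum (?F y) label_tuples (\<lambda>a. a(i := undefined)) a"
    have fp: "0 < fiber_sum (?F y) label_tuples \<phi> a" if "a \<in> label_tuples" for a and \<phi> :: "(nat \<Rightarrow> nat \<times> nat) \<Rightarrow> 'z"
      using that by (intro fiber_sum_pos) (auto simp: W_pos)
    have tot: "0 < sum (?F y) label_tuples" using label_tuples_nonempty by (intro sum_pos) (auto simp: W_pos)
    have fa: "fiber_sum (?F y) label_tuples (\<lambda>a. restrict (\<lambda>k. fst (a k)) (set ks)) a = fiber_sum (?F y) label_tuples ?\<alpha> a" for a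
      by (rule fiber_sum_cong) (auto simp: restrict_def fun_eq_iff)
    have "(\<Sum>a\<in>label_tuples. ?F y a * ln (fiber_sum (?F y) label_tuples ?\<alpha> a / sum (?F y) label_tuples)) \<le> (\<Sum>i\<in>set ks. \<Sum>a\<in>label_tuples. ?F y a * ln (?g i a / ?h i a))"
      using fiber_entropy_chain[of label_tuples "?F y" "set ks" fst] W_pos unfolding fa by simp
    moreover have "(\<Sum>a\<in>label_tuples. ?F y a * ln (fiber_sum (?F y) label_tuples ?\<alpha> a / sum (?F y) label_tuples)) = - ln 2 * ?N * R y"
    proof -
      have "?F y a * ln (fiber_sum (?F y) label_tuples ?\<alpha> a / sum (?F y) label_tuples)
        = - ln 2 * (?F y a * log 2 (sum (?F y) label_tuples / fiber_sum (?F y) label_tuples ?\<alpha> a))" if "a \<in> label_tuples" for a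
      proof -
        have "ln (fiber_sum (?F y) label_tuples ?\<alpha> a / sum (?F y) label_tuples) = - ln 2 * log 2 (sum (?F y) label_tuples / fiber_sum (?F y) label_tuples ?\<alpha> a)"
          using fp[OF that, of ?\<alpha>] tot by (simp add: log_def ln_div)
        then show ?thesis by simp
      qed
      then have "(\<Sum>a\<in>label_tuples. ?F y a * ln (fiber_sum (?F y) label_tuples ?\<alpha> a / sum (?F y) label_tuples))
        = - ln 2 * (\<Sum>a\<in>label_tuples. ?F y a * log 2 (sum (?F y) label_tuples / fiber_sum (?F y) label_tuples ?\<alpha> a))"
        unfolding sum_distrib_left by (rule sum.cong[OF refl])
      also have "(\<Sum>a\<in>label_tuples. ?F y a * log 2 (sum (?F y) label_tuples / fiber_sum (?F y) label_tuples ?\<alpha> a)) = ?N * R y"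
        using N unfolding R_def by simp
      finally show ?thesis by simp
    qed
    moreover have "(\<Sum>a\<in>label_tuples. ?F y a * ln (?g i a / ?h i a)) = ?N * leak j i y - ln (Mn i) * sum (?F y) label_tuples" for i
    proof -
      have "?F y a * ln (?g i a / ?h i a) = ?F y a * ln (real (Mn i) * (?g i a / ?h i a)) - ln (Mn i) * ?F y a" if "a \<in> label_tuples" for a
        using fp[OF that, of "\<lambda>a. (fst (a i), a(i := undefined))"] fp[OF that, of "\<lambda>a. a(i := undefined)"] Mn_pos[of i]
        by (simp add: ln_mult ln_div algebra_simps)
      then have "(\<Sum>a\<in>label_tuples. ?F y a * ln (?g i a / ?h i a))
        = (\<Sum>a\<in>label_tuples. ?F y a * ln (real (Mn i) * (?g i a / ?h i a))) - ln (Mn i) * sum (?F y) label_tuples"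
        unfolding sum_distrib_left sum_subtractf[symmetric] by (rule sum.cong[OF refl])
      also have "(\<Sum>a\<in>label_tuples. ?F y a * ln (real (Mn i) * (?g i a / ?h i a))) = ?N * leak j i y"
        using N unfolding leak_def by simp
      finally show ?thesis .
    qed
    ultimately have "- ln 2 * ?N * R y \<le> (\<Sum>i\<in>set ks. ?N * leak j i y - ln (Mn i) * sum (?F y) label_tuples)" by simp
    also have "\<dots> = ?N * (\<Sum>i\<in>set ks. leak j i y) - ln 2 * h0 * sum (?F y) label_tuples"
    proof -
      have "(\<Sum>i\<in>set ks. ?N * l i - ln (Mn i) * T) = ?N * sum l (set ks) - ln 2 * h0 * T" for l and T :: real
        by (simp add: sum_subtractf sum_distrib_left sum_distrib_right h0_def log_def)
      then show ?thesis .
    qed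
    finally have "ln 2 * h0 * sum (?F y) label_tuples \<le> ?N * ((\<Sum>i\<in>set ks. leak j i y) + ln 2 * R y)" by (simp add: algebra_simps)
    then have "ln 2 * (h0 * (sum (?F y) label_tuples / ?N)) \<le> (\<Sum>i\<in>set ks. leak j i y) + ln 2 * R y" using N by (simp add: field_simps)
    then show "h0 * (sum (?F y) label_tuples / ?N) \<le> R y + (\<Sum>i\<in>set ks. leak j i y) / ln 2" by (simp add: field_simps)
    have "fiber_sum (?F y) label_tuples ?\<alpha> a \<le> sum (?F y) label_tuples" for a
      unfolding fiber_sum_def by (intro sum_mono2) (auto simp: W_pos less_imp_le)
    then have "0 \<le> log 2 (sum (?F y) label_tuples / fiber_sum (?F y) label_tuples ?\<alpha> a)" if "a \<in> label_tuples" for a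
      using fp[OF that, of ?\<alpha>] tot by (subst zero_le_log_cancel_iff) auto
    then show "0 \<le> R y" unfolding R_def
      by (intro divide_nonneg_nonneg sum_nonneg mult_nonneg_nonneg) (auto simp: W_pos less_imp_le)
  qed
  have ln: "0 \<le> leak j i y" if "i \<in> set ks" for i y using that ks(1) by (intro leak_nonneg) auto
  have Rm[measurable]: "R \<in> borel_measurable (blk n)" unfolding R_def by measurable
  have "ennreal h0 = (\<integral>\<^sup>+y. ennreal (h0 * (sum (?F y) label_tuples / ?N)) \<partial>blk n)"
  proof -
    have "(\<integral>\<^sup>+y. ennreal (h0 * (sum (?F y) label_tuples / ?N)) \<partial>blk n) = (\<integral>\<^sup>+y. (\<Sum>a\<in>label_tuples. ennreal (h0 / ?N) * ennreal (?F y a)) \<partial>blk n)"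
    proof (intro nn_integral_cong)
      fix y
      have "(\<Sum>a\<in>label_tuples. ennreal (h0 / ?N) * ennreal (?F y a)) = (\<Sum>a\<in>label_tuples. ennreal (h0 / ?N * ?F y a))"
        using h0 by (intro sum.cong) (auto simp: ennreal_mult[symmetric] W_pos less_imp_le)
      also have "\<dots> = ennreal (\<Sum>a\<in>label_tuples. h0 / ?N * ?F y a)" using h0 by (intro sum_ennreal) (auto simp: W_pos less_imp_le)
      finally show "ennreal (h0 * (sum (?F y) label_tuples / ?N)) = (\<Sum>a\<in>label_tuples. ennreal (h0 / ?N) * ennreal (?F y a))"
        by (simp add: sum_distrib_left sum_divide_distrib)
    qed
    also have "\<dots> = (\<Sum>a\<in>label_tuples. ennreal (h0 / ?N))"
      by (subst nn_integral_sum) (auto simp: nn_integral_cmult nn_integral_W)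
    also have "\<dots> = ennreal h0" using N h0 label_tuples_nonempty by (simp add: ennreal_of_nat_eq_real_of_nat ennreal_mult[symmetric])
    finally show ?thesis ..
  qed
  also have "\<dots> \<le> (\<integral>\<^sup>+y. (ennreal (R y) + ennreal (1 / ln 2) * (\<Sum>i\<in>set ks. ennreal (leak j i y))) \<partial>blk n)"
  proof (intro nn_integral_mono)
    fix y
    have "ennreal (h0 * (sum (?F y) label_tuples / ?N)) \<le> ennreal (R y + 1 / ln 2 * (\<Sum>i\<in>set ks. leak j i y))"
      using point[of y] by (intro ennreal_leI) simp
    also have "\<dots> = ennreal (R y) + ennreal (1 / ln 2) * ennreal (\<Sum>i\<in>set ks. leak j i y)"
    proof -
      have nn: "0 \<le> (\<Sum>i\<in>set ks. leak j i y)" using ln by (intro sum_nonneg)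
      then have "ennreal (R y + 1 / ln 2 * (\<Sum>i\<in>set ks. leak j i y)) = ennreal (R y) + ennreal (1 / ln 2 * (\<Sum>i\<in>set ks. leak j i y))"
        using R_nn[of y] by (intro ennreal_plus) auto
      also have "ennreal (1 / ln 2 * (\<Sum>i\<in>set ks. leak j i y)) = ennreal (1 / ln 2) * ennreal (\<Sum>i\<in>set ks. leak j i y)"
        using nn by (intro ennreal_mult) auto
      finally show ?thesis .
    qed
    also have "ennreal (\<Sum>i\<in>set ks. leak j i y) = (\<Sum>i\<in>set ks. ennreal (leak j i y))"
      using ln by (intro sum_ennreal[symmetric])
    finally show "ennreal (h0 * (sum (?F y) label_tuples / ?N)) \<le> ennreal (R y) + ennreal (1 / ln 2) * (\<Sum>i\<in>set ks. ennreal (leak j i y))" .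
  qed
  also have "\<dots> = ennreal ?H + ennreal (1 / ln 2) * (\<Sum>i\<in>set ks. \<integral>\<^sup>+y. ennreal (leak j i y) \<partial>blk n)"
    unfolding cond by (simp add: nn_integral_add nn_integral_cmult nn_integral_sum)
  also have "\<dots> \<le> ennreal ?H + ennreal (1 / ln 2) * ennreal \<delta>"
    using leak by (intro add_left_mono mult_left_mono) auto
  also have "\<dots> = ennreal ?H + ennreal (\<delta> / ln 2)" using \<delta> by (simp add: ennreal_mult[symmetric])
  finally have le: "ennreal h0 \<le> ennreal ?H + ennreal (\<delta> / ln 2)" .
  \<comment> \<open>\<open>ennreal\<close> truncates negative reals, so the inequality is first read
    off with \<open>max 0\<close>; nonnegativity of the conditional entropy then removes the
    truncation.\<close>
  have "h0 \<le> max 0 ?H + \<delta> / ln 2"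
    using le \<delta> by (cases "0 \<le> ?H") (auto simp: ennreal_plus[symmetric] ennreal_neg max_def simp del: ennreal_plus)
  moreover have "0 \<le> ?H"
    by (rule \<Omega>.conditional_entropy_mixture_nonneg[OF msgs_measurable[OF ks(1)] cY_measurable[OF j] sigma_finite_blk finite_label_tuples label_tuples_nonempty
          W_measurable W_pos nn_integral_W msgs_law[OF j ks(1)]])
  ultimately show ?thesis unfolding entropy_msgs[OF ks] h0_def by simp
qed

end

section \<open>Ensembles of padded codebooks\<close>

lemma expectation_measurable [measurable (raw)]:
  fixes f :: "'b \<Rightarrow> 'a \<Rightarrow> real"
  assumes "finite (set_pmf p)" "\<And>x. (\<lambda>y. f y x) \<in> borel_measurable M"
  shows "(\<lambda>y. measure_pmf.expectation p (f y)) \<in> borel_measurable M"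
proof -
  have "(\<lambda>y. measure_pmf.expectation p (f y)) = (\<lambda>y. \<Sum>x\<in>set_pmf p. f y x * pmf p x)"
    using assms(1) by (intro ext integral_measure_pmf_real) auto
  then show ?thesis using assms(2) by simp
qed

lemma nn_integral_pmf_eq_expectation:
  fixes f :: "'a \<Rightarrow> real"
  assumes "finite (set_pmf p)" "\<And>x. 0 \<le> f x"
  shows "(\<integral>\<^sup>+x. ennreal (f x) \<partial>measure_pmf p) = ennreal (measure_pmf.expectation p f)"
  using assms by (intro nn_integral_eq_integral integrable_measure_pmf_finite) auto

lemma nn_integral_pmf_swap:
  fixes f :: "'a \<Rightarrow> 'b \<Rightarrow> ennreal"
  assumes "finite (set_pmf p)" "\<And>x. f x \<in> borel_measurable M"
  shows "(\<integral>\<^sup>+x. (\<integral>\<^sup>+y. f x y \<partial>M) \<partial>measure_pmf p) = (\<integral>\<^sup>+y. (\<integral>\<^sup>+x. f x y \<partial>measure_pmf p) \<partial>M)"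
  using assms by (simp add: nn_integral_measure_pmf_finite nn_integral_sum nn_integral_multc)

text \<open>Jensen's inequality, from the tangent to \<open>exp\<close> at the mean.\<close>

lemma exp_average_le:
  fixes x :: "'b \<Rightarrow> real"
  assumes "finite B" "B \<noteq> {}"
  shows "exp ((\<Sum>b\<in>B. x b) / card B) \<le> (\<Sum>b\<in>B. exp (x b)) / card B"
proof -
  let ?m = "(\<Sum>b\<in>B. x b) / card B"
  have N: "0 < real (card B)" using assms by (simp add: card_gt_0_iff)
  have "(\<Sum>b\<in>B. exp ?m * (1 + (x b - ?m))) \<le> (\<Sum>b\<in>B. exp (x b))"
  proof (intro sum_mono)
    fix b
    have "exp ?m * (1 + (x b - ?m)) \<le> exp ?m * exp (x b - ?m)" by (intro mult_left_mono exp_ge_add_one_self) auto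
    then show "exp ?m * (1 + (x b - ?m)) \<le> exp (x b)" by (simp add: exp_add[symmetric])
  qed
  also have "(\<Sum>b\<in>B. exp ?m * (1 + (x b - ?m))) = exp ?m * card B"
    using N by (simp add: sum_distrib_left[symmetric] sum.distrib sum_subtractf)
  finally show ?thesis using N by (simp add: field_simps)
qed

lemma blk_component:
  assumes "t \<in> {..<n}"
  shows "(\<lambda>y. y t) \<in> blk n \<rightarrow>\<^sub>M borel"
proof -
  have "(\<lambda>x. x t) \<in> blk n \<rightarrow>\<^sub>M lborel" unfolding blk_def using assms by (intro measurable_component_singleton)
  then show ?thesis by simp
qed

locale wiretap_ensemble =
  fixes K :: nat and h :: "nat \<Rightarrow> nat \<Rightarrow> real" and g :: "nat \<Rightarrow> real"
    and p :: "nat \<Rightarrow> nat pmf" and \<kappa>0 :: "nat \<Rightarrow> nat \<Rightarrow> real measure"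
    and n n1 :: nat and Mn Ln :: "nat \<Rightarrow> nat"
  assumes fin_p: "\<And>i. finite (set_pmf (p i))"
    and prob0: "\<And>k v. prob_space (\<kappa>0 k v)" and sets0: "\<And>k v. sets (\<kappa>0 k v) = sets borel"
    and n1: "n1 \<le> n" and Mn0: "\<And>k. 0 < Mn k" and Ln0: "\<And>k. 0 < Ln k"
begin

text \<open>Sending 0 after the first \<open>n1\<close> letters leaves slack in the power budget: for \<open>0 < P\<close> the power
  constraint can fail only if the random codebook exceeds its mean power by a constant factor.\<close>

definition "\<kappa> k t v = (if t < n1 then \<kappa>0 k v else return borel 0)"
definition "q i = Pi_pmf {..<n} undefined (\<lambda>_. p i)"
definition "V = Pi_pmf {1..K} undefined p"
definition "letter_density j v = channel_density {1..K} (\<lambda>k. gain h g k j) (\<lambda>k. \<kappa>0 k (v k))"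

abbreviation "E P F \<equiv> measure_pmf.expectation P (F :: _ \<Rightarrow> real)"

lemma fin_q: "finite (set_pmf (q i))"
  unfolding q_def by (intro finite_set_Pi_pmf fin_p) auto

sublocale rc: random_code "{1..K}" q Mn Ln
  by (rule random_code.intro) (auto simp: fin_q Mn0 Ln0)

sublocale gc: gaussian_code K h g n Mn Ln \<kappa> C for C
proof (rule gaussian_code.intro)
  show "prob_space (\<kappa> k t v)" for k t v by (simp add: \<kappa>_def prob0 prob_space_return)
  show "sets (\<kappa> k t v) = sets borel" for k t v by (simp add: \<kappa>_def sets0)
qed (rule Mn0 Ln0)+

abbreviation "ft \<equiv> gaussian_code.f K h g \<kappa>"
abbreviation "Wn \<equiv> gaussian_code.W K h g n \<kappa>"

lemma fin_V [simp]: "finite (set_pmf V)"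
  unfolding V_def by (intro finite_set_Pi_pmf fin_p) auto

lemma f_active: "t < n1 \<Longrightarrow> ft j t v = letter_density j v"
  unfolding gc.f_def letter_density_def by (intro channel_density_cong) (simp add: \<kappa>_def)

text \<open>A silent letter has the same output law for every codeword. All likelihood ratios equal
  1 there, so padded positions contribute a factor 1 to every moment and only \<open>n1\<close>
  letters count.\<close>

lemma f_padded: "\<not> t < n1 \<Longrightarrow> ft j t v = ft j t v'"
  unfolding gc.f_def by (intro channel_density_cong) (simp add: \<kappa>_def)

lemma U_eq: "rc.U = Pi_pmf {1..K} undefined (\<lambda>i. Pi_pmf {..<n} undefined (\<lambda>_. p i))"
  unfolding rc.U_def q_def ..

lemma E_U_prod:
  assumes "\<And>t v. 0 \<le> G t v"
  shows "E rc.U (\<lambda>u. \<Prod>t<n. G t (\<lambda>k\<in>{1..K}. u k t)) = (\<Prod>t<n. E V (G t))"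
  unfolding U_eq V_def using assms by (intro expectation_prod_transpose) (auto simp: fin_p)

lemma W_upd:
  assumes "i \<in> {1..K}"
  shows "Wn j y (u(i := c)) = (\<Prod>t<n. ft j t ((\<lambda>k\<in>{1..K}. u k t)(i := c t)) (y t))"
  unfolding gc.W_def using assms
  by (intro prod.cong refl arg_cong2[where f = "ft j _"]) (auto simp: restrict_def fun_eq_iff)

text \<open>With \<open>err_term\<close>, the letter factor of the moments in
  \<open>rc.E_genie_leak_le\<close> and \<open>rc.E_decoding_error_le\<close>: a memoryless channel
  and independent codeword letters make these block moments products over time.\<close>

definition "leak_term j i s t y v =
  ft j t v y * (ft j t v y / E (p i) (\<lambda>c. ft j t (v(i := c)) y)) powr s"

definition "err_term i s t y v =
  ft i t v y * (E V (\<lambda>v'. ft i t v' y) / E V (\<lambda>v'. ft i t (v'(i := v i)) y)) powr s"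

lemma leak_term_nonneg: "0 \<le> leak_term j i s t y v"
  unfolding leak_term_def by (intro mult_nonneg_nonneg) (auto simp: gc.f_pos less_imp_le)

lemma err_term_nonneg: "0 \<le> err_term j s t y v"
  unfolding err_term_def by (intro mult_nonneg_nonneg) (auto simp: gc.f_pos less_imp_le)

lemma E_leak_factor:
  assumes i: "i \<in> {1..K}"
  shows "E rc.U (\<lambda>u. Wn j y u * (Wn j y u / E (q i) (\<lambda>c. Wn j y (u(i := c)))) powr s)
    = (\<Prod>t<n. E V (leak_term j i s t (y t)))"
proof -
  have Q: "E (q i) (\<lambda>c. Wn j y (u(i := c))) = (\<Prod>t<n. E (p i) (\<lambda>c. ft j t ((\<lambda>k\<in>{1..K}. u k t)(i := c)) (y t)))" for u
    unfolding W_upd[OF i] q_def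
    by (intro expectation_prod_Pi_pmf integrable_measure_pmf_finite) (auto simp: fin_p gc.f_pos less_imp_le)
  have "Wn j y u * (Wn j y u / E (q i) (\<lambda>c. Wn j y (u(i := c)))) powr s = (\<Prod>t<n. leak_term j i s t (y t) (\<lambda>k\<in>{1..K}. u k t))" for u
    unfolding Q unfolding gc.W_def leak_term_def prod_dividef[symmetric] prod_powr_distrib prod.distrib[symmetric] ..
  then show ?thesis using E_U_prod[of "\<lambda>t. leak_term j i s t (y t)"] leak_term_nonneg by simp
qed

lemma E_U_W: "E rc.U (Wn j y) = (\<Prod>t<n. E V (\<lambda>v. ft j t v (y t)))"
  using E_U_prod[of "\<lambda>t v. ft j t v (y t)"] by (simp add: gc.W_def[abs_def] gc.f_pos less_imp_le)

lemma E_U_W_upd: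
  assumes i: "i \<in> {1..K}"
  shows "E rc.U (\<lambda>u. Wn j y (u(i := c))) = (\<Prod>t<n. E V (\<lambda>v. ft j t (v(i := c t)) (y t)))"
  unfolding W_upd[OF i] using E_U_prod[of "\<lambda>t v. ft j t (v(i := c t)) (y t)"] by (simp add: gc.f_pos less_imp_le)

lemma E_err_factor:
  assumes i: "i \<in> {1..K}"
  shows "E rc.U (\<lambda>u. Wn i y u * (E rc.U (Wn i y) / E rc.U (\<lambda>u'. Wn i y (u'(i := u i)))) powr s)
    = (\<Prod>t<n. E V (err_term i s t (y t)))"
proof -
  have "Wn i y u * (E rc.U (Wn i y) / E rc.U (\<lambda>u'. Wn i y (u'(i := u i)))) powr s
      = (\<Prod>t<n. err_term i s t (y t) (\<lambda>k\<in>{1..K}. u k t))" for u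
    unfolding E_U_W E_U_W_upd[OF i] unfolding gc.W_def err_term_def prod_dividef[symmetric] prod_powr_distrib prod.distrib[symmetric]
    using i by (intro prod.cong) auto
  then show ?thesis using E_U_prod[of "\<lambda>t. err_term i s t (y t)"] err_term_nonneg by simp
qed

lemma measurable_terms [measurable]:
  "(\<lambda>y. leak_term j i s t y v) \<in> borel_measurable borel"
  "(\<lambda>y. err_term i s t y v) \<in> borel_measurable borel"
  unfolding leak_term_def err_term_def by (measurable, simp_all add: fin_p)

text \<open>Mean of the ratio f(y | v) / f(y | v without i) to the power \<open>s\<close>; the slope
  of its logarithm at \<open>s = 0\<close> is I(V i; Y j | V_{-i}) in nats. In
  \<open>err_moment\<close> the ratio is f(y) / f(y | v i), with slope - I(V i; Y i).\<close>

definition "leak_moment j i s =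
  (\<integral>\<^sup>+y. ennreal (E V (\<lambda>v. letter_density j v y * (letter_density j v y / E (p i) (\<lambda>c. letter_density j (v(i := c)) y)) powr s)) \<partial>lborel)"

definition "err_moment i s =
  (\<integral>\<^sup>+y. ennreal (E V (\<lambda>v. letter_density i v y * (E V (\<lambda>v'. letter_density i v' y) / E V (\<lambda>v'. letter_density i (v'(i := v i)) y)) powr s)) \<partial>lborel)"

lemma nn_integral_prod_blk:
  assumes "\<And>t. t < n \<Longrightarrow> (\<lambda>y. \<phi> t y) \<in> borel_measurable borel" "\<And>t y. 0 \<le> (\<phi> t y :: real)"
  shows "(\<integral>\<^sup>+y. ennreal (\<Prod>t<n. \<phi> t (y t)) \<partial>blk n) = (\<Prod>t<n. \<integral>\<^sup>+y. ennreal (\<phi> t y) \<partial>lborel)"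
proof -
  interpret L: product_sigma_finite "\<lambda>_::nat. lborel :: real measure" by standard
  have "(\<integral>\<^sup>+y. ennreal (\<Prod>t<n. \<phi> t (y t)) \<partial>blk n) = (\<integral>\<^sup>+y. (\<Prod>t<n. ennreal (\<phi> t (y t))) \<partial>PiM {..<n} (\<lambda>_. lborel))"
    unfolding blk_def using assms by (intro nn_integral_cong prod_ennreal[symmetric]) auto
  also have "\<dots> = (\<Prod>t<n. \<integral>\<^sup>+y. ennreal (\<phi> t y) \<partial>lborel)"
    using assms by (intro L.product_nn_integral_prod) auto
  finally show ?thesis .
qed

lemma prod_active_padded:
  assumes "\<And>t. t < n1 \<Longrightarrow> \<phi> t = (c :: ennreal)" "\<And>t. \<not> t < n1 \<Longrightarrow> \<phi> t = 1"
  shows "(\<Prod>t<n. \<phi> t) = c ^ n1"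
proof -
  have "(\<Prod>t<n. \<phi> t) = (\<Prod>t<n1. \<phi> t)"
    using n1 assms(2) by (intro prod.mono_neutral_right) auto
  also have "\<dots> = c ^ n1" using assms(1) by simp
  finally show ?thesis .
qed

lemma leak_integral:
  assumes i: "i \<in> {1..K}"
  shows "(\<integral>\<^sup>+y. ennreal (\<Prod>t<n. E V (leak_term j i s t (y t))) \<partial>blk n) = leak_moment j i s ^ n1"
proof -
  have "(\<integral>\<^sup>+y. ennreal (\<Prod>t<n. E V (leak_term j i s t (y t))) \<partial>blk n) = (\<Prod>t<n. \<integral>\<^sup>+y. ennreal (E V (leak_term j i s t y)) \<partial>lborel)"
    by (rule nn_integral_prod_blk) (auto intro!: Bochner_Integration.integral_nonneg leak_term_nonneg expectation_measurable measurable_terms)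
  also have "\<dots> = leak_moment j i s ^ n1"
  proof (rule prod_active_padded)
    fix t assume t: "t < n1"
    show "(\<integral>\<^sup>+y. ennreal (E V (leak_term j i s t y)) \<partial>lborel) = leak_moment j i s"
      unfolding leak_moment_def leak_term_def[abs_def] by (simp add: f_active[OF t])
  next
    fix t assume t: "\<not> t < n1"
    define \<phi> where "\<phi> = ft j t undefined"
    have eq: "ft j t v = \<phi>" for v unfolding \<phi>_def by (rule f_padded[OF t])
    have "leak_term j i s t y v = \<phi> y" for y v
      using gc.f_pos[of j t undefined y] unfolding leak_term_def eq by simp
    then have "leak_term j i s t y = (\<lambda>_. \<phi> y)" for y by (intro ext)
    then show "(\<integral>\<^sup>+y. ennreal (E V (leak_term j i s t y)) \<partial>lborel) = 1"
      using gc.nn_integral_f[of j t undefined] by (simp add: eq)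
  qed
  finally show ?thesis .
qed

lemma err_integral:
  assumes i: "i \<in> {1..K}"
  shows "(\<integral>\<^sup>+y. ennreal (\<Prod>t<n. E V (err_term i s t (y t))) \<partial>blk n) = err_moment i s ^ n1"
proof -
  have "(\<integral>\<^sup>+y. ennreal (\<Prod>t<n. E V (err_term i s t (y t))) \<partial>blk n) = (\<Prod>t<n. \<integral>\<^sup>+y. ennreal (E V (err_term i s t y)) \<partial>lborel)"
    by (rule nn_integral_prod_blk) (auto intro!: Bochner_Integration.integral_nonneg err_term_nonneg expectation_measurable measurable_terms)
  also have "\<dots> = err_moment i s ^ n1"
  proof (rule prod_active_padded)
    fix t assume t: "t < n1"
    show "(\<integral>\<^sup>+y. ennreal (E V (err_term i s t y)) \<partial>lborel) = err_moment i s"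
      unfolding err_moment_def err_term_def[abs_def] by (simp add: f_active[OF t])
  next
    fix t assume t: "\<not> t < n1"
    define \<phi> where "\<phi> = ft i t undefined"
    have eq: "ft i t v = \<phi>" for v unfolding \<phi>_def by (rule f_padded[OF t])
    have "err_term i s t y v = \<phi> y" for y v
      using gc.f_pos[of i t undefined y] unfolding err_term_def eq by simp
    then have "err_term i s t y = (\<lambda>_. \<phi> y)" for y by (intro ext)
    then show "(\<integral>\<^sup>+y. ennreal (E V (err_term i s t y)) \<partial>lborel) = 1"
      using gc.nn_integral_f[of i t undefined] by (simp add: eq)
  qed
  finally show ?thesis .
qed

lemma label_tuples_eq: "gaussian_code.label_tuples K Mn Ln = rc.A"
  unfolding gc.label_tuples_def rc.A_def gc.label_set_def rc.labels_def by (simp add: PiE_def Pi_def)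

lemma leak_eq: "gc.leak C j i y = rc.genie_leak (Wn j y) i C"
  unfolding gc.leak_def rc.genie_leak_def gc.word_def rc.word_def label_tuples_eq ..

text \<open>Tonelli exchanges the codebook average with the integral over \<open>y\<close>, so that
  soft covering applies at each fixed \<open>y\<close> and the remaining integral splits into
  letters.\<close>

lemma expected_leak:
  assumes i: "i \<in> {1..K}" and s: "0 < s" "s \<le> 1"
  shows "(\<integral>\<^sup>+C. (\<integral>\<^sup>+y. ennreal (gc.leak C j i y) \<partial>blk n) \<partial>measure_pmf rc.codebook_law)
    \<le> ennreal (real (Ln i) powr (- s) / s) * leak_moment j i s ^ n1"
proof -
  have "(\<integral>\<^sup>+C. (\<integral>\<^sup>+y. ennreal (gc.leak C j i y) \<partial>blk n) \<partial>measure_pmf rc.codebook_law)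
      = (\<integral>\<^sup>+y. (\<integral>\<^sup>+C. ennreal (gc.leak C j i y) \<partial>measure_pmf rc.codebook_law) \<partial>blk n)"
    by (intro nn_integral_pmf_swap rc.finite_codebook_law measurable_compose[OF gc.leak_measurable measurable_ennreal])
  also have "\<dots> \<le> (\<integral>\<^sup>+y. ennreal (real (Ln i) powr (- s) / s) * ennreal (\<Prod>t<n. E V (leak_term j i s t (y t))) \<partial>blk n)"
  proof (intro nn_integral_mono)
    fix y
    have "(\<integral>\<^sup>+C. ennreal (gc.leak C j i y) \<partial>measure_pmf rc.codebook_law) = ennreal (E rc.codebook_law (rc.genie_leak (Wn j y) i))"
      unfolding leak_eq using gc.W_pos by (intro nn_integral_pmf_eq_expectation rc.finite_codebook_law rc.genie_leak_nonneg i) auto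
    also have "\<dots> \<le> ennreal (real (Ln i) powr (- s) / s * (\<Prod>t<n. E V (leak_term j i s t (y t))))"
      unfolding E_leak_factor[OF i, symmetric] using gc.W_pos by (intro ennreal_leI rc.E_genie_leak_le i s)
    also have "\<dots> = ennreal (real (Ln i) powr (- s) / s) * ennreal (\<Prod>t<n. E V (leak_term j i s t (y t)))"
      using s by (intro ennreal_mult prod_nonneg) (auto intro!: Bochner_Integration.integral_nonneg leak_term_nonneg)
    finally show "(\<integral>\<^sup>+C. ennreal (gc.leak C j i y) \<partial>measure_pmf rc.codebook_law)
      \<le> ennreal (real (Ln i) powr (- s) / s) * ennreal (\<Prod>t<n. E V (leak_term j i s t (y t)))" .
  qed
  also have "\<dots> = ennreal (real (Ln i) powr (- s) / s) * (\<integral>\<^sup>+y. ennreal (\<Prod>t<n. E V (leak_term j i s t (y t))) \<partial>blk n)"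
  proof (rule nn_integral_cmult)
    have "(\<lambda>y. E V (leak_term j i s t (y t))) \<in> borel_measurable (blk n)" if t: "t \<in> {..<n}" for t
      by (intro expectation_measurable fin_V measurable_compose[OF blk_component[OF t] measurable_terms(1)])
    then show "(\<lambda>y. ennreal (\<Prod>t<n. E V (leak_term j i s t (y t)))) \<in> borel_measurable (blk n)"
      by (intro measurable_compose[OF _ measurable_ennreal] borel_measurable_prod)
  qed
  finally show ?thesis unfolding leak_integral[OF i] .
qed

text \<open>Information density test: codeword \<open>c\<close> passes if f(y | c) exceeds \<tau>
  times f(y), both taken with random codewords of the other users.\<close>

definition "decoder \<tau> C i y = rc.threshold_decoder (\<lambda>c. E rc.U (\<lambda>u. Wn i y (u(i := c)))) (\<tau> * E rc.U (Wn i y)) i C"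

lemma decoder_measurable: "decoder \<tau> C i \<in> blk n \<rightarrow>\<^sub>M count_space UNIV"
proof -
  have [measurable]: "(\<lambda>y. E rc.U (\<lambda>u. Wn i y (u(i := c)))) \<in> borel_measurable (blk n)" for c
    by (intro expectation_measurable rc.fin_U gc.W_measurable)
  have [measurable]: "(\<lambda>y. E rc.U (Wn i y)) \<in> borel_measurable (blk n)"
    by (intro expectation_measurable rc.fin_U gc.W_measurable)
  show ?thesis unfolding decoder_def rc.threshold_decoder_def by measurable
qed

lemma expected_error:
  assumes i: "i \<in> {1..K}" and s: "0 < s" and \<tau>: "0 < \<tau>"
  shows "(\<integral>\<^sup>+C. emeasure (gc.\<Omega> C) {\<omega> \<in> space (gc.\<Omega> C). decoder \<tau> C i (cY h g K n i \<omega>) \<noteq> cW i \<omega>} \<partial>measure_pmf rc.codebook_law)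
    \<le> ennreal (\<tau> powr s) * err_moment i s ^ n1 + ennreal (real (Mn i * Ln i) / \<tau>)"
proof -
  have eq: "emeasure (gc.\<Omega> C) {\<omega> \<in> space (gc.\<Omega> C). decoder \<tau> C i (cY h g K n i \<omega>) \<noteq> cW i \<omega>}
     = (\<integral>\<^sup>+y. ennreal (rc.decoding_error (Wn i y) \<tau> i C) \<partial>blk n)" for C
    unfolding gc.error_prob[OF i decoder_measurable] unfolding rc.decoding_error_def gc.word_def rc.word_def label_tuples_eq decoder_def ..
  have m: "(\<lambda>y. rc.decoding_error (Wn i y) \<tau> i C) \<in> borel_measurable (blk n)" for C
  proof -
    have d: "(\<lambda>y. of_bool (decoder \<tau> C i y \<noteq> w) :: real) \<in> borel_measurable (blk n)" for w
      by (rule measurable_compose[OF decoder_measurable]) simp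
    show ?thesis unfolding rc.decoding_error_def decoder_def[symmetric]
      by (intro borel_measurable_divide borel_measurable_sum borel_measurable_times gc.W_measurable d borel_measurable_const)
  qed
  have ev: "(\<lambda>y. y t) \<in> blk n \<rightarrow>\<^sub>M borel" if "t \<in> {..<n}" for t by (rule blk_component[OF that])
  have nn: "0 \<le> rc.decoding_error (Wn i y) \<tau> i C" for y C
    unfolding rc.decoding_error_def by (intro divide_nonneg_nonneg sum_nonneg mult_nonneg_nonneg) (auto simp: gc.W_pos less_imp_le)
  have Wp: "0 \<le> E rc.U (Wn i y)" for y by (intro Bochner_Integration.integral_nonneg) (simp add: gc.W_pos less_imp_le)
  have Ep: "0 \<le> (\<Prod>t<n. E V (err_term i s t (y t)))" for y
    by (intro prod_nonneg) (auto intro!: Bochner_Integration.integral_nonneg err_term_nonneg)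
  have "(\<integral>\<^sup>+C. emeasure (gc.\<Omega> C) {\<omega> \<in> space (gc.\<Omega> C). decoder \<tau> C i (cY h g K n i \<omega>) \<noteq> cW i \<omega>} \<partial>measure_pmf rc.codebook_law)
      = (\<integral>\<^sup>+y. (\<integral>\<^sup>+C. ennreal (rc.decoding_error (Wn i y) \<tau> i C) \<partial>measure_pmf rc.codebook_law) \<partial>blk n)"
    unfolding eq by (intro nn_integral_pmf_swap rc.finite_codebook_law measurable_compose[OF m measurable_ennreal])
  also have "\<dots> \<le> (\<integral>\<^sup>+y. (ennreal (\<tau> powr s) * ennreal (\<Prod>t<n. E V (err_term i s t (y t)))
      + ennreal (real (Mn i * Ln i) / \<tau>) * ennreal (E rc.U (Wn i y))) \<partial>blk n)"
  proof (intro nn_integral_mono)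
    fix y
    have "(\<integral>\<^sup>+C. ennreal (rc.decoding_error (Wn i y) \<tau> i C) \<partial>measure_pmf rc.codebook_law) = ennreal (E rc.codebook_law (rc.decoding_error (Wn i y) \<tau> i))"
      using nn by (intro nn_integral_pmf_eq_expectation rc.finite_codebook_law)
    also have "\<dots> \<le> ennreal (\<tau> powr s * (\<Prod>t<n. E V (err_term i s t (y t))) + real (Mn i * Ln i) / \<tau> * E rc.U (Wn i y))"
      unfolding E_err_factor[OF i, symmetric] using gc.W_pos by (intro ennreal_leI rc.E_decoding_error_le i s \<tau>)
    also have "\<dots> = ennreal (\<tau> powr s) * ennreal (\<Prod>t<n. E V (err_term i s t (y t)))
      + ennreal (real (Mn i * Ln i) / \<tau>) * ennreal (E rc.U (Wn i y))"
    proof -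
      have "ennreal (\<tau> powr s * (\<Prod>t<n. E V (err_term i s t (y t))) + real (Mn i * Ln i) / \<tau> * E rc.U (Wn i y))
        = ennreal (\<tau> powr s * (\<Prod>t<n. E V (err_term i s t (y t)))) + ennreal (real (Mn i * Ln i) / \<tau> * E rc.U (Wn i y))"
        using Ep[of y] Wp[of y] \<tau> by (intro ennreal_plus mult_nonneg_nonneg) auto
      then show ?thesis using Ep[of y] Wp[of y] \<tau> by (simp only: ennreal_mult ennreal_mult' powr_ge_zero divide_nonneg_pos of_nat_0_le_iff)
    qed
    finally show "(\<integral>\<^sup>+C. ennreal (rc.decoding_error (Wn i y) \<tau> i C) \<partial>measure_pmf rc.codebook_law)
      \<le> ennreal (\<tau> powr s) * ennreal (\<Prod>t<n. E V (err_term i s t (y t)))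
      + ennreal (real (Mn i * Ln i) / \<tau>) * ennreal (E rc.U (Wn i y))" .
  qed
  also have "\<dots> = ennreal (\<tau> powr s) * (\<integral>\<^sup>+y. ennreal (\<Prod>t<n. E V (err_term i s t (y t))) \<partial>blk n)
      + ennreal (real (Mn i * Ln i) / \<tau>) * (\<integral>\<^sup>+y. ennreal (E rc.U (Wn i y)) \<partial>blk n)"
  proof -
    have m1: "(\<lambda>y. ennreal (\<Prod>t<n. E V (err_term i s t (y t)))) \<in> borel_measurable (blk n)"
      by (intro measurable_compose[OF _ measurable_ennreal] borel_measurable_prod expectation_measurable fin_V
          measurable_compose[OF _ measurable_terms(2)] ev)
    have m2: "(\<lambda>y. ennreal (E rc.U (Wn i y))) \<in> borel_measurable (blk n)"
      by (intro measurable_compose[OF _ measurable_ennreal] expectation_measurable rc.fin_U gc.W_measurable)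
    show ?thesis
      unfolding nn_integral_cmult[OF m1, symmetric] nn_integral_cmult[OF m2, symmetric]
      by (intro nn_integral_add borel_measurable_times_ennreal borel_measurable_const m1 m2)
  qed
  \<comment> \<open>The output density averaged over random codewords is again a density, so the
    wrong labels contribute their number divided by \<tau>.\<close>
  also have "(\<integral>\<^sup>+y. ennreal (E rc.U (Wn i y)) \<partial>blk n) = 1"
  proof -
    have "(\<integral>\<^sup>+y. ennreal (E rc.U (Wn i y)) \<partial>blk n) = (\<integral>\<^sup>+y. (\<integral>\<^sup>+u. ennreal (Wn i y u) \<partial>measure_pmf rc.U) \<partial>blk n)"
      by (intro nn_integral_cong, rule nn_integral_pmf_eq_expectation[symmetric, OF rc.fin_U]) (rule gc.W_pos[THEN less_imp_le])
    also have "\<dots> = (\<integral>\<^sup>+u. (\<integral>\<^sup>+y. ennreal (Wn i y u) \<partial>blk n) \<partial>measure_pmf rc.U)"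
    proof (rule nn_integral_pmf_swap[symmetric, where f = "\<lambda>u y. ennreal (Wn i y u)", OF rc.fin_U])
      show "(\<lambda>y. ennreal (Wn i y u)) \<in> borel_measurable (blk n)" for u
        by (rule measurable_compose[OF gc.W_measurable measurable_ennreal])
    qed
    also have "\<dots> = 1" by (simp add: gc.nn_integral_W)
    finally show ?thesis .
  qed
  finally show ?thesis unfolding err_integral[OF i] by simp
qed

text \<open>Energy of a whole block, averaged over the labels of user \<open>i\<close>; it is to be
  compared with \<open>P * real n\<close>, not with \<open>P\<close>.\<close>

definition "avg_power pw i C = (\<Sum>b\<in>rc.labels i. \<Sum>t<n1. pw (C (i, b) t)) / real (Mn i * Ln i)"

text \<open>Chernoff bound in which Jensen moves the average over labels out of the exponential, so
  that each codeword is treated by itself. The concentration comes from the letters over time, not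
  from the number of labels.\<close>

lemma power_excess_prob:
  fixes pw :: "nat \<Rightarrow> real" and s c :: real
  assumes i: "i \<in> {1..K}" and s: "0 < s"
  shows "(\<integral>\<^sup>+C. indicator {C. c < avg_power pw i C} C \<partial>measure_pmf rc.codebook_law)
    \<le> ennreal (exp (- (s * c)) * E (p i) (\<lambda>v. exp (s * pw v)) ^ n1)"
proof -
  have B: "finite (rc.labels i)" "rc.labels i \<noteq> {}" "real (card (rc.labels i)) = real (Mn i * Ln i)"
    using Mn0[of i] Ln0[of i] by (auto simp: rc.labels_def card_cartesian_product)
  have cb: "map_pmf (\<lambda>C. C (i, b)) rc.codebook_law = q i" if "b \<in> rc.labels i" for b
    unfolding rc.codebook_law_def using i that by (subst Pi_pmf_component) auto
  have one: "E rc.codebook_law (\<lambda>C. exp (s * (\<Sum>t<n1. pw (C (i, b) t)))) = E (p i) (\<lambda>v. exp (s * pw v)) ^ n1" if b: "b \<in> rc.labels i" for b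
  proof -
    have "E rc.codebook_law (\<lambda>C. exp (s * (\<Sum>t<n1. pw (C (i, b) t)))) = E (q i) (\<lambda>c. exp (s * (\<Sum>t<n1. pw (c t))))"
      unfolding cb[OF b, symmetric] by simp
    \<comment> \<open>The factor 1 at silent positions extends the product to the full block on
      which codewords are drawn.\<close>
    also have "\<dots> = E (q i) (\<lambda>c. \<Prod>t<n. if t < n1 then exp (s * pw (c t)) else 1)"
    proof (intro Bochner_Integration.integral_cong refl)
      fix c :: "nat \<Rightarrow> nat"
      have "exp (s * (\<Sum>t<n1. pw (c t))) = (\<Prod>t<n1. exp (s * pw (c t)))" by (simp add: sum_distrib_left exp_sum)
      also have "\<dots> = (\<Prod>t<n1. if t < n1 then exp (s * pw (c t)) else 1)" by (intro prod.cong) auto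
      also have "\<dots> = (\<Prod>t<n. if t < n1 then exp (s * pw (c t)) else 1)"
        using n1 by (intro prod.mono_neutral_left) auto
      finally show "exp (s * (\<Sum>t<n1. pw (c t))) = (\<Prod>t<n. if t < n1 then exp (s * pw (c t)) else 1)" .
    qed
    also have "\<dots> = (\<Prod>t<n. E (p i) (\<lambda>v. if t < n1 then exp (s * pw v) else 1))"
      unfolding q_def by (rule expectation_prod_Pi_pmf) (auto intro!: integrable_measure_pmf_finite simp: fin_p)
    also have "\<dots> = (\<Prod>t<n1. E (p i) (\<lambda>v. if t < n1 then exp (s * pw v) else 1))"
      using n1 by (intro prod.mono_neutral_right) auto
    also have "\<dots> = E (p i) (\<lambda>v. exp (s * pw v)) ^ n1" by simp
    finally show ?thesis .
  qed
  have "(\<integral>\<^sup>+C. indicator {C. c < avg_power pw i C} C \<partial>measure_pmf rc.codebook_law)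
      \<le> (\<integral>\<^sup>+C. ennreal (exp (- (s * c)) * ((\<Sum>b\<in>rc.labels i. exp (s * (\<Sum>t<n1. pw (C (i, b) t)))) / card (rc.labels i))) \<partial>measure_pmf rc.codebook_law)"
  proof (intro nn_integral_mono)
    fix C
    have le: "exp (s * avg_power pw i C) \<le> (\<Sum>b\<in>rc.labels i. exp (s * (\<Sum>t<n1. pw (C (i, b) t)))) / card (rc.labels i)"
      using exp_average_le[OF B(1,2), of "\<lambda>b. s * (\<Sum>t<n1. pw (C (i, b) t))"]
      unfolding avg_power_def B(3)[symmetric] by (simp add: sum_distrib_left[symmetric])
    have "1 \<le> exp (- (s * c)) * ((\<Sum>b\<in>rc.labels i. exp (s * (\<Sum>t<n1. pw (C (i, b) t)))) / card (rc.labels i))" if "c < avg_power pw i C"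
    proof -
      have "1 \<le> exp (s * avg_power pw i C - s * c)" using that s by simp
      also have "\<dots> = exp (- (s * c)) * exp (s * avg_power pw i C)" by (simp add: exp_add[symmetric])
      also have "\<dots> \<le> exp (- (s * c)) * ((\<Sum>b\<in>rc.labels i. exp (s * (\<Sum>t<n1. pw (C (i, b) t)))) / card (rc.labels i))"
        using le by (intro mult_left_mono) auto
      finally show ?thesis .
    qed
    then show "indicator {C. c < avg_power pw i C} C \<le> ennreal (exp (- (s * c)) * ((\<Sum>b\<in>rc.labels i. exp (s * (\<Sum>t<n1. pw (C (i, b) t)))) / card (rc.labels i)))"
      by (auto simp: indicator_def simp del: of_nat_mult intro: ennreal_leI[of 1, simplified])
  qed
  also have "\<dots> = ennreal (E rc.codebook_law (\<lambda>C. exp (- (s * c)) * ((\<Sum>b\<in>rc.labels i. exp (s * (\<Sum>t<n1. pw (C (i, b) t)))) / card (rc.labels i))))"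
    by (intro nn_integral_pmf_eq_expectation rc.finite_codebook_law) (auto intro!: mult_nonneg_nonneg divide_nonneg_nonneg sum_nonneg)
  also have "E rc.codebook_law (\<lambda>C. exp (- (s * c)) * ((\<Sum>b\<in>rc.labels i. exp (s * (\<Sum>t<n1. pw (C (i, b) t)))) / card (rc.labels i)))
      = exp (- (s * c)) * ((\<Sum>b\<in>rc.labels i. E rc.codebook_law (\<lambda>C. exp (s * (\<Sum>t<n1. pw (C (i, b) t))))) / card (rc.labels i))"
    by (simp only: integral_mult_right_zero integral_divide_zero Bochner_Integration.integral_sum[OF rc.integrable_codebook_law])
  also have "\<dots> = exp (- (s * c)) * E (p i) (\<lambda>v. exp (s * pw v)) ^ n1"
  proof -
    have "(\<Sum>b\<in>rc.labels i. E rc.codebook_law (\<lambda>C. exp (s * (\<Sum>t<n1. pw (C (i, b) t)))))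
        = (\<Sum>b\<in>rc.labels i. E (p i) (\<lambda>v. exp (s * pw v)) ^ n1)"
      by (intro sum.cong refl one)
    then show ?thesis using B(1,2) by (simp only:) (simp add: card_gt_0_iff)
  qed
  finally show ?thesis .
qed

end

section \<open>Single-letter information quantities\<close>

lemma nn_integral_Pi_pmf_resample:
  assumes I: "finite I" "i \<in> I" and fin: "finite (set_pmf (p i))"
  shows "(\<integral>\<^sup>+v. F v \<partial>measure_pmf (Pi_pmf I d p))
    = (\<integral>\<^sup>+v. \<integral>\<^sup>+c. F (v(i := c)) \<partial>measure_pmf (p i) \<partial>measure_pmf (Pi_pmf I d p))"
proof -
  let ?R = "Pi_pmf (I - {i}) d p"
  have eq: "Pi_pmf I d p = map_pmf (\<lambda>(y, f). f(i := y)) (pair_pmf (p i) ?R)"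
    using I Pi_pmf_insert[of "I - {i}" i d p] by (simp add: insert_absorb)
  have "(\<integral>\<^sup>+v. \<integral>\<^sup>+c. F (v(i := c)) \<partial>measure_pmf (p i) \<partial>measure_pmf (Pi_pmf I d p))
      = (\<integral>\<^sup>+y. \<integral>\<^sup>+v. \<integral>\<^sup>+c. F (v(i := c)) \<partial>measure_pmf (p i) \<partial>measure_pmf ?R \<partial>measure_pmf (p i))"
    by (simp add: eq nn_integral_pair_pmf' case_prod_unfold)
  also have "\<dots> = (\<integral>\<^sup>+v. \<integral>\<^sup>+c. F (v(i := c)) \<partial>measure_pmf (p i) \<partial>measure_pmf ?R)"
    by simp
  also have "\<dots> = (\<integral>\<^sup>+c. \<integral>\<^sup>+v. F (v(i := c)) \<partial>measure_pmf ?R \<partial>measure_pmf (p i))"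
    by (rule nn_integral_pmf_swap[symmetric, OF fin]) simp
  also have "\<dots> = (\<integral>\<^sup>+v. F v \<partial>measure_pmf (Pi_pmf I d p))"
    by (simp add: eq nn_integral_pair_pmf' case_prod_unfold)
  finally show ?thesis ..
qed

text \<open>\<open>ratio\<close> says that \<open>r\<close> is the density of the joint law relative
  to the product of the marginals, \<omega> and \<omega>' being two independent copies. Mutual
  information is then the mean of \<open>log b r\<close> under the joint law, and the marginals
  never have to be computed.\<close>

lemma (in prob_space) mutual_information_ratio:
  assumes b: "1 < b" and A[measurable]: "A \<in> M \<rightarrow>\<^sub>M S" and B[measurable]: "B \<in> M \<rightarrow>\<^sub>M T"
    and r[measurable]: "r \<in> borel_measurable (S \<Otimes>\<^sub>M T)" and nn: "\<And>z. 0 \<le> r z"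
    and ratio: "\<And>F. F \<in> borel_measurable (S \<Otimes>\<^sub>M T) \<Longrightarrow>
      (\<integral>\<^sup>+\<omega>. F (A \<omega>, B \<omega>) \<partial>M) = (\<integral>\<^sup>+\<omega>. \<integral>\<^sup>+\<omega>'. F (A \<omega>, B \<omega>') * ennreal (r (A \<omega>, B \<omega>')) \<partial>M \<partial>M)"
  shows "mutual_information b S T A B = (\<integral>\<omega>. log b (r (A \<omega>, B \<omega>)) \<partial>M)"
proof -
  let ?P = "distr M S A \<Otimes>\<^sub>M distr M T B" and ?J = "distr M (S \<Otimes>\<^sub>M T) (\<lambda>\<omega>. (A \<omega>, B \<omega>))"
  interpret PA: prob_space "distr M S A" by (rule prob_space_distr) simp
  interpret PB: prob_space "distr M T B" by (rule prob_space_distr) simp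
  interpret PAB: pair_prob_space "distr M S A" "distr M T B" ..
  have sP[measurable_cong]: "sets ?P = sets (S \<Otimes>\<^sub>M T)" by (intro sets_pair_measure_cong) auto
  have J: "?J = density ?P (\<lambda>z. ennreal (r z))"
  proof (rule measure_eqI)
    show "sets ?J = sets (density ?P (\<lambda>z. ennreal (r z)))" by (simp add: sP)
    fix Z assume "Z \<in> sets ?J"
    then have Z[measurable]: "Z \<in> sets (S \<Otimes>\<^sub>M T)" by simp
    have "emeasure ?J Z = (\<integral>\<^sup>+\<omega>. indicator Z (A \<omega>, B \<omega>) \<partial>M)"
      by (subst nn_integral_distr[of "\<lambda>\<omega>. (A \<omega>, B \<omega>)" M "S \<Otimes>\<^sub>M T" "indicator Z", symmetric]) auto
    also have "\<dots> = (\<integral>\<^sup>+\<omega>. \<integral>\<^sup>+\<omega>'. indicator Z (A \<omega>, B \<omega>') * ennreal (r (A \<omega>, B \<omega>')) \<partial>M \<partial>M)"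
      by (rule ratio) simp
    also have "\<dots> = (\<integral>\<^sup>+\<omega>. \<integral>\<^sup>+y. indicator Z (A \<omega>, y) * ennreal (r (A \<omega>, y)) \<partial>distr M T B \<partial>M)"
    proof (intro nn_integral_cong)
      fix \<omega> assume \<omega>: "\<omega> \<in> space M"
      have [measurable]: "(\<lambda>y. (A \<omega>, y)) \<in> T \<rightarrow>\<^sub>M S \<Otimes>\<^sub>M T"
        using measurable_space[OF A \<omega>] by (rule measurable_Pair1')
      show "(\<integral>\<^sup>+\<omega>'. indicator Z (A \<omega>, B \<omega>') * ennreal (r (A \<omega>, B \<omega>')) \<partial>M)
        = (\<integral>\<^sup>+y. indicator Z (A \<omega>, y) * ennreal (r (A \<omega>, y)) \<partial>distr M T B)"
        by (subst nn_integral_distr) auto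
    qed
    also have "\<dots> = (\<integral>\<^sup>+x. \<integral>\<^sup>+y. indicator Z (x, y) * ennreal (r (x, y)) \<partial>distr M T B \<partial>distr M S A)"
    proof -
      have "(\<lambda>(x, y). indicator Z (x, y) * ennreal (r (x, y))) \<in> borel_measurable (S \<Otimes>\<^sub>M distr M T B)"
        by measurable
      from PB.borel_measurable_nn_integral[OF this] show ?thesis
        by (subst nn_integral_distr) auto
    qed
    also have "\<dots> = (\<integral>\<^sup>+z. indicator Z z * ennreal (r z) \<partial>?P)"
      by (rule PB.nn_integral_fst) measurable
    also have "\<dots> = emeasure (density ?P (\<lambda>z. ennreal (r z))) Z"
      by (subst emeasure_density) (auto simp: sP mult.commute)
    finally show "emeasure ?J Z = emeasure (density ?P (\<lambda>z. ennreal (r z))) Z" .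
  qed
  have rP: "r \<in> borel_measurable ?P" by measurable
  have "mutual_information b S T A B = KL_divergence b ?P (density ?P (\<lambda>z. ennreal (r z)))"
    unfolding mutual_information_def J ..
  also have "\<dots> = (\<integral>z. r z * log b (r z) \<partial>?P)"
    by (rule PAB.KL_density[OF b rP]) (simp add: nn)
  also have "\<dots> = (\<integral>z. log b (r z) \<partial>density ?P (\<lambda>z. ennreal (r z)))"
    by (subst integral_density) (auto simp: nn)
  also have "\<dots> = (\<integral>z. log b (r z) \<partial>?J)" unfolding J ..
  also have "\<dots> = (\<integral>\<omega>. log b (r (A \<omega>, B \<omega>)) \<partial>M)"
    by (rule integral_distr) auto
  finally show ?thesis .
qed

text \<open>\<open>V\<close> takes finitely many values, so elementary conditioning on the values of
  positive probability yields the kernel.\<close>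

lemma (in prob_space) disintegration:
  fixes V :: "'a \<Rightarrow> nat" and X :: "'a \<Rightarrow> real"
  assumes V[measurable]: "V \<in> M \<rightarrow>\<^sub>M count_space UNIV" and fin: "finite (V ` space M)"
    and X[measurable]: "X \<in> borel_measurable M"
  obtains p :: "nat pmf" and \<kappa> :: "nat \<Rightarrow> real measure"
  where "finite (set_pmf p)" "\<And>v. prob_space (\<kappa> v)" "\<And>v. sets (\<kappa> v) = sets borel"
    "\<And>F. F \<in> borel_measurable (count_space UNIV \<Otimes>\<^sub>M borel) \<Longrightarrow>
      (\<integral>\<^sup>+\<omega>. F (V \<omega>, X \<omega>) \<partial>M) = (\<Sum>v\<in>set_pmf p. ennreal (pmf p v) * (\<integral>\<^sup>+x. F (v, x) \<partial>\<kappa> v))"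
proof -
  define Ev where "Ev v = {\<omega> \<in> space M. V \<omega> = v}" for v
  have Ev[measurable]: "Ev v \<in> sets M" for v unfolding Ev_def by measurable
  define p where "p = embed_pmf (\<lambda>v. prob (Ev v))"
  have pmf_p: "pmf p v = prob (Ev v)" for v
    unfolding p_def
  proof (rule pmf_embed_pmf)
    let ?D = "distr M (count_space UNIV) V"
    interpret D: prob_space ?D by (rule prob_space_distr) simp
    have "(\<integral>\<^sup>+v. ennreal (prob (Ev v)) \<partial>count_space UNIV) = (\<integral>\<^sup>+v. emeasure ?D {v} \<partial>count_space UNIV)"
    proof (intro nn_integral_cong)
      fix v
      have "V -` {v} \<inter> space M = Ev v" by (auto simp: Ev_def)
      then show "ennreal (prob (Ev v)) = emeasure ?D {v}" by (simp add: emeasure_distr emeasure_eq_measure)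
    qed
    also have "\<dots> = emeasure ?D UNIV" by (rule emeasure_countable_singleton[symmetric]) auto
    finally show "(\<integral>\<^sup>+v. ennreal (prob (Ev v)) \<partial>count_space UNIV) = 1" using D.emeasure_space_1 by simp
  qed simp
  have set_p: "set_pmf p = {v. prob (Ev v) \<noteq> 0}" by (auto simp: set_pmf_iff pmf_p)
  have sub: "set_pmf p \<subseteq> V ` space M"
  proof
    fix v assume v: "v \<in> set_pmf p"
    show "v \<in> V ` space M"
    proof (rule ccontr)
      assume "v \<notin> V ` space M"
      then have "Ev v = {}" by (auto simp: Ev_def)
      then show False using v by (simp add: set_p)
    qed
  qed
  \<comment> \<open>Values of probability 0 get the point mass at 0, so that the kernel consists of
    probability measures throughout.\<close>
  define \<kappa> where "\<kappa> v = (if v \<in> set_pmf p then distr (uniform_measure M (Ev v)) borel X else return borel 0)" for v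
  show ?thesis
  proof (rule that[of p \<kappa>])
    show "finite (set_pmf p)" using finite_subset[OF sub fin] .
    show "prob_space (\<kappa> v)" for v
    proof (cases "v \<in> set_pmf p")
      case True
      then have "emeasure M (Ev v) \<noteq> 0" by (simp add: set_p emeasure_eq_measure)
      then have "prob_space (uniform_measure M (Ev v))" by (intro prob_space_uniform_measure) auto
      then show ?thesis using True by (simp add: \<kappa>_def prob_space.prob_space_distr)
    qed (simp add: \<kappa>_def prob_space_return)
    show "sets (\<kappa> v) = sets borel" for v by (simp add: \<kappa>_def)
    fix F :: "nat \<times> real \<Rightarrow> ennreal" assume F[measurable]: "F \<in> borel_measurable (count_space UNIV \<Otimes>\<^sub>M borel)"
    have "(\<integral>\<^sup>+\<omega>. F (V \<omega>, X \<omega>) \<partial>M) = (\<integral>\<^sup>+\<omega>. (\<Sum>v\<in>V ` space M. F (v, X \<omega>) * indicator (Ev v) \<omega>) \<partial>M)"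
    proof (intro nn_integral_cong)
      fix \<omega> assume \<omega>: "\<omega> \<in> space M"
      have "(\<Sum>v\<in>V ` space M. F (v, X \<omega>) * indicator (Ev v) \<omega>) = (\<Sum>v\<in>{V \<omega>}. F (v, X \<omega>) * indicator (Ev v) \<omega>)"
        using fin \<omega> by (intro sum.mono_neutral_right) (auto simp: Ev_def)
      then show "F (V \<omega>, X \<omega>) = (\<Sum>v\<in>V ` space M. F (v, X \<omega>) * indicator (Ev v) \<omega>)"
        using \<omega> by (simp add: Ev_def)
    qed
    also have "\<dots> = (\<Sum>v\<in>V ` space M. \<integral>\<^sup>+\<omega>. F (v, X \<omega>) * indicator (Ev v) \<omega> \<partial>M)"
      by (rule nn_integral_sum) measurable
    also have "\<dots> = (\<Sum>v\<in>set_pmf p. \<integral>\<^sup>+\<omega>. F (v, X \<omega>) * indicator (Ev v) \<omega> \<partial>M)"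
    proof (rule sum.mono_neutral_right[OF fin sub], safe)
      fix \<omega> assume "V \<omega> \<notin> set_pmf p"
      then have "Ev (V \<omega>) \<in> null_sets M" by (auto simp: set_p null_sets_def emeasure_eq_measure)
      then show "(\<integral>\<^sup>+x. F (V \<omega>, X x) * indicator (Ev (V \<omega>)) x \<partial>M) = 0" by (rule nn_integral_null_set)
    qed
    also have "\<dots> = (\<Sum>v\<in>set_pmf p. ennreal (pmf p v) * (\<integral>\<^sup>+x. F (v, x) \<partial>\<kappa> v))"
    proof (intro sum.cong refl)
      fix v assume v: "v \<in> set_pmf p"
      then have pos: "0 < prob (Ev v)" by (simp add: set_p less_le)
      have "(\<integral>\<^sup>+x. F (v, x) \<partial>\<kappa> v) = (\<integral>\<^sup>+\<omega>. F (v, X \<omega>) \<partial>uniform_measure M (Ev v))"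
        using v by (simp add: \<kappa>_def nn_integral_distr)
      also have "\<dots> = (\<integral>\<^sup>+\<omega>. F (v, X \<omega>) * indicator (Ev v) \<omega> \<partial>M) / ennreal (prob (Ev v))"
        by (subst nn_integral_uniform_measure) (auto simp: emeasure_eq_measure)
      finally have "ennreal (pmf p v) * (\<integral>\<^sup>+x. F (v, x) \<partial>\<kappa> v)
        = ennreal (prob (Ev v)) * ((\<integral>\<^sup>+\<omega>. F (v, X \<omega>) * indicator (Ev v) \<omega> \<partial>M) / ennreal (prob (Ev v)))"
        by (simp add: pmf_p)
      also have "\<dots> = (\<integral>\<^sup>+\<omega>. F (v, X \<omega>) * indicator (Ev v) \<omega> \<partial>M)"
        using pos by (subst ennreal_times_divide, subst mult.commute, intro mult_divide_eq_ennreal) auto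
      finally show "(\<integral>\<^sup>+\<omega>. F (v, X \<omega>) * indicator (Ev v) \<omega> \<partial>M) = ennreal (pmf p v) * (\<integral>\<^sup>+x. F (v, x) \<partial>\<kappa> v)" ..
    qed
    finally show "(\<integral>\<^sup>+\<omega>. F (V \<omega>, X \<omega>) \<partial>M) = (\<Sum>v\<in>set_pmf p. ennreal (pmf p v) * (\<integral>\<^sup>+x. F (v, x) \<partial>\<kappa> v))" .
  qed
qed

lemma nn_integral_Pi_pmf_sum:
  assumes "finite I" "\<And>i. i \<in> I \<Longrightarrow> finite (set_pmf (p i))"
  shows "(\<integral>\<^sup>+v. F v \<partial>measure_pmf (Pi_pmf I undefined p))
    = (\<Sum>v\<in>PiE I (\<lambda>i. set_pmf (p i)). (\<Prod>i\<in>I. ennreal (pmf (p i) (v i))) * F v)"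
proof -
  have "(\<integral>\<^sup>+v. F v \<partial>measure_pmf (Pi_pmf I undefined p))
      = (\<Sum>v\<in>PiE I (\<lambda>i. set_pmf (p i)). F v * ennreal (pmf (Pi_pmf I undefined p) v))"
    using assms
    by (intro nn_integral_measure_pmf_support finite_PiE)
      (auto simp: set_Pi_pmf PiE_dflt_def PiE_def extensional_def)
  also have "\<dots> = (\<Sum>v\<in>PiE I (\<lambda>i. set_pmf (p i)). (\<Prod>i\<in>I. ennreal (pmf (p i) (v i))) * F v)"
  proof (intro sum.cong refl)
    fix v assume "v \<in> PiE I (\<lambda>i. set_pmf (p i))"
    then have "pmf (Pi_pmf I undefined p) v = (\<Prod>i\<in>I. pmf (p i) (v i))"
      using assms by (intro pmf_Pi') (auto simp: PiE_def extensional_def)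
    then show "F v * ennreal (pmf (Pi_pmf I undefined p) v) = (\<Prod>i\<in>I. ennreal (pmf (p i) (v i))) * F v"
      by (simp add: prod_ennreal mult.commute)
  qed
  finally show ?thesis .
qed

text \<open>Independence makes the joint law of the input pairs and the noises a product.
  Conditioning on the auxiliary letters and averaging out prefix channels and noise leaves the
  output density. This ties the given random variables to the densities that govern the
  codebooks.\<close>

lemma (in prob_space) gaussian_network_law:
  fixes V :: "nat \<Rightarrow> 'a \<Rightarrow> nat" and X N :: "nat \<Rightarrow> 'a \<Rightarrow> real" and p :: "nat \<Rightarrow> nat pmf"
    and \<kappa> :: "nat \<Rightarrow> nat \<Rightarrow> real measure" and c :: "nat \<Rightarrow> real"
  assumes K: "0 < K"
    and V_rv: "\<And>i. i \<in> {1..K} \<Longrightarrow> V i \<in> M \<rightarrow>\<^sub>M count_space UNIV"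
    and X_rv: "\<And>i. i \<in> {1..K} \<Longrightarrow> X i \<in> borel_measurable M"
    and pairs_indep: "indep_vars (\<lambda>_. count_space UNIV \<Otimes>\<^sub>M borel) (\<lambda>i \<omega>. (V i \<omega>, X i \<omega>)) {1..K}"
    and noise_gauss: "\<And>j. j \<in> {0..K} \<Longrightarrow> distributed M lborel (N j) std_normal_density"
    and noise_indep: "indep_vars (\<lambda>_. borel) N {0..K}"
    and noise_indep_inputs: "indep_set
          {(\<lambda>\<omega>. \<lambda>i\<in>{1..K}. (V i \<omega>, X i \<omega>)) -` A \<inter> space M | A.
             A \<in> sets (PiM {1..K} (\<lambda>_. count_space UNIV \<Otimes>\<^sub>M borel))}
          {(\<lambda>\<omega>. \<lambda>j\<in>{0..K}. N j \<omega>) -` B \<inter> space M | B.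
             B \<in> sets (PiM {0..K} (\<lambda>_. borel))}"
    and fin_p: "\<And>i. finite (set_pmf (p i))"
    and kappa: "\<And>i v. prob_space (\<kappa> i v)" "\<And>i v. sets (\<kappa> i v) = sets borel"
    and dis: "\<And>i F. i \<in> {1..K} \<Longrightarrow> F \<in> borel_measurable (count_space UNIV \<Otimes>\<^sub>M borel) \<Longrightarrow>
      (\<integral>\<^sup>+\<omega>. F (V i \<omega>, X i \<omega>) \<partial>M) = (\<Sum>v\<in>set_pmf (p i). ennreal (pmf (p i) v) * (\<integral>\<^sup>+x. F (v, x) \<partial>\<kappa> i v))"
    and j: "j \<in> {0..K}"
    and G: "case_prod G \<in> borel_measurable (PiM {1..K} (\<lambda>_. count_space UNIV) \<Otimes>\<^sub>M borel)"
  shows "(\<integral>\<^sup>+\<omega>. G (\<lambda>k\<in>{1..K}. V k \<omega>) ((\<Sum>k\<in>{1..K}. c k * X k \<omega>) + N j \<omega>) \<partial>M)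
    = (\<integral>\<^sup>+v. \<integral>\<^sup>+y. G v y * ennreal (channel_density {1..K} c (\<lambda>k. \<kappa> k (v k)) y) \<partial>lborel
        \<partial>measure_pmf (Pi_pmf {1..K} undefined p))"
proof -
  let ?codebook_law = "count_space (UNIV :: nat set) \<Otimes>\<^sub>M (borel :: real measure)"
  let ?PA = "PiM {1..K} (\<lambda>_. ?codebook_law)" and ?PB = "PiM {0..K} (\<lambda>_. borel :: real measure)"
  let ?A = "\<lambda>\<omega>. \<lambda>i\<in>{1..K}. (V i \<omega>, X i \<omega>)" and ?B = "\<lambda>\<omega>. \<lambda>j\<in>{0..K}. N j \<omega>"
  have N_rv: "N j \<in> borel_measurable M" if "j \<in> {0..K}" for j
    using distributed_measurable[OF noise_gauss[OF that]] by simp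
  have VX: "(\<lambda>\<omega>. (V i \<omega>, X i \<omega>)) \<in> M \<rightarrow>\<^sub>M ?codebook_law" if "i \<in> {1..K}" for i
    using V_rv[OF that] X_rv[OF that] by (rule measurable_Pair)
  have A: "?A \<in> M \<rightarrow>\<^sub>M ?PA" by (rule measurable_restrict) (rule VX)
  have B: "?B \<in> M \<rightarrow>\<^sub>M ?PB" by (rule measurable_restrict) (rule N_rv)
  \<comment> \<open>Outside \<open>{1..K}\<close> a point mass is filled in, because the mixture
    lemma asks for a probability measure at every index.\<close>
  define \<mu> where "\<mu> i = (if i \<in> {1..K} then distr M ?codebook_law (\<lambda>\<omega>. (V i \<omega>, X i \<omega>)) else return ?codebook_law (0, 0))" for i
  have pm: "prob_space (\<mu> i)" for i
    unfolding \<mu>_def using VX by (auto intro!: prob_space_distr prob_space_return simp: space_pair_measure)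
  have sm: "sets (\<mu> i) = sets ?codebook_law" for i by (simp add: \<mu>_def)
  have sPA: "sets (PiM {1..K} \<mu>) = sets ?PA" by (intro sets_PiM_cong refl sm)
  have dA: "distr M ?PA ?A = PiM {1..K} \<mu>"
  proof -
    have "distr M ?PA ?A = PiM {1..K} (\<lambda>i. distr M ?codebook_law (\<lambda>\<omega>. (V i \<omega>, X i \<omega>)))"
      using K pairs_indep by (subst indep_vars_iff_distr_eq_PiM'[symmetric]) (auto intro: VX)
    also have "\<dots> = PiM {1..K} \<mu>" by (intro PiM_cong) (auto simp: \<mu>_def)
    finally show ?thesis .
  qed
  have dN: "distr M borel (N j) = std_gauss" if "j \<in> {0..K}" for j
  proof -
    have "distr M borel (N j) = distr M lborel (N j)" by (intro distr_cong) auto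
    then show ?thesis using distributed_distr_eq_density[OF noise_gauss[OF that]] by (simp add: std_gauss_def)
  qed
  have dB: "distr M ?PB ?B = PiM {0..K} (\<lambda>_. std_gauss)"
  proof -
    have "distr M ?PB ?B = PiM {0..K} (\<lambda>j. distr M borel (N j))"
      using noise_indep by (subst indep_vars_iff_distr_eq_PiM'[symmetric]) (auto intro: N_rv)
    also have "\<dots> = PiM {0..K} (\<lambda>_. std_gauss)" by (intro PiM_cong) (auto simp: dN)
    finally show ?thesis .
  qed
  \<comment> \<open>The independence hypothesis on preimages is the product formula on rectangles,
    which determines a product of sigma-finite measures.\<close>
  have joint: "PiM {1..K} \<mu> \<Otimes>\<^sub>M PiM {0..K} (\<lambda>_. std_gauss) = distr M (?PA \<Otimes>\<^sub>M ?PB) (\<lambda>\<omega>. (?A \<omega>, ?B \<omega>))"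
    unfolding dA[symmetric] dB[symmetric]
  proof (rule pair_measure_eqI)
    show "sigma_finite_measure (distr M ?PA ?A)" "sigma_finite_measure (distr M ?PB ?B)"
      using A B by (auto intro!: prob_space_imp_sigma_finite prob_space_distr)
    show "sets (distr M ?PA ?A \<Otimes>\<^sub>M distr M ?PB ?B) = sets (distr M (?PA \<Otimes>\<^sub>M ?PB) (\<lambda>\<omega>. (?A \<omega>, ?B \<omega>)))"
      unfolding sets_distr by (intro sets_pair_measure_cong sets_distr)
    fix Z Z' assume "Z \<in> sets (distr M ?PA ?A)" "Z' \<in> sets (distr M ?PB ?B)"
    then have Z: "Z \<in> sets ?PA" "Z' \<in> sets ?PB" by auto
    have "prob (?A -` Z \<inter> space M \<inter> (?B -` Z' \<inter> space M)) = prob (?A -` Z \<inter> space M) * prob (?B -` Z' \<inter> space M)"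
      by (rule indep_setD[OF noise_indep_inputs]) (use Z in blast)+
    moreover have "(\<lambda>\<omega>. (?A \<omega>, ?B \<omega>)) -` (Z \<times> Z') \<inter> space M = ?A -` Z \<inter> space M \<inter> (?B -` Z' \<inter> space M)"
      by blast
    ultimately show "emeasure (distr M ?PA ?A) Z * emeasure (distr M ?PB ?B) Z' = emeasure (distr M (?PA \<Otimes>\<^sub>M ?PB) (\<lambda>\<omega>. (?A \<omega>, ?B \<omega>))) (Z \<times> Z')"
      unfolding emeasure_distr[OF A Z(1)] emeasure_distr[OF B Z(2)]
        emeasure_distr[OF measurable_Pair[OF A B] pair_measureI[OF Z]]
      by (simp only: emeasure_eq_measure ennreal_mult'[OF measure_nonneg])
  qed
  define H where "H x z = G (\<lambda>k\<in>{1..K}. fst (x k)) ((\<Sum>k\<in>{1..K}. c k * snd (x k)) + z)" for x :: "nat \<Rightarrow> nat \<times> real" and z :: real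
  have H: "case_prod H \<in> borel_measurable (?PA \<Otimes>\<^sub>M borel)"
  proof -
    have cmp: "(\<lambda>x. fst x k) \<in> ?PA \<Otimes>\<^sub>M (borel :: real measure) \<rightarrow>\<^sub>M ?codebook_law" if "k \<in> {1..K}" for k
      by (rule measurable_compose[OF measurable_fst measurable_component_singleton[OF that]])
    have 1: "(\<lambda>x. \<lambda>k\<in>{1..K}. fst (fst x k)) \<in> ?PA \<Otimes>\<^sub>M (borel :: real measure) \<rightarrow>\<^sub>M PiM {1..K} (\<lambda>_. count_space UNIV)"
      by (rule measurable_restrict) (rule measurable_compose[OF cmp measurable_fst])
    have 2: "(\<lambda>x. (\<Sum>k\<in>{1..K}. c k * snd (fst x k)) + snd x) \<in> ?PA \<Otimes>\<^sub>M (borel :: real measure) \<rightarrow>\<^sub>M borel"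
      by (intro borel_measurable_add borel_measurable_sum borel_measurable_times borel_measurable_const measurable_snd
          measurable_compose[OF cmp measurable_snd])
    show ?thesis using measurable_compose[OF measurable_Pair[OF 1 2] G] by (simp only: H_def case_prod_unfold fst_conv snd_conv)
  qed
  have sH: "sets (PiM {1..K} \<mu> \<Otimes>\<^sub>M std_gauss) = sets (?PA \<Otimes>\<^sub>M borel)"
    by (intro sets_pair_measure_cong sPA sets_std_gauss)
  interpret SG: prob_space std_gauss by (rule prob_space_std_gauss)
  interpret NB: prob_space "PiM {0..K} (\<lambda>_. std_gauss)" by (intro prob_space_PiM prob_space_std_gauss)
  have Hj: "(\<lambda>p. H (fst p) (snd p j)) \<in> borel_measurable (?PA \<Otimes>\<^sub>M ?PB)"
  proof -
    have "(\<lambda>p. (fst p, snd p j)) \<in> ?PA \<Otimes>\<^sub>M ?PB \<rightarrow>\<^sub>M ?PA \<Otimes>\<^sub>M borel"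
      by (rule measurable_Pair[OF measurable_fst measurable_compose[OF measurable_snd measurable_component_singleton[OF j]]])
    from measurable_compose[OF this H] show ?thesis by simp
  qed
  have "(\<integral>\<^sup>+\<omega>. G (\<lambda>k\<in>{1..K}. V k \<omega>) ((\<Sum>k\<in>{1..K}. c k * X k \<omega>) + N j \<omega>) \<partial>M) = (\<integral>\<^sup>+\<omega>. H (?A \<omega>) (?B \<omega> j) \<partial>M)"
    using j by (simp add: H_def cong: restrict_cong)
  also have "\<dots> = (\<integral>\<^sup>+p. H (fst p) (snd p j) \<partial>distr M (?PA \<Otimes>\<^sub>M ?PB) (\<lambda>\<omega>. (?A \<omega>, ?B \<omega>)))"
    by (subst nn_integral_distr[OF measurable_Pair[OF A B]]) (use Hj in \<open>simp_all only: fst_conv snd_conv measurable_distr_eq1\<close>)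
  also have "\<dots> = (\<integral>\<^sup>+x. \<integral>\<^sup>+z. H x (z j) \<partial>PiM {0..K} (\<lambda>_. std_gauss) \<partial>PiM {1..K} \<mu>)"
  proof -
    have sAB: "sets (PiM {1..K} \<mu> \<Otimes>\<^sub>M PiM {0..K} (\<lambda>_. std_gauss)) = sets (?PA \<Otimes>\<^sub>M ?PB)"
      by (intro sets_pair_measure_cong sPA sets_PiM_cong refl sets_std_gauss)
    have "(\<lambda>p. H (fst p) (snd p j)) \<in> borel_measurable (PiM {1..K} \<mu> \<Otimes>\<^sub>M PiM {0..K} (\<lambda>_. std_gauss))"
      unfolding measurable_cong_sets[OF sAB refl] by (rule Hj)
    from NB.nn_integral_fst[OF this] show ?thesis unfolding joint[symmetric] by simp
  qed
  also have "\<dots> = (\<integral>\<^sup>+x. \<integral>\<^sup>+z. H x z \<partial>std_gauss \<partial>PiM {1..K} \<mu>)"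
  proof (intro nn_integral_cong)
    fix x assume x: "x \<in> space (PiM {1..K} \<mu>)"
    have xs: "x \<in> space ?PA" using x sets_eq_imp_space_eq[OF sPA] by simp
    have m: "H x \<in> borel_measurable std_gauss"
      using measurable_compose[OF measurable_Pair1'[OF xs] H] by (simp add: measurable_cong_sets[OF sets_std_gauss refl])
    have "(\<integral>\<^sup>+z. H x (z j) \<partial>PiM {0..K} (\<lambda>_. std_gauss))
        = (\<integral>\<^sup>+z. H x z \<partial>distr (PiM {0..K} (\<lambda>_. std_gauss)) std_gauss (\<lambda>z. z j))"
      using j m by (subst nn_integral_distr) auto
    also have "distr (PiM {0..K} (\<lambda>_. std_gauss)) std_gauss (\<lambda>z. z j) = std_gauss"
      using j by (intro distr_PiM_component[where M = "\<lambda>_. std_gauss"] prob_space_std_gauss) auto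
    finally show "(\<integral>\<^sup>+z. H x (z j) \<partial>PiM {0..K} (\<lambda>_. std_gauss)) = (\<integral>\<^sup>+z. H x z \<partial>std_gauss)" .
  qed
  also have "\<dots> = (\<Sum>v\<in>PiE {1..K} (\<lambda>k. set_pmf (p k)). (\<Prod>k\<in>{1..K}. ennreal (pmf (p k) (v k))) *
      (\<integral>\<^sup>+\<xi>. (\<integral>\<^sup>+z. H (\<lambda>k\<in>{1..K}. (\<lambda>k v \<xi>. (v, \<xi>)) k (v k) (\<xi> k)) z \<partial>std_gauss) \<partial>PiM {1..K} (\<lambda>k. \<kappa> k (v k))))"
  proof (rule nn_integral_PiM_mixture[where c = "\<lambda>k v. ennreal (pmf (p k) v)" and \<nu> = \<kappa> and \<theta> = "\<lambda>k v \<xi>. (v, \<xi>)"])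
    fix k v assume "k \<in> {1..K}"
    show "(\<lambda>\<xi>. (v, \<xi>)) \<in> \<kappa> k v \<rightarrow>\<^sub>M \<mu> k"
      unfolding measurable_cong_sets[OF kappa(2) sm] by (rule measurable_Pair1') simp
  next
    fix k and F :: "nat \<times> real \<Rightarrow> ennreal" assume k: "k \<in> {1..K}" and F: "F \<in> borel_measurable (\<mu> k)"
    have F': "F \<in> borel_measurable ?codebook_law" using F unfolding measurable_cong_sets[OF sm refl] .
    have "(\<integral>\<^sup>+x. F x \<partial>\<mu> k) = (\<integral>\<^sup>+\<omega>. F (V k \<omega>, X k \<omega>) \<partial>M)"
      using k F' VX[OF k] by (simp add: \<mu>_def nn_integral_distr)
    also have "\<dots> = (\<Sum>v\<in>set_pmf (p k). ennreal (pmf (p k) v) * (\<integral>\<^sup>+x. F (v, x) \<partial>\<kappa> k v))"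
      by (rule dis[OF k F'])
    finally show "(\<integral>\<^sup>+x. F x \<partial>\<mu> k) = (\<Sum>v\<in>set_pmf (p k). ennreal (pmf (p k) v) * (\<integral>\<^sup>+x. F (v, x) \<partial>\<kappa> k v))" .
  next
    have "case_prod H \<in> borel_measurable (PiM {1..K} \<mu> \<Otimes>\<^sub>M std_gauss)"
      unfolding measurable_cong_sets[OF sH refl] by (rule H)
    then show "(\<lambda>x. \<integral>\<^sup>+z. H x z \<partial>std_gauss) \<in> borel_measurable (PiM {1..K} \<mu>)"
      by (rule SG.borel_measurable_nn_integral)
  qed (use pm kappa(1) fin_p in \<open>auto\<close>)
  also have "\<dots> = (\<Sum>v\<in>PiE {1..K} (\<lambda>k. set_pmf (p k)). (\<Prod>k\<in>{1..K}. ennreal (pmf (p k) (v k))) *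
      (\<integral>\<^sup>+y. G v y * ennreal (channel_density {1..K} c (\<lambda>k. \<kappa> k (v k)) y) \<partial>lborel))"
  proof (intro sum.cong refl arg_cong2[where f = "(*)"])
    fix v assume v: "v \<in> PiE {1..K} (\<lambda>k. set_pmf (p k))"
    have vs: "v \<in> space (PiM {1..K} (\<lambda>_. count_space (UNIV :: nat set)))" using v by (auto simp: space_PiM PiE_def)
    have Gv: "G v \<in> borel_measurable borel"
      using measurable_compose[OF measurable_Pair1'[OF vs] G] by simp
    interpret letter_real_inputs: real_inputs "{1..K}" "\<lambda>k. \<kappa> k (v k)"
      by (rule real_inputs.intro) (simp, rule kappa(1), rule kappa(2))
    have e1: "(\<lambda>k\<in>{1..K}. fst ((\<lambda>k\<in>{1..K}. (\<lambda>k v \<xi>. (v, \<xi>)) k (v k) (\<xi> k)) k)) = v" for \<xi> :: "nat \<Rightarrow> real"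
      using v by (auto simp: fun_eq_iff restrict_def PiE_def extensional_def)
    have e2: "(\<Sum>k\<in>{1..K}. c k * snd ((\<lambda>k\<in>{1..K}. (\<lambda>k v \<xi>. (v, \<xi>)) k (v k) (\<xi> k)) k)) = (\<Sum>k\<in>{1..K}. c k * \<xi> k)" for \<xi> :: "nat \<Rightarrow> real"
      by (intro sum.cong) auto
    show "(\<integral>\<^sup>+\<xi>. (\<integral>\<^sup>+z. H (\<lambda>k\<in>{1..K}. (\<lambda>k v \<xi>. (v, \<xi>)) k (v k) (\<xi> k)) z \<partial>std_gauss) \<partial>PiM {1..K} (\<lambda>k. \<kappa> k (v k)))
      = (\<integral>\<^sup>+y. G v y * ennreal (channel_density {1..K} c (\<lambda>k. \<kappa> k (v k)) y) \<partial>lborel)"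
      unfolding H_def e1 e2 by (rule letter_real_inputs.channel_law[OF Gv])
  qed
  also have "\<dots> = (\<integral>\<^sup>+v. \<integral>\<^sup>+y. G v y * ennreal (channel_density {1..K} c (\<lambda>k. \<kappa> k (v k)) y) \<partial>lborel
        \<partial>measure_pmf (Pi_pmf {1..K} undefined p))"
    by (rule nn_integral_Pi_pmf_sum[symmetric]) (auto simp: fin_p)
  finally show ?thesis .
qed

section \<open>Information densities of the single-letter variables\<close>

locale single_letter = prob_space M for M :: "'a measure" +
  fixes K :: nat and h :: "nat \<Rightarrow> nat \<Rightarrow> real" and g :: "nat \<Rightarrow> real"
    and p :: "nat \<Rightarrow> nat pmf" and \<kappa>0 :: "nat \<Rightarrow> nat \<Rightarrow> real measure"
    and V :: "nat \<Rightarrow> 'a \<Rightarrow> nat" and Y :: "nat \<Rightarrow> 'a \<Rightarrow> real"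
  assumes fin_p: "\<And>i. finite (set_pmf (p i))"
    and prob0: "\<And>k v. prob_space (\<kappa>0 k v)" and sets0: "\<And>k v. sets (\<kappa>0 k v) = sets borel"
    and V_rv: "\<And>i. i \<in> {1..K} \<Longrightarrow> V i \<in> M \<rightarrow>\<^sub>M count_space UNIV"
    and Y_rv: "\<And>j. j \<in> {0..K} \<Longrightarrow> Y j \<in> borel_measurable M"
    and law: "\<And>j F. j \<in> {0..K} \<Longrightarrow> case_prod F \<in> borel_measurable (PiM {1..K} (\<lambda>_. count_space UNIV) \<Otimes>\<^sub>M borel) \<Longrightarrow>
      (\<integral>\<^sup>+\<omega>. F (\<lambda>k\<in>{1..K}. V k \<omega>) (Y j \<omega>) \<partial>M)
      = (\<integral>\<^sup>+v. \<integral>\<^sup>+y. F v y * ennreal (channel_density {1..K} (\<lambda>k. gain h g k j) (\<lambda>k. \<kappa>0 k (v k)) y) \<partial>lborel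
          \<partial>measure_pmf (Pi_pmf {1..K} undefined p))"
begin

text \<open>Block length 0 and a single codeword per user: this instance provides single-letter
  quantities such as \<open>letter_density\<close>, \<open>err_moment\<close> and
  \<open>leak_moment\<close>, which do not depend on these parameters.\<close>

sublocale we: wiretap_ensemble K h g p \<kappa>0 0 0 "\<lambda>_. 1" "\<lambda>_. 1"
  by (rule wiretap_ensemble.intro) (auto simp: fin_p sets0 intro: prob0)

abbreviation "f \<equiv> wiretap_ensemble.letter_density K h g \<kappa>0"
abbreviation "input_pmf \<equiv> wiretap_ensemble.V K p"
abbreviation "E P F \<equiv> measure_pmf.expectation P (F :: _ \<Rightarrow> real)"

lemma letter_real_inputs: "real_inputs {1..K} (\<lambda>k. \<kappa>0 k (v k))"
  by (rule real_inputs.intro) (simp, rule prob0, rule sets0)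

lemma f_pos: "0 < f j v y"
  unfolding we.letter_density_def by (rule real_inputs.channel_density_pos[OF letter_real_inputs])

lemma f_measurable [measurable]: "f j v \<in> borel_measurable borel"
  unfolding we.letter_density_def by (rule real_inputs.channel_density_measurable[OF letter_real_inputs])

lemma nn_integral_f: "(\<integral>\<^sup>+y. ennreal (f j v y) \<partial>lborel) = 1"
  unfolding we.letter_density_def by (rule real_inputs.nn_integral_channel_density[OF letter_real_inputs])

lemma f_cong: "(\<And>k. k \<in> {1..K} \<Longrightarrow> v k = w k) \<Longrightarrow> f j v = f j w"
  unfolding we.letter_density_def by (intro channel_density_cong) simp

lemma finite_input_pmf: "finite (set_pmf input_pmf)"
  by (rule we.fin_V)

definition "inputs \<omega> = (\<lambda>k\<in>{1..K}. V k \<omega>)"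

text \<open>Input tuples range over a countable set, so measurability only has to be checked for one
  tuple at a time.\<close>

lemma inputs_law:
  assumes j: "j \<in> {0..K}" and F: "\<And>v. F v \<in> borel_measurable borel"
  shows "(\<integral>\<^sup>+\<omega>. F (inputs \<omega>) (Y j \<omega>) \<partial>M) = (\<integral>\<^sup>+v. \<integral>\<^sup>+y. F v y * ennreal (f j v y) \<partial>lborel \<partial>measure_pmf input_pmf)"
proof -
  have PC: "PiM {1..K} (\<lambda>_. count_space (UNIV :: nat set)) = count_space (PiE {1..K} (\<lambda>_. UNIV))"
    by (rule count_space_PiM_finite) auto
  have "case_prod F \<in> borel_measurable (PiM {1..K} (\<lambda>_. count_space UNIV) \<Otimes>\<^sub>M borel)"
    unfolding PC by (rule measurable_pair_measure_countable1) (auto intro: F countable_PiE)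
  from law[OF j this] show ?thesis unfolding inputs_def we.letter_density_def we.V_def .
qed

lemma resample_input:
  assumes "i \<in> {1..K}"
  shows "(\<integral>\<^sup>+v. F v \<partial>measure_pmf input_pmf) = (\<integral>\<^sup>+v. \<integral>\<^sup>+c. F (v(i := c)) \<partial>measure_pmf (p i) \<partial>measure_pmf input_pmf)"
  unfolding we.V_def using assms by (intro nn_integral_Pi_pmf_resample fin_p) auto

lemma swap_pmf:
  fixes F :: "'x \<Rightarrow> 'y \<Rightarrow> ennreal"
  assumes "finite (set_pmf P)"
  shows "(\<integral>\<^sup>+x. \<integral>\<^sup>+y. F x y \<partial>measure_pmf Q \<partial>measure_pmf P) = (\<integral>\<^sup>+y. \<integral>\<^sup>+x. F x y \<partial>measure_pmf P \<partial>measure_pmf Q)"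
  by (rule nn_integral_pmf_swap[OF assms]) simp

lemma nn_integral_weighted_average:
  assumes P: "finite (set_pmf P)" and F: "F \<in> borel_measurable borel"
    and \<phi>: "\<And>x. \<phi> x \<in> borel_measurable borel" and nn: "\<And>x y. 0 \<le> (\<phi> x y :: real)"
  shows "(\<integral>\<^sup>+x. \<integral>\<^sup>+y. F y * ennreal (\<phi> x y) \<partial>lborel \<partial>measure_pmf P) = (\<integral>\<^sup>+y. F y * ennreal (E P (\<lambda>x. \<phi> x y)) \<partial>lborel)"
proof -
  have m: "(\<lambda>y. F y * ennreal (\<phi> x y)) \<in> borel_measurable lborel" for x
  proof -
    note [measurable] = F \<phi>
    show ?thesis by measurable
  qed
  have "(\<integral>\<^sup>+x. \<integral>\<^sup>+y. F y * ennreal (\<phi> x y) \<partial>lborel \<partial>measure_pmf P) = (\<integral>\<^sup>+y. \<integral>\<^sup>+x. F y * ennreal (\<phi> x y) \<partial>measure_pmf P \<partial>lborel)"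
    by (rule nn_integral_pmf_swap[OF P m])
  also have "\<dots> = (\<integral>\<^sup>+y. F y * ennreal (E P (\<lambda>x. \<phi> x y)) \<partial>lborel)"
  proof (intro nn_integral_cong)
    fix y
    have "(\<integral>\<^sup>+x. F y * ennreal (\<phi> x y) \<partial>measure_pmf P) = F y * (\<integral>\<^sup>+x. ennreal (\<phi> x y) \<partial>measure_pmf P)"
      by (rule nn_integral_cmult) simp
    then show "(\<integral>\<^sup>+x. F y * ennreal (\<phi> x y) \<partial>measure_pmf P) = F y * ennreal (E P (\<lambda>x. \<phi> x y))"
      using nn_integral_pmf_eq_expectation[OF P, of "\<lambda>x. \<phi> x y"] nn by simp
  qed
  finally show ?thesis .
qed

lemma prior_law:
  assumes i: "i \<in> {1..K}"
  shows "(\<integral>\<^sup>+\<omega>. \<phi> (V i \<omega>) \<partial>M) = (\<integral>\<^sup>+c. \<phi> c \<partial>measure_pmf (p i))"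
proof -
  have "(\<integral>\<^sup>+\<omega>. \<phi> (V i \<omega>) \<partial>M) = (\<integral>\<^sup>+\<omega>. \<phi> (inputs \<omega> i) \<partial>M)" using i by (simp add: inputs_def)
  \<comment> \<open>Any receiver would do: its output density is integrated out and gives 1.\<close>
  also have "\<dots> = (\<integral>\<^sup>+v. \<integral>\<^sup>+y. \<phi> (v i) * ennreal (f 0 v y) \<partial>lborel \<partial>measure_pmf input_pmf)"
    by (rule inputs_law[where F = "\<lambda>v y. \<phi> (v i)"]) auto
  also have "\<dots> = (\<integral>\<^sup>+v. \<phi> (v i) \<partial>measure_pmf input_pmf)"
    by (simp add: nn_integral_cmult nn_integral_f)
  also have "\<dots> = (\<integral>\<^sup>+c. \<phi> c \<partial>measure_pmf (p i))"
    unfolding resample_input[OF i, of "\<lambda>v. \<phi> (v i)"] by simp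
  finally show ?thesis .
qed

lemma AE_support:
  assumes i: "i \<in> {1..K}"
  shows "AE \<omega> in M. V i \<omega> \<in> set_pmf (p i)"
proof -
  have "(\<integral>\<^sup>+\<omega>. indicator (- set_pmf (p i)) (V i \<omega>) \<partial>M) = (\<integral>\<^sup>+c. indicator (- set_pmf (p i)) c \<partial>measure_pmf (p i))"
    by (rule prior_law[OF i])
  also have "\<dots> = 0" by (subst nn_integral_0_iff_AE) (auto simp: AE_measure_pmf_iff)
  finally have "AE \<omega> in M. indicator (- set_pmf (p i)) (V i \<omega>) = (0::ennreal)"
    using measurable_compose[OF V_rv[OF i], of "indicator (- set_pmf (p i))" "borel :: ennreal measure"]
    by (subst (asm) nn_integral_0_iff_AE) auto
  then show ?thesis by eventually_elim (auto simp: indicator_def split: if_splits)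
qed

text \<open>The moment bounds for a log-likelihood ratio \<open>ln (N / D)\<close> that is bounded above because
  the prior of \<open>V i\<close> is finitely supported.\<close>

lemma likelihood_ratio_moments:
  fixes Nu De :: "'a \<Rightarrow> real"
  assumes i: "i \<in> {1..K}"
    and m: "Nu \<in> borel_measurable M" "De \<in> borel_measurable M"
    and pos: "\<And>\<omega>. 0 < Nu \<omega>" "\<And>\<omega>. 0 < De \<omega>"
    and le: "\<And>\<omega>. pmf (p i) (V i \<omega>) * Nu \<omega> \<le> De \<omega>"
    and one: "(\<integral>\<^sup>+\<omega>. ennreal (De \<omega> / Nu \<omega>) \<partial>M) = 1"
    and d: "0 < d"
  obtains s where "0 < s" "s \<le> 1"
    "(\<integral>\<^sup>+\<omega>. ennreal ((Nu \<omega> / De \<omega>) powr s) \<partial>M) \<le> ennreal (exp (s * (ln 2 * (\<integral>\<omega>. log 2 (Nu \<omega> / De \<omega>) \<partial>M) + d)))"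
    "(\<integral>\<^sup>+\<omega>. ennreal ((De \<omega> / Nu \<omega>) powr s) \<partial>M) \<le> ennreal (exp (- (s * (ln 2 * (\<integral>\<omega>. log 2 (Nu \<omega> / De \<omega>) \<partial>M) - d))))"
    "0 \<le> (\<integral>\<omega>. log 2 (Nu \<omega> / De \<omega>) \<partial>M)"
proof -
  note [measurable] = m
  let ?i = "\<lambda>\<omega>. ln (Nu \<omega> / De \<omega>)"
  let ?m = "Min (pmf (p i) ` set_pmf (p i))"
  have mpos: "0 < ?m" using fin_p[of i] by (subst Min_gr_iff) (auto simp: set_pmf_not_empty pmf_positive)
  \<comment> \<open>Almost surely the letter lies in the finite support, where its prior mass is at
    least \<open>?m\<close>; by \<open>le\<close> the denominator is then at least \<open>?m\<close>
    times the numerator.\<close>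
  have ub: "AE \<omega> in M. ?i \<omega> \<le> ln (1 / ?m)"
    using AE_support[OF i]
  proof eventually_elim
    case (elim \<omega>)
    have "?m \<le> pmf (p i) (V i \<omega>)" using elim fin_p[of i] by (intro Min_le) auto
    then have "?m * Nu \<omega> \<le> pmf (p i) (V i \<omega>) * Nu \<omega>" using pos(1)[of \<omega>] by (intro mult_right_mono) auto
    also have "\<dots> \<le> De \<omega>" by (rule le)
    finally have "Nu \<omega> / De \<omega> \<le> 1 / ?m" using mpos pos[of \<omega>] by (simp add: field_simps)
    then show ?case using pos[of \<omega>] mpos by (subst ln_le_cancel_iff) auto
  qed
  have ex: "exp (- ?i \<omega>) = De \<omega> / Nu \<omega>" for \<omega>
    using pos[of \<omega>] by (simp add: ln_div exp_diff)
  have int: "integrable M (\<lambda>\<omega>. exp (- ?i \<omega>))"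
    unfolding ex using one pos by (intro integrableI_nonneg) (auto simp: less_imp_le)
  \<comment> \<open>The inverse ratio has mean 1. Together with 1 - x \<le> exp (- x) this makes the
    mean log-likelihood ratio nonnegative.\<close>
  have E1: "expectation (\<lambda>\<omega>. exp (- ?i \<omega>)) = 1"
    using one pos unfolding ex by (subst integral_eq_nn_integral) (auto simp: less_imp_le)
  have im: "?i \<in> borel_measurable M" by measurable
  obtain s where s: "0 < s" "s \<le> 1" "integrable M ?i"
    "integrable M (\<lambda>x. exp (s * ?i x))" "expectation (\<lambda>x. exp (s * ?i x)) \<le> exp (s * (expectation ?i + d))"
    "integrable M (\<lambda>x. exp (- (s * ?i x)))" "expectation (\<lambda>x. exp (- (s * ?i x))) \<le> exp (- (s * (expectation ?i - d)))"
    using exponential_moment_near_0[OF im ub int d] by blast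
  have L: "expectation ?i = ln 2 * (\<integral>\<omega>. log 2 (Nu \<omega> / De \<omega>) \<partial>M)"
    by (simp add: log_def)
  have "expectation (\<lambda>\<omega>. 1 - ?i \<omega>) \<le> expectation (\<lambda>\<omega>. exp (- ?i \<omega>))"
    using s(3) int by (intro integral_mono) (auto intro: exp_ge_add_one_self[of "- _", simplified])
  then have "0 \<le> expectation ?i" using s(3) E1 prob_space by simp
  then have "0 \<le> (\<integral>\<omega>. log 2 (Nu \<omega> / De \<omega>) \<partial>M)" unfolding L by (simp add: zero_le_mult_iff)
  moreover have "(\<integral>\<^sup>+\<omega>. ennreal ((Nu \<omega> / De \<omega>) powr s) \<partial>M) \<le> ennreal (exp (s * (expectation ?i + d)))"
  proof -
    have "(Nu \<omega> / De \<omega>) powr s = exp (s * ?i \<omega>)" for \<omega> using pos[of \<omega>] by (simp add: powr_def)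
    then have "(\<integral>\<^sup>+\<omega>. ennreal ((Nu \<omega> / De \<omega>) powr s) \<partial>M) = ennreal (expectation (\<lambda>\<omega>. exp (s * ?i \<omega>)))"
      using nn_integral_eq_integral[OF s(4)] by simp
    then show ?thesis using s(5) by (simp add: ennreal_leI)
  qed
  moreover have "(\<integral>\<^sup>+\<omega>. ennreal ((De \<omega> / Nu \<omega>) powr s) \<partial>M) \<le> ennreal (exp (- (s * (expectation ?i - d))))"
  proof -
    have "(De \<omega> / Nu \<omega>) powr s = exp (- (s * ?i \<omega>))" for \<omega> using pos[of \<omega>] by (simp add: powr_def ln_div algebra_simps)
    then have "(\<integral>\<^sup>+\<omega>. ennreal ((De \<omega> / Nu \<omega>) powr s) \<partial>M) = ennreal (expectation (\<lambda>\<omega>. exp (- (s * ?i \<omega>))))"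
      using nn_integral_eq_integral[OF s(6)] by simp
    then show ?thesis using s(7) by (simp add: ennreal_leI)
  qed
  ultimately show ?thesis using s(1,2) unfolding L by (intro that[of s]) auto
qed

text \<open>f(y | v i = c) at receiver \<open>i\<close>, the inputs of the other users being
  averaged as noise; \<open>out_density\<close> is f(y).\<close>

definition "cond_density i c y = E input_pmf (\<lambda>v. f i (v(i := c)) y)"
definition "out_density i y = E input_pmf (\<lambda>v. f i v y)"

lemma cond_density_pos: "0 < cond_density i c y" and out_density_pos: "0 < out_density i y"
  unfolding cond_density_def out_density_def by (intro expectation_pos finite_input_pmf f_pos)+

lemma out_density_measurable [measurable]: "cond_density i c \<in> borel_measurable borel" "out_density i \<in> borel_measurable borel"
  unfolding cond_density_def[abs_def] out_density_def[abs_def] by (intro expectation_measurable finite_input_pmf f_measurable)+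

lemma input_output_law:
  assumes i: "i \<in> {1..K}" and F: "\<And>c. F c \<in> borel_measurable borel"
  shows "(\<integral>\<^sup>+\<omega>. F (V i \<omega>) (Y i \<omega>) \<partial>M) = (\<integral>\<^sup>+c. \<integral>\<^sup>+y. F c y * ennreal (cond_density i c y) \<partial>lborel \<partial>measure_pmf (p i))"
proof -
  have j: "i \<in> {0..K}" using i by auto
  have "(\<integral>\<^sup>+\<omega>. F (V i \<omega>) (Y i \<omega>) \<partial>M) = (\<integral>\<^sup>+\<omega>. F (inputs \<omega> i) (Y i \<omega>) \<partial>M)" using i by (simp add: inputs_def)
  also have "\<dots> = (\<integral>\<^sup>+v. \<integral>\<^sup>+y. F (v i) y * ennreal (f i v y) \<partial>lborel \<partial>measure_pmf input_pmf)"
    by (rule inputs_law[OF j, where F = "\<lambda>v. F (v i)"]) (rule F)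
  also have "\<dots> = (\<integral>\<^sup>+v. \<integral>\<^sup>+c. (\<integral>\<^sup>+y. F c y * ennreal (f i (v(i := c)) y) \<partial>lborel) \<partial>measure_pmf (p i) \<partial>measure_pmf input_pmf)"
    unfolding resample_input[OF i, of "\<lambda>v. \<integral>\<^sup>+y. F (v i) y * ennreal (f i v y) \<partial>lborel"] by simp
  also have "\<dots> = (\<integral>\<^sup>+c. \<integral>\<^sup>+v. (\<integral>\<^sup>+y. F c y * ennreal (f i (v(i := c)) y) \<partial>lborel) \<partial>measure_pmf input_pmf \<partial>measure_pmf (p i))"
    by (rule swap_pmf[OF finite_input_pmf])
  also have "\<dots> = (\<integral>\<^sup>+c. \<integral>\<^sup>+y. F c y * ennreal (cond_density i c y) \<partial>lborel \<partial>measure_pmf (p i))"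
    unfolding cond_density_def by (intro nn_integral_cong nn_integral_weighted_average finite_input_pmf F f_measurable f_pos[THEN less_imp_le])
  finally show ?thesis .
qed

lemma output_law:
  assumes i: "i \<in> {1..K}" and F: "F \<in> borel_measurable borel"
  shows "(\<integral>\<^sup>+\<omega>. F (Y i \<omega>) \<partial>M) = (\<integral>\<^sup>+y. F y * ennreal (out_density i y) \<partial>lborel)"
proof -
  have j: "i \<in> {0..K}" using i by auto
  have "(\<integral>\<^sup>+\<omega>. F (Y i \<omega>) \<partial>M) = (\<integral>\<^sup>+v. \<integral>\<^sup>+y. F y * ennreal (f i v y) \<partial>lborel \<partial>measure_pmf input_pmf)"
    by (rule inputs_law[OF j, where F = "\<lambda>v. F"]) (rule F)
  also have "\<dots> = (\<integral>\<^sup>+y. F y * ennreal (out_density i y) \<partial>lborel)"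
    unfolding out_density_def by (intro nn_integral_weighted_average finite_input_pmf F f_measurable f_pos[THEN less_imp_le])
  finally show ?thesis .
qed

lemma mutual_information_eq:
  assumes i: "i \<in> {1..K}"
  shows "mutual_information 2 (count_space UNIV) borel (V i) (Y i) = (\<integral>\<omega>. log 2 (cond_density i (V i \<omega>) (Y i \<omega>) / out_density i (Y i \<omega>)) \<partial>M)"
proof -
  have j: "i \<in> {0..K}" using i by auto
  have "mutual_information 2 (count_space UNIV) borel (V i) (Y i)
    = (\<integral>\<omega>. log 2 ((\<lambda>(c, y). cond_density i c y / out_density i y) (V i \<omega>, Y i \<omega>)) \<partial>M)"
  proof (rule mutual_information_ratio[OF _ V_rv[OF i] Y_rv[OF j]])
    show "(\<lambda>(c, y). cond_density i c y / out_density i y) \<in> borel_measurable (count_space UNIV \<Otimes>\<^sub>M borel)"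
      by (rule measurable_pair_measure_countable1) auto
    show "0 \<le> (\<lambda>(c, y). cond_density i c y / out_density i y) z" for z
      using cond_density_pos out_density_pos by (auto simp: case_prod_unfold less_imp_le)
    fix F :: "nat \<times> real \<Rightarrow> ennreal" assume F[measurable]: "F \<in> borel_measurable (count_space UNIV \<Otimes>\<^sub>M borel)"
    have Fc[measurable]: "(\<lambda>y. F (c, y)) \<in> borel_measurable borel" for c by measurable
    have "(\<integral>\<^sup>+\<omega>. F (V i \<omega>, Y i \<omega>) \<partial>M) = (\<integral>\<^sup>+c. \<integral>\<^sup>+y. F (c, y) * ennreal (cond_density i c y) \<partial>lborel \<partial>measure_pmf (p i))"
      by (rule input_output_law[OF i, where F = "\<lambda>c y. F (c, y)"]) (rule Fc)
    also have "\<dots> = (\<integral>\<^sup>+\<omega>. \<integral>\<^sup>+y. F (V i \<omega>, y) * ennreal (cond_density i (V i \<omega>) y) \<partial>lborel \<partial>M)"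
      by (rule prior_law[OF i, symmetric])
    also have "\<dots> = (\<integral>\<^sup>+\<omega>. \<integral>\<^sup>+\<omega>'. F (V i \<omega>, Y i \<omega>') * ennreal ((\<lambda>(c, y). cond_density i c y / out_density i y) (V i \<omega>, Y i \<omega>')) \<partial>M \<partial>M)"
    proof (intro nn_integral_cong)
      fix \<omega>
      have "(\<integral>\<^sup>+\<omega>'. F (V i \<omega>, Y i \<omega>') * ennreal (cond_density i (V i \<omega>) (Y i \<omega>') / out_density i (Y i \<omega>')) \<partial>M)
          = (\<integral>\<^sup>+y. F (V i \<omega>, y) * ennreal (cond_density i (V i \<omega>) y / out_density i y) * ennreal (out_density i y) \<partial>lborel)"
        by (rule output_law[OF i]) measurable
      also have "\<dots> = (\<integral>\<^sup>+y. F (V i \<omega>, y) * ennreal (cond_density i (V i \<omega>) y) \<partial>lborel)"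
      proof (intro nn_integral_cong)
        fix y
        have "ennreal (cond_density i (V i \<omega>) y / out_density i y) * ennreal (out_density i y) = ennreal (cond_density i (V i \<omega>) y)"
          using cond_density_pos[of i "V i \<omega>" y] out_density_pos[of i y] by (subst ennreal_mult[symmetric]) auto
        then show "F (V i \<omega>, y) * ennreal (cond_density i (V i \<omega>) y / out_density i y) * ennreal (out_density i y) = F (V i \<omega>, y) * ennreal (cond_density i (V i \<omega>) y)"
          by (simp only: mult.assoc)
      qed
      finally show "(\<integral>\<^sup>+y. F (V i \<omega>, y) * ennreal (cond_density i (V i \<omega>) y) \<partial>lborel)
        = (\<integral>\<^sup>+\<omega>'. F (V i \<omega>, Y i \<omega>') * ennreal ((\<lambda>(c, y). cond_density i c y / out_density i y) (V i \<omega>, Y i \<omega>')) \<partial>M)" by simp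
    qed
    finally show "(\<integral>\<^sup>+\<omega>. F (V i \<omega>, Y i \<omega>) \<partial>M)
      = (\<integral>\<^sup>+\<omega>. \<integral>\<^sup>+\<omega>'. F (V i \<omega>, Y i \<omega>') * ennreal ((\<lambda>(c, y). cond_density i c y / out_density i y) (V i \<omega>, Y i \<omega>')) \<partial>M \<partial>M)" .
  qed simp
  then show ?thesis by simp
qed

text \<open>In the ratio f(y | v i) / f(y) the numerator is one component of the mixture f(y), which
  bounds the ratio by the inverse prior; its inverse has mean 1 because f(y) is a density. The
  moment wanted is that of the inverse ratio.\<close>

lemma err_moment_bound:
  assumes i: "i \<in> {1..K}" and d: "0 < d"
  obtains s where "0 < s" "s \<le> 1"
    "we.err_moment i s \<le> ennreal (exp (- (s * (ln 2 * mutual_information 2 (count_space UNIV) borel (V i) (Y i) - d))))"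
proof -
  have j: "i \<in> {0..K}" using i by auto
  note [measurable] = V_rv[OF i] Y_rv[OF j]
  have m1: "(\<lambda>\<omega>. cond_density i (V i \<omega>) (Y i \<omega>)) \<in> borel_measurable M"
    by (rule measurable_compose_countable[of "\<lambda>c \<omega>. cond_density i c (Y i \<omega>)"]) auto
  have m2: "(\<lambda>\<omega>. out_density i (Y i \<omega>)) \<in> borel_measurable M" by measurable
  have Q: "out_density i y = E (p i) (\<lambda>c. cond_density i c y)" for y
  proof -
    have "E (p i) (\<lambda>c. cond_density i c y) = E input_pmf (\<lambda>v. E (p i) (\<lambda>c. f i (v(i := c)) y))"
      unfolding cond_density_def by (rule expectation_swap_finite[OF fin_p finite_input_pmf])
    also have "\<dots> = out_density i y"
      unfolding out_density_def we.V_def using i fin_p by (intro expectation_Pi_pmf_resample) auto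
    finally show ?thesis ..
  qed
  have le: "pmf (p i) c * cond_density i c y \<le> out_density i y" for c y
  proof (cases "c \<in> set_pmf (p i)")
    case True
    have "cond_density i c y * pmf (p i) c \<le> (\<Sum>c\<in>set_pmf (p i). cond_density i c y * pmf (p i) c)"
      using True fin_p[of i] cond_density_pos by (intro member_le_sum) (auto simp: less_imp_le)
    then show ?thesis unfolding Q using fin_p[of i]
      by (subst integral_measure_pmf_real[of "set_pmf (p i)"]) (auto simp: mult.commute)
  next
    case False
    then have "pmf (p i) c = 0" by (simp add: set_pmf_iff)
    then show ?thesis using out_density_pos[of i y] by simp
  qed
  have one: "(\<integral>\<^sup>+\<omega>. ennreal (out_density i (Y i \<omega>) / cond_density i (V i \<omega>) (Y i \<omega>)) \<partial>M) = 1"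
  proof -
    have "(\<integral>\<^sup>+\<omega>. ennreal (out_density i (Y i \<omega>) / cond_density i (V i \<omega>) (Y i \<omega>)) \<partial>M)
        = (\<integral>\<^sup>+c. \<integral>\<^sup>+y. ennreal (out_density i y / cond_density i c y) * ennreal (cond_density i c y) \<partial>lborel \<partial>measure_pmf (p i))"
      by (rule input_output_law[OF i, where F = "\<lambda>c y. ennreal (out_density i y / cond_density i c y)"]) measurable
    also have "\<dots> = (\<integral>\<^sup>+c. \<integral>\<^sup>+y. 1 * ennreal (out_density i y) \<partial>lborel \<partial>measure_pmf (p i))"
    proof (intro nn_integral_cong)
      fix c y
      show "ennreal (out_density i y / cond_density i c y) * ennreal (cond_density i c y) = 1 * ennreal (out_density i y)"
        using cond_density_pos[of i c y] out_density_pos[of i y] by (subst ennreal_mult[symmetric]) auto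
    qed
    also have "\<dots> = (\<integral>\<^sup>+c. (\<integral>\<^sup>+\<omega>. 1 \<partial>M) \<partial>measure_pmf (p i))"
      using output_law[OF i, of "\<lambda>_. 1"] by simp
    also have "\<dots> = 1" by (simp add: emeasure_space_1)
    finally show ?thesis .
  qed
  obtain s where s: "0 < s" "s \<le> 1"
    "(\<integral>\<^sup>+\<omega>. ennreal ((out_density i (Y i \<omega>) / cond_density i (V i \<omega>) (Y i \<omega>)) powr s) \<partial>M)
      \<le> ennreal (exp (- (s * (ln 2 * (\<integral>\<omega>. log 2 (cond_density i (V i \<omega>) (Y i \<omega>) / out_density i (Y i \<omega>)) \<partial>M) - d))))"
    by (rule likelihood_ratio_moments[OF i m1 m2 cond_density_pos out_density_pos le one d])
  \<comment> \<open>The moment, defined by an integral over outputs, is read back as an expectation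
    on \<open>M\<close>, where \<open>likelihood_ratio_moments\<close> applies.\<close>
  have "we.err_moment i s = (\<integral>\<^sup>+y. 1 * ennreal (E input_pmf (\<lambda>v. f i v y * (out_density i y / cond_density i (v i) y) powr s)) \<partial>lborel)"
    unfolding we.err_moment_def cond_density_def out_density_def by simp
  also have "\<dots> = (\<integral>\<^sup>+v. \<integral>\<^sup>+y. 1 * ennreal (f i v y * (out_density i y / cond_density i (v i) y) powr s) \<partial>lborel \<partial>measure_pmf input_pmf)"
    by (rule nn_integral_weighted_average[symmetric, OF finite_input_pmf]) (auto intro!: mult_nonneg_nonneg simp: f_pos less_imp_le)
  also have "\<dots> = (\<integral>\<^sup>+v. \<integral>\<^sup>+y. ennreal ((out_density i y / cond_density i (v i) y) powr s) * ennreal (f i v y) \<partial>lborel \<partial>measure_pmf input_pmf)"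
    by (intro nn_integral_cong) (simp add: ennreal_mult[symmetric] f_pos less_imp_le mult.commute)
  also have "\<dots> = (\<integral>\<^sup>+\<omega>. ennreal ((out_density i (Y i \<omega>) / cond_density i (inputs \<omega> i) (Y i \<omega>)) powr s) \<partial>M)"
    by (rule inputs_law[OF j, where F = "\<lambda>v y. ennreal ((out_density i y / cond_density i (v i) y) powr s)", symmetric]) measurable
  also have "\<dots> = (\<integral>\<^sup>+\<omega>. ennreal ((out_density i (Y i \<omega>) / cond_density i (V i \<omega>) (Y i \<omega>)) powr s) \<partial>M)"
    using i by (simp add: inputs_def)
  finally have "we.err_moment i s = (\<integral>\<^sup>+\<omega>. ennreal ((out_density i (Y i \<omega>) / cond_density i (V i \<omega>) (Y i \<omega>)) powr s) \<partial>M)" .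
  then have "we.err_moment i s \<le> ennreal (exp (- (s * (ln 2 * mutual_information 2 (count_space UNIV) borel (V i) (Y i) - d))))"
    using s(3) unfolding mutual_information_eq[OF i] by simp
  then show ?thesis by (rule that[OF s(1,2)])
qed

text \<open>f(y | v without i) at receiver \<open>j\<close>: the inputs of the other users are
  known, that of user \<open>i\<close> is averaged out.\<close>

definition "avg_density i j v y = E (p i) (\<lambda>c. f j (v(i := c)) y)"

lemma avg_density_pos: "0 < avg_density i j v y"
  unfolding avg_density_def by (intro expectation_pos fin_p f_pos)

lemma avg_density_measurable [measurable]: "avg_density i j v \<in> borel_measurable borel"
  unfolding avg_density_def[abs_def] by (intro expectation_measurable fin_p f_measurable)

text \<open>The conditional mutual information of the theorem is given the list of the other users'
  inputs; \<open>side_fun\<close> reads such a list back as a function of the user.\<close>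

definition "others i = filter (\<lambda>k. k \<noteq> i) [1..<Suc K]"
definition "side_list i v = map v (others i)" for v :: "nat \<Rightarrow> nat"
definition "side_fun i l k = (case map_of (zip (others i) l) k of None \<Rightarrow> 0 | Some w \<Rightarrow> w)" for l :: "nat list"

lemma side_fun_side_list:
  assumes "k \<in> {1..K}" "k \<noteq> i"
  shows "side_fun i (side_list i v) k = v k"
  using assms unfolding side_fun_def side_list_def map_of_zip_map by (auto simp: others_def)

lemma side_list_upd: "side_list i (v(i := c)) = side_list i v"
  unfolding side_list_def by (intro map_cong) (auto simp: others_def)

lemma f_side_fun: "f j ((side_fun i (side_list i v))(i := c)) = f j (v(i := c))"
  by (rule f_cong) (auto simp: side_fun_side_list)

lemma avg_density_side_fun: "avg_density i j (side_fun i (side_list i v)) = avg_density i j v"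
  unfolding avg_density_def[abs_def] f_side_fun ..

lemma side_list_inputs: "side_list i (inputs \<omega>) = map (\<lambda>k. V k \<omega>) (others i)"
  unfolding side_list_def inputs_def by (intro map_cong) (auto simp: others_def)

lemma measurable_side_list: "(\<lambda>\<omega>. map (\<lambda>k. V k \<omega>) (others i)) \<in> M \<rightarrow>\<^sub>M count_space UNIV"
proof -
  have *: "(\<lambda>\<omega>. map (\<lambda>k. V k \<omega>) ks) \<in> M \<rightarrow>\<^sub>M count_space UNIV" if "set ks \<subseteq> {1..K}" for ks
    using that
  proof (induction ks)
    case (Cons k ks)
    have "(\<lambda>\<omega>. (V k \<omega>, map (\<lambda>k. V k \<omega>) ks)) \<in> M \<rightarrow>\<^sub>M count_space UNIV \<Otimes>\<^sub>M count_space UNIV"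
      using Cons by (intro measurable_Pair V_rv) auto
    then have "(\<lambda>\<omega>. (V k \<omega>, map (\<lambda>k. V k \<omega>) ks)) \<in> M \<rightarrow>\<^sub>M count_space UNIV"
      by (simp add: pair_measure_countable)
    from measurable_compose[OF this, of "\<lambda>(w, l). w # l" "count_space UNIV"] show ?case by simp
  qed simp
  show ?thesis by (rule *) (auto simp: others_def)
qed

text \<open>The side list does not see coordinate \<open>i\<close>, so the letter of user
  \<open>i\<close> can be drawn independently of it.\<close>

lemma side_information_law:
  assumes i: "i \<in> {1..K}" and j: "j \<in> {0..K}" and F: "\<And>c l. (\<lambda>y. F c y l) \<in> borel_measurable borel"
  shows "(\<integral>\<^sup>+\<omega>. F (V i \<omega>) (Y j \<omega>) (side_list i (inputs \<omega>)) \<partial>M)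
    = (\<integral>\<^sup>+c. \<integral>\<^sup>+v. \<integral>\<^sup>+y. F c y (side_list i v) * ennreal (f j (v(i := c)) y) \<partial>lborel \<partial>measure_pmf input_pmf \<partial>measure_pmf (p i))"
proof -
  have "(\<integral>\<^sup>+\<omega>. F (V i \<omega>) (Y j \<omega>) (side_list i (inputs \<omega>)) \<partial>M) = (\<integral>\<^sup>+\<omega>. F (inputs \<omega> i) (Y j \<omega>) (side_list i (inputs \<omega>)) \<partial>M)"
    using i by (simp add: inputs_def)
  also have "\<dots> = (\<integral>\<^sup>+v. \<integral>\<^sup>+y. F (v i) y (side_list i v) * ennreal (f j v y) \<partial>lborel \<partial>measure_pmf input_pmf)"
    by (rule inputs_law[OF j, where F = "\<lambda>v y. F (v i) y (side_list i v)"]) (rule F)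
  also have "\<dots> = (\<integral>\<^sup>+v. \<integral>\<^sup>+c. (\<integral>\<^sup>+y. F c y (side_list i v) * ennreal (f j (v(i := c)) y) \<partial>lborel) \<partial>measure_pmf (p i) \<partial>measure_pmf input_pmf)"
    unfolding resample_input[OF i, of "\<lambda>v. \<integral>\<^sup>+y. F (v i) y (side_list i v) * ennreal (f j v y) \<partial>lborel"] side_list_upd by simp
  also have "\<dots> = (\<integral>\<^sup>+c. \<integral>\<^sup>+v. (\<integral>\<^sup>+y. F c y (side_list i v) * ennreal (f j (v(i := c)) y) \<partial>lborel) \<partial>measure_pmf input_pmf \<partial>measure_pmf (p i))"
    by (rule swap_pmf[OF finite_input_pmf])
  finally show ?thesis .
qed

lemma marginal_side_information_law:
  assumes i: "i \<in> {1..K}" and j: "j \<in> {0..K}" and F: "\<And>l. (\<lambda>y. F y l) \<in> borel_measurable borel"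
  shows "(\<integral>\<^sup>+\<omega>. F (Y j \<omega>) (side_list i (inputs \<omega>)) \<partial>M)
    = (\<integral>\<^sup>+v. \<integral>\<^sup>+y. F y (side_list i v) * ennreal (avg_density i j v y) \<partial>lborel \<partial>measure_pmf input_pmf)"
proof -
  have "(\<integral>\<^sup>+\<omega>. F (Y j \<omega>) (side_list i (inputs \<omega>)) \<partial>M)
      = (\<integral>\<^sup>+c. \<integral>\<^sup>+v. \<integral>\<^sup>+y. F y (side_list i v) * ennreal (f j (v(i := c)) y) \<partial>lborel \<partial>measure_pmf input_pmf \<partial>measure_pmf (p i))"
    by (rule side_information_law[OF i j, where F = "\<lambda>c. F"]) (rule F)
  also have "\<dots> = (\<integral>\<^sup>+v. \<integral>\<^sup>+c. \<integral>\<^sup>+y. F y (side_list i v) * ennreal (f j (v(i := c)) y) \<partial>lborel \<partial>measure_pmf (p i) \<partial>measure_pmf input_pmf)"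
    by (rule swap_pmf[OF fin_p])
  also have "\<dots> = (\<integral>\<^sup>+v. \<integral>\<^sup>+y. F y (side_list i v) * ennreal (avg_density i j v y) \<partial>lborel \<partial>measure_pmf input_pmf)"
    unfolding avg_density_def by (intro nn_integral_cong nn_integral_weighted_average fin_p F f_measurable f_pos[THEN less_imp_le])
  finally show ?thesis .
qed

text \<open>Conditional mutual information is I(V i; (Y j, V_{-i})) - I(V i; V_{-i}). The second
  term is 0 by independence of the inputs, and the first one is the mean of log f(y | v) / f(y | v
  without i).\<close>

lemma conditional_mutual_information_eq:
  assumes i: "i \<in> {1..K}" and j: "j \<in> {0..K}"
  shows "conditional_mutual_information 2 (count_space UNIV) borel (count_space UNIV) (V i) (Y j) (\<lambda>\<omega>. map (\<lambda>k. V k \<omega>) (others i))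
    = (\<integral>\<omega>. log 2 (f j (inputs \<omega>) (Y j \<omega>) / avg_density i j (inputs \<omega>) (Y j \<omega>)) \<partial>M)"
proof -
  let ?r = "\<lambda>z. case z of (c, (y, l)) \<Rightarrow> f j ((side_fun i l)(i := c)) y / avg_density i j (side_fun i l) y"
  have r_lst: "?r (c, (y, side_list i v)) = f j (v(i := c)) y / avg_density i j v y" for c y v
    by (simp add: f_side_fun avg_density_side_fun)
  have inputs_upd: "(inputs \<omega>)(i := V i \<omega>) = inputs \<omega>" for \<omega> using i by (auto simp: inputs_def)
  have "mutual_information 2 (count_space UNIV) (borel \<Otimes>\<^sub>M count_space UNIV) (V i) (\<lambda>\<omega>. (Y j \<omega>, side_list i (inputs \<omega>)))
    = (\<integral>\<omega>. log 2 (?r (V i \<omega>, (Y j \<omega>, side_list i (inputs \<omega>)))) \<partial>M)"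
  proof (rule mutual_information_ratio[OF _ V_rv[OF i]])
    show "(\<lambda>\<omega>. (Y j \<omega>, side_list i (inputs \<omega>))) \<in> M \<rightarrow>\<^sub>M borel \<Otimes>\<^sub>M count_space UNIV"
      unfolding side_list_inputs by (rule measurable_Pair[OF Y_rv[OF j] measurable_side_list])
    show "?r \<in> borel_measurable (count_space UNIV \<Otimes>\<^sub>M (borel \<Otimes>\<^sub>M count_space UNIV))"
    proof (rule measurable_pair_measure_countable1)
      fix c
      have "(\<lambda>w. (\<lambda>l w. f j ((side_fun i l)(i := c)) (fst w) / avg_density i j (side_fun i l) (fst w)) (snd w) w)
        \<in> borel_measurable (borel \<Otimes>\<^sub>M count_space UNIV)"
        by (rule measurable_compose_countable) measurable
      then show "(\<lambda>y. ?r (c, y)) \<in> borel_measurable (borel \<Otimes>\<^sub>M count_space UNIV)" by (simp add: case_prod_unfold)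
    qed auto
    show "0 \<le> ?r z" for z using f_pos avg_density_pos by (auto simp: case_prod_unfold less_imp_le)
    fix F :: "nat \<times> real \<times> nat list \<Rightarrow> ennreal" assume F: "F \<in> borel_measurable (count_space UNIV \<Otimes>\<^sub>M (borel \<Otimes>\<^sub>M count_space UNIV))"
    have Fc[measurable]: "(\<lambda>y. F (c, (y, l))) \<in> borel_measurable borel" for c l
      by (rule measurable_compose[OF _ F]) measurable
    have "(\<integral>\<^sup>+\<omega>. F (V i \<omega>, (Y j \<omega>, side_list i (inputs \<omega>))) \<partial>M)
      = (\<integral>\<^sup>+c. \<integral>\<^sup>+v. \<integral>\<^sup>+y. F (c, (y, side_list i v)) * ennreal (f j (v(i := c)) y) \<partial>lborel \<partial>measure_pmf input_pmf \<partial>measure_pmf (p i))"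
      by (rule side_information_law[OF i j, where F = "\<lambda>c y l. F (c, (y, l))"]) (rule Fc)
    also have "\<dots> = (\<integral>\<^sup>+\<omega>. \<integral>\<^sup>+v. \<integral>\<^sup>+y. F (V i \<omega>, (y, side_list i v)) * ennreal (f j (v(i := V i \<omega>)) y) \<partial>lborel \<partial>measure_pmf input_pmf \<partial>M)"
      by (rule prior_law[OF i, symmetric])
    also have "\<dots> = (\<integral>\<^sup>+\<omega>. \<integral>\<^sup>+\<omega>'. F (V i \<omega>, (Y j \<omega>', side_list i (inputs \<omega>'))) * ennreal (?r (V i \<omega>, (Y j \<omega>', side_list i (inputs \<omega>')))) \<partial>M \<partial>M)"
    proof (intro nn_integral_cong)
      fix \<omega>
      have "(\<integral>\<^sup>+\<omega>'. F (V i \<omega>, (Y j \<omega>', side_list i (inputs \<omega>'))) * ennreal (?r (V i \<omega>, (Y j \<omega>', side_list i (inputs \<omega>')))) \<partial>M)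
        = (\<integral>\<^sup>+v. \<integral>\<^sup>+y. F (V i \<omega>, (y, side_list i v)) * ennreal (?r (V i \<omega>, (y, side_list i v))) * ennreal (avg_density i j v y) \<partial>lborel \<partial>measure_pmf input_pmf)"
      proof (rule marginal_side_information_law[OF i j, where F = "\<lambda>y l. F (V i \<omega>, (y, l)) * ennreal (?r (V i \<omega>, (y, l)))"])
        show "(\<lambda>y. F (V i \<omega>, (y, l)) * ennreal (?r (V i \<omega>, (y, l)))) \<in> borel_measurable borel" for l
          unfolding prod.case by measurable
      qed
      also have "\<dots> = (\<integral>\<^sup>+v. \<integral>\<^sup>+y. F (V i \<omega>, (y, side_list i v)) * ennreal (f j (v(i := V i \<omega>)) y) \<partial>lborel \<partial>measure_pmf input_pmf)"
      proof (intro nn_integral_cong)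
        fix v y
        have "ennreal (?r (V i \<omega>, (y, side_list i v))) * ennreal (avg_density i j v y) = ennreal (f j (v(i := V i \<omega>)) y)"
          unfolding r_lst using f_pos[of j "v(i := V i \<omega>)" y] avg_density_pos[of i j v y] by (subst ennreal_mult[symmetric]) auto
        then show "F (V i \<omega>, (y, side_list i v)) * ennreal (?r (V i \<omega>, (y, side_list i v))) * ennreal (avg_density i j v y)
          = F (V i \<omega>, (y, side_list i v)) * ennreal (f j (v(i := V i \<omega>)) y)"
          by (simp only: mult.assoc)
      qed
      finally show "(\<integral>\<^sup>+v. \<integral>\<^sup>+y. F (V i \<omega>, (y, side_list i v)) * ennreal (f j (v(i := V i \<omega>)) y) \<partial>lborel \<partial>measure_pmf input_pmf)
        = (\<integral>\<^sup>+\<omega>'. F (V i \<omega>, (Y j \<omega>', side_list i (inputs \<omega>'))) * ennreal (?r (V i \<omega>, (Y j \<omega>', side_list i (inputs \<omega>')))) \<partial>M)" ..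
    qed
    finally show "(\<integral>\<^sup>+\<omega>. F (V i \<omega>, (Y j \<omega>, side_list i (inputs \<omega>))) \<partial>M)
      = (\<integral>\<^sup>+\<omega>. \<integral>\<^sup>+\<omega>'. F (V i \<omega>, (Y j \<omega>', side_list i (inputs \<omega>'))) * ennreal (?r (V i \<omega>, (Y j \<omega>', side_list i (inputs \<omega>')))) \<partial>M \<partial>M)" .
  qed simp
  \<comment> \<open>Independent inputs have joint density 1 relative to the product of their
    marginals, hence mutual information 0.\<close>
  moreover have "mutual_information 2 (count_space UNIV) (count_space UNIV) (V i) (\<lambda>\<omega>. side_list i (inputs \<omega>)) = (\<integral>\<omega>. log 2 ((\<lambda>_. 1) (V i \<omega>, side_list i (inputs \<omega>))) \<partial>M)"
  proof (rule mutual_information_ratio[OF _ V_rv[OF i]])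
    show "(\<lambda>\<omega>. side_list i (inputs \<omega>)) \<in> M \<rightarrow>\<^sub>M count_space UNIV" unfolding side_list_inputs by (rule measurable_side_list)
    fix F :: "nat \<times> nat list \<Rightarrow> ennreal"
    have "(\<integral>\<^sup>+\<omega>. F (V i \<omega>, side_list i (inputs \<omega>)) \<partial>M)
      = (\<integral>\<^sup>+c. \<integral>\<^sup>+v. \<integral>\<^sup>+y. F (c, side_list i v) * ennreal (f j (v(i := c)) y) \<partial>lborel \<partial>measure_pmf input_pmf \<partial>measure_pmf (p i))"
      by (rule side_information_law[OF i j, where F = "\<lambda>c y l. F (c, l)"]) simp
    also have "\<dots> = (\<integral>\<^sup>+c. \<integral>\<^sup>+v. F (c, side_list i v) \<partial>measure_pmf input_pmf \<partial>measure_pmf (p i))"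
      by (simp add: nn_integral_cmult nn_integral_f)
    also have "\<dots> = (\<integral>\<^sup>+\<omega>. \<integral>\<^sup>+v. F (V i \<omega>, side_list i v) \<partial>measure_pmf input_pmf \<partial>M)"
      by (rule prior_law[OF i, symmetric])
    also have "\<dots> = (\<integral>\<^sup>+\<omega>. \<integral>\<^sup>+\<omega>'. F (V i \<omega>, side_list i (inputs \<omega>')) * ennreal 1 \<partial>M \<partial>M)"
    proof (intro nn_integral_cong)
      fix \<omega>
      have "(\<integral>\<^sup>+\<omega>'. F (V i \<omega>, side_list i (inputs \<omega>')) \<partial>M) = (\<integral>\<^sup>+v. \<integral>\<^sup>+y. F (V i \<omega>, side_list i v) * ennreal (f j v y) \<partial>lborel \<partial>measure_pmf input_pmf)"
        by (rule inputs_law[OF j, where F = "\<lambda>v y. F (V i \<omega>, side_list i v)"]) simp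
      then show "(\<integral>\<^sup>+v. F (V i \<omega>, side_list i v) \<partial>measure_pmf input_pmf) = (\<integral>\<^sup>+\<omega>'. F (V i \<omega>, side_list i (inputs \<omega>')) * ennreal 1 \<partial>M)"
        by (simp add: nn_integral_cmult nn_integral_f)
    qed
    finally show "(\<integral>\<^sup>+\<omega>. F (V i \<omega>, side_list i (inputs \<omega>)) \<partial>M) = (\<integral>\<^sup>+\<omega>. \<integral>\<^sup>+\<omega>'. F (V i \<omega>, side_list i (inputs \<omega>')) * ennreal 1 \<partial>M \<partial>M)" .
  qed auto
  ultimately show ?thesis
    unfolding conditional_mutual_information_def side_list_inputs[symmetric] r_lst inputs_upd by simp
qed

text \<open>As in \<open>err_moment_bound\<close>, but with the other inputs known: given them, f(y
  | v) is one component of the mixture over the letter of user \<open>i\<close>. Here the moment of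
  the ratio itself is wanted. Nonnegativity of \<open>I\<close> is recorded because it later keeps
  the randomisation rates nonnegative.\<close>

lemma leak_moment_bound:
  fixes i j
  defines "I \<equiv> conditional_mutual_information 2 (count_space UNIV) borel (count_space UNIV) (V i) (Y j) (\<lambda>\<omega>. map (\<lambda>k. V k \<omega>) (others i))"
  assumes i: "i \<in> {1..K}" and j: "j \<in> {0..K}" and d: "0 < d"
  obtains s where "0 < s" "s \<le> 1" "0 \<le> I" "we.leak_moment j i s \<le> ennreal (exp (s * (ln 2 * I + d)))"
proof -
  note [measurable] = V_rv[OF i] Y_rv[OF j]
  have PC: "PiM {1..K} (\<lambda>_. count_space (UNIV :: nat set)) = count_space (PiE {1..K} (\<lambda>_. UNIV))"
    by (rule count_space_PiM_finite) auto
  have vm: "inputs \<in> M \<rightarrow>\<^sub>M count_space (PiE {1..K} (\<lambda>_. UNIV))"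
    unfolding PC[symmetric] inputs_def[abs_def] by (rule measurable_restrict) (rule V_rv)
  have m1: "(\<lambda>\<omega>. f j (inputs \<omega>) (Y j \<omega>)) \<in> borel_measurable M"
    by (rule measurable_compose_countable'[of _ "\<lambda>v \<omega>. f j v (Y j \<omega>)", OF _ vm]) (auto intro: countable_PiE)
  have m2: "(\<lambda>\<omega>. avg_density i j (inputs \<omega>) (Y j \<omega>)) \<in> borel_measurable M"
    by (rule measurable_compose_countable'[of _ "\<lambda>v \<omega>. avg_density i j v (Y j \<omega>)", OF _ vm]) (auto intro: countable_PiE)
  have le: "pmf (p i) (V i \<omega>) * f j (inputs \<omega>) y \<le> avg_density i j (inputs \<omega>) y" for \<omega> y
  proof (cases "V i \<omega> \<in> set_pmf (p i)")
    case True
    have "f j ((inputs \<omega>)(i := V i \<omega>)) y * pmf (p i) (V i \<omega>) \<le> (\<Sum>c\<in>set_pmf (p i). f j ((inputs \<omega>)(i := c)) y * pmf (p i) c)"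
      using True fin_p[of i] f_pos by (intro member_le_sum[where f = "\<lambda>c. f j ((inputs \<omega>)(i := c)) y * pmf (p i) c"]) (auto simp: less_imp_le)
    moreover have "(inputs \<omega>)(i := V i \<omega>) = inputs \<omega>" using i by (auto simp: inputs_def)
    ultimately show ?thesis unfolding avg_density_def using fin_p[of i]
      by (subst integral_measure_pmf_real[of "set_pmf (p i)"]) (auto simp: mult.commute)
  next
    case False
    then have "pmf (p i) (V i \<omega>) = 0" by (simp add: set_pmf_iff)
    then show ?thesis using avg_density_pos[of i j "inputs \<omega>" y] by simp
  qed
  have one: "(\<integral>\<^sup>+\<omega>. ennreal (avg_density i j (inputs \<omega>) (Y j \<omega>) / f j (inputs \<omega>) (Y j \<omega>)) \<partial>M) = 1"
  proof -
    have "(\<integral>\<^sup>+\<omega>. ennreal (avg_density i j (inputs \<omega>) (Y j \<omega>) / f j (inputs \<omega>) (Y j \<omega>)) \<partial>M)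
        = (\<integral>\<^sup>+v. \<integral>\<^sup>+y. ennreal (avg_density i j v y / f j v y) * ennreal (f j v y) \<partial>lborel \<partial>measure_pmf input_pmf)"
      by (rule inputs_law[OF j, where F = "\<lambda>v y. ennreal (avg_density i j v y / f j v y)"]) measurable
    also have "\<dots> = (\<integral>\<^sup>+v. \<integral>\<^sup>+y. 1 * ennreal (avg_density i j v y) \<partial>lborel \<partial>measure_pmf input_pmf)"
    proof (intro nn_integral_cong)
      fix v y
      show "ennreal (avg_density i j v y / f j v y) * ennreal (f j v y) = 1 * ennreal (avg_density i j v y)"
        using f_pos[of j v y] avg_density_pos[of i j v y] by (subst ennreal_mult[symmetric]) auto
    qed
    also have "\<dots> = (\<integral>\<^sup>+\<omega>. 1 \<partial>M)"
      by (rule marginal_side_information_law[OF i j, where F = "\<lambda>_ _. 1", symmetric]) simp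
    also have "\<dots> = 1" by (simp add: emeasure_space_1)
    finally show ?thesis .
  qed
  have I: "I = (\<integral>\<omega>. log 2 (f j (inputs \<omega>) (Y j \<omega>) / avg_density i j (inputs \<omega>) (Y j \<omega>)) \<partial>M)"
    unfolding I_def by (rule conditional_mutual_information_eq[OF i j])
  obtain s where s: "0 < s" "s \<le> 1"
    "(\<integral>\<^sup>+\<omega>. ennreal ((f j (inputs \<omega>) (Y j \<omega>) / avg_density i j (inputs \<omega>) (Y j \<omega>)) powr s) \<partial>M) \<le> ennreal (exp (s * (ln 2 * I + d)))"
    "0 \<le> I"
    unfolding I by (rule likelihood_ratio_moments[OF i m1 m2 f_pos avg_density_pos le one d])
  have "we.leak_moment j i s = (\<integral>\<^sup>+y. 1 * ennreal (E input_pmf (\<lambda>v. f j v y * (f j v y / avg_density i j v y) powr s)) \<partial>lborel)"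
    unfolding we.leak_moment_def avg_density_def by simp
  also have "\<dots> = (\<integral>\<^sup>+v. \<integral>\<^sup>+y. 1 * ennreal (f j v y * (f j v y / avg_density i j v y) powr s) \<partial>lborel \<partial>measure_pmf input_pmf)"
    by (rule nn_integral_weighted_average[symmetric, OF finite_input_pmf]) (auto intro!: mult_nonneg_nonneg simp: f_pos less_imp_le)
  also have "\<dots> = (\<integral>\<^sup>+v. \<integral>\<^sup>+y. ennreal ((f j v y / avg_density i j v y) powr s) * ennreal (f j v y) \<partial>lborel \<partial>measure_pmf input_pmf)"
    by (intro nn_integral_cong) (simp add: ennreal_mult[symmetric] f_pos less_imp_le mult.commute)
  also have "\<dots> = (\<integral>\<^sup>+\<omega>. ennreal ((f j (inputs \<omega>) (Y j \<omega>) / avg_density i j (inputs \<omega>) (Y j \<omega>)) powr s) \<partial>M)"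
    by (rule inputs_law[OF j, where F = "\<lambda>v y. ennreal ((f j v y / avg_density i j v y) powr s)", symmetric]) measurable
  finally show ?thesis using s by (intro that[of s]) auto
qed

end

section \<open>Achievability\<close>

lemma exp_decay:
  assumes "0 < (a :: real)" "0 < D"
  shows "(\<lambda>m. exp (- (a * real (D * m)))) \<longlonglongrightarrow> 0"
proof -
  have "(\<lambda>m. exp (- (a * real D)) ^ m) \<longlonglongrightarrow> 0"
    using assms by (intro LIMSEQ_power_zero) auto
  moreover have "exp (- (a * real D)) ^ m = exp (- (a * real (D * m)))" for m
    by (simp add: exp_of_nat_mult[symmetric] mult_ac)
  ultimately show ?thesis by simp
qed

lemma pmf_exists_below_mean:
  fixes \<Phi> :: "'b \<Rightarrow> ennreal"
  assumes "(\<integral>\<^sup>+x. \<Phi> x \<partial>measure_pmf P) < B"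
  shows "\<exists>x\<in>set_pmf P. \<Phi> x < B"
proof (rule ccontr)
  assume "\<not> (\<exists>x\<in>set_pmf P. \<Phi> x < B)"
  then have "(\<integral>\<^sup>+x. B \<partial>measure_pmf P) \<le> (\<integral>\<^sup>+x. \<Phi> x \<partial>measure_pmf P)"
    by (intro nn_integral_mono_AE) (auto simp: AE_measure_pmf_iff not_less)
  then show False using assms by simp
qed

text \<open>2 to the power n R rounded up, written with base e to match the moment bounds. It is
  never 0, so every user has at least one codeword.\<close>

definition code_size :: "nat \<Rightarrow> real \<Rightarrow> nat" where
  "code_size n R = nat \<lceil>exp (ln 2 * R * real n)\<rceil>"

lemma code_size_ge: "exp (ln 2 * R * real n) \<le> real (code_size n R)"
  unfolding code_size_def by (rule order.trans[OF le_of_int_ceiling]) simp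

lemma code_size_pos: "0 < code_size n R"
  using code_size_ge[of R n] exp_gt_zero[of "ln 2 * R * real n"] by (metis gr0I not_le of_nat_0)

text \<open>For nonnegative rates the exponential is at least 1, so rounding up costs at most a
  factor 2.\<close>

lemma code_size_le:
  assumes "0 \<le> R"
  shows "real (code_size n R) \<le> 2 * exp (ln 2 * R * real n)"
proof -
  have "real (code_size n R) = of_int \<lceil>exp (ln 2 * R * real n)\<rceil>"
    unfolding code_size_def by (simp add: less_imp_le order.strict_trans1[OF _ exp_gt_zero])
  also have "\<dots> \<le> exp (ln 2 * R * real n) + 1" by (rule of_int_ceiling_le_add_one)
  also have "1 \<le> exp (ln 2 * R * real n)" using assms by simp
  finally show ?thesis by simp
qed

lemma (in wiretap_ensemble) letter_in_support:
  assumes "C \<in> set_pmf rc.codebook_law" "i \<in> {1..K}" "b \<in> rc.labels i" "t < n"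
  shows "C (i, b) t \<in> set_pmf (p i)"
proof -
  have "C \<in> PiE_dflt (Sigma {1..K} rc.labels) undefined (set_pmf \<circ> (\<lambda>(i, b). q i))"
    using assms(1) unfolding rc.codebook_law_def by (simp only: set_Pi_pmf rc.finite_codebook_index)
  then have "C (i, b) \<in> set_pmf (q i)"
    using assms(2,3) unfolding PiE_dflt_def by (cases b) (auto dest!: spec[of _ "(i, b)"])
  then show ?thesis using assms(4) unfolding q_def by (auto simp: set_Pi_pmf PiE_dflt_def)
qed

text \<open>With threshold \<open>exp (\<theta> * real n1)\<close> the true codeword fails with
  exponent \<open>s * (\<eta> - \<theta>)\<close>, and wrong ones pass with exponent
  \<open>\<theta> - ln 2 * (R + R')\<close>. The factor 4 comes from rounding up both code
  sizes.\<close>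

lemma (in wiretap_ensemble) expected_error_exp:
  assumes i: "i \<in> {1..K}" and s: "0 < s" and mom: "err_moment i s \<le> ennreal (exp (- (s * \<eta>)))"
    and sizes: "Mn i = code_size n1 R" "Ln i = code_size n1 R'" "0 \<le> R" "0 \<le> R'"
  shows "(\<integral>\<^sup>+C. emeasure (gc.\<Omega> C) {\<omega> \<in> space (gc.\<Omega> C). decoder (exp (\<theta> * real n1)) C i (cY h g K n i \<omega>) \<noteq> cW i \<omega>} \<partial>measure_pmf rc.codebook_law)
    \<le> ennreal (exp (- (s * (\<eta> - \<theta>) * real n1)) + 4 * exp (- ((\<theta> - ln 2 * (R + R')) * real n1)))"
proof -
  have "real (Mn i * Ln i) \<le> (2 * exp (ln 2 * R * real n1)) * (2 * exp (ln 2 * R' * real n1))"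
    unfolding of_nat_mult sizes(1,2) by (intro mult_mono code_size_le sizes) auto
  then have "real (Mn i * Ln i) / exp (\<theta> * real n1) \<le> 4 * (exp (ln 2 * R * real n1) * exp (ln 2 * R' * real n1)) / exp (\<theta> * real n1)"
    by (intro divide_right_mono) auto
  also have "\<dots> = 4 * exp (- ((\<theta> - ln 2 * (R + R')) * real n1))"
    by (simp add: exp_add exp_diff exp_minus algebra_simps divide_simps)
  finally have b2: "real (Mn i * Ln i) / exp (\<theta> * real n1) \<le> 4 * exp (- ((\<theta> - ln 2 * (R + R')) * real n1))" .
  have "ennreal (exp (\<theta> * real n1) powr s) * err_moment i s ^ n1
      \<le> ennreal (exp (\<theta> * real n1) powr s) * ennreal (exp (- (s * \<eta>))) ^ n1"
    by (intro mult_left_mono power_mono mom) auto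
  also have "\<dots> = ennreal (exp (\<theta> * real n1) powr s * exp (- (s * \<eta>)) ^ n1)"
    by (simp add: ennreal_power ennreal_mult)
  also have "exp (\<theta> * real n1) powr s * exp (- (s * \<eta>)) ^ n1 = exp (- (s * (\<eta> - \<theta>) * real n1))"
    by (simp add: powr_def exp_of_nat_mult[symmetric] exp_add[symmetric] algebra_simps)
  finally have b1: "ennreal (exp (\<theta> * real n1) powr s) * err_moment i s ^ n1 \<le> ennreal (exp (- (s * (\<eta> - \<theta>) * real n1)))" .
  show ?thesis
    using order.trans[OF expected_error[OF i s exp_gt_zero] add_mono[OF b1 ennreal_leI[OF b2]]]
    by (simp add: ennreal_plus[symmetric] del: ennreal_plus)
qed

text \<open>The randomisation gain \<open>Ln i powr (- s)\<close> has exponent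
  \<open>s * (ln 2 * R')\<close> and beats the moment exponent \<open>s * l\<close> as soon as
  \<open>l < ln 2 * R'\<close>.\<close>

lemma (in wiretap_ensemble) expected_leak_exp:
  assumes i: "i \<in> {1..K}" and s: "0 < s" "s \<le> 1" and mom: "leak_moment j i s \<le> ennreal (exp (s * l))"
    and sizes: "Ln i = code_size n1 R'"
  shows "(\<integral>\<^sup>+C. (\<integral>\<^sup>+y. ennreal (gc.leak C j i y) \<partial>blk n) \<partial>measure_pmf rc.codebook_law)
    \<le> ennreal (1 / s * exp (- (s * (ln 2 * R' - l) * real n1)))"
proof -
  have "real (Ln i) powr (- s) \<le> exp (ln 2 * R' * real n1) powr (- s)"
    unfolding sizes using code_size_ge[of R' n1] s by (intro powr_mono2') auto
  then have "real (Ln i) powr (- s) / s \<le> 1 / s * exp (- (s * (ln 2 * R') * real n1))"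
    using s by (simp add: powr_def field_simps)
  then have "ennreal (real (Ln i) powr (- s) / s) * leak_moment j i s ^ n1
     \<le> ennreal (1 / s * exp (- (s * (ln 2 * R') * real n1))) * ennreal (exp (s * l)) ^ n1"
    by (intro mult_mono power_mono mom ennreal_leI) auto
  also have "\<dots> = ennreal (1 / s * exp (- (s * (ln 2 * R') * real n1)) * exp (s * l) ^ n1)"
    using s by (subst ennreal_mult) (auto simp: ennreal_power)
  also have "1 / s * exp (- (s * (ln 2 * R') * real n1)) * exp (s * l) ^ n1 = 1 / s * exp (- (s * (ln 2 * R' - l) * real n1))"
  proof -
    have "exp (- (s * (ln 2 * R') * real n1)) * exp (s * l) ^ n1 = exp (- (s * (ln 2 * R' - l) * real n1))"
      by (simp add: exp_of_nat_mult[symmetric] exp_add[symmetric] algebra_simps)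
    then show ?thesis by (simp only: mult.assoc)
  qed
  finally show ?thesis by (rule order.trans[OF expected_leak[OF i s]])
qed

text \<open>A finite support bounds \<open>pw\<close> from above and makes
  \<open>exp (- pw v)\<close> integrable, so the general moment bound applies.\<close>

lemma power_moment:
  fixes pw :: "nat \<Rightarrow> real"
  assumes fin: "finite (set_pmf p)" and d: "0 < d"
  obtains s where "0 < s" "measure_pmf.expectation p (\<lambda>v. exp (s * pw v)) \<le> exp (s * (measure_pmf.expectation p pw + d))"
proof -
  have ub: "AE v in measure_pmf p. pw v \<le> Max (pw ` set_pmf p)"
    using fin by (auto simp: AE_measure_pmf_iff)
  have m: "pw \<in> borel_measurable (measure_pmf p)" by simp
  have int: "integrable (measure_pmf p) (\<lambda>v. exp (- pw v))"
    using fin by (rule integrable_measure_pmf_finite)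
  show ?thesis
    by (rule measure_pmf.exponential_moment_near_0[OF m ub int d]) (rule that)
qed

text \<open>Error probabilities, leakages and the events of excessive power are added into a single
  functional of the codebook. Its mean tends to 0, and nonnegativity of all summands lets one
  codebook satisfy every requirement.\<close>

lemma achievable_of_moment_bounds:
  fixes K :: nat and h :: "nat \<Rightarrow> nat \<Rightarrow> real" and g R R' :: "nat \<Rightarrow> real" and P :: real
    and p :: "nat \<Rightarrow> nat pmf" and \<kappa>0 :: "nat \<Rightarrow> nat \<Rightarrow> real measure" and pw :: "nat \<Rightarrow> nat \<Rightarrow> real"
  assumes fin_p: "\<And>i. finite (set_pmf (p i))"
    and prob0: "\<And>k v. prob_space (\<kappa>0 k v)" and sets0: "\<And>k v. sets (\<kappa>0 k v) = sets borel"
    and R: "\<And>i. i \<in> {1..K} \<Longrightarrow> 0 \<le> R i" "\<And>i. i \<in> {1..K} \<Longrightarrow> 0 \<le> R' i"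
    and err: "\<And>i. i \<in> {1..K} \<Longrightarrow> \<exists>s \<eta>. 0 < s \<and> ln 2 * (R i + R' i) < \<eta> \<and>
      wiretap_ensemble.err_moment K h g p \<kappa>0 i s \<le> ennreal (exp (- (s * \<eta>)))"
    and leak: "\<And>i j. i \<in> {1..K} \<Longrightarrow> j \<in> {0..K} - {i} \<Longrightarrow> \<exists>s l. 0 < s \<and> s \<le> 1 \<and> l < ln 2 * R' i \<and>
      wiretap_ensemble.leak_moment K h g p \<kappa>0 j i s \<le> ennreal (exp (s * l))"
    and pw_nn: "\<And>i v. 0 \<le> pw i v"
    and pw: "\<And>i v. i \<in> {1..K} \<Longrightarrow> v \<in> set_pmf (p i) \<Longrightarrow> (\<integral>\<^sup>+x. ennreal (x\<^sup>2) \<partial>\<kappa>0 i v) = ennreal (pw i v)"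
    and power: "\<And>i. i \<in> {1..K} \<Longrightarrow> measure_pmf.expectation (p i) (pw i) \<le> P"
  shows "ic_cm_ee_achievable K h g P R"
  unfolding ic_cm_ee_achievable_def
proof (intro allI impI)
  fix \<epsilon> :: real assume \<epsilon>: "0 < \<epsilon>"
  let ?em = "wiretap_ensemble.err_moment K h g p \<kappa>0" and ?lm = "wiretap_ensemble.leak_moment K h g p \<kappa>0"
  obtain se et where se: "\<And>i. i \<in> {1..K} \<Longrightarrow> 0 < se i \<and> ln 2 * (R i + R' i) < et i \<and> ?em i (se i) \<le> ennreal (exp (- (se i * et i)))"
    using err by metis
  have "\<forall>i j. \<exists>s l. i \<in> {1..K} \<and> j \<in> {0..K} - {i} \<longrightarrow> 0 < s \<and> s \<le> 1 \<and> l < ln 2 * R' i \<and> ?lm j i s \<le> ennreal (exp (s * l))"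
    using leak by blast
  then obtain sl ll where sl: "\<And>i j. i \<in> {1..K} \<Longrightarrow> j \<in> {0..K} - {i} \<Longrightarrow>
      0 < sl i j \<and> sl i j \<le> 1 \<and> ll i j < ln 2 * R' i \<and> ?lm j i (sl i j) \<le> ennreal (exp (sl i j * ll i j))"
    by metis
  \<comment> \<open>The midpoint between the total rate and the exponent \<open>et i\<close>, which
    leaves room on both sides.\<close>
  define \<theta> where "\<theta> i = (et i + ln 2 * (R i + R' i)) / 2" for i
  have \<theta>: "0 < et i - \<theta> i" "0 < \<theta> i - ln 2 * (R i + R' i)" if "i \<in> {1..K}" for i
    using se[OF that] by (auto simp: \<theta>_def)
  \<comment> \<open>Silent letters will make up a fraction 1 / (\<open>D\<close> + 1) of the block;
    with \<open>R i \<le> \<epsilon> * D\<close> they cost at most \<epsilon> in rate.\<close>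
  define D where "D = (\<Sum>i\<in>{1..K}. nat \<lceil>R i / \<epsilon>\<rceil>) + 1"
  have D: "0 < D" by (simp add: D_def)
  have D_ge: "R i \<le> \<epsilon> * real D" if i: "i \<in> {1..K}" for i
  proof -
    have "R i / \<epsilon> \<le> real (nat \<lceil>R i / \<epsilon>\<rceil>)" by (rule real_nat_ceiling_ge)
    also have "nat \<lceil>R i / \<epsilon>\<rceil> \<le> (\<Sum>i\<in>{1..K}. nat \<lceil>R i / \<epsilon>\<rceil>)"
      using i by (intro member_le_sum) auto
    finally have "R i / \<epsilon> \<le> real D" by (simp add: D_def)
    then show ?thesis using \<epsilon> by (simp add: field_simps)
  qed
  \<comment> \<open>One silent letter saves energy \<open>P\<close>, that is \<open>P / D\<close>
    per active letter; half of this is granted as tolerance, the other half becomes the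
    exponent.\<close>
  have "\<exists>s. 0 < s \<and> measure_pmf.expectation (p i) (\<lambda>v. exp (s * pw i v)) \<le> exp (s * (measure_pmf.expectation (p i) (pw i) + P / (2 * real D)))" if "0 < P" for i
    by (rule power_moment[OF fin_p[of i], of "P / (2 * real D)" "pw i"]) (use that D in auto)
  then obtain sp where sp: "\<And>i. 0 < P \<Longrightarrow> 0 < sp i \<and>
      measure_pmf.expectation (p i) (\<lambda>v. exp (sp i * pw i v)) \<le> exp (sp i * (measure_pmf.expectation (p i) (pw i) + P / (2 * real D)))"
    by metis
  define be where "be i m = exp (- (se i * (et i - \<theta> i) * real (D * m))) + 4 * exp (- ((\<theta> i - ln 2 * (R i + R' i)) * real (D * m)))" for i m
  define bl where "bl i j m = 1 / sl i j * exp (- (sl i j * (ln 2 * R' i - ll i j) * real (D * m)))" for i j m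
  \<comment> \<open>For \<open>P \<le> 0\<close> silence creates no slack, so no power event is
    charged; that case is settled directly in \<open>pow_le\<close>.\<close>
  define bp where "bp i m = (if 0 < P then exp (- (sp i * P / 2 * real (1 * m))) else 0)" for i m
  define total where "total m = (\<Sum>i\<in>{1..K}. be i m + (\<Sum>j\<in>{0..K} - {i}. bl i j m) + bp i m)" for m
  \<comment> \<open>The cap 1 rules out the event of excessive power, whose indicator would already
    reach 1; the factor \<open>ln 2\<close> turns nats into bits.\<close>
  define \<eta> where "\<eta> = min 1 (\<epsilon> * ln 2)"
  have \<eta>: "0 < \<eta>" using \<epsilon> by (simp add: \<eta>_def)
  have "total \<longlonglongrightarrow> (\<Sum>i\<in>{1..K}. (0 + 4 * 0) + (\<Sum>j\<in>{0..K} - {i}. 1 / sl i j * 0) + 0)"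
    unfolding total_def
  proof (intro tendsto_sum tendsto_add)
    fix i assume i: "i \<in> {1..K}"
    show "be i \<longlonglongrightarrow> 0 + 4 * 0" unfolding be_def
      using se[OF i] \<theta>[OF i] D by (intro tendsto_add tendsto_mult tendsto_const exp_decay) auto
    show "bp i \<longlonglongrightarrow> 0"
    proof (cases "0 < P")
      case True
      then have "(\<lambda>m. exp (- (sp i * P / 2 * real (1 * m)))) \<longlonglongrightarrow> 0" using sp[of i] by (intro exp_decay) auto
      moreover have "bp i = (\<lambda>m. exp (- (sp i * P / 2 * real (1 * m))))" unfolding bp_def if_P[OF True] ..
      ultimately show ?thesis by (simp only:)
    next
      case False
      have "bp i = (\<lambda>m. 0)" unfolding bp_def if_not_P[OF False] ..
      then show ?thesis by simp
    qed
    fix j assume j: "j \<in> {0..K} - {i}"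
    show "bl i j \<longlonglongrightarrow> 1 / sl i j * 0" unfolding bl_def
      using sl[OF i j] D by (intro tendsto_mult tendsto_const exp_decay) auto
  qed
  then have "total \<longlonglongrightarrow> 0" by simp
  then have "eventually (\<lambda>m. total m < \<eta>) sequentially" using \<eta> by (rule order_tendstoD(2))
  moreover have "eventually (\<lambda>m. 0 < m) sequentially" by (rule eventually_gt_at_top)
  ultimately obtain m where m: "0 < m" "total m < \<eta>" by (metis (mono_tags, lifting) eventually_conj eventually_happens sequentially_bot)
  define n1 where "n1 = D * m"
  define n where "n = (D + 1) * m"
  have n: "0 < n" "n1 \<le> n" using m by (auto simp: n_def n1_def)
  interpret we: wiretap_ensemble K h g p \<kappa>0 n n1 "\<lambda>i. code_size n1 (R i)" "\<lambda>i. code_size n1 (R' i)"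
    by (rule wiretap_ensemble.intro) (rule fin_p prob0 sets0 n(2) code_size_pos)+
  let ?err = "\<lambda>C i. emeasure (we.gc.\<Omega> C) {\<omega> \<in> space (we.gc.\<Omega> C). we.decoder (exp (\<theta> i * real n1)) C i (cY h g K n i \<omega>) \<noteq> cW i \<omega>}"
  let ?leak = "\<lambda>C i j. \<integral>\<^sup>+y. ennreal (we.gc.leak C j i y) \<partial>blk n"
  let ?pb = "\<lambda>C i. if 0 < P then indicator {C. P * real n < we.avg_power (pw i) i C} C else (0::ennreal)"
  let ?\<Phi> = "\<lambda>C. \<Sum>i\<in>{1..K}. ?err C i + (\<Sum>j\<in>{0..K} - {i}. ?leak C i j) + ?pb C i"
  have bl_nn: "0 \<le> bl i j m" if "i \<in> {1..K}" "j \<in> {0..K} - {i}" for i j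
    using sl[OF that] by (simp add: bl_def)
  have "(\<integral>\<^sup>+C. ?\<Phi> C \<partial>measure_pmf we.rc.codebook_law)
      = (\<Sum>i\<in>{1..K}. (\<integral>\<^sup>+C. ?err C i \<partial>measure_pmf we.rc.codebook_law) + (\<Sum>j\<in>{0..K} - {i}. (\<integral>\<^sup>+C. ?leak C i j \<partial>measure_pmf we.rc.codebook_law))
         + (\<integral>\<^sup>+C. ?pb C i \<partial>measure_pmf we.rc.codebook_law))"
    by (simp add: nn_integral_add nn_integral_sum)
  also have "\<dots> \<le> (\<Sum>i\<in>{1..K}. ennreal (be i m) + (\<Sum>j\<in>{0..K} - {i}. ennreal (bl i j m)) + ennreal (bp i m))"
  proof (intro sum_mono add_mono)
    fix i assume i: "i \<in> {1..K}"
    show "(\<integral>\<^sup>+C. ?err C i \<partial>measure_pmf we.rc.codebook_law) \<le> ennreal (be i m)"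
      unfolding be_def n1_def[symmetric] using se[OF i] R[OF i] i by (intro we.expected_error_exp) auto
    show "(\<integral>\<^sup>+C. ?pb C i \<partial>measure_pmf we.rc.codebook_law) \<le> ennreal (bp i m)"
    proof (cases "0 < P")
      case True
      let ?s = "sp i" and ?E = "measure_pmf.expectation (p i) (pw i)"
      have s: "0 < ?s" using sp[OF True] by simp
      have "(\<integral>\<^sup>+C. ?pb C i \<partial>measure_pmf we.rc.codebook_law)
          \<le> ennreal (exp (- (?s * (P * real n))) * measure_pmf.expectation (p i) (\<lambda>v. exp (?s * pw i v)) ^ n1)"
        using we.power_excess_prob[OF i s, of "P * real n" "pw i"] True by simp
      also have "\<dots> \<le> ennreal (exp (- (?s * (P * real n))) * exp (?s * (P + P / (2 * real D))) ^ n1)"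
      proof (intro ennreal_leI mult_left_mono power_mono)
        have "measure_pmf.expectation (p i) (\<lambda>v. exp (?s * pw i v)) \<le> exp (?s * (?E + P / (2 * real D)))"
          using sp[OF True, of i] by simp
        also have "\<dots> \<le> exp (?s * (P + P / (2 * real D)))" using s power[OF i] by simp
        finally show "measure_pmf.expectation (p i) (\<lambda>v. exp (?s * pw i v)) \<le> exp (?s * (P + P / (2 * real D)))" .
        show "0 \<le> measure_pmf.expectation (p i) (\<lambda>v. exp (?s * pw i v))"
          by (intro Bochner_Integration.integral_nonneg) simp
      qed simp
      also have "exp (- (?s * (P * real n))) * exp (?s * (P + P / (2 * real D))) ^ n1 = bp i m"
      proof -
        \<comment> \<open>Tolerated energy \<open>P * D * m + P * m / 2\<close> against the budget
          \<open>P * (D + 1) * m\<close> leaves a deficit of \<open>P * m / 2\<close>.\<close>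
        have "real n1 * (?s * (P + P / (2 * real D))) - ?s * (P * real n) = - (?s * P / 2 * real m)"
          using D by (simp add: n1_def n_def field_simps)
        then show ?thesis using True by (simp add: bp_def exp_of_nat_mult[symmetric] exp_add[symmetric])
      qed
      finally show ?thesis .
    qed simp
    fix j assume j: "j \<in> {0..K} - {i}"
    show "(\<integral>\<^sup>+C. ?leak C i j \<partial>measure_pmf we.rc.codebook_law) \<le> ennreal (bl i j m)"
      unfolding bl_def n1_def[symmetric] using sl[OF i j] i by (intro we.expected_leak_exp) auto
  qed
  also have "\<dots> = ennreal (total m)"
  proof -
    have bp_nn: "0 \<le> bp i m" for i by (simp add: bp_def)
    have be_nn: "0 \<le> be i m" for i by (simp add: be_def)
    have ls: "(\<Sum>j\<in>{0..K} - {i}. ennreal (bl i j m)) = ennreal (\<Sum>j\<in>{0..K} - {i}. bl i j m)" "0 \<le> (\<Sum>j\<in>{0..K} - {i}. bl i j m)"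
      if "i \<in> {1..K}" for i
      by (rule sum_ennreal, erule bl_nn[OF that]) (rule sum_nonneg, erule bl_nn[OF that])
    have "(\<Sum>i\<in>{1..K}. ennreal (be i m) + (\<Sum>j\<in>{0..K} - {i}. ennreal (bl i j m)) + ennreal (bp i m))
        = (\<Sum>i\<in>{1..K}. ennreal (be i m + (\<Sum>j\<in>{0..K} - {i}. bl i j m) + bp i m))"
      by (intro sum.cong refl) (simp only: ls ennreal_plus be_nn bp_nn add_nonneg_nonneg)
    also have "\<dots> = ennreal (total m)"
      unfolding total_def by (intro sum_ennreal add_nonneg_nonneg be_nn bp_nn ls)
    finally show ?thesis .
  qed
  also have "\<dots> < ennreal \<eta>" using m(2) \<eta> by (simp add: ennreal_lessI)
  finally obtain C where C: "C \<in> set_pmf we.rc.codebook_law" "?\<Phi> C < ennreal \<eta>"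
    using pmf_exists_below_mean by blast
  have part: "?err C i + (\<Sum>j\<in>{0..K} - {i}. ?leak C i j) + ?pb C i \<le> ennreal \<eta>" if "i \<in> {1..K}" for i
  proof -
    have "?err C i + (\<Sum>j\<in>{0..K} - {i}. ?leak C i j) + ?pb C i \<le> ?\<Phi> C"
      using that by (intro member_le_sum[where f = "\<lambda>i. ?err C i + (\<Sum>j\<in>{0..K} - {i}. ?leak C i j) + ?pb C i"]) auto
    then show ?thesis using C(2) by simp
  qed
  have errC: "?err C i \<le> ennreal \<eta>" if "i \<in> {1..K}" for i
    by (rule order.trans[OF _ part[OF that]]) (simp add: add.assoc)
  \<comment> \<open>The indicator takes only the values 0 and 1, and the whole functional stays
    below 1.\<close>
  have pbC: "we.avg_power (pw i) i C \<le> P * real n" if i: "i \<in> {1..K}" and P: "0 < P" for i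
  proof (rule ccontr)
    assume "\<not> we.avg_power (pw i) i C \<le> P * real n"
    then have pb: "?pb C i = 1" using P by simp
    have "?pb C i \<le> ?\<Phi> C"
    proof -
      have "?pb C i \<le> ?err C i + (\<Sum>j\<in>{0..K} - {i}. ?leak C i j) + ?pb C i" by simp
      also have "\<dots> \<le> ?\<Phi> C"
        using i by (intro member_le_sum[where f = "\<lambda>i. ?err C i + (\<Sum>j\<in>{0..K} - {i}. ?leak C i j) + ?pb C i"]) auto
      finally show ?thesis .
    qed
    then have "1 < ennreal \<eta>" using C(2) unfolding pb by (rule order.strict_trans1)
    moreover have "ennreal \<eta> \<le> 1" by (simp add: \<eta>_def)
    ultimately show False by simp
  qed
  \<comment> \<open>Leakage to \<open>j\<close> is charged only for users other than
    \<open>j\<close>. So \<open>S\<close> may be all users for the eavesdropper, and all users but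
    \<open>j\<close> for receiver \<open>j\<close>, as the two kinds of secrecy constraints
    require.\<close>
  have leakC: "(\<Sum>i\<in>S. ?leak C i j) \<le> ennreal \<eta>" if "S \<subseteq> {1..K} - {j}" "j \<in> {0..K}" for S j
  proof -
    have "(\<Sum>i\<in>S. ?leak C i j) \<le> (\<Sum>i\<in>S. ?err C i + (\<Sum>j\<in>{0..K} - {i}. ?leak C i j) + ?pb C i)"
    proof (intro sum_mono)
      fix i assume "i \<in> S"
      then have "?leak C i j \<le> (\<Sum>j\<in>{0..K} - {i}. ?leak C i j)"
        using that by (intro member_le_sum[where f = "\<lambda>j. ?leak C i j"]) auto
      also have "\<dots> \<le> ?err C i + (\<Sum>j\<in>{0..K} - {i}. ?leak C i j)" by simp
      also have "\<dots> \<le> ?err C i + (\<Sum>j\<in>{0..K} - {i}. ?leak C i j) + ?pb C i" by (rule add_increasing2) simp_all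
      finally show "?leak C i j \<le> ?err C i + (\<Sum>j\<in>{0..K} - {i}. ?leak C i j) + ?pb C i" .
    qed
    also have "\<dots> \<le> ?\<Phi> C" using that by (intro sum_mono2) auto
    finally show ?thesis using C(2) by simp
  qed
  have \<eta>\<epsilon>: "\<eta> \<le> \<epsilon>" "\<eta> / ln 2 \<le> real n * \<epsilon>"
  proof -
    have "\<epsilon> * ln 2 \<le> \<epsilon> * 1" using \<epsilon> ln_2_less_1 by (intro mult_left_mono) auto
    then show "\<eta> \<le> \<epsilon>" by (simp add: \<eta>_def)
    have "\<eta> / ln 2 \<le> \<epsilon>" by (simp add: \<eta>_def field_simps min_le_iff_disj)
    also have "\<epsilon> \<le> real n * \<epsilon>" using n(1) \<epsilon> by simp
    finally show "\<eta> / ln 2 \<le> real n * \<epsilon>" .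
  qed
  have secr: "we.gc.\<Omega>.conditional_entropy C 2 (count_space UNIV) (blk n) (we.gc.msgs ks) (cY h g K n j)
      \<ge> we.gc.\<Omega>.entropy C 2 (count_space UNIV) (we.gc.msgs ks) - real n * \<epsilon>"
    if "set ks \<subseteq> {1..K} - {j}" "distinct ks" "j \<in> {0..K}" for ks j
    using we.gc.secrecy[of j ks C \<eta>] leakC[of "set ks" j] that \<eta> \<eta>\<epsilon>(2) by fastforce
  define Mn where "Mn i = code_size n1 (R i)" for i
  have \<Omega>: "code_space K n Mn (we.gc.enc C) = we.gc.\<Omega> C"
    unfolding we.gc.\<Omega>_def Mn_def ..
  have msgs: "cWminus K i = we.gc.msgs (filter (\<lambda>j. j \<noteq> i) [1..<Suc K])" "cWall K = we.gc.msgs [1..<Suc K]" for i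
    by (auto simp: fun_eq_iff cWminus_def cWall_def we.gc.msgs_def)
  define pt where "pt i t v = (if t < n1 then pw i v else 0)" for i t v
  have pws: "integrable (we.gc.\<Omega> C) (\<lambda>\<omega>. (cX i \<omega> t)\<^sup>2)"
    "(\<integral>\<omega>. (cX i \<omega> t)\<^sup>2 \<partial>we.gc.\<Omega> C) = (\<Sum>b\<in>we.rc.labels i. pt i t (C (i, b) t)) / real (code_size n1 (R i) * code_size n1 (R' i))"
    if i: "i \<in> {1..K}" and t: "t < n" for i t
  proof -
    have label_set: "we.gc.label_set i = we.rc.labels i" by (simp add: we.gc.label_set_def we.rc.labels_def)
    have fin: "(\<integral>\<^sup>+x. ennreal (x\<^sup>2) \<partial>we.\<kappa> i t (C (i, b) t)) = ennreal (pt i t (C (i, b) t))" if b: "b \<in> we.gc.label_set i" for b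
      using we.letter_in_support[OF C(1) i _ t, of b] b pw[OF i] unfolding label_set
      by (auto simp: we.\<kappa>_def pt_def nn_integral_return)
    have nn: "0 \<le> pt i t v" for v by (simp add: pt_def pw_nn)
    show "integrable (we.gc.\<Omega> C) (\<lambda>\<omega>. (cX i \<omega> t)\<^sup>2)"
      by (rule we.gc.input_power(1)[where pw = "pt i t" and C = C, OF i t fin nn])
    show "(\<integral>\<omega>. (cX i \<omega> t)\<^sup>2 \<partial>we.gc.\<Omega> C) = (\<Sum>b\<in>we.rc.labels i. pt i t (C (i, b) t)) / real (code_size n1 (R i) * code_size n1 (R' i))"
      using we.gc.input_power(2)[where pw = "pt i t" and C = C, OF i t fin nn] unfolding label_set by simp
  qed
  have pow_avg: "(\<Sum>t<n. \<integral>\<omega>. (cX i \<omega> t)\<^sup>2 \<partial>we.gc.\<Omega> C) = we.avg_power (pw i) i C" if i: "i \<in> {1..K}" for i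
  proof -
    have "(\<Sum>t<n. \<integral>\<omega>. (cX i \<omega> t)\<^sup>2 \<partial>we.gc.\<Omega> C)
        = (\<Sum>t<n. \<Sum>b\<in>we.rc.labels i. pt i t (C (i, b) t)) / real (code_size n1 (R i) * code_size n1 (R' i))"
      using pws(2)[OF i] by (simp add: sum_divide_distrib)
    also have "(\<Sum>t<n. \<Sum>b\<in>we.rc.labels i. pt i t (C (i, b) t)) = (\<Sum>b\<in>we.rc.labels i. \<Sum>t<n. pt i t (C (i, b) t))"
      by (rule sum.swap)
    also have "\<dots> = (\<Sum>b\<in>we.rc.labels i. \<Sum>t<n1. pw i (C (i, b) t))"
    proof (rule sum.cong[OF refl])
      fix b
      have "(\<Sum>t<n. pt i t (C (i, b) t)) = (\<Sum>t<n1. pt i t (C (i, b) t))"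
        using n(2) by (intro sum.mono_neutral_right) (auto simp: pt_def)
      then show "(\<Sum>t<n. pt i t (C (i, b) t)) = (\<Sum>t<n1. pw i (C (i, b) t))" by (simp add: pt_def)
    qed
    finally show ?thesis unfolding we.avg_power_def .
  qed
  have pow_le: "we.avg_power (pw i) i C \<le> P * real n" if i: "i \<in> {1..K}" for i
  proof (cases "0 < P")
    case True
    then show ?thesis by (rule pbC[OF i])
  next
    case False
    \<comment> \<open>Here \<open>P\<close> must be 0, and a nonnegative function with mean 0
      vanishes on the support: every letter that the codebook can use has power 0.\<close>
    have E0: "0 \<le> measure_pmf.expectation (p i) (pw i)" by (intro Bochner_Integration.integral_nonneg pw_nn)
    then have P0: "P = 0" "measure_pmf.expectation (p i) (pw i) = 0" using power[OF i] False by auto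
    have "pw i v = 0" if v: "v \<in> set_pmf (p i)" for v
    proof -
      have "AE v in measure_pmf (p i). pw i v = 0"
        using P0(2) pw_nn fin_p[of i] by (subst (asm) integral_nonneg_eq_0_iff_AE) (auto intro: integrable_measure_pmf_finite)
      then show ?thesis using v by (simp add: AE_measure_pmf_iff)
    qed
    then have "we.avg_power (pw i) i C = 0"
      unfolding we.avg_power_def using we.letter_in_support[OF C(1) i] n(2) by simp
    then show ?thesis by (simp add: P0)
  qed
  show "\<exists>n Msz enc dec. 0 < n \<and>
      (\<forall>i\<in>{1..K}. 0 < Msz i \<and> R i - \<epsilon> \<le> log 2 (real (Msz i)) / real n \<and>
         (\<forall>m. prob_space (enc i m) \<and> sets (enc i m) = sets (blk n)) \<and> dec i \<in> blk n \<rightarrow>\<^sub>M count_space UNIV) \<and>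
      (let \<Omega> = code_space K n Msz enc in
        (\<forall>i\<in>{1..K}. (\<forall>t<n. integrable \<Omega> (\<lambda>\<omega>. (cX i \<omega> t)\<^sup>2)) \<and>
           (\<Sum>t<n. \<integral>\<omega>. (cX i \<omega> t)\<^sup>2 \<partial>\<Omega>) / real n \<le> P \<and>
           measure \<Omega> {\<omega> \<in> space \<Omega>. dec i (cY h g K n i \<omega>) \<noteq> cW i \<omega>} \<le> \<epsilon> \<and>
           prob_space.conditional_entropy \<Omega> 2 (count_space UNIV) (blk n) (cWminus K i) (cY h g K n i)
             \<ge> prob_space.entropy \<Omega> 2 (count_space UNIV) (cWminus K i) - real n * \<epsilon>) \<and>
        prob_space.conditional_entropy \<Omega> 2 (count_space UNIV) (blk n) (cWall K) (cY h g K n 0)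
          \<ge> prob_space.entropy \<Omega> 2 (count_space UNIV) (cWall K) - real n * \<epsilon>)"
  proof (intro exI[of _ n] exI[of _ Mn] exI[of _ "we.gc.enc C"] exI[of _ "\<lambda>i. we.decoder (exp (\<theta> i * real n1)) C i"])
    have rate: "R i - \<epsilon> \<le> log 2 (real (Mn i)) / real n" if i: "i \<in> {1..K}" for i
    proof -
      have "ln 2 * R i * real n1 \<le> ln (real (Mn i))"
        using code_size_ge[of "R i" n1] code_size_pos[of n1 "R i"] unfolding Mn_def
        by (subst ln_ge_iff) auto
      then have l: "R i * real n1 \<le> log 2 (real (Mn i))" by (simp add: log_def field_simps)
      have "(R i - \<epsilon>) * real n \<le> R i * real n1"
      proof -
        have "R i * real m \<le> \<epsilon> * real D * real m" using D_ge[OF i] by (intro mult_right_mono) auto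
        moreover have "0 \<le> \<epsilon> * real m" using \<epsilon> by simp
        ultimately show ?thesis unfolding n_def n1_def by (simp add: algebra_simps)
      qed
      then show ?thesis using l n(1) by (simp add: field_simps)
    qed
    have dec: "measure (we.gc.\<Omega> C) {\<omega> \<in> space (we.gc.\<Omega> C). we.decoder (exp (\<theta> i * real n1)) C i (cY h g K n i \<omega>) \<noteq> cW i \<omega>} \<le> \<epsilon>"
      if i: "i \<in> {1..K}" for i
    proof -
      have "?err C i \<le> ennreal \<epsilon>" using errC[OF i] \<eta>\<epsilon>(1) by (meson ennreal_leI order.trans)
      then show ?thesis unfolding measure_def using \<epsilon> by (intro enn2real_leI) auto
    qed
    have pw_final: "(\<Sum>t<n. \<integral>\<omega>. (cX i \<omega> t)\<^sup>2 \<partial>we.gc.\<Omega> C) / real n \<le> P" if "i \<in> {1..K}" for i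
      unfolding pow_avg[OF that] using pow_le[OF that] n(1) by (simp add: field_simps)
    have enc: "prob_space (we.gc.enc C i mm) \<and> sets (we.gc.enc C i mm) = sets (blk n)" for i mm
      unfolding we.gc.enc_def using we.gc.kernel.prob_space_stochastic_encoder we.gc.kernel.sets_stochastic_encoder by blast
    have s1: "prob_space.conditional_entropy (we.gc.\<Omega> C) 2 (count_space UNIV) (blk n) (cWminus K i) (cY h g K n i)
             \<ge> prob_space.entropy (we.gc.\<Omega> C) 2 (count_space UNIV) (cWminus K i) - real n * \<epsilon>" if "i \<in> {1..K}" for i
      unfolding msgs by (rule secr) (use that in auto)
    have s0: "prob_space.conditional_entropy (we.gc.\<Omega> C) 2 (count_space UNIV) (blk n) (cWall K) (cY h g K n 0)
             \<ge> prob_space.entropy (we.gc.\<Omega> C) 2 (count_space UNIV) (cWall K) - real n * \<epsilon>"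
      unfolding msgs by (rule secr) auto
    show "0 < n \<and>
      (\<forall>i\<in>{1..K}. 0 < Mn i \<and> R i - \<epsilon> \<le> log 2 (real (Mn i)) / real n \<and>
         (\<forall>m. prob_space (we.gc.enc C i m) \<and> sets (we.gc.enc C i m) = sets (blk n)) \<and>
         we.decoder (exp (\<theta> i * real n1)) C i \<in> blk n \<rightarrow>\<^sub>M count_space UNIV) \<and>
      (let \<Omega> = code_space K n Mn (we.gc.enc C) in
        (\<forall>i\<in>{1..K}. (\<forall>t<n. integrable \<Omega> (\<lambda>\<omega>. (cX i \<omega> t)\<^sup>2)) \<and>
           (\<Sum>t<n. \<integral>\<omega>. (cX i \<omega> t)\<^sup>2 \<partial>\<Omega>) / real n \<le> P \<and>
           measure \<Omega> {\<omega> \<in> space \<Omega>. we.decoder (exp (\<theta> i * real n1)) C i (cY h g K n i \<omega>) \<noteq> cW i \<omega>} \<le> \<epsilon> \<and>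
           prob_space.conditional_entropy \<Omega> 2 (count_space UNIV) (blk n) (cWminus K i) (cY h g K n i)
             \<ge> prob_space.entropy \<Omega> 2 (count_space UNIV) (cWminus K i) - real n * \<epsilon>) \<and>
        prob_space.conditional_entropy \<Omega> 2 (count_space UNIV) (blk n) (cWall K) (cY h g K n 0)
          \<ge> prob_space.entropy \<Omega> 2 (count_space UNIV) (cWall K) - real n * \<epsilon>)"
      unfolding \<Omega> Let_def
      using n(1) rate enc dec pw_final s1 s0 pws(1) we.decoder_measurable code_size_pos[folded Mn_def]
      by (intro conjI ballI allI impI) (blast | simp only: Mn_def code_size_pos)+
  qed
qed

section \<open>Choice of the randomisation rates\<close>

theorem theorem2:
  fixes K :: nat and h :: "nat \<Rightarrow> nat \<Rightarrow> real" and g :: "nat \<Rightarrow> real" and P :: real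
    and M :: "'a measure"
    and V :: "nat \<Rightarrow> 'a \<Rightarrow> nat" and X :: "nat \<Rightarrow> 'a \<Rightarrow> real" and N :: "nat \<Rightarrow> 'a \<Rightarrow> real"
    and R :: "nat \<Rightarrow> real"
  assumes gains: "\<And>j i. j \<in> {1..K} \<Longrightarrow> i \<in> {1..K} \<Longrightarrow> h j i \<noteq> 0"
      "\<And>j. j \<in> {1..K} \<Longrightarrow> g j \<noteq> 0"
    and M: "prob_space M"
    and V_rv: "\<And>i. i \<in> {1..K} \<Longrightarrow> V i \<in> M \<rightarrow>\<^sub>M count_space UNIV"
    and V_fin: "\<And>i. i \<in> {1..K} \<Longrightarrow> finite (V i ` space M)"
    and X_rv: "\<And>i. i \<in> {1..K} \<Longrightarrow> X i \<in> borel_measurable M"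
    and pairs_indep: "prob_space.indep_vars M (\<lambda>_. count_space UNIV \<Otimes>\<^sub>M borel)
                        (\<lambda>i \<omega>. (V i \<omega>, X i \<omega>)) {1..K}"
    and noise_gauss: "\<And>j. j \<in> {0..K} \<Longrightarrow> distributed M lborel (N j) std_normal_density"
    and noise_indep: "prob_space.indep_vars M (\<lambda>_. borel) N {0..K}"
    and noise_indep_inputs: "prob_space.indep_set M
          {(\<lambda>\<omega>. \<lambda>i\<in>{1..K}. (V i \<omega>, X i \<omega>)) -` A \<inter> space M | A.
             A \<in> sets (PiM {1..K} (\<lambda>_. count_space UNIV \<Otimes>\<^sub>M borel))}
          {(\<lambda>\<omega>. \<lambda>j\<in>{0..K}. N j \<omega>) -` B \<inter> space M | B.
             B \<in> sets (PiM {0..K} (\<lambda>_. borel))}"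
    and power: "\<And>i. i \<in> {1..K} \<Longrightarrow> integrable M (\<lambda>\<omega>. (X i \<omega>)\<^sup>2) \<and> (\<integral>\<omega>. (X i \<omega>)\<^sup>2 \<partial>M) \<le> P"
    and rates: "\<And>i. i \<in> {1..K} \<Longrightarrow>
       (let Y = (\<lambda>j \<omega>. (\<Sum>k\<in>{1..K}. gain h g k j * X k \<omega>) + N j \<omega>);
            Vm = (\<lambda>\<omega>. map (\<lambda>j. V j \<omega>) (filter (\<lambda>j. j \<noteq> i) [1..<Suc K]))
        in 0 \<le> R i \<and>
           R i < prob_space.mutual_information M 2 (count_space UNIV) borel (V i) (Y i)
              - (MAX j\<in>{0..K} - {i}.
                   prob_space.conditional_mutual_information M 2 (count_space UNIV) borel
                     (count_space UNIV) (V i) (Y j) Vm))"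
  shows "ic_cm_ee_achievable K h g P R"
proof -
  interpret prob_space M by (rule M)
  have "\<forall>i. \<exists>p \<kappa>. finite (set_pmf p) \<and> (\<forall>v. prob_space (\<kappa> v) \<and> sets (\<kappa> v) = sets borel) \<and>
      (i \<in> {1..K} \<longrightarrow> (\<forall>F \<in> borel_measurable (count_space UNIV \<Otimes>\<^sub>M borel).
        (\<integral>\<^sup>+\<omega>. F (V i \<omega>, X i \<omega>) \<partial>M) = (\<Sum>v\<in>set_pmf p. ennreal (pmf p v) * (\<integral>\<^sup>+x. F (v, x) \<partial>\<kappa> v))))"
    (is "\<forall>i. \<exists>p \<kappa>. ?Q i p \<kappa>")
  proof
    fix i
    show "\<exists>p \<kappa>. ?Q i p \<kappa>"
    proof (cases "i \<in> {1..K}")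
      case True
      show ?thesis by (rule disintegration[OF V_rv[OF True] V_fin[OF True] X_rv[OF True]]) blast
    next
      case False
      \<comment> \<open>Outside \<open>{1..K}\<close> any distribution and kernel will do; they only
        make \<open>p\<close> and \<open>\<kappa>\<close> total.\<close>
      show ?thesis
        by (rule exI[of _ "return_pmf 0"], rule exI[of _ "\<lambda>_. return borel 0"]) (use False in \<open>auto intro: prob_space_return\<close>)
    qed
  qed
  then obtain p where "\<forall>i. \<exists>\<kappa>. ?Q i (p i) \<kappa>" by (rule choice[THEN exE])
  then obtain \<kappa> where pk: "\<forall>i. ?Q i (p i) (\<kappa> i)" by (rule choice[THEN exE])
  have fin_p: "\<And>i. finite (set_pmf (p i))"
    and prob0: "\<And>i v. prob_space (\<kappa> i v)" and sets0: "\<And>i v. sets (\<kappa> i v) = sets borel"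
    and dis: "\<And>i F. i \<in> {1..K} \<Longrightarrow> F \<in> borel_measurable (count_space UNIV \<Otimes>\<^sub>M borel) \<Longrightarrow>
      (\<integral>\<^sup>+\<omega>. F (V i \<omega>, X i \<omega>) \<partial>M) = (\<Sum>v\<in>set_pmf (p i). ennreal (pmf (p i) v) * (\<integral>\<^sup>+x. F (v, x) \<partial>\<kappa> i v))"
    using pk by blast+
  define Y where "Y = (\<lambda>j \<omega>. (\<Sum>k\<in>{1..K}. gain h g k j * X k \<omega>) + N j \<omega>)"
  define I where "I i = mutual_information 2 (count_space UNIV) borel (V i) (Y i)" for i
  define J where "J i j = conditional_mutual_information 2 (count_space UNIV) borel (count_space UNIV)
    (V i) (Y j) (\<lambda>\<omega>. map (\<lambda>j. V j \<omega>) (filter (\<lambda>j. j \<noteq> i) [1..<Suc K]))" for i j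
  define Jm where "Jm i = (MAX j\<in>{0..K} - {i}. J i j)" for i
  have rates': "0 \<le> R i" "R i < I i - Jm i" if "i \<in> {1..K}" for i
    using rates[OF that] unfolding Let_def Y_def[symmetric] I_def[symmetric] J_def[symmetric] Jm_def[symmetric] by blast+
  have J_le: "J i j \<le> Jm i" if "j \<in> {0..K} - {i}" for i j
    unfolding Jm_def using that by (intro Max_ge) auto
  define pw where "pw i v = enn2real (\<integral>\<^sup>+x. ennreal (x\<^sup>2) \<partial>\<kappa> i v)" for i v
  have pw_nn: "0 \<le> pw i v" for i v by (simp add: pw_def)
  have second_moment: "(\<Sum>v\<in>set_pmf (p i). ennreal (pmf (p i) v) * (\<integral>\<^sup>+x. ennreal (x\<^sup>2) \<partial>\<kappa> i v)) = ennreal (\<integral>\<omega>. (X i \<omega>)\<^sup>2 \<partial>M)"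
    if i: "i \<in> {1..K}" for i
  proof -
    have "(\<lambda>z. ennreal ((snd z)\<^sup>2)) \<in> borel_measurable (count_space (UNIV :: nat set) \<Otimes>\<^sub>M borel)" by measurable
    from dis[OF i this] show ?thesis
      using power[OF i] by (simp add: nn_integral_eq_integral)
  qed
  \<comment> \<open>A positive prior weight passes finiteness of the mean second moment on to each
    letter of the support.\<close>
  have pw: "(\<integral>\<^sup>+x. ennreal (x\<^sup>2) \<partial>\<kappa> i v) = ennreal (pw i v)" if i: "i \<in> {1..K}" and v: "v \<in> set_pmf (p i)" for i v
  proof -
    have "ennreal (pmf (p i) v) * (\<integral>\<^sup>+x. ennreal (x\<^sup>2) \<partial>\<kappa> i v) \<le> ennreal (\<integral>\<omega>. (X i \<omega>)\<^sup>2 \<partial>M)"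
      unfolding second_moment[OF i, symmetric]
      by (rule member_le_sum[where f = "\<lambda>v. ennreal (pmf (p i) v) * (\<integral>\<^sup>+x. ennreal (x\<^sup>2) \<partial>\<kappa> i v)"]) (auto simp: v fin_p)
    then have "ennreal (pmf (p i) v) * (\<integral>\<^sup>+x. ennreal (x\<^sup>2) \<partial>\<kappa> i v) < \<top>"
      by (rule order.strict_trans1) simp
    then have "(\<integral>\<^sup>+x. ennreal (x\<^sup>2) \<partial>\<kappa> i v) < \<top>"
      using pmf_positive[OF v] by (auto simp: ennreal_mult_less_top)
    then show ?thesis unfolding pw_def by simp
  qed
  have pw_mean: "measure_pmf.expectation (p i) (pw i) \<le> P" if i: "i \<in> {1..K}" for i
  proof -
    have "ennreal (\<Sum>v\<in>set_pmf (p i). pmf (p i) v * pw i v) = (\<Sum>v\<in>set_pmf (p i). ennreal (pmf (p i) v) * ennreal (pw i v))"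
      by (subst sum_ennreal[symmetric]) (auto simp: pw_def ennreal_mult)
    also have "\<dots> = ennreal (\<integral>\<omega>. (X i \<omega>)\<^sup>2 \<partial>M)"
      unfolding second_moment[OF i, symmetric] by (intro sum.cong refl) (simp add: pw[OF i])
    finally have "(\<Sum>v\<in>set_pmf (p i). pmf (p i) v * pw i v) = (\<integral>\<omega>. (X i \<omega>)\<^sup>2 \<partial>M)"
      by (subst (asm) ennreal_inj) (auto intro!: sum_nonneg simp: pw_def)
    moreover have "measure_pmf.expectation (p i) (pw i) = (\<Sum>v\<in>set_pmf (p i). pmf (p i) v * pw i v)"
      using fin_p[of i] by (subst integral_measure_pmf_real[of "set_pmf (p i)"]) (auto simp: mult.commute)
    ultimately show ?thesis using power[OF i] by simp
  qed
  \<comment> \<open>The product form of independence is taken for a nonempty set of users, hence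
    \<open>0 < K\<close>; wherever \<open>sl\<close> is applied, some user \<open>i\<close> is at
    hand.\<close>
  have sl: "single_letter M K h g p \<kappa> V Y" if K: "0 < K"
  proof (intro single_letter.intro single_letter_axioms.intro M)
    fix j assume j: "j \<in> {0..K}"
    have "N j \<in> borel_measurable M"
      using distributed_measurable[OF noise_gauss[OF j]] by simp
    then show "Y j \<in> borel_measurable M"
      unfolding Y_def using X_rv by (intro borel_measurable_add borel_measurable_sum borel_measurable_times borel_measurable_const) auto
    fix F :: "(nat \<Rightarrow> nat) \<Rightarrow> real \<Rightarrow> ennreal"
    assume F: "case_prod F \<in> borel_measurable (PiM {1..K} (\<lambda>_. count_space UNIV) \<Otimes>\<^sub>M borel)"
    show "(\<integral>\<^sup>+\<omega>. F (\<lambda>k\<in>{1..K}. V k \<omega>) (Y j \<omega>) \<partial>M)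
      = (\<integral>\<^sup>+v. \<integral>\<^sup>+y. F v y * ennreal (channel_density {1..K} (\<lambda>k. gain h g k j) (\<lambda>k. \<kappa> k (v k)) y) \<partial>lborel
          \<partial>measure_pmf (Pi_pmf {1..K} undefined p))"
      unfolding Y_def
      by (rule gaussian_network_law[OF K V_rv X_rv pairs_indep noise_gauss noise_indep noise_indep_inputs fin_p prob0 sets0 dis j F])
  qed (rule fin_p prob0 sets0 V_rv, assumption?)+
  have J_nn: "0 \<le> J i j" if i: "i \<in> {1..K}" and j: "j \<in> {0..K}" for i j
  proof -
    interpret single_letter M K h g p \<kappa> V Y by (rule sl) (use i in auto)
    show ?thesis
      by (rule leak_moment_bound[OF i j zero_less_one]) (simp only: J_def others_def)
  qed
  \<comment> \<open>The eavesdropper has index 0, which differs from every user, so the maximum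
    always includes it.\<close>
  have Jm_nn: "0 \<le> Jm i" if i: "i \<in> {1..K}" for i
    using J_nn[OF i, of 0] J_le[of 0 i] i by auto
  \<comment> \<open>The midpoint of \<open>Jm i\<close> and \<open>I i - R i\<close>. The rate
    condition says exactly that this interval is nonempty; the midpoint exceeds every leakage rate
    and stays below what decoding allows.\<close>
  define R' where "R' i = (I i + Jm i - R i) / 2" for i
  show ?thesis
  proof (rule achievable_of_moment_bounds[OF fin_p prob0 sets0, where R' = R' and pw = pw])
    fix i assume i: "i \<in> {1..K}"
    show "0 \<le> R i" by (rule rates'[OF i])
    show "0 \<le> R' i" using rates'[OF i] Jm_nn[OF i] by (simp add: R'_def)
    show "measure_pmf.expectation (p i) (pw i) \<le> P" by (rule pw_mean[OF i])
    interpret single_letter M K h g p \<kappa> V Y by (rule sl) (use i in auto)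
    have gap: "R i + R' i < I i" "Jm i < R' i" using rates'[OF i] by (auto simp: R'_def field_simps)
    \<comment> \<open>Half of the decoding gap, in nats, is spent on the moment bound; the other
      half keeps the error exponent positive. \<open>e\<close> below does the same for the leakage
      gap.\<close>
    define d where "d = ln 2 * (I i - (R i + R' i)) / 2"
    have d: "0 < d" using gap by (simp add: d_def)
    obtain s where s: "0 < s" "we.err_moment i s \<le> ennreal (exp (- (s * (ln 2 * I i - d))))"
      unfolding I_def by (rule err_moment_bound[OF i d])
    have "ln 2 * I i - d = ln 2 * (R i + R' i) + d" by (simp add: d_def algebra_simps)
    then have "ln 2 * (R i + R' i) < ln 2 * I i - d" using d by simp
    with s show "\<exists>s \<eta>. 0 < s \<and> ln 2 * (R i + R' i) < \<eta> \<and>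
      we.err_moment i s \<le> ennreal (exp (- (s * \<eta>)))" by blast
    fix j assume j: "j \<in> {0..K} - {i}"
    define e where "e = ln 2 * (R' i - J i j) / 2"
    have e: "0 < e" using gap J_le[OF j] by (simp add: e_def)
    obtain s where s: "0 < s" "s \<le> 1" "we.leak_moment j i s \<le> ennreal (exp (s * (ln 2 * J i j + e)))"
      using j unfolding J_def by (elim DiffE) (rule leak_moment_bound[OF i _ e, unfolded others_def J_def])
    have "ln 2 * R' i = ln 2 * J i j + e + e" by (simp add: e_def algebra_simps)
    then have "ln 2 * J i j + e < ln 2 * R' i" using e by simp
    with s show "\<exists>s l. 0 < s \<and> s \<le> 1 \<and> l < ln 2 * R' i \<and>
      we.leak_moment j i s \<le> ennreal (exp (s * l))" by blast
  qed (rule pw_nn, rule pw)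
qed

end
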